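(* Let $d\in\{1,2,3\}$, $T>0$, $r\ge 0$, $0<\epsilon<\tfrac14$ (arbitrarily small), and set $$ r_2 := \begin{cases} r+2, & \text{if } r>\frac d2,\\ 2+\frac d2+\epsilon, & \text{if } 0<r\le \frac d2,\\ 2+\frac d4, & \text{if } r=0.\end{cases} $$ For every $u_0\in H^{r_2}(\mathbb{T}^d)$ and $V\in H^{r_2}(\mathbb{T}^d)$, let $u\in\mathcal{C}([0,T],H^{r_2}(\mathbb{T}^d))$ be the unique (mild) solution of the Gross-Pitaevskii equation $$ i\partial_t u(t,x) = -\Delta u(t,x)+V(x)u(t,x)+|u(t,x)|^2u(t,x),\qquad u|_{t=0}=u_0, $$ on $[0,T]\times\mathbb{T}^d$. Then there exist $\tau_{\min}>0$ and $C_T>0$ such that for every time step size $0<\tau\le\tau_{\min}$ the sequence $(u^n)_{n\ge0}$ defined by $u^0=u_0$ and $$ \begin{aligned} u^{n+1} ={}& e^{i\tau\Delta}u^n - i\tau e^{i\tau\Delta}\Big(u^n\,\varphi_1(-i\tau\Delta)V+(u^n)^2\,\varphi_1(-2i\tau\Delta)\overline{u^n}\Big)\\ & - i\tau\Big((e^{i\tau\Delta}u^n)\,\varphi_2(-i\tau\Delta)(e^{i\tau\Delta}V)+(e^{i\tau\Delta}u^n)^2\,\varphi_2(-2i\tau\Delta)e^{i\tau\Delta}\overline{u^n}\Big)\\ & + i\tau e^{i\tau\Delta}\Big(u^n\,\varphi_2(-i\tau\Delta)V+(u^n)^2\,\varphi_2(-2i\tau\Delta)\overline{u^n}\Big)\\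 & -\frac{\tau^2}{2}e^{i\tau\Delta}\Big(|u^n|^4u^n+3u^n|u^n|^2V-|u^n|^2u^n\overline{V}+u^nV^2\Big) \end{aligned} $$ satisfies $$ \|u^n-u(n\tau)\|_{H^r}\le C_T\,\tau^2\qquad\text{for all integers } n\ge 1\text{ with } n\tau\le T. $$
   Context: $\mathbb{T}^d$ is the $d$-dimensional torus $(\mathbb{R}/2\pi\mathbb{Z})^d$; functions are complex valued. For $u=\sum_{k\in\mathbb{Z}^d}u_k\frac{e^{ik\cdot x}}{\sqrt{(2\pi)^d}}\in L^2(\mathbb{T}^d)$ and $r>0$, $\|u\|_{H^r}^2=\sum_{k\in\mathbb{Z}^d}(1+|k|^{2r})|u_k|^2$, and $H^r(\mathbb{T}^d)$ is the space where this is finite; $H^0=L^2$. A mild solution is a solution of Duhamel's formula $u(t)=e^{it\Delta}u_0-i\int_0^t e^{i(t-\zeta)\Delta}\big(Vu(\zeta)+u(\zeta)^2\overline{u(\zeta)}\big)\,d\zeta$. $T$ is a time up to which this solution exists in the stated class. $\varphi_1(z)=\frac{e^z-1}{z}$ (with $\varphi_1(0)=1$) and $\varphi_2(z)=\frac{e^z-\varphi_1(z)}{z}$ (with $\varphi_2(0)=\tfrac12$). For a function $\varphi$ bounded on $i\mathbb{R}$ and $\xi\in\mathbb{R}$, $\varphi(i\xi\Delta)$ is the Fourier multiplier with symbol $\varphi(-i\xi|k|^2)$, $k\in\mathbb{Z}^d$; likewise $e^{i\xi\Delta}$ has symbol $e^{-i\xi|k|^2}$. In the scheme, each $\varphi_j(-i\tau\Delta)$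 acts only on the factor $V$ or $e^{i\tau\Delta}V$ immediately to its right, and each $\varphi_j(-2i\tau\Delta)$ acts only on the factor $\overline{u^n}$ or $e^{i\tau\Delta}\overline{u^n}$ immediately to its right. *)

theory Defs
  imports "HOL-Analysis.Analysis"
begin

text \<open>
  A function on the torus is a function on \<open>real ^ 'n\<close> that is \<open>2 * pi\<close>-periodic in each
  coordinate; the dimension is \<open>CARD('n)\<close>. Elements of \<open>L2\<close> and \<open>H^r\<close> are represented by
  functions, so equality of elements is equality almost everywhere. Integrals over the torus
  are taken over the fundamental cell, with Lebesgue measure (total mass \<open>(2 * pi) ^ CARD('n)\<close>).
\<close>

definition torus_measure :: "(real ^ 'n::finite) measure" where
  "torus_measure = lebesgue_on (cbox 0 (\<chi> i. 2 * pi))"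

definition torus_periodic :: "(real ^ 'n::finite \<Rightarrow> complex) \<Rightarrow> bool" where
  "torus_periodic f \<longleftrightarrow> (\<forall>x i. f (x + axis i (2 * pi)) = f x)"

definition torus_L2 :: "(real ^ 'n::finite \<Rightarrow> complex) set" where
  "torus_L2 = {f. torus_periodic f \<and> f \<in> borel_measurable torus_measure \<and>
                  integrable torus_measure (\<lambda>x. (cmod (f x))\<^sup>2)}"

definition freq :: "int ^ 'n \<Rightarrow> real ^ 'n::finite" where
  "freq k = (\<chi> i. real_of_int (k $ i))"

definition fourier_mode :: "int ^ 'n \<Rightarrow> real ^ 'n::finite \<Rightarrow> complex" where
  "fourier_mode k x = cis (freq k \<bullet> x) / complex_of_real (sqrt ((2 * pi) ^ CARD('n)))"

definition fourier_coeff :: "(real ^ 'n::finite \<Rightarrow> complex) \<Rightarrow> int ^ 'n \<Rightarrow> complex" where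
  "fourier_coeff f k = (\<integral>x. f x * cnj (fourier_mode k x) \<partial>torus_measure)"

text \<open>
  The weight \<open>1 + |k|^(2 r)\<close>. The case \<open>r = 0\<close> is separate because \<open>0 powr 0 = 0\<close>, whereas
  the usual convention \<open>0^0 = 1\<close> is wanted, which makes the \<open>H^0\<close> norm \<open>sqrt 2\<close> times the
  \<open>L2\<close> norm.
\<close>

definition sobolev_weight :: "real \<Rightarrow> int ^ 'n::finite \<Rightarrow> real" where
  "sobolev_weight r k = 1 + (if r = 0 then 1 else norm (freq k) powr (2 * r))"

definition sobolev :: "real \<Rightarrow> (real ^ 'n::finite \<Rightarrow> complex) set" where
  "sobolev r = {f \<in> torus_L2.
     (\<lambda>k. sobolev_weight r k * (cmod (fourier_coeff f k))\<^sup>2) summable_on UNIV}"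

text \<open>
  Only meaningful for members of \<open>sobolev r\<close>: a divergent \<open>infsum\<close> is \<open>0\<close>, so a bound on
  this norm has to be accompanied by membership.
\<close>

definition sobolev_norm :: "real \<Rightarrow> (real ^ 'n::finite \<Rightarrow> complex) \<Rightarrow> real" where
  "sobolev_norm r f =
     sqrt (\<Sum>\<^sub>\<infinity>k. sobolev_weight r k * (cmod (fourier_coeff f k))\<^sup>2)"

definition continuous_into_sobolev ::
    "real \<Rightarrow> real set \<Rightarrow> (real \<Rightarrow> real ^ 'n::finite \<Rightarrow> complex) \<Rightarrow> bool" where
  "continuous_into_sobolev r I u \<longleftrightarrow>
     (\<forall>t\<in>I. u t \<in> sobolev r) \<and>
     (\<forall>t\<in>I. ((\<lambda>s. sobolev_norm r (\<lambda>x. u s x - u t x)) \<longlongrightarrow> 0) (at t within I))"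

text \<open>
  \<open>laplace_op \<phi> \<xi>\<close> is the operator \<open>\<phi>(i \<xi> \<Delta>)\<close>, the Fourier multiplier with symbol
  \<open>\<phi>(- i \<xi> |k|^2)\<close>; \<open>laplace_op exp \<xi>\<close> is the free propagator. The Fourier series is summed
  pointwise, which requires absolutely summable coefficients. This holds on \<open>H^s\<close> with
  \<open>s > d / 2\<close> for bounded symbols, the only situation in which the operator is used here.
\<close>

definition laplace_op ::
    "(complex \<Rightarrow> complex) \<Rightarrow> real \<Rightarrow> (real ^ 'n::finite \<Rightarrow> complex) \<Rightarrow> (real ^ 'n \<Rightarrow> complex)" where
  "laplace_op \<phi> \<xi> f x =
     (\<Sum>\<^sub>\<infinity>k. \<phi> (- \<i> * complex_of_real (\<xi> * (norm (freq k))\<^sup>2)) * fourier_coeff f k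
              * fourier_mode k x)"

definition phi1 :: "complex \<Rightarrow> complex" where
  "phi1 z = (if z = 0 then 1 else (exp z - 1) / z)"

definition phi2 :: "complex \<Rightarrow> complex" where
  "phi2 z = (if z = 0 then 1 / 2 else (exp z - phi1 z) / z)"

text \<open>
  Duhamel's formula as an identity in \<open>H^s\<close>, i.e. almost everywhere in \<open>x\<close> for each \<open>t\<close>. For
  \<open>s > d / 2\<close> the integrand is a continuous function of \<open>\<zeta>\<close> with values in \<open>H^s\<close> and point
  evaluation (of the continuous representative) is a bounded functional on \<open>H^s\<close>, so the
  \<open>H^s\<close>-valued integral is computed pointwise in \<open>x\<close>.
\<close>

definition gp_mild_solution ::
    "real \<Rightarrow> real \<Rightarrow> (real ^ 'n::finite \<Rightarrow> complex) \<Rightarrow> (real ^ 'n \<Rightarrow> complex) \<Rightarrow>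
     (real \<Rightarrow> real ^ 'n \<Rightarrow> complex) \<Rightarrow> bool" where
  "gp_mild_solution s T V u0 u \<longleftrightarrow>
     continuous_into_sobolev s {0..T} u \<and>
     (\<forall>t\<in>{0..T}. AE x in torus_measure.
        u t x = laplace_op exp t u0 x
          - \<i> * integral {0..t} (\<lambda>\<zeta>.
              laplace_op exp (t - \<zeta>) (\<lambda>y. V y * u \<zeta> y + (u \<zeta> y)\<^sup>2 * cnj (u \<zeta> y)) x))"

definition gp_step ::
    "real \<Rightarrow> (real ^ 'n::finite \<Rightarrow> complex) \<Rightarrow> (real ^ 'n \<Rightarrow> complex) \<Rightarrow> (real ^ 'n \<Rightarrow> complex)" where
  "gp_step \<tau> V w =
    (let S = laplace_op exp \<tau>;
         wb = (\<lambda>y. cnj (w y));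
         \<tau>c = complex_of_real \<tau>
     in (\<lambda>x.
        S w x
        - \<i> * \<tau>c * S (\<lambda>y. w y * laplace_op phi1 (- \<tau>) V y
                         + (w y)\<^sup>2 * laplace_op phi1 (- 2 * \<tau>) wb y) x
        - \<i> * \<tau>c * (S w x * laplace_op phi2 (- \<tau>) (S V) x
                    + (S w x)\<^sup>2 * laplace_op phi2 (- 2 * \<tau>) (S wb) x)
        + \<i> * \<tau>c * S (\<lambda>y. w y * laplace_op phi2 (- \<tau>) V y
                         + (w y)\<^sup>2 * laplace_op phi2 (- 2 * \<tau>) wb y) x
        - \<tau>c\<^sup>2 / 2 * S (\<lambda>y. complex_of_real (cmod (w y) ^ 4) * w y
                             + 3 * w y * complex_of_real ((cmod (w y))\<^sup>2) * V y
                             - complex_of_real ((cmod (w y))\<^sup>2) * w y * cnj (V y)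
                             + w y * (V y)\<^sup>2) x))"

primrec gp_scheme ::
    "real \<Rightarrow> (real ^ 'n::finite \<Rightarrow> complex) \<Rightarrow> (real ^ 'n \<Rightarrow> complex) \<Rightarrow> nat \<Rightarrow>
     (real ^ 'n \<Rightarrow> complex)" where
  "gp_scheme \<tau> V u0 0 = u0"
| "gp_scheme \<tau> V u0 (Suc n) = gp_step \<tau> V (gp_scheme \<tau> V u0 n)"

definition data_regularity :: "nat \<Rightarrow> real \<Rightarrow> real \<Rightarrow> real" where
  "data_regularity d r \<epsilon> =
     (if r > real d / 2 then r + 2
      else if r > 0 then 2 + real d / 2 + \<epsilon>
      else 2 + real d / 4)"

end

theory Submission
  imports Defs
begin

text \<open>
  Why the scheme converges with order two. Write \<open>S t\<close> for the free propagator, \<open>F w = V w + w^2 cnj w\<close>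
  for the nonlinearity, and let \<open>w = u t\<close>. Duhamel's formula gives
  \<open>S (-\<tau>) (u (t + \<tau>)) = w - i \<integral> S (-\<zeta>) (F (u (t + \<zeta>))) d\<zeta>\<close> over \<open>[0, \<tau>]\<close>. The numerical step has the
  same form, with the integrand replaced by an interpolant in \<open>\<zeta>\<close> that integrates in closed form, plus
  the quintic correction. So the local error is an integral of a residual, and the residual has two sources.

  \<^item> \<open>F (u (t + \<zeta>))\<close> versus \<open>F (S \<zeta> w)\<close>. To first order \<open>u (t + \<zeta>) = S \<zeta> w - i \<zeta> F w\<close>, so the
  difference is \<open>-i \<zeta> G w\<close> with \<open>G\<close> the quintic expression of the scheme, up to \<open>O(\<zeta>^2)\<close>
  (\<open>gpF_second_order\<close>). Each power of \<open>\<zeta>\<close> that comes from the propagator costs two derivatives, and no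
  term is differentiated more than that.
  \<^item> \<open>S (-\<zeta>) (F (S \<zeta> w))\<close> versus the interpolant. In a product of three modes \<open>k1, k2, k3\<close> the phase is
  \<open>(1 - \<mu>) |k3|^2 + \<beta>\<close>, where \<open>\<mu> = 0\<close> for the potential and \<open>\<mu> = -1\<close> for the cubic term. The first summand
  acts on a single factor and is integrated exactly by the filter functions; the factor \<open>exp (i \<zeta> \<beta>)\<close> is
  interpolated linearly between \<open>0\<close> and \<open>\<tau>\<close>. Since \<open>\<beta>\<close> contains mixed products only,
  \<open>\<beta>^2\<close> is bounded by sums of \<open>|ki|^2 |kj|^2\<close> with distinct \<open>i, j\<close>: the error \<open>O(\<tau>^2)\<close> costs two
  derivatives on each of two different factors instead of four on one (\<open>fnorm_le_interp_defect\<close>).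

  Hence the local error is \<open>O(\<tau>^3)\<close> (\<open>local_error\<close>), the flow is Lipschitz with constant
  \<open>1 + O(\<tau>)\<close> on bounded sets (\<open>stability\<close>), and a discrete Gronwall argument concludes
  (\<open>convergence\<close>).

  Two norms occur: an algebra norm \<open>X\<close> in which the numerical solution must stay bounded, and a target
  norm \<open>Y\<close> on which \<open>X\<close> acts by multiplication. For positive \<open>r\<close> both are a Sobolev norm of order greater
  than \<open>d/2\<close> (\<open>good_norms_supercritical\<close>; for \<open>r \<le> d/2\<close> the order is raised to \<open>d/2 + \<epsilon>\<close>). For \<open>r = 0\<close>
  (\<open>good_norms_L2\<close>) \<open>Y\<close> is the \<open>L2\<close> norm and \<open>X\<close> the Wiener norm, the sum of the moduli of the Fourier
  coefficients. There the products of two factors with two derivatives each are controlled by the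
  critical estimate \<open>H^(d/4) H^(d/4) \<subseteq> L2\<close> (\<open>wnorm_critical\<close>), and the boundedness in \<open>X\<close> comes from
  first order convergence in \<open>X\<close>, for which one derivative in the Wiener norm is enough; the embedding of
  \<open>H^(1 + d/4)\<close> into the Wiener algebra restricts the dimension to \<open>d < 4\<close>.

  All estimates are made on absolutely convergent Fourier series, which form an algebra under pointwise
  multiplication. Elements of \<open>H^r2\<close> have such series, and by uniqueness of Fourier coefficients
  (\<open>fourier_uniqueness\<close>) they agree with them almost everywhere. The mild solution is thereby turned into
  a Duhamel formula for each Fourier coefficient (\<open>duhamel_twisted\<close>).
\<close>

section \<open>Interchange of series and integrals\<close>

abbreviation summable_abs :: "('k \<Rightarrow> complex) \<Rightarrow> bool" where
  "summable_abs a \<equiv> (\<lambda>k. cmod (a k)) summable_on UNIV"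

text \<open>
  Enumerating the index type turns an unordered sum into an ordinary series.
\<close>

lemma infsum_eq_suminf_to_nat:
  fixes f :: "'k::countable \<Rightarrow> complex"
  assumes "summable_abs f"
  shows "summable (\<lambda>n. norm (if n \<in> range (to_nat :: 'k \<Rightarrow> nat) then f (from_nat n) else 0 :: complex))"
    and "infsum f UNIV = (\<Sum>n. if n \<in> range (to_nat :: 'k \<Rightarrow> nat) then f (from_nat n) else 0)"
proof -
  let ?g = "\<lambda>n. if n \<in> range (to_nat :: 'k \<Rightarrow> nat) then f (from_nat n) else 0 :: complex"
  have inj: "inj (to_nat :: 'k \<Rightarrow> nat)" by (rule inj_to_nat)
  have "(norm \<circ> f) summable_on UNIV" using assms by (simp add: o_def)
  hence "((\<lambda>n. norm (?g n)) \<circ> to_nat) summable_on (UNIV :: 'k set)"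
    by (simp add: o_def)
  hence *: "(\<lambda>n. norm (?g n)) summable_on range (to_nat :: 'k \<Rightarrow> nat)"
    using summable_on_reindex[OF inj, of "\<lambda>n. norm (?g n)"] by blast
  have "(\<lambda>n. norm (?g n)) summable_on UNIV \<longleftrightarrow> (\<lambda>n. norm (?g n)) summable_on range (to_nat :: 'k \<Rightarrow> nat)"
    by (rule summable_on_cong_neutral) auto
  with * have abs: "(\<lambda>n. norm (?g n)) summable_on UNIV" by blast
  thus "summable (\<lambda>n. norm (?g n))" by (rule summable_on_imp_summable)
  have "infsum f UNIV = infsum (?g \<circ> to_nat) (UNIV :: 'k set)" by (simp add: o_def)
  also have "\<dots> = infsum ?g (range (to_nat :: 'k \<Rightarrow> nat))"
    by (rule infsum_reindex[symmetric]) (use inj in auto)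
  also have "\<dots> = infsum ?g UNIV" by (rule infsum_cong_neutral) auto
  also have "\<dots> = (\<Sum>n. ?g n)"
  proof -
    have "?g summable_on UNIV" using abs by (rule abs_summable_summable)
    hence "(?g has_sum infsum ?g UNIV) UNIV" by (rule has_sum_infsum)
    from has_sum_imp_sums[OF this] show ?thesis by (simp add: sums_iff)
  qed
  finally show "infsum f UNIV = (\<Sum>n. ?g n)" .
qed

lemma abs_summable_onI_bdd:
  fixes f :: "'k \<Rightarrow> complex"
  assumes "\<And>F. finite F \<Longrightarrow> (\<Sum>k\<in>F. cmod (f k)) \<le> B"
  shows "summable_abs f"
  unfolding abs_summable_iff_bdd_above using assms by (auto intro!: bdd_aboveI2)

text \<open>
  Integrating the bound over a finite measure space bounds the sum of the integrals of the moduli, and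
  this permits the interchange. The bound is uniform in the point and not in the index, because the
  Fourier coefficients of a curve in a function space are summable uniformly in time but have no
  evident summable majorant.
\<close>

lemma integral_infsum_bounded:
  fixes f :: "'k::countable \<Rightarrow> 'a \<Rightarrow> complex"
  assumes "finite_measure M" and meas: "\<And>k. f k \<in> borel_measurable M"
    and bound: "\<And>F x. finite F \<Longrightarrow> x \<in> space M \<Longrightarrow> (\<Sum>k\<in>F. cmod (f k x)) \<le> B"
  shows "integrable M (\<lambda>x. \<Sum>\<^sub>\<infinity>k. f k x)"
    and "summable_abs (\<lambda>k. \<integral>x. f k x \<partial>M)"
    and "(\<integral>x. (\<Sum>\<^sub>\<infinity>k. f k x) \<partial>M) = (\<Sum>\<^sub>\<infinity>k. \<integral>x. f k x \<partial>M)"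
proof -
  interpret finite_measure M by fact
  have int: "integrable M (f k)" for k
    by (rule integrable_const_bound[where B = B])
      (use bound[of "{k}"] meas in auto)
  have fin: "(\<Sum>k\<in>F. cmod (\<integral>x. f k x \<partial>M)) \<le> (\<integral>x. B \<partial>M)"
    and finabs: "(\<Sum>k\<in>F. \<integral>x. cmod (f k x) \<partial>M) \<le> (\<integral>x. B \<partial>M)" if "finite F" for F
  proof -
    have "(\<Sum>k\<in>F. cmod (\<integral>x. f k x \<partial>M)) \<le> (\<Sum>k\<in>F. \<integral>x. cmod (f k x) \<partial>M)"
      by (intro sum_mono integral_norm_bound)
    also have "\<dots> = (\<integral>x. (\<Sum>k\<in>F. cmod (f k x)) \<partial>M)"
      by (subst Bochner_Integration.integral_sum) (use int in auto)
    also have *: "\<dots> \<le> (\<integral>x. B \<partial>M)"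
      by (intro integral_mono) (use int bound that in auto)
    finally show "(\<Sum>k\<in>F. cmod (\<integral>x. f k x \<partial>M)) \<le> (\<integral>x. B \<partial>M)" .
    show "(\<Sum>k\<in>F. \<integral>x. cmod (f k x) \<partial>M) \<le> (\<integral>x. B \<partial>M)"
      using * by (subst Bochner_Integration.integral_sum[symmetric]) (use int in auto)
  qed
  show absI: "summable_abs (\<lambda>k. \<integral>x. f k x \<partial>M)"
    using fin by (rule abs_summable_onI_bdd)
  have absx: "summable_abs (\<lambda>k. f k x)" if "x \<in> space M" for x
    by (rule abs_summable_onI_bdd, rule bound) (use that in auto)
  define g where "g n x = (if n \<in> range (to_nat :: 'k \<Rightarrow> nat) then f (from_nat n) x else 0)" for n x
  have gint: "integrable M (g n)" for n
    unfolding g_def using int by (cases "n \<in> range (to_nat :: 'k \<Rightarrow> nat)") auto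
  have sumx: "AE x in M. summable (\<lambda>n. norm (g n x))"
    using infsum_eq_suminf_to_nat(1)[OF absx] by (auto simp: g_def)
  have "summable (\<lambda>n. \<integral>x. norm (g n x) \<partial>M)"
  proof (rule summableI_nonneg_bounded)
    fix n
    let ?F = "{k :: 'k. to_nat k < n}"
    have "inj_on (to_nat :: 'k \<Rightarrow> nat) ?F" by simp
    moreover have "to_nat ` ?F \<subseteq> {..<n}" by auto
    ultimately have finF: "finite ?F" by (meson finite_imageD finite_lessThan finite_subset)
    have "(\<Sum>i<n. \<integral>x. norm (g i x) \<partial>M) = (\<Sum>i\<in>to_nat ` ?F. \<integral>x. norm (g i x) \<partial>M)"
    proof (rule sum.mono_neutral_right)
      show "\<forall>i\<in>{..<n} - to_nat ` ?F. (\<integral>x. norm (g i x) \<partial>M) = 0"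
      proof
        fix i assume "i \<in> {..<n} - to_nat ` ?F"
        hence "i \<notin> range (to_nat :: 'k \<Rightarrow> nat)" by auto
        thus "(\<integral>x. norm (g i x) \<partial>M) = 0" by (simp add: g_def)
      qed
    qed auto
    also have "\<dots> = (\<Sum>k\<in>?F. \<integral>x. norm (f k x) \<partial>M)"
      by (subst sum.reindex) (auto simp: g_def)
    also have "\<dots> \<le> (\<integral>x. B \<partial>M)" by (rule finabs[OF finF])
    finally show "(\<Sum>i<n. \<integral>x. norm (g i x) \<partial>M) \<le> (\<integral>x. B \<partial>M)" .
  qed auto
  note S = gint sumx this
  have eq: "(\<Sum>\<^sub>\<infinity>k. f k x) = (\<Sum>n. g n x)" if "x \<in> space M" for x
    using infsum_eq_suminf_to_nat(2)[OF absx[OF that]] by (simp add: g_def)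
  show "integrable M (\<lambda>x. \<Sum>\<^sub>\<infinity>k. f k x)"
    using integrable_suminf[OF S] eq by (simp cong: Bochner_Integration.integrable_cong)
  have "(\<integral>x. (\<Sum>\<^sub>\<infinity>k. f k x) \<partial>M) = (\<integral>x. (\<Sum>n. g n x) \<partial>M)"
    using eq by (intro Bochner_Integration.integral_cong) auto
  also have "\<dots> = (\<Sum>n. \<integral>x. g n x \<partial>M)" by (rule integral_suminf[OF S])
  also have "\<dots> = (\<Sum>\<^sub>\<infinity>k. \<integral>x. f k x \<partial>M)"
    unfolding infsum_eq_suminf_to_nat(2)[OF absI]
    by (intro arg_cong[where f = suminf] ext) (simp add: g_def)
  finally show "(\<integral>x. (\<Sum>\<^sub>\<infinity>k. f k x) \<partial>M) = (\<Sum>\<^sub>\<infinity>k. \<integral>x. f k x \<partial>M)" .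
qed

lemma has_integral_infsum_bounded:
  fixes f :: "'k::countable \<Rightarrow> real \<Rightarrow> complex"
  assumes cont: "\<And>k. continuous_on {a..b} (f k)"
    and bound: "\<And>F x. finite F \<Longrightarrow> x \<in> {a..b} \<Longrightarrow> (\<Sum>k\<in>F. cmod (f k x)) \<le> B"
  shows "((\<lambda>x. \<Sum>\<^sub>\<infinity>k. f k x) has_integral (\<Sum>\<^sub>\<infinity>k. integral {a..b} (f k))) {a..b}"
    and "summable_abs (\<lambda>k. integral {a..b} (f k))"
proof -
  let ?M = "lebesgue_on {a..b}"
  have fm: "finite_measure ?M" by (rule finite_measure_lebesgue_on) auto
  have meas: "f k \<in> borel_measurable ?M" for k
    by (rule continuous_imp_measurable_on_sets_lebesgue[OF cont]) auto
  have sp: "space ?M = {a..b}" by simp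
  have B: "(\<Sum>k\<in>F. cmod (f k x)) \<le> B" if "finite F" "x \<in> space ?M" for F x
    using bound that by (simp add: sp)
  note * = integral_infsum_bounded[OF fm meas B]
  interpret finite_measure ?M by fact
  have intf: "integrable ?M (f k)" for k
    by (rule integrable_const_bound[where B = B])
      (use bound[of "{k}"] meas in \<open>auto simp: sp\<close>)
  have eqk: "integral\<^sup>L ?M (f k) = integral {a..b} (f k)" for k
    by (rule lebesgue_integral_eq_integral[OF intf]) auto
  show "summable_abs (\<lambda>k. integral {a..b} (f k))"
    using *(2) by (simp add: eqk)
  have "(\<lambda>x. \<Sum>\<^sub>\<infinity>k. f k x) integrable_on {a..b}"
    using *(1) by (rule integrable_on_lebesgue_on) auto
  moreover have "integral {a..b} (\<lambda>x. \<Sum>\<^sub>\<infinity>k. f k x) = (\<Sum>\<^sub>\<infinity>k. integral {a..b} (f k))"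
    using *(3) by (subst lebesgue_integral_eq_integral[symmetric, OF *(1)]) (auto simp: eqk)
  ultimately show "((\<lambda>x. \<Sum>\<^sub>\<infinity>k. f k x) has_integral (\<Sum>\<^sub>\<infinity>k. integral {a..b} (f k))) {a..b}"
    by (simp add: has_integral_iff)
qed

section \<open>Fourier coefficients on the torus\<close>

lemma space_torus [simp]: "space torus_measure = cbox 0 (\<chi> i. 2 * pi)"
  by (simp add: torus_measure_def)

lemma finite_measure_torus: "finite_measure (torus_measure :: (real ^ 'n::finite) measure)"
  unfolding torus_measure_def by (rule finite_measure_lebesgue_on) auto

lemma borel_measurable_torus:
  "continuous_on UNIV f \<Longrightarrow> f \<in> borel_measurable (torus_measure :: (real ^ 'n::finite) measure)"
  unfolding torus_measure_def
  by (rule continuous_imp_measurable_on_sets_lebesgue) (auto intro: continuous_on_subset)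

lemma freq_add: "freq (k + l) = freq k + freq l"
  and freq_diff: "freq (k - l) = freq k - freq l"
  and freq_minus: "freq (- k) = - freq k"
  and freq_0 [simp]: "freq 0 = 0"
  by (auto simp: freq_def vec_eq_iff)

lemma integral_cis_interval:
  fixes m :: int
  shows "integrable lborel (\<lambda>y. indicator {0..2*pi} y *\<^sub>R cis (of_int m * y))"
    and "(\<integral>y. indicator {0..2*pi} y *\<^sub>R cis (of_int m * y) \<partial>lborel) = (if m = 0 then of_real (2*pi) else 0)"
proof -
  have cont: "continuous_on {0..2*pi} (\<lambda>y. cis (of_int m * y))"
    by (intro continuous_intros)
  show int: "integrable lborel (\<lambda>y. indicator {0..2*pi} y *\<^sub>R cis (of_int m * y))"
    using borel_integrable_atLeastAtMost'[OF cont] by (simp add: set_integrable_def)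
  have "(\<integral>y. indicator {0..2*pi} y *\<^sub>R cis (of_int m * y) \<partial>lborel) = integral {0..2*pi} (\<lambda>y. cis (of_int m * y))"
    using set_borel_integral_eq_integral(2)[of "{0..2*pi}" "\<lambda>y. cis (of_int m * y)"] int
    by (simp add: set_integrable_def set_lebesgue_integral_def)
  also have "\<dots> = (if m = 0 then of_real (2*pi) else 0)"
  proof (cases "m = 0")
    case True
    thus ?thesis by (simp add: scaleR_conv_of_real)
  next
    case False
    have "((\<lambda>y. cis (of_int m * y)) has_integral
      (cis (of_int m * (2*pi)) / (\<i> * of_int m) - cis (of_int m * 0) / (\<i> * of_int m))) {0..2*pi}"
    proof (rule fundamental_theorem_of_calculus)
      fix y :: real
      show "((\<lambda>y. cis (of_int m * y) / (\<i> * of_int m)) has_vector_derivative cis (of_int m * y)) (at y within {0..2*pi})"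
        unfolding cis_conv_exp using False
        by (auto intro!: derivative_eq_intros has_vector_derivative_real_field simp: field_simps)
    qed simp
    moreover have "cis (of_int m * (2*pi)) = 1"
      using cis_multiple_2pi[of "of_int m"] by (simp add: mult_ac)
    ultimately show ?thesis using False by (simp add: has_integral_iff)
  qed
  finally show "(\<integral>y. indicator {0..2*pi} y *\<^sub>R cis (of_int m * y) \<partial>lborel) = (if m = 0 then of_real (2*pi) else 0)" .
qed

lemma cis_sum: "finite A \<Longrightarrow> cis (\<Sum>i\<in>A. f i) = (\<Prod>i\<in>A. cis (f i))"
  by (induction A rule: finite_induct) (auto simp: cis_mult[symmetric])

text \<open>
  Lebesgue measure is a product of one-dimensional Lebesgue measures and the character is a product of
  one-dimensional characters; one factor vanishes unless all frequencies do.
\<close>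

lemma torus_integral_cis:
  fixes k :: "int ^ 'n::finite"
  shows "(\<integral>x. cis (freq k \<bullet> x) \<partial>torus_measure) = (if k = 0 then of_real ((2*pi) ^ CARD('n)) else 0)"
proof -
  define m :: "real ^ 'n \<Rightarrow> int" where "m b = k $ (axis_index b)" for b
  define g :: "real ^ 'n \<Rightarrow> real \<Rightarrow> complex"
    where "g b y = indicator {0..2*pi} y *\<^sub>R cis (of_int (m b) * y)" for b y
  have gint: "integrable lborel (g b)" for b
    unfolding g_def by (rule integral_cis_interval)
  have [measurable]: "g b \<in> borel_measurable borel" for b
    using gint[of b] by (simp add: integrable_iff_bounded)
  have G: "indicator (cbox 0 (\<chi> i. 2 * pi)) x *\<^sub>R cis (freq k \<bullet> x) = (\<Prod>b\<in>Basis. g b (x \<bullet> b))" for x :: "real ^ 'n"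
  proof -
    have 1: "(\<Prod>b\<in>Basis. g b (x \<bullet> b)) = (\<Prod>i\<in>UNIV. indicator {0..2*pi} (x $ i) *\<^sub>R cis (of_int (k $ i) * x $ i))"
    proof -
      have B: "(Basis :: (real ^ 'n) set) = (\<lambda>i. axis i 1) ` UNIV"
        by (auto simp: Basis_vec_def)
      show ?thesis unfolding B
        by (subst prod.reindex)
          (auto simp: inj_on_def axis_eq_axis g_def m_def inner_axis)
    qed
    have 2: "cis (freq k \<bullet> x) = (\<Prod>i\<in>UNIV. cis (of_int (k $ i) * x $ i))"
      by (simp add: inner_vec_def freq_def cis_sum)
    have 3: "(indicator (cbox 0 (\<chi> i. 2 * pi)) x :: real) = (\<Prod>i\<in>UNIV. indicator {0..2*pi} (x $ i))"
      by (cases "x \<in> cbox 0 (\<chi> i. 2 * pi)")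
        (auto simp: mem_box_cart intro!: prod.neutral[symmetric] prod_zero indicator_eq_0_iff[THEN iffD2] split: split_indicator)
    show ?thesis unfolding 1 2 3 by (simp add: scaleR_conv_of_real prod.distrib)
  qed
  have cm: "cbox 0 (\<chi> i. 2 * pi) \<in> sets (lebesgue :: (real^'n) measure)" by simp
  have meas: "(\<lambda>x :: real ^ 'n. \<Prod>b\<in>Basis. g b (x \<bullet> b)) \<in> borel_measurable borel"
    by measurable
  have "(\<integral>x. cis (freq k \<bullet> x) \<partial>torus_measure) = (\<integral>x. (\<Prod>b\<in>Basis. g b (x \<bullet> b)) \<partial>(lebesgue :: (real^'n) measure))"
    unfolding torus_measure_def by (subst integral_restrict_space) (auto simp: G)
  also have "\<dots> = (\<integral>x. (\<Prod>b\<in>Basis. g b (x \<bullet> b)) \<partial>(lborel :: (real^'n) measure))"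
    by (rule integral_completion) (use meas in simp)
  also have "\<dots> = (\<integral>\<phi>. (\<Prod>b\<in>(Basis :: (real ^ 'n) set). g b (\<phi> b)) \<partial>(\<Pi>\<^sub>M b\<in>Basis. lborel))"
    by (subst lborel_eq, subst integral_distr)
      (use meas in \<open>auto simp: inner_sum_left inner_Basis if_distrib cong: if_cong prod.cong\<close>)
  also have "\<dots> = (\<Prod>b\<in>(Basis :: (real ^ 'n) set). integral\<^sup>L lborel (g b))"
  proof -
    interpret product_sigma_finite "\<lambda>_ :: real ^ 'n. lborel :: real measure" ..
    show ?thesis by (rule product_integral_prod) (use gint in auto)
  qed
  also have "\<dots> = (\<Prod>i\<in>UNIV. if k $ i = 0 then of_real (2 * pi) else 0)"
  proof -
    have B: "(Basis :: (real ^ 'n) set) = (\<lambda>i. axis i 1) ` UNIV"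
      by (auto simp: Basis_vec_def)
    show ?thesis unfolding B g_def integral_cis_interval
      by (subst prod.reindex) (auto simp: inj_on_def axis_eq_axis m_def)
  qed
  also have "\<dots> = (if k = 0 then of_real ((2*pi) ^ CARD('n)) else 0)"
    by (auto simp: vec_eq_iff intro!: prod_zero)
  finally show ?thesis .
qed


text \<open>
  Built one mode at a time, so that closure under products is an induction on each factor.
\<close>

inductive trig_poly :: "(real ^ 'n::finite \<Rightarrow> complex) \<Rightarrow> bool" where
  zero: "trig_poly (\<lambda>x. 0)"
| step: "trig_poly p \<Longrightarrow> trig_poly (\<lambda>x. c * cis (freq k \<bullet> x) + p x)"

lemma trig_poly_add: "trig_poly p \<Longrightarrow> trig_poly q \<Longrightarrow> trig_poly (\<lambda>x. p x + q x)"
proof (induction rule: trig_poly.induct)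
  case (step p c k)
  from trig_poly.step[OF step.IH[OF step.prems], of c k] show ?case by (simp add: add.assoc)
qed simp

lemma trig_poly_mono: "trig_poly (\<lambda>x. c * cis (freq k \<bullet> x))"
  using trig_poly.step[OF trig_poly.zero] by simp

lemma trig_poly_const: "trig_poly (\<lambda>x. c)"
  using trig_poly_mono[of c 0] by simp

lemma trig_poly_mult_mono: "trig_poly p \<Longrightarrow> trig_poly (\<lambda>x. c * cis (freq k \<bullet> x) * p x)"
proof (induction rule: trig_poly.induct)
  case (step p c' k')
  have "c * cis (freq k \<bullet> x) * (c' * cis (freq k' \<bullet> x) + p x)
     = (c * c') * cis (freq (k + k') \<bullet> x) + c * cis (freq k \<bullet> x) * p x" for x
    by (simp add: freq_add inner_add_left cis_mult[symmetric] algebra_simps)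
  with trig_poly.step[OF step.IH, of "c * c'" "k + k'"] show ?case by simp
qed (simp add: trig_poly.zero)

lemma trig_poly_mult: "trig_poly p \<Longrightarrow> trig_poly q \<Longrightarrow> trig_poly (\<lambda>x. p x * q x)"
proof (induction rule: trig_poly.induct)
  case (step p c k)
  from trig_poly_add[OF trig_poly_mult_mono[OF step.prems] step.IH[OF step.prems], of c k]
  show ?case by (simp add: algebra_simps)
qed (simp add: trig_poly.zero)

lemma trig_poly_sum: "finite A \<Longrightarrow> (\<And>i. i \<in> A \<Longrightarrow> trig_poly (p i)) \<Longrightarrow> trig_poly (\<lambda>x. \<Sum>i\<in>A. p i x)"
  by (induction A rule: finite_induct) (auto intro: trig_poly_add trig_poly.zero)

text \<open>
  The torus as a product of circles in complex space. Real polynomials in the coordinates of a point of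
  the image are trigonometric polynomials, which makes the Stone-Weierstrass theorem applicable.
\<close>

definition torus_embed :: "real ^ 'n::finite \<Rightarrow> complex ^ 'n" where
  "torus_embed x = (\<chi> i. cis (x $ i))"

lemma continuous_torus_embed: "continuous_on S torus_embed"
  unfolding torus_embed_def by (intro continuous_intros)

lemma freq_axis: "freq (axis i m) \<bullet> x = of_int m * x $ i"
proof -
  have "freq (axis i m) = axis i (of_int m)" by (auto simp: freq_def vec_eq_iff axis_def)
  thus ?thesis by (simp add: inner_axis')
qed

lemma trig_poly_Re_embed: "trig_poly (\<lambda>x. of_real (Re (torus_embed x $ i)))"
  and trig_poly_Im_embed: "trig_poly (\<lambda>x. of_real (Im (torus_embed x $ i)))"
proof -
  let ?e = "\<lambda>m x. cis (freq (axis i m) \<bullet> x)"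
  have R: "of_real (Re (torus_embed x $ i)) = (1/2) * ?e 1 x + (1/2) * ?e (-1) x" for x
    unfolding freq_axis by (simp add: torus_embed_def complex_eq_iff)
  have I: "of_real (Im (torus_embed x $ i)) = (-\<i>/2) * ?e 1 x + (\<i>/2) * ?e (-1) x" for x
    unfolding freq_axis by (simp add: torus_embed_def complex_eq_iff)
  show "trig_poly (\<lambda>x. of_real (Re (torus_embed x $ i)))"
    unfolding R by (intro trig_poly_add trig_poly_mono)
  show "trig_poly (\<lambda>x. of_real (Im (torus_embed x $ i)))"
    unfolding I by (intro trig_poly_add trig_poly_mono)
qed

lemma trig_poly_real_polynomial:
  fixes p :: "complex ^ 'n::finite \<Rightarrow> real"
  assumes "real_polynomial_function p"
  shows "trig_poly (\<lambda>x. of_real (p (torus_embed x)))"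
  using assms
proof (induction rule: real_polynomial_function.induct)
  case (linear f)
  interpret bounded_linear f by fact
  have "f z = (\<Sum>i\<in>UNIV. Re (z $ i) * f (axis i 1) + Im (z $ i) * f (axis i \<i>))" for z
  proof -
    have "z = (\<Sum>i\<in>UNIV. Re (z $ i) *\<^sub>R axis i 1 + Im (z $ i) *\<^sub>R axis i \<i>)"
      by (auto simp: vec_eq_iff axis_def complex_eq_iff if_distrib sum.distrib cong: if_cong)
    hence "f z = f \<dots>" by simp
    thus ?thesis by (simp add: sum add scaleR)
  qed
  hence eq: "(\<lambda>x. of_real (f (torus_embed x)) :: complex) =
    (\<lambda>x. \<Sum>i\<in>UNIV. of_real (Re (torus_embed x $ i)) * of_real (f (axis i 1))
       + of_real (Im (torus_embed x $ i)) * of_real (f (axis i \<i>)))"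
    by (metis (mono_tags, lifting) of_real_sum of_real_add of_real_mult sum.cong)
  show ?case unfolding eq
    by (intro trig_poly_sum trig_poly_add trig_poly_mult trig_poly_Re_embed trig_poly_Im_embed trig_poly_const) auto
qed (auto intro: trig_poly_const trig_poly_add trig_poly_mult)

lemma integrable_torus_mult_bounded:
  fixes f g :: "real ^ 'n::finite \<Rightarrow> complex"
  assumes "integrable torus_measure f" "g \<in> borel_measurable torus_measure"
    "\<And>x. x \<in> cbox 0 (\<chi> i. 2 * pi) \<Longrightarrow> cmod (g x) \<le> B"
  shows "integrable torus_measure (\<lambda>x. f x * g x)"
proof (rule Bochner_Integration.integrable_bound)
  show "integrable torus_measure (\<lambda>x. B * cmod (f x))" using assms(1) by auto
  show "(\<lambda>x. f x * g x) \<in> borel_measurable torus_measure"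
    using assms(1,2) by (auto intro: borel_measurable_times)
  have "cmod (f x * g x) \<le> norm (B * cmod (f x))" if "x \<in> cbox 0 (\<chi> i. 2 * pi)" for x
  proof -
    have "cmod (f x) * cmod (g x) \<le> cmod (f x) * B" by (intro mult_left_mono assms that) auto
    moreover have "cmod (f x) * B = norm (B * cmod (f x))"
      using order_trans[OF norm_ge_zero assms(3)[OF that]] by (simp add: abs_mult)
    ultimately show ?thesis by (simp add: norm_mult)
  qed
  thus "AE x in torus_measure. cmod (f x * g x) \<le> norm (B * cmod (f x))" by auto
qed

lemma borel_measurable_cis [measurable]:
  fixes k :: "int ^ 'n::finite"
  shows "(\<lambda>x. cis (freq k \<bullet> x)) \<in> borel_measurable torus_measure"
  by (rule borel_measurable_torus) (intro continuous_intros)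

lemma integrable_torus_cis:
  fixes k :: "int ^ 'n::finite"
  assumes "integrable torus_measure f"
  shows "integrable torus_measure (\<lambda>x. f x * cis (freq k \<bullet> x))"
  by (rule integrable_torus_mult_bounded[OF assms, where B = 1]) auto

lemma fourier_coeff_altdef:
  fixes f :: "real ^ 'n::finite \<Rightarrow> complex"
  shows "fourier_coeff f k = (\<integral>x. f x * cis (freq (- k) \<bullet> x) \<partial>torus_measure) / complex_of_real (sqrt ((2 * pi) ^ CARD('n)))"
  by (simp add: fourier_coeff_def fourier_mode_def cis_cnj freq_minus)

lemma integral_trig_poly_eq_0:
  fixes f :: "real ^ 'n::finite \<Rightarrow> complex"
  assumes f: "integrable torus_measure f" and 0: "\<And>k. fourier_coeff f k = 0" and p: "trig_poly p"
  shows "integrable torus_measure (\<lambda>x. f x * p x)" "(\<integral>x. f x * p x \<partial>torus_measure) = 0"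
proof -
  have 0: "(\<integral>x. f x * cis (freq k \<bullet> x) \<partial>torus_measure) = 0" for k
    using 0[of "- k"] by (simp add: fourier_coeff_altdef)
  have "integrable torus_measure (\<lambda>x. f x * p x) \<and> (\<integral>x. f x * p x \<partial>torus_measure) = 0"
    using p
  proof (induction rule: trig_poly.induct)
    case (step p c k)
    have i: "integrable torus_measure (\<lambda>x. c * (f x * cis (freq k \<bullet> x)))"
      using integrable_torus_cis[OF f] by auto
    have "f x * (c * cis (freq k \<bullet> x) + p x) = c * (f x * cis (freq k \<bullet> x)) + f x * p x" for x
      by (simp add: algebra_simps)
    thus ?case using i step 0 by simp
  qed simp
  thus "integrable torus_measure (\<lambda>x. f x * p x)" "(\<integral>x. f x * p x \<partial>torus_measure) = 0" by auto
qed

text \<open>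
  On the compact image of the cell, \<open>G\<close> is a uniform limit of polynomials, that is, of trigonometric
  polynomials, to which \<open>f\<close> is orthogonal.
\<close>

lemma integral_torus_continuous_eq_0:
  fixes f :: "real ^ 'n::finite \<Rightarrow> complex" and G :: "complex ^ 'n \<Rightarrow> real"
  assumes f: "integrable torus_measure f" and 0: "\<And>k. fourier_coeff f k = 0"
    and G: "continuous_on UNIV G"
  shows "(\<integral>x. f x * of_real (G (torus_embed x)) \<partial>torus_measure) = 0"
proof -
  let ?Q = "cbox 0 (\<chi> i. 2 * pi) :: (real ^ 'n) set"
  let ?K = "torus_embed ` ?Q"
  let ?I = "\<integral>x. f x * of_real (G (torus_embed x)) \<partial>torus_measure"
  have K: "compact ?K"
    by (rule compact_continuous_image[OF continuous_torus_embed]) auto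
  have contG: "continuous_on UNIV (\<lambda>x. G (torus_embed x))"
    using continuous_on_compose2[OF G continuous_torus_embed] by auto
  obtain B where B: "\<And>x. x \<in> ?Q \<Longrightarrow> cmod (of_real (G (torus_embed x))) \<le> B"
  proof -
    have "compact ((\<lambda>x. G (torus_embed x)) ` ?Q)"
      by (rule compact_continuous_image) (auto intro: continuous_on_subset[OF contG])
    from compact_imp_bounded[OF this] that show ?thesis
      unfolding bounded_iff by auto
  qed
  have cont': "continuous_on UNIV (\<lambda>x. of_real (G (torus_embed x)) :: complex)"
    using contG by (intro continuous_intros)
  have intG: "integrable torus_measure (\<lambda>x. f x * of_real (G (torus_embed x)))"
    by (rule integrable_torus_mult_bounded[OF f borel_measurable_torus[OF cont'] B])
  have "cmod ?I \<le> e * (\<integral>x. cmod (f x) \<partial>torus_measure)" if "e > 0" for e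
  proof -
    obtain p where p: "polynomial_function p" "\<And>z. z \<in> ?K \<Longrightarrow> norm (G z - p z) < e"
      using Stone_Weierstrass_polynomial_function[OF K continuous_on_subset[OF G] \<open>e > 0\<close>] by auto
    have tp: "trig_poly (\<lambda>x. of_real (p (torus_embed x)))"
      using p(1) by (intro trig_poly_real_polynomial) (simp add: real_polynomial_function_eq)
    note P = integral_trig_poly_eq_0[OF f 0 tp]
    have "?I = (\<integral>x. f x * of_real (G (torus_embed x)) - f x * of_real (p (torus_embed x)) \<partial>torus_measure)"
      using intG P by simp
    also have "cmod \<dots> \<le> (\<integral>x. e * cmod (f x) \<partial>torus_measure)"
    proof (rule Bochner_Integration.integral_norm_bound_integral)
      fix x :: "real ^ 'n" assume "x \<in> space torus_measure"
      hence "norm (G (torus_embed x) - p (torus_embed x)) \<le> e" using p(2) by (auto intro: less_imp_le)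
      hence "cmod (of_real (G (torus_embed x) - p (torus_embed x))) \<le> e"
        unfolding norm_of_real by simp
      hence "cmod (f x) * cmod (of_real (G (torus_embed x) - p (torus_embed x))) \<le> cmod (f x) * e"
        by (intro mult_left_mono) auto
      thus "cmod (f x * of_real (G (torus_embed x)) - f x * of_real (p (torus_embed x))) \<le> e * cmod (f x)"
        by (simp add: norm_mult[symmetric] algebra_simps)
    qed (use f intG P in auto)
    finally show ?thesis by simp
  qed
  note * = this
  have "cmod ?I \<le> 0 + e" if "e > 0" for e
  proof -
    define J where "J = (\<integral>x. cmod (f x) \<partial>(torus_measure :: (real ^ 'n) measure))"
    have J: "J \<ge> 0" by (simp add: J_def)
    have "e / (J + 1) > 0" using J that by simp
    hence "cmod ?I \<le> (e / (J + 1)) * J" unfolding J_def by (rule *)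
    also have "\<dots> \<le> e" using J that by (simp add: field_simps)
    finally show ?thesis by simp
  qed
  hence "cmod ?I \<le> 0" by (rule field_le_epsilon)
  thus ?thesis by simp
qed

text \<open>
  Opposite faces of the cell have the same image, so one of the two points has to be interior.
\<close>

lemma torus_embed_inj_interior:
  assumes x: "x \<in> cbox 0 (\<chi> i. 2 * pi)" and y: "y \<in> box 0 (\<chi> i. 2 * pi)"
    and eq: "torus_embed x = torus_embed y"
  shows "x = y"
proof -
  have "x $ i = y $ i" for i
  proof -
    have "cis (x $ i) = cis (y $ i)" using eq by (simp add: torus_embed_def vec_eq_iff)
    hence "sin (x $ i) = sin (y $ i) \<and> cos (x $ i) = cos (y $ i)" by (simp add: complex_eq_iff)
    then obtain n :: int where n: "x $ i = y $ i + 2 * pi * n" using sin_cos_eq_iff by blast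
    have "0 \<le> x $ i" "x $ i \<le> 2 * pi" "0 < y $ i" "y $ i < 2 * pi"
      using x y by (auto simp: mem_box_cart)
    hence *: "2 * pi * real_of_int n < 2 * pi * 1" "2 * pi * (-1) < 2 * pi * real_of_int n"
      using n by linarith+
    have "real_of_int n < 1" "- 1 < real_of_int n"
      using * by (simp_all only: mult_less_cancel_left_pos[of "2 * pi"] pi_gt_zero zero_less_mult_iff zero_less_numeral simp_thms)
    hence "n = 0" by linarith
    thus ?thesis using n by simp
  qed
  thus ?thesis by (simp add: vec_eq_iff)
qed

text \<open>
  The tents \<open>max 0 (1 - m * dist (z, image of K))\<close> are continuous functions of the embedded variable that
  decrease to the indicator of the image of \<open>K\<close>. A compact set in the open cell is separated by the
  embedding from all other points of the cell, so the limit is the indicator of \<open>K\<close> itself.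
\<close>

lemma integral_torus_compact_eq_0:
  fixes f :: "real ^ 'n::finite \<Rightarrow> complex"
  assumes f: "integrable torus_measure f" and 0: "\<And>k. fourier_coeff f k = 0"
    and K: "compact K" "K \<subseteq> box 0 (\<chi> i. 2 * pi)"
  shows "(\<integral>x. indicator K x *\<^sub>R f x \<partial>torus_measure) = 0"
proof (cases "K = {}")
  case False
  let ?K = "torus_embed ` K"
  define G where "G m z = max 0 (1 - real m * infdist z ?K)" for m z
  have cl: "closed ?K"
    by (rule compact_imp_closed, rule compact_continuous_image[OF continuous_torus_embed K(1)])
  have contG: "continuous_on UNIV (G m)" for m
    unfolding G_def by (intro continuous_intros)
  have contG': "continuous_on UNIV (\<lambda>x. of_real (G m (torus_embed x)) :: complex)" for m
    by (intro continuous_intros continuous_on_compose2[OF contG continuous_torus_embed]) auto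
  have G01: "0 \<le> G m z" "G m z \<le> 1" for m z
    unfolding G_def by (auto simp: infdist_nonneg)
  have lim: "(\<lambda>m. f x * of_real (G m (torus_embed x))) \<longlonglongrightarrow> indicator K x *\<^sub>R f x"
    if "x \<in> cbox 0 (\<chi> i. 2 * pi)" for x
  proof (cases "x \<in> K")
    case True
    thus ?thesis by (simp add: G_def)
  next
    case False
    have "torus_embed x \<notin> ?K" using torus_embed_inj_interior[OF that] K(2) False by (metis imageE subsetD)
    hence pos: "infdist (torus_embed x) ?K > 0"
      using cl \<open>K \<noteq> {}\<close> by (simp add: infdist_pos_not_in_closed)
    have "eventually (\<lambda>m. G m (torus_embed x) = 0) sequentially"
    proof -
      obtain N :: nat where N: "1 / infdist (torus_embed x) ?K < real N" using reals_Archimedean2 by blast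
      have "G m (torus_embed x) = 0" if "m \<ge> N" for m
      proof -
        have "1 / infdist (torus_embed x) ?K < real m" using N that by linarith
        hence "1 < real m * infdist (torus_embed x) ?K" using pos by (simp add: field_simps)
        thus ?thesis by (simp add: G_def)
      qed
      thus ?thesis by (auto simp: eventually_sequentially)
    qed
    hence "eventually (\<lambda>m. f x * of_real (G m (torus_embed x)) = indicator K x *\<^sub>R f x) sequentially"
      by eventually_elim (use False in auto)
    thus ?thesis by (rule tendsto_eventually)
  qed
  have "(\<lambda>m. \<integral>x. f x * of_real (G m (torus_embed x)) \<partial>torus_measure)
     \<longlonglongrightarrow> (\<integral>x. indicator K x *\<^sub>R f x \<partial>torus_measure)"
  proof (rule integral_dominated_convergence[where w = "\<lambda>x. cmod (f x)"])
    have "K \<in> sets (lebesgue :: (real ^ 'n) measure)" using K(1) by (simp add: borel_compact)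
    hence "K \<in> sets torus_measure" using K(2) box_subset_cbox[of 0 "\<chi> i. 2 * pi"]
      by (auto simp: torus_measure_def sets_restrict_space_iff)
    thus "(\<lambda>x. indicator K x *\<^sub>R f x) \<in> borel_measurable torus_measure"
      using f by (intro borel_measurable_scaleR borel_measurable_indicator) auto
    show "(\<lambda>x. f x * of_real (G m (torus_embed x))) \<in> borel_measurable torus_measure" for m
      using f borel_measurable_torus[OF contG'] by (intro borel_measurable_times) auto
    show "AE x in torus_measure. (\<lambda>m. f x * of_real (G m (torus_embed x))) \<longlonglongrightarrow> indicator K x *\<^sub>R f x"
      using lim by auto
    show "AE x in torus_measure. cmod (f x * of_real (G m (torus_embed x))) \<le> cmod (f x)" for m
      using G01 by (auto simp: norm_mult intro!: mult_left_le)
  qed (use f in auto)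
  moreover have "(\<integral>x. f x * of_real (G m (torus_embed x)) \<partial>torus_measure) = 0" for m
    by (rule integral_torus_continuous_eq_0[OF f 0 contG])
  ultimately show ?thesis by (simp add: LIMSEQ_const_iff)
qed simp

text \<open>
  Up to a null set, every measurable subset of the cell is an increasing union of compact subsets of the
  open cell. So \<open>f\<close> has integral zero over every measurable set.
\<close>

theorem fourier_uniqueness:
  fixes f :: "real ^ 'n::finite \<Rightarrow> complex"
  assumes f: "integrable torus_measure f" and 0: "\<And>k. fourier_coeff f k = 0"
  shows "AE x in torus_measure. f x = 0"
proof -
  interpret finite_measure "torus_measure :: (real ^ 'n) measure" by (rule finite_measure_torus)
  show ?thesis
  proof (rule density_zero[OF f])
  fix A :: "(real ^ 'n) set" assume A: "A \<in> sets torus_measure"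
  let ?Q = "cbox 0 (\<chi> i. 2 * pi) :: (real ^ 'n) set" and ?B = "box 0 (\<chi> i. 2 * pi) :: (real ^ 'n) set"
  have AQ: "A \<in> sets lebesgue" "A \<subseteq> ?Q" using A by (auto simp: torus_measure_def sets_restrict_space_iff)
  have "A \<inter> ?B \<in> sets lebesgue" using AQ(1) by (intro sets.Int) auto
  then obtain C N where CN: "fsigma C" "N \<in> null_sets lebesgue" "C \<union> N = A \<inter> ?B"
    by (metis lebesgue_set_almost_fsigma)
  then obtain F where F: "range F \<subseteq> Collect compact" "C = \<Union>(range (F :: nat \<Rightarrow> _))"
    using fsigma_Union_compact by metis
  define K where "K n = (\<Union>i\<le>n. F i)" for n
  have K: "compact (K n)" for n unfolding K_def using F(1) by (intro compact_UN) auto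
  have CB: "C \<subseteq> ?B" using CN(3) by auto
  have KB: "K n \<subseteq> ?B" for n using CB F(2) by (auto simp: K_def)
  have Csets: "C \<in> sets torus_measure"
  proof -
    have "C \<in> sets lebesgue" unfolding F(2) using F(1) by (intro sets.countable_UN) (auto simp: borel_compact)
    thus ?thesis using CB box_subset_cbox[of 0 "\<chi> i. 2 * pi"]
      by (auto simp: torus_measure_def sets_restrict_space_iff)
  qed
  have Ksets: "K n \<in> sets torus_measure" for n
    using K[of n] KB[of n] box_subset_cbox[of 0 "\<chi> i. 2 * pi"]
    by (auto simp: torus_measure_def sets_restrict_space_iff borel_compact)
  have "(\<lambda>n. \<integral>x. indicator (K n) x *\<^sub>R f x \<partial>torus_measure) \<longlonglongrightarrow> (\<integral>x. indicator C x *\<^sub>R f x \<partial>torus_measure)"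
  proof (rule integral_dominated_convergence[where w = "\<lambda>x. cmod (f x)"])
    show "AE x in torus_measure. (\<lambda>n. indicator (K n) x *\<^sub>R f x) \<longlonglongrightarrow> indicator C x *\<^sub>R f x"
    proof (rule AE_I2)
      fix x
      show "(\<lambda>n. indicator (K n) x *\<^sub>R f x) \<longlonglongrightarrow> indicator C x *\<^sub>R f x"
      proof (cases "x \<in> C")
        case True
        then obtain m where "x \<in> F m" using F(2) by auto
        hence "x \<in> K n" if "n \<ge> m" for n using that by (auto simp: K_def)
        hence "eventually (\<lambda>n. indicator (K n) x *\<^sub>R f x = indicator C x *\<^sub>R f x) sequentially"
          using True unfolding eventually_sequentially by (intro exI[of _ m]) auto
        thus ?thesis by (rule tendsto_eventually)
      next
        case False
        hence "x \<notin> K n" for n using F(2) by (auto simp: K_def)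
        thus ?thesis using False by simp
      qed
    qed
  qed (use f Csets Ksets in \<open>auto intro!: borel_measurable_scaleR borel_measurable_indicator simp: indicator_def\<close>)
  hence "(\<integral>x. indicator C x *\<^sub>R f x \<partial>torus_measure) = 0"
    using integral_torus_compact_eq_0[OF f 0 K KB] by (simp add: LIMSEQ_const_iff)
  moreover have "(\<integral>x. indicator C x *\<^sub>R f x \<partial>torus_measure) = (\<integral>x. indicator A x *\<^sub>R f x \<partial>torus_measure)"
  proof (rule integral_cong_AE)
    have "negligible (?Q - ?B)" by (rule negligible_frontier_interval)
    hence "?Q - ?B \<in> null_sets lebesgue" by (simp add: negligible_iff_null_sets)
    hence "N \<union> (?Q - ?B) \<in> null_sets lebesgue" using CN(2) by blast
    hence "AE x in lebesgue. x \<notin> N \<union> (?Q - ?B)" by (rule AE_not_in)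
    hence "AE x in torus_measure. x \<notin> N \<union> (?Q - ?B)" unfolding torus_measure_def
      by (subst AE_restrict_space_iff) auto
    thus "AE x in torus_measure. indicator C x *\<^sub>R f x = indicator A x *\<^sub>R f x"
    proof eventually_elim
      case (elim x)
      hence "x \<in> C \<longleftrightarrow> x \<in> A" using CN(3) AQ(2) by blast
      thus ?case by (simp add: indicator_def)
    qed
  qed (use f A Csets in \<open>auto intro!: borel_measurable_scaleR borel_measurable_indicator\<close>)
  ultimately show "set_lebesgue_integral torus_measure A f = 0"
    by (simp add: set_lebesgue_integral_def)
qed
qed

section \<open>The Wiener algebra\<close>

text \<open>
  The coefficients with respect to the unnormalized characters. In terms of them the Fourier coefficients
  of a product are a convolution without a constant.
\<close>

definition fc :: "(real ^ 'n::finite \<Rightarrow> complex) \<Rightarrow> int ^ 'n \<Rightarrow> complex" where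
  "fc f k = fourier_coeff f k / complex_of_real (sqrt ((2 * pi) ^ CARD('n)))"

definition synth :: "(int ^ 'n::finite \<Rightarrow> complex) \<Rightarrow> real ^ 'n \<Rightarrow> complex" where
  "synth a x = (\<Sum>\<^sub>\<infinity>k. a k * cis (freq k \<bullet> x))"

text \<open>
  The functions that are equal at every point, and not only almost everywhere, to an absolutely convergent
  Fourier series. Consequently pointwise identities between such functions can be checked on coefficients,
  and polynomial identities between coefficient sequences can be checked pointwise.
\<close>

definition wiener :: "(real ^ 'n::finite \<Rightarrow> complex) set" where
  "wiener = {f. summable_abs (fc f) \<and> f = synth (fc f)}"

lemma sqrt_volume_sq:
  "complex_of_real (sqrt ((2 * pi) ^ n)) * complex_of_real (sqrt ((2 * pi) ^ n)) = of_real ((2 * pi) ^ n)"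
  by (subst of_real_mult[symmetric]) simp

lemma fc_altdef:
  fixes f :: "real ^ 'n::finite \<Rightarrow> complex"
  shows "fc f k = (\<integral>x. f x * cis (freq (- k) \<bullet> x) \<partial>torus_measure) / of_real ((2 * pi) ^ CARD('n))"
  unfolding fc_def fourier_coeff_altdef divide_divide_eq_left sqrt_volume_sq ..

lemma summable_abs_mult_cis:
  "summable_abs a \<Longrightarrow> summable_abs (\<lambda>k. a k * cis (freq k \<bullet> x))"
  by (simp add: norm_mult)

lemma sum_le_infsum_abs:
  assumes "summable_abs a" "finite F"
  shows "(\<Sum>k\<in>F. cmod (a k)) \<le> (\<Sum>\<^sub>\<infinity>k. cmod (a k))"
  using finite_sum_le_infsum[OF assms(1), of F] assms(2) by auto

lemma fc_synth:
  fixes a :: "int ^ 'n::finite \<Rightarrow> complex"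
  assumes a: "summable_abs a"
  shows "fc (synth a) = a"
proof
  fix k :: "int ^ 'n"
  define B where "B = (\<Sum>\<^sub>\<infinity>k. cmod (a k))"
  define f where "f j x = a j * cis (freq (j - k) \<bullet> x)" for j x
  have meas: "f j \<in> borel_measurable torus_measure" for j
    unfolding f_def by (rule borel_measurable_torus) (intro continuous_intros)
  have bd: "(\<Sum>j\<in>F. cmod (f j x)) \<le> B" if "finite F" for F x
    using sum_le_infsum_abs[OF a that] by (simp add: f_def norm_mult B_def)
  note * = integral_infsum_bounded[OF finite_measure_torus meas bd]
  have "synth a x * cis (freq (- k) \<bullet> x) = (\<Sum>\<^sub>\<infinity>j. f j x)" for x
    unfolding synth_def f_def
    by (subst infsum_cmult_left'[symmetric])
      (simp add: freq_diff freq_minus inner_diff_left cis_mult mult.assoc)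
  hence "(\<integral>x. synth a x * cis (freq (- k) \<bullet> x) \<partial>torus_measure) = (\<Sum>\<^sub>\<infinity>j. \<integral>x. f j x \<partial>torus_measure)"
    using * by simp
  also have "\<dots> = (\<Sum>\<^sub>\<infinity>j. if j = k then a k * of_real ((2 * pi) ^ CARD('n)) else 0)"
    by (rule infsum_cong) (auto simp: f_def torus_integral_cis)
  also have "\<dots> = (\<Sum>\<^sub>\<infinity>j\<in>{k}. if j = k then a k * of_real ((2 * pi) ^ CARD('n)) else 0)"
    by (rule infsum_cong_neutral) auto
  also have "\<dots> = a k * of_real ((2 * pi) ^ CARD('n))" by simp
  finally show "fc (synth a) k = a k" unfolding fc_altdef by simp
qed

lemma wiener_synth: "summable_abs a \<Longrightarrow> synth a \<in> wiener"
  by (simp add: wiener_def fc_synth)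

lemma wiener_summable: "f \<in> wiener \<Longrightarrow> summable_abs (fc f)"
  by (simp add: wiener_def)

lemma wiener_eq: "f \<in> wiener \<Longrightarrow> synth (fc f) = f"
  by (simp add: wiener_def)

lemma wiener_eqI: "f \<in> wiener \<Longrightarrow> g \<in> wiener \<Longrightarrow> fc f = fc g \<Longrightarrow> f = g"
  by (metis wiener_eq)

lemma continuous_synth:
  assumes a: "summable_abs a"
  shows "continuous_on UNIV (synth a)"
proof -
  have "uniform_limit UNIV (\<lambda>F x. \<Sum>k\<in>F. a k * cis (freq k \<bullet> x)) (\<lambda>x. \<Sum>\<^sub>\<infinity>k. a k * cis (freq k \<bullet> x)) (finite_subsets_at_top UNIV)"
    by (rule Weierstrass_m_test_general[OF _ a]) (simp add: norm_mult)
  hence "continuous_on UNIV (\<lambda>x. \<Sum>\<^sub>\<infinity>k. a k * cis (freq k \<bullet> x))"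
    by (rule uniform_limit_theorem[rotated]) (auto intro!: always_eventually continuous_intros)
  thus ?thesis by (simp add: synth_def[abs_def])
qed

lemma cmod_synth_le:
  assumes a: "summable_abs a"
  shows "cmod (synth a x) \<le> (\<Sum>\<^sub>\<infinity>k. cmod (a k))"
  unfolding synth_def using norm_infsum_bound[OF summable_abs_mult_cis[OF a, of x]] by (simp add: norm_mult)

lemma synth_periodic:
  fixes a :: "int ^ 'n::finite \<Rightarrow> complex"
  shows "torus_periodic (synth a)"
proof -
  have "cis (freq k \<bullet> (x + axis i (2 * pi))) = cis (freq k \<bullet> x)" for k :: "int ^ 'n" and i x
  proof -
    have "freq k \<bullet> axis i (2 * pi) = 2 * pi * of_int (k $ i)"
      by (simp add: inner_axis freq_def)
    thus ?thesis using cis_multiple_2pi[of "of_int (k $ i)"] by (simp add: inner_add_right cis_mult[symmetric])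
  qed
  thus ?thesis by (simp add: torus_periodic_def synth_def)
qed

lemma torus_L2_bounded:
  assumes "torus_periodic f" "continuous_on UNIV f" "\<And>x. cmod (f x) \<le> B"
  shows "f \<in> torus_L2"
proof -
  interpret finite_measure "torus_measure :: (real ^ 'a) measure" by (rule finite_measure_torus)
  have m: "f \<in> borel_measurable torus_measure" by (rule borel_measurable_torus[OF assms(2)])
  have "integrable torus_measure (\<lambda>x. (cmod (f x))\<^sup>2)"
  proof (rule integrable_const_bound[where B = "B\<^sup>2"])
    show "AE x in torus_measure. norm ((cmod (f x))\<^sup>2) \<le> B\<^sup>2"
      by (rule AE_I2) (simp add: assms(3) power_mono)
  qed (use m in measurable)
  thus ?thesis using assms(1) m by (simp add: torus_L2_def)
qed

lemma wiener_torus_L2: "f \<in> wiener \<Longrightarrow> f \<in> torus_L2"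
proof -
  assume f: "f \<in> wiener"
  have "synth (fc f) \<in> torus_L2"
    by (rule torus_L2_bounded[OF synth_periodic continuous_synth cmod_synth_le]) (fact wiener_summable[OF f])+
  thus ?thesis by (simp add: wiener_eq f)
qed

lemma torus_L2_integrable:
  assumes "f \<in> torus_L2"
  shows "integrable torus_measure f"
proof (rule Bochner_Integration.integrable_bound)
  interpret finite_measure "torus_measure :: (real ^ 'a) measure" by (rule finite_measure_torus)
  show "integrable torus_measure (\<lambda>x. 1 + (cmod (f x))\<^sup>2)" using assms by (auto simp: torus_L2_def)
  show "f \<in> borel_measurable torus_measure" using assms by (auto simp: torus_L2_def)
  have "y \<le> 1 + y\<^sup>2" for y :: real
    using zero_le_power2[of "y - 1/2"] by (simp add: power2_eq_square algebra_simps)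
  thus "AE x in torus_measure. norm (f x) \<le> norm (1 + (cmod (f x))\<^sup>2)"
    by (intro AE_I2) (simp add: abs_of_nonneg add_nonneg_nonneg)
qed

lemma torus_L2_diff:
  assumes f: "f \<in> torus_L2" and g: "g \<in> torus_L2"
  shows "(\<lambda>x. f x - g x) \<in> torus_L2"
proof -
  have m: "f \<in> borel_measurable torus_measure" "g \<in> borel_measurable torus_measure"
    using f g by (auto simp: torus_L2_def)
  have "integrable torus_measure (\<lambda>x. (cmod (f x - g x))\<^sup>2)"
  proof (rule Bochner_Integration.integrable_bound)
    show "integrable torus_measure (\<lambda>x. 2 * (cmod (f x))\<^sup>2 + 2 * (cmod (g x))\<^sup>2)"
      using f g by (auto simp: torus_L2_def)
    have "(cmod (a - b))\<^sup>2 \<le> 2 * (cmod a)\<^sup>2 + 2 * (cmod b)\<^sup>2" for a b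
    proof -
      have "(cmod (a - b))\<^sup>2 \<le> (cmod a + cmod b)\<^sup>2" by (intro power_mono norm_triangle_ineq4) auto
      also have "\<dots> \<le> 2 * (cmod a)\<^sup>2 + 2 * (cmod b)\<^sup>2"
        using zero_le_power2[of "cmod a - cmod b"] by (simp add: power2_eq_square algebra_simps)
      finally show ?thesis .
    qed
    thus "AE x in torus_measure. norm ((cmod (f x - g x))\<^sup>2) \<le> norm (2 * (cmod (f x))\<^sup>2 + 2 * (cmod (g x))\<^sup>2)"
      by (intro AE_I2) (simp add: abs_of_nonneg)
  qed (use m in measurable)
  moreover have "torus_periodic (\<lambda>x. f x - g x)"
    using f g by (auto simp: torus_L2_def torus_periodic_def)
  ultimately show ?thesis using m by (simp add: torus_L2_def)
qed

lemma fc_diff_L2: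
  assumes f: "f \<in> torus_L2" and g: "g \<in> torus_L2"
  shows "fc (\<lambda>x. f x - g x) k = fc f k - fc g k"
  using integrable_torus_cis[OF torus_L2_integrable[OF f]] integrable_torus_cis[OF torus_L2_integrable[OF g]]
  by (simp add: fc_altdef left_diff_distrib diff_divide_distrib)

lemma fc_cong_AE:
  assumes "AE x in torus_measure. f x = g x" "f \<in> borel_measurable torus_measure" "g \<in> borel_measurable torus_measure"
  shows "fc f = fc g"
proof
  fix k
  have "(\<integral>x. f x * cis (freq (- k) \<bullet> x) \<partial>torus_measure) = (\<integral>x. g x * cis (freq (- k) \<bullet> x) \<partial>torus_measure)"
    by (rule integral_cong_AE) (use assms in \<open>auto intro!: borel_measurable_times\<close>)
  thus "fc f k = fc g k" by (simp add: fc_altdef)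
qed

lemma AE_eq_synth:
  fixes f :: "real ^ 'n::finite \<Rightarrow> complex"
  assumes f: "f \<in> torus_L2" and s: "summable_abs (fc f)"
  shows "AE x in torus_measure. f x = synth (fc f) x"
proof -
  have w: "synth (fc f) \<in> torus_L2" using s by (intro wiener_torus_L2 wiener_synth)
  note d = torus_L2_diff[OF f w]
  have "fc (\<lambda>x. f x - synth (fc f) x) k = 0" for k
    using fc_diff_L2[OF f w] by (simp add: fc_synth s)
  hence "fourier_coeff (\<lambda>x. f x - synth (fc f) x) k = 0" for k
    by (simp add: fc_def)
  from fourier_uniqueness[OF torus_L2_integrable[OF d] this] show ?thesis by simp
qed

subsection \<open>Algebraic operations\<close>

lemma summable_abs_add:
  assumes "summable_abs a" "summable_abs b"
  shows "summable_abs (\<lambda>k. a k + b k)"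
  by (rule summable_on_comparison_test[OF summable_on_add[OF assms]]) (auto intro: norm_triangle_ineq)

lemma summable_abs_bounded_mult:
  assumes "summable_abs a" "\<And>k. cmod (m k) \<le> C"
  shows "summable_abs (\<lambda>k. m k * a k)"
proof (rule summable_on_comparison_test)
  show "(\<lambda>k. C * cmod (a k)) summable_on UNIV" using assms(1) by (rule summable_on_cmult_right)
  show "cmod (m k * a k) \<le> C * cmod (a k)" for k
    using assms(2)[of k] by (simp add: norm_mult mult_right_mono)
qed auto

lemma synth_add:
  assumes "summable_abs a" "summable_abs b"
  shows "synth (\<lambda>k. a k + b k) x = synth a x + synth b x"
  unfolding synth_def distrib_right
  by (rule infsum_add; rule abs_summable_summable; rule summable_abs_mult_cis; fact)

lemma synth_cmult: "synth (\<lambda>k. c * a k) x = c * synth a x"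
  unfolding synth_def mult.assoc by (rule infsum_cmult_right')

lemma wiener_coeffs_eqI:
  assumes "summable_abs a" "\<And>x. f x = synth a x"
  shows "f \<in> wiener" "fc f = a"
proof -
  have "f = synth a" using assms(2) by auto
  thus "f \<in> wiener" "fc f = a" using assms(1) by (auto simp: wiener_synth fc_synth)
qed

lemma wiener_add:
  assumes "f \<in> wiener" "g \<in> wiener"
  shows "(\<lambda>x. f x + g x) \<in> wiener" "fc (\<lambda>x. f x + g x) = (\<lambda>k. fc f k + fc g k)"
proof -
  have *: "f x + g x = synth (\<lambda>k. fc f k + fc g k) x" for x
    using assms by (simp add: synth_add wiener_summable wiener_eq)
  have s: "summable_abs (\<lambda>k. fc f k + fc g k)" by (intro summable_abs_add wiener_summable assms)
  show "(\<lambda>x. f x + g x) \<in> wiener" "fc (\<lambda>x. f x + g x) = (\<lambda>k. fc f k + fc g k)"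
    by (rule wiener_coeffs_eqI[OF s *])+
qed

lemma wiener_cmult:
  assumes "f \<in> wiener"
  shows "(\<lambda>x. c * f x) \<in> wiener" "fc (\<lambda>x. c * f x) = (\<lambda>k. c * fc f k)"
proof -
  have *: "c * f x = synth (\<lambda>k. c * fc f k) x" for x
    using assms by (simp add: synth_cmult wiener_eq)
  have s: "summable_abs (\<lambda>k. c * fc f k)"
    by (rule summable_abs_bounded_mult[OF wiener_summable[OF assms], where C = "cmod c"]) simp
  show "(\<lambda>x. c * f x) \<in> wiener" "fc (\<lambda>x. c * f x) = (\<lambda>k. c * fc f k)"
    by (rule wiener_coeffs_eqI[OF s *])+
qed

lemma wiener_uminus:
  assumes "f \<in> wiener"
  shows "(\<lambda>x. - f x) \<in> wiener" "fc (\<lambda>x. - f x) = (\<lambda>k. - fc f k)"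
  using wiener_cmult[OF assms, of "- 1"] by simp_all

lemma wiener_diff:
  assumes "f \<in> wiener" "g \<in> wiener"
  shows "(\<lambda>x. f x - g x) \<in> wiener" "fc (\<lambda>x. f x - g x) = (\<lambda>k. fc f k - fc g k)"
  using wiener_add[OF assms(1) wiener_uminus(1)[OF assms(2)]] wiener_uminus(2)[OF assms(2)] by simp_all

lemma wiener_const:
  fixes c :: complex
  shows "(\<lambda>x :: real ^ 'n::finite. c) \<in> wiener" "fc (\<lambda>x :: real ^ 'n. c) = (\<lambda>k. if k = 0 then c else 0)"
proof -
  let ?a = "\<lambda>k :: int ^ 'n. if k = 0 then c else 0"
  have "(\<lambda>k. cmod (?a k)) summable_on UNIV \<longleftrightarrow> (\<lambda>k. cmod (?a k)) summable_on {0}"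
    by (rule summable_on_cong_neutral) auto
  hence s: "summable_abs ?a" by simp
  have *: "c = synth ?a x" for x
  proof -
    have "synth ?a x = (\<Sum>\<^sub>\<infinity>k\<in>{0}. ?a k * cis (freq k \<bullet> x))"
      unfolding synth_def by (rule infsum_cong_neutral) auto
    thus ?thesis by simp
  qed
  show "(\<lambda>x :: real ^ 'n. c) \<in> wiener" "fc (\<lambda>x :: real ^ 'n. c) = ?a"
    by (rule wiener_coeffs_eqI[OF s *])+
qed

lemma wiener_cnj:
  assumes "f \<in> wiener"
  shows "(\<lambda>x. cnj (f x)) \<in> wiener" "fc (\<lambda>x. cnj (f x)) = (\<lambda>k. cnj (fc f (- k)))"
proof -
  have bij: "bij (uminus :: int ^ 'a \<Rightarrow> _)" by (rule bij_uminus)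
  have s: "summable_abs (\<lambda>k. cnj (fc f (- k)))"
    using summable_on_reindex_bij_betw[OF bij, of "\<lambda>k. cmod (fc f k)"] wiener_summable[OF assms] by simp
  have *: "cnj (f x) = synth (\<lambda>k. cnj (fc f (- k))) x" for x
  proof -
    have "cnj (f x) = cnj (synth (fc f) x)" by (simp add: wiener_eq assms)
    also have "\<dots> = (\<Sum>\<^sub>\<infinity>k. cnj (fc f k) * cis (- (freq k \<bullet> x)))"
      unfolding synth_def infsum_cnj[symmetric] by (simp add: cis_cnj)
    also have "\<dots> = (\<Sum>\<^sub>\<infinity>k. cnj (fc f (- k)) * cis (freq k \<bullet> x))"
      using infsum_reindex_bij_betw[OF bij, of "\<lambda>k. cnj (fc f k) * cis (- (freq k \<bullet> x))"]
      by (simp add: freq_minus)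
    finally show ?thesis by (simp add: synth_def)
  qed
  show "(\<lambda>x. cnj (f x)) \<in> wiener" "fc (\<lambda>x. cnj (f x)) = (\<lambda>k. cnj (fc f (- k)))"
    by (rule wiener_coeffs_eqI[OF s *])+
qed

lemma summable_abs_prod:
  fixes a b :: "'k \<Rightarrow> complex"
  assumes "summable_abs a" "summable_abs b"
  shows "summable_abs (\<lambda>(j, l). a j * b l)"
proof -
  have "summable_abs (\<lambda>p. (\<lambda>(j, l). a j * b l) p) \<longleftrightarrow>
     (\<forall>x\<in>UNIV. summable_abs (\<lambda>y. a x * b y)) \<and>
     ((\<lambda>x. norm (\<Sum>\<^sub>\<infinity>y. norm (a x * b y))) summable_on UNIV)"
    using Infinite_Sum.abs_summable_on_Sigma_iff[of "\<lambda>(j, l). a j * b l" UNIV "\<lambda>_. UNIV"] by simp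
  moreover have "summable_abs (\<lambda>y. a x * b y)" for x
    by (rule summable_abs_bounded_mult[OF assms(2), where C = "cmod (a x)"]) simp
  moreover have "(\<lambda>x. norm (\<Sum>\<^sub>\<infinity>y. norm (a x * b y))) summable_on UNIV"
    unfolding norm_mult infsum_cmult_right' using assms(1) by (auto simp: abs_mult intro: summable_on_cmult_left)
  ultimately show ?thesis by blast
qed

lemma bij_shift_pair: "bij (\<lambda>(k, j). (j, k - j :: 'a :: ab_group_add))"
  by (rule bij_betwI[where g = "\<lambda>(j, l). (j + l, j)"]) auto

lemma summable_abs_conv_pairs:
  fixes a b :: "'k :: ab_group_add \<Rightarrow> complex"
  assumes "summable_abs a" "summable_abs b"
  shows "summable_abs (\<lambda>(k, j). a j * b (k - j))"
proof -
  have "(\<lambda>p. cmod ((\<lambda>(j, l). a j * b l) p)) summable_on UNIV" using summable_abs_prod[OF assms] by simp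
  hence "(\<lambda>p. cmod ((\<lambda>(j, l). a j * b l) ((\<lambda>(k, j). (j, k - j)) p))) summable_on UNIV"
    using summable_on_reindex_bij_betw[OF bij_shift_pair, of "\<lambda>p. cmod ((\<lambda>(j, l). a j * b l) p)"] by simp
  thus ?thesis by (simp add: case_prod_unfold)
qed

lemma summable_abs_conv:
  fixes a b :: "'k :: ab_group_add \<Rightarrow> complex"
  assumes "summable_abs a" "summable_abs b"
  shows "summable_abs (\<lambda>j. a j * b (k - j))" "summable_abs (\<lambda>k. \<Sum>\<^sub>\<infinity>j. a j * b (k - j))"
proof -
  have "(\<forall>x\<in>UNIV. summable_abs (\<lambda>y. a y * b (x - y))) \<and>
     ((\<lambda>x. norm (\<Sum>\<^sub>\<infinity>y. norm (a y * b (x - y)))) summable_on UNIV)"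
    using Infinite_Sum.abs_summable_on_Sigma_iff[of "\<lambda>(k, j). a j * b (k - j)" UNIV "\<lambda>_. UNIV"]
      summable_abs_conv_pairs[OF assms] by simp
  hence 1: "summable_abs (\<lambda>y. a y * b (k - y))" and
    2: "(\<lambda>k. norm (\<Sum>\<^sub>\<infinity>y. norm (a y * b (k - y)))) summable_on UNIV" for k by auto
  show "summable_abs (\<lambda>j. a j * b (k - j))" by (rule 1)
  show "summable_abs (\<lambda>k. \<Sum>\<^sub>\<infinity>j. a j * b (k - j))"
    by (rule summable_on_comparison_test[OF 2]) (auto intro!: order_trans[OF norm_infsum_bound[OF 1]])
qed

lemma wiener_mult:
  assumes f: "f \<in> wiener" and g: "g \<in> wiener"
  shows "(\<lambda>x. f x * g x) \<in> wiener" "fc (\<lambda>x. f x * g x) = (\<lambda>k. \<Sum>\<^sub>\<infinity>j. fc f j * fc g (k - j))"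
proof -
  let ?a = "fc f" and ?b = "fc g"
  have ab: "summable_abs ?a" "summable_abs ?b" using f g by (auto intro: wiener_summable)
  have s: "summable_abs (\<lambda>k. \<Sum>\<^sub>\<infinity>j. ?a j * ?b (k - j))" by (rule summable_abs_conv[OF ab])
  have *: "f x * g x = synth (\<lambda>k. \<Sum>\<^sub>\<infinity>j. ?a j * ?b (k - j)) x" for x
  proof -
    let ?e = "\<lambda>k. cis (freq k \<bullet> x)"
    let ?A = "\<lambda>j. ?a j * ?e j" and ?B = "\<lambda>j. ?b j * ?e j"
    have AB: "summable_abs ?A" "summable_abs ?B" by (intro summable_abs_mult_cis ab)+
    have S1: "(\<lambda>(j, l). ?A j * ?B l) summable_on UNIV"
      using summable_abs_prod[OF AB] by (rule abs_summable_summable)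
    have S2: "(\<lambda>(k, j). ?A j * ?B (k - j)) summable_on UNIV"
      using summable_abs_conv_pairs[OF AB] by (rule abs_summable_summable)
    have "f x * g x = synth ?a x * synth ?b x" using f g by (simp add: wiener_eq)
    also have "\<dots> = (\<Sum>\<^sub>\<infinity>j. \<Sum>\<^sub>\<infinity>l. ?A j * ?B l)"
      unfolding synth_def by (simp add: infsum_cmult_right' infsum_cmult_left')
    also have "\<dots> = (\<Sum>\<^sub>\<infinity>(j, l). ?A j * ?B l)"
      using infsum_Sigma'_banach[of "\<lambda>j l. ?A j * ?B l" UNIV "\<lambda>_. UNIV"] S1 by simp
    also have "\<dots> = (\<Sum>\<^sub>\<infinity>(k, j). ?A j * ?B (k - j))"
      using infsum_reindex_bij_betw[OF bij_shift_pair, of "\<lambda>(j, l). ?A j * ?B l"]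
      by (simp add: case_prod_unfold)
    also have "\<dots> = (\<Sum>\<^sub>\<infinity>k. \<Sum>\<^sub>\<infinity>j. ?A j * ?B (k - j))"
      using infsum_Sigma'_banach[of "\<lambda>k j. ?A j * ?B (k - j)" UNIV "\<lambda>_. UNIV"] S2 by simp
    also have "\<dots> = (\<Sum>\<^sub>\<infinity>k. (\<Sum>\<^sub>\<infinity>j. ?a j * ?b (k - j)) * ?e k)"
    proof (rule infsum_cong)
      fix k
      have "?A j * ?B (k - j) = (?a j * ?b (k - j)) * ?e k" for j
      proof -
        have "?e j * ?e (k - j) = ?e k" by (simp add: cis_mult freq_diff inner_diff_left)
        moreover have "?A j * ?B (k - j) = ?a j * ?b (k - j) * (?e j * ?e (k - j))" by (simp add: mult_ac)
        ultimately show ?thesis by simp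
      qed
      thus "(\<Sum>\<^sub>\<infinity>j. ?A j * ?B (k - j)) = (\<Sum>\<^sub>\<infinity>j. ?a j * ?b (k - j)) * ?e k"
        by (simp only: infsum_cmult_left')
    qed
    finally show ?thesis by (simp add: synth_def)
  qed
  show "(\<lambda>x. f x * g x) \<in> wiener" "fc (\<lambda>x. f x * g x) = (\<lambda>k. \<Sum>\<^sub>\<infinity>j. ?a j * ?b (k - j))"
    by (rule wiener_coeffs_eqI[OF s *])+
qed

text \<open>
  The form in which the interactions of three frequencies \<open>j\<close>, \<open>l\<close>, \<open>k - j - l\<close> are estimated.
\<close>

lemma wiener_mult3:
  assumes f: "f \<in> wiener" and g: "g \<in> wiener" and h: "h \<in> wiener"
  shows "summable_abs (\<lambda>(j, l). fc f j * fc g l * fc h (k - j - l))"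
    "fc (\<lambda>x. f x * g x * h x) k = (\<Sum>\<^sub>\<infinity>(j, l). fc f j * fc g l * fc h (k - j - l))"
proof -
  define H where "H = (\<Sum>\<^sub>\<infinity>k. cmod (fc h k))"
  have H: "cmod (fc h k) \<le> H" for k
    using sum_le_infsum_abs[OF wiener_summable[OF h], of "{k}"] by (simp add: H_def)
  show S: "summable_abs (\<lambda>(j, l). fc f j * fc g l * fc h (k - j - l))"
  proof (rule summable_on_comparison_test)
    show "(\<lambda>p. H * cmod (case p of (j, l) \<Rightarrow> fc f j * fc g l)) summable_on UNIV"
      by (intro summable_on_cmult_right summable_abs_prod wiener_summable f g)
    show "cmod (case p of (j, l) \<Rightarrow> fc f j * fc g l * fc h (k - j - l))
      \<le> H * cmod (case p of (j, l) \<Rightarrow> fc f j * fc g l)" for p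
      using H by (cases p) (auto simp: norm_mult mult.commute[of H] intro!: mult_left_mono)
  qed auto
  have "fc (\<lambda>x. f x * g x * h x) k = (\<Sum>\<^sub>\<infinity>j. fc f j * (\<Sum>\<^sub>\<infinity>l. fc g l * fc h (k - j - l)))"
    unfolding mult.assoc wiener_mult(2)[OF f wiener_mult(1)[OF g h]] wiener_mult(2)[OF g h] ..
  also have "\<dots> = (\<Sum>\<^sub>\<infinity>j. \<Sum>\<^sub>\<infinity>l. fc f j * fc g l * fc h (k - j - l))"
    by (simp add: infsum_cmult_right' mult.assoc)
  also have "\<dots> = (\<Sum>\<^sub>\<infinity>(j, l). fc f j * fc g l * fc h (k - j - l))"
    using infsum_Sigma'_banach[of "\<lambda>j l. fc f j * fc g l * fc h (k - j - l)" UNIV "\<lambda>_. UNIV"]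
      abs_summable_summable[OF S] by simp
  finally show "fc (\<lambda>x. f x * g x * h x) k = (\<Sum>\<^sub>\<infinity>(j, l). fc f j * fc g l * fc h (k - j - l))" .
qed

subsection \<open>Fourier multipliers\<close>

definition fmult :: "(int ^ 'n::finite \<Rightarrow> complex) \<Rightarrow> (real ^ 'n \<Rightarrow> complex) \<Rightarrow> real ^ 'n \<Rightarrow> complex" where
  "fmult m f = synth (\<lambda>k. m k * fc f k)"

definition ksq :: "int ^ 'n::finite \<Rightarrow> real" where
  "ksq k = (norm (freq k))\<^sup>2"

lemma laplace_op_fmult:
  "laplace_op \<phi> \<xi> f = fmult (\<lambda>k. \<phi> (- \<i> * complex_of_real (\<xi> * ksq k))) f"
  unfolding laplace_op_def fmult_def synth_def fc_def fourier_mode_def ksq_def by (simp add: fun_eq_iff)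

lemma wiener_fmult:
  assumes "f \<in> wiener" "\<And>k. cmod (m k) \<le> C"
  shows "fmult m f \<in> wiener" "fc (fmult m f) = (\<lambda>k. m k * fc f k)"
  using summable_abs_bounded_mult[OF wiener_summable[OF assms(1)] assms(2)]
  by (auto simp: fmult_def wiener_synth fc_synth)

lemma fmult_cong: "fc f = fc g \<Longrightarrow> fmult m f = fmult m g"
  by (simp add: fmult_def)

section \<open>Norms given by duality\<close>

definition test_family :: "(int ^ 'n::finite \<Rightarrow> real) set \<Rightarrow> bool" where
  "test_family E \<longleftrightarrow> E \<noteq> {} \<and>
     (\<forall>\<psi>\<in>E. finite {k. \<psi> k \<noteq> 0} \<and> (\<forall>k. 0 \<le> \<psi> k) \<and> (\<lambda>k. \<psi> (- k)) \<in> E)"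

text \<open>
  The norm of a nonnegative sequence \<open>a\<close> as the supremum of its pairings with the members of a family \<open>E\<close> of
  finitely supported nonnegative test sequences. The weighted \<open>l1\<close> and \<open>l2\<close> norms are of this form. Only
  finite sums occur, so that monotonicity, the triangle inequality, Fatou's lemma and Minkowski's
  inequality for integrals hold for all such norms at once and without summability conditions.
\<close>

definition dual_le :: "(int ^ 'n::finite \<Rightarrow> real) set \<Rightarrow> (int ^ 'n \<Rightarrow> real) \<Rightarrow> real \<Rightarrow> bool" where
  "dual_le E a B \<longleftrightarrow> (\<forall>\<psi>\<in>E. (\<Sum>k | \<psi> k \<noteq> 0. \<psi> k * a k) \<le> B)"

lemma dual_le_nonneg: "test_family E \<Longrightarrow> dual_le E a B \<Longrightarrow> (\<And>k. 0 \<le> a k) \<Longrightarrow> 0 \<le> B"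
proof -
  assume E: "test_family E" "dual_le E a B" and a: "\<And>k. 0 \<le> a k"
  then obtain \<psi> where \<psi>: "\<psi> \<in> E" by (auto simp: test_family_def)
  have "0 \<le> (\<Sum>k | \<psi> k \<noteq> 0. \<psi> k * a k)"
    using E(1) \<psi> a by (intro sum_nonneg) (auto simp: test_family_def)
  thus ?thesis using E(2) \<psi> by (force simp: dual_le_def)
qed

lemma dual_le_mono:
  assumes "test_family E" "dual_le E a A" "\<And>k. b k \<le> a k" "A \<le> B"
  shows "dual_le E b B"
  unfolding dual_le_def
proof
  fix \<psi> assume \<psi>: "\<psi> \<in> E"
  have "(\<Sum>k | \<psi> k \<noteq> 0. \<psi> k * b k) \<le> (\<Sum>k | \<psi> k \<noteq> 0. \<psi> k * a k)"
    using assms(1,3) \<psi> by (intro sum_mono mult_left_mono) (auto simp: test_family_def)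
  thus "(\<Sum>k | \<psi> k \<noteq> 0. \<psi> k * b k) \<le> B" using assms(2,4) \<psi> by (force simp: dual_le_def)
qed

lemma dual_le_add:
  assumes "dual_le E a A" "dual_le E b B"
  shows "dual_le E (\<lambda>k. a k + b k) (A + B)"
  using assms by (auto simp: dual_le_def distrib_left sum.distrib intro: add_mono)

lemma dual_le_scale:
  assumes "dual_le E a A" "0 \<le> c"
  shows "dual_le E (\<lambda>k. c * a k) (c * A)"
  unfolding dual_le_def
proof
  fix \<psi> assume \<psi>: "\<psi> \<in> E"
  have "(\<Sum>k | \<psi> k \<noteq> 0. \<psi> k * (c * a k)) = c * (\<Sum>k | \<psi> k \<noteq> 0. \<psi> k * a k)"
    by (simp add: sum_distrib_left mult_ac)
  also have "\<dots> \<le> c * A" using assms \<psi> by (intro mult_left_mono) (auto simp: dual_le_def)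
  finally show "(\<Sum>k | \<psi> k \<noteq> 0. \<psi> k * (c * a k)) \<le> c * A" .
qed

lemma dual_le_reflect:
  assumes "test_family E" "dual_le E a A"
  shows "dual_le E (\<lambda>k. a (- k)) A"
  unfolding dual_le_def
proof
  fix \<psi> assume \<psi>: "\<psi> \<in> E"
  let ?\<chi> = "\<lambda>k. \<psi> (- k)"
  have "?\<chi> \<in> E" using assms(1) \<psi> by (auto simp: test_family_def)
  have "(\<Sum>k | \<psi> k \<noteq> 0. \<psi> k * a (- k)) = (\<Sum>k | ?\<chi> k \<noteq> 0. ?\<chi> k * a k)"
    by (rule sum.reindex_bij_witness[of _ uminus uminus]) auto
  thus "(\<Sum>k | \<psi> k \<noteq> 0. \<psi> k * a (- k)) \<le> A" using assms(2) \<open>?\<chi> \<in> E\<close> by (auto simp: dual_le_def)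
qed

text \<open>
  Fatou's lemma: the pairing with each test sequence is a finite sum.
\<close>

lemma dual_le_tendsto:
  assumes "F \<noteq> bot" "eventually (\<lambda>i. dual_le E (a i) B) F" "\<And>k. ((\<lambda>i. a i k) \<longlongrightarrow> b k) F"
  shows "dual_le E b B"
  unfolding dual_le_def
proof
  fix \<psi> assume \<psi>: "\<psi> \<in> E"
  have "((\<lambda>i. \<Sum>k | \<psi> k \<noteq> 0. \<psi> k * a i k) \<longlongrightarrow> (\<Sum>k | \<psi> k \<noteq> 0. \<psi> k * b k)) F"
    by (intro tendsto_sum tendsto_mult tendsto_const assms)
  moreover have "eventually (\<lambda>i. (\<Sum>k | \<psi> k \<noteq> 0. \<psi> k * a i k) \<le> B) F"
    using assms(2) by eventually_elim (use \<psi> in \<open>auto simp: dual_le_def\<close>)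
  ultimately show "(\<Sum>k | \<psi> k \<noteq> 0. \<psi> k * b k) \<le> B"
    using assms(1) by (rule tendsto_upperbound)
qed

text \<open>
  Minkowski's inequality for integrals. In the pairing with a test sequence, each coefficient of the
  integral is rotated onto the positive axis; this leaves the integral of one finite sum, which is bounded
  by \<open>B\<close> pointwise.
\<close>

lemma dual_le_integral:
  fixes g :: "real \<Rightarrow> int ^ 'n::finite \<Rightarrow> complex"
  assumes E: "test_family E" and t: "0 \<le> t"
    and g: "\<And>\<zeta>. \<zeta> \<in> {0..t} \<Longrightarrow> dual_le E (\<lambda>k. cmod (g \<zeta> k)) B"
    and I: "\<And>k. ((\<lambda>\<zeta>. g \<zeta> k) has_integral I k) {0..t}"
  shows "dual_le E (\<lambda>k. cmod (I k)) (t * B)"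
  unfolding dual_le_def
proof
  fix \<psi> assume \<psi>: "\<psi> \<in> E"
  let ?S = "{k. \<psi> k \<noteq> 0}"
  have B: "0 \<le> B" using dual_le_nonneg[OF E g[of 0]] t by auto
  have pos: "\<psi> k \<ge> 0" and fin: "finite ?S" for k using E \<psi> by (auto simp: test_family_def)
  \<comment> \<open>The phase that makes \<open>I k\<close> nonnegative.\<close>
  define u where "u k = (if I k = 0 then 0 else cnj (I k) / cmod (I k))" for k
  have u1: "cmod (u k) \<le> 1" for k by (simp add: u_def norm_divide)
  have uI: "u k * I k = cmod (I k)" for k
    by (auto simp: u_def complex_norm_square[symmetric] power2_eq_square mult.commute[of "cnj _"])
  have "((\<lambda>\<zeta>. \<Sum>k\<in>?S. (\<psi> k * u k) * g \<zeta> k) has_integral (\<Sum>k\<in>?S. (\<psi> k * u k) * I k)) {0..t}"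
    by (intro has_integral_sum fin has_integral_mult_right I)
  moreover have "(\<Sum>k\<in>?S. (\<psi> k * u k) * I k) = of_real (\<Sum>k\<in>?S. \<psi> k * cmod (I k))"
    unfolding of_real_sum by (intro sum.cong) (auto simp: mult.assoc uI)
  moreover have "cmod (\<Sum>k\<in>?S. (\<psi> k * u k) * g \<zeta> k) \<le> B" if "\<zeta> \<in> {0..t}" for \<zeta>
  proof -
    have "cmod (\<Sum>k\<in>?S. (\<psi> k * u k) * g \<zeta> k) \<le> (\<Sum>k\<in>?S. \<psi> k * cmod (g \<zeta> k))"
    proof (rule sum_norm_le)
      fix k
      have "\<psi> k * (cmod (u k) * cmod (g \<zeta> k)) \<le> \<psi> k * (1 * cmod (g \<zeta> k))"
        by (intro mult_left_mono mult_right_mono u1 pos) auto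
      thus "cmod ((\<psi> k * u k) * g \<zeta> k) \<le> \<psi> k * cmod (g \<zeta> k)"
        using pos by (simp add: norm_mult mult.assoc)
    qed
    also have "\<dots> \<le> B" using g[OF that] \<psi> by (auto simp: dual_le_def)
    finally show ?thesis .
  qed
  ultimately have "cmod (of_real (\<Sum>k\<in>?S. \<psi> k * cmod (I k))) \<le> B * measure lborel {0..t}"
    by (intro has_integral_bound_real[OF B finite.emptyI]) auto
  hence "\<bar>\<Sum>k\<in>?S. \<psi> k * cmod (I k)\<bar> \<le> B * t" unfolding norm_of_real using t by simp
  thus "(\<Sum>k\<in>?S. \<psi> k * cmod (I k)) \<le> t * B" by (simp add: mult.commute)
qed

text \<open>
  Convolution with the summation restricted to \<open>J\<close>. Bounds that do not depend on \<open>J\<close> pass to the full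
  convolution by Fatou's lemma.
\<close>

definition fconv :: "(int ^ 'n::finite) set \<Rightarrow> (int ^ 'n \<Rightarrow> real) \<Rightarrow> (int ^ 'n \<Rightarrow> real) \<Rightarrow> int ^ 'n \<Rightarrow> real" where
  "fconv J a b k = (\<Sum>j\<in>J. a j * b (k - j))"

text \<open>
  Multiplication maps \<open>X\<close> times \<open>Y\<close> into \<open>Y\<close> with norm at most one. A larger constant is
  removed by rescaling the test family of \<open>X\<close>.
\<close>

definition conv_bound :: "(int ^ 'n::finite \<Rightarrow> real) set \<Rightarrow> (int ^ 'n \<Rightarrow> real) set \<Rightarrow> bool" where
  "conv_bound X Y \<longleftrightarrow> (\<forall>a b A B J. (\<forall>k. 0 \<le> a k) \<longrightarrow> (\<forall>k. 0 \<le> b k) \<longrightarrow> dual_le X a A \<longrightarrow> dual_le Y b B \<longrightarrow>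
     finite J \<longrightarrow> dual_le Y (fconv J a b) (A * B))"

lemma fconv_nonneg: "(\<And>k. 0 \<le> a k) \<Longrightarrow> (\<And>k. 0 \<le> b k) \<Longrightarrow> 0 \<le> fconv J a b k"
  by (auto simp: fconv_def intro!: sum_nonneg)

text \<open>
  The truncation breaks the symmetry of the convolution. On finitely many output frequencies it is restored
  at the price of a larger truncation set.
\<close>

lemma fconv_le_swapped:
  assumes "finite S" "finite J" "\<And>k. 0 \<le> a k" "\<And>k. 0 \<le> b k"
  shows "\<exists>M. finite M \<and> (\<forall>k\<in>S. fconv J b a k \<le> fconv M a b k)"
proof (intro exI conjI ballI)
  let ?M = "(\<lambda>(k, j). k - j) ` (S \<times> J)"
  show fin: "finite ?M" using assms by auto
  fix k assume k: "k \<in> S"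
  have "fconv J b a k = (\<Sum>i\<in>(\<lambda>j. k - j) ` J. a i * b (k - i))"
    unfolding fconv_def by (subst sum.reindex) (auto simp: inj_on_def mult.commute)
  also have "\<dots> \<le> fconv ?M a b k"
    unfolding fconv_def using fin k assms(3,4) by (intro sum_mono2) auto
  finally show "fconv J b a k \<le> fconv ?M a b k" .
qed

lemma conv_bound_left:
  assumes "conv_bound X Y" "dual_le X a A" "dual_le Y b B" "finite J" "\<And>k. 0 \<le> a k" "\<And>k. 0 \<le> b k"
  shows "dual_le Y (fconv J a b) (A * B)"
  using assms by (auto simp: conv_bound_def)

lemma conv_bound_right:
  assumes Y: "test_family Y" and "conv_bound X Y" "dual_le X a A" "dual_le Y b B" "finite J"
    "\<And>k. 0 \<le> a k" "\<And>k. 0 \<le> b k"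
  shows "dual_le Y (fconv J b a) (A * B)"
  unfolding dual_le_def
proof
  fix \<psi> assume \<psi>: "\<psi> \<in> Y"
  let ?S = "{k. \<psi> k \<noteq> 0}"
  have pos: "\<psi> k \<ge> 0" and fin: "finite ?S" for k using Y \<psi> by (auto simp: test_family_def)
  obtain M where M: "finite M" "\<And>k. k \<in> ?S \<Longrightarrow> fconv J b a k \<le> fconv M a b k"
    using fconv_le_swapped[of ?S J a b] fin assms by blast
  have "(\<Sum>k\<in>?S. \<psi> k * fconv J b a k) \<le> (\<Sum>k\<in>?S. \<psi> k * fconv M a b k)"
    by (intro sum_mono mult_left_mono M pos) auto
  also have "\<dots> \<le> A * B"
    using conv_bound_left[OF assms(2-4) M(1)] assms \<psi> by (auto simp: dual_le_def)
  finally show "(\<Sum>k\<in>?S. \<psi> k * fconv J b a k) \<le> A * B" .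
qed

subsection \<open>Bounds on functions\<close>

text \<open>
  Membership in the Wiener algebra is part of the bound; it makes the function determined by its
  coefficients.
\<close>

definition fnorm_le :: "(int ^ 'n::finite \<Rightarrow> real) set \<Rightarrow> (real ^ 'n \<Rightarrow> complex) \<Rightarrow> real \<Rightarrow> bool" where
  "fnorm_le E f B \<longleftrightarrow> f \<in> wiener \<and> dual_le E (\<lambda>k. cmod (fc f k)) B"

lemma fnorm_le_wiener: "fnorm_le E f B \<Longrightarrow> f \<in> wiener" by (simp add: fnorm_le_def)

lemma fnorm_le_nonneg: "test_family E \<Longrightarrow> fnorm_le E f B \<Longrightarrow> 0 \<le> B"
  unfolding fnorm_le_def by (auto intro: dual_le_nonneg)

lemma fnorm_le_mono: "test_family E \<Longrightarrow> fnorm_le E f A \<Longrightarrow> A \<le> B \<Longrightarrow> fnorm_le E f B"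
  unfolding fnorm_le_def by (auto intro: dual_le_mono)

lemma fnorm_le_dominated:
  "test_family E \<Longrightarrow> dual_le E a B \<Longrightarrow> f \<in> wiener \<Longrightarrow> (\<And>k. cmod (fc f k) \<le> a k) \<Longrightarrow> fnorm_le E f B"
  unfolding fnorm_le_def by (auto intro: dual_le_mono)

lemma fnorm_le_add:
  assumes "test_family E" "fnorm_le E f A" "fnorm_le E g B"
  shows "fnorm_le E (\<lambda>x. f x + g x) (A + B)"
  using assms by (intro fnorm_le_dominated[OF assms(1) dual_le_add, of "\<lambda>k. cmod (fc f k)" A "\<lambda>k. cmod (fc g k)" B])
    (auto simp: fnorm_le_def wiener_add norm_triangle_ineq)

lemma fnorm_le_diff:
  assumes "test_family E" "fnorm_le E f A" "fnorm_le E g B"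
  shows "fnorm_le E (\<lambda>x. f x - g x) (A + B)"
  using assms by (intro fnorm_le_dominated[OF assms(1) dual_le_add, of "\<lambda>k. cmod (fc f k)" A "\<lambda>k. cmod (fc g k)" B])
    (auto simp: fnorm_le_def wiener_diff norm_triangle_ineq4)

lemma fnorm_le_cmult:
  assumes "test_family E" "fnorm_le E f A"
  shows "fnorm_le E (\<lambda>x. c * f x) (cmod c * A)"
  using assms by (intro fnorm_le_dominated[OF assms(1) dual_le_scale, of "\<lambda>k. cmod (fc f k)" A "cmod c"])
    (auto simp: fnorm_le_def wiener_cmult norm_mult)

lemma fnorm_le_cnj:
  assumes "test_family E" "fnorm_le E f A"
  shows "fnorm_le E (\<lambda>x. cnj (f x)) A"
  using assms by (intro fnorm_le_dominated[OF assms(1) dual_le_reflect[OF assms(1), of "\<lambda>k. cmod (fc f k)"]])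
    (auto simp: fnorm_le_def wiener_cnj)

lemma fnorm_le_fmult:
  assumes "test_family E" "fnorm_le E f A" "0 \<le> C" "\<And>k. cmod (m k) \<le> C"
  shows "fnorm_le E (fmult m f) (C * A)"
proof -
  have f: "f \<in> wiener" using assms by (simp add: fnorm_le_def)
  show ?thesis
    by (rule fnorm_le_dominated[OF assms(1) dual_le_scale[OF _ assms(3), of _ "\<lambda>k. cmod (fc f k)" A]])
      (use assms wiener_fmult[OF f assms(4)] in \<open>auto simp: fnorm_le_def norm_mult intro!: mult_right_mono\<close>)
qed

lemma tendsto_cmod_fconv:
  assumes f: "f \<in> wiener" and g: "g \<in> wiener"
  shows "((\<lambda>J. fconv J (\<lambda>k. cmod (fc f k)) (\<lambda>k. cmod (fc g k)) k) \<longlongrightarrow>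
     (\<Sum>\<^sub>\<infinity>j. cmod (fc f j) * cmod (fc g (k - j)))) (finite_subsets_at_top UNIV)"
  using infsum_tendsto[OF summable_abs_conv(1)[OF wiener_summable[OF f] wiener_summable[OF g], of k]]
  unfolding fconv_def norm_mult .

lemma fc_mult_le:
  assumes f: "f \<in> wiener" and g: "g \<in> wiener"
  shows "cmod (fc (\<lambda>x. f x * g x) k) \<le> (\<Sum>\<^sub>\<infinity>j. cmod (fc f j) * cmod (fc g (k - j)))"
  unfolding wiener_mult(2)[OF f g] norm_mult[symmetric]
  by (rule norm_infsum_bound[OF summable_abs_conv(1)[OF wiener_summable[OF f] wiener_summable[OF g]]])

lemma fnorm_le_mult:
  assumes Y: "test_family Y" and XY: "conv_bound X Y" and f: "fnorm_le X f A" and g: "fnorm_le Y g B"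
  shows "fnorm_le Y (\<lambda>x. f x * g x) (A * B)"
proof -
  have fg: "f \<in> wiener" "g \<in> wiener" using f g by (auto simp: fnorm_le_def)
  have "dual_le Y (\<lambda>k. \<Sum>\<^sub>\<infinity>j. cmod (fc f j) * cmod (fc g (k - j))) (A * B)"
    by (rule dual_le_tendsto[OF _ eventually_finite_subsets_at_top_weakI tendsto_cmod_fconv[OF fg]])
      (use f g in \<open>auto simp: fnorm_le_def intro!: conv_bound_left[OF XY]\<close>)
  thus ?thesis
    by (rule fnorm_le_dominated[OF Y]) (use fg wiener_mult(1) fc_mult_le in auto)
qed

lemma fnorm_le_integral:
  assumes E: "test_family E" and t: "0 \<le> t" and "\<And>\<zeta>. \<zeta> \<in> {0..t} \<Longrightarrow> fnorm_le E (g \<zeta>) B"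
    and "f \<in> wiener" and "\<And>k. ((\<lambda>\<zeta>. fc (g \<zeta>) k) has_integral fc f k) {0..t}"
  shows "fnorm_le E f (t * B)"
  unfolding fnorm_le_def using assms by (auto simp: fnorm_le_def intro!: dual_le_integral[OF E t, of "\<lambda>\<zeta>. fc (g \<zeta>)"])

subsection \<open>Order of magnitude of families of functions\<close>

text \<open>
  The order symbol with a constant that is uniform in the parameter \<open>p\<close>, which collects everything that an
  estimate has to be uniform in: times, step sizes, or arguments of the numerical flow.
\<close>

definition bigO :: "(int ^ 'n::finite \<Rightarrow> real) set \<Rightarrow> 'p set \<Rightarrow> ('p \<Rightarrow> real ^ 'n \<Rightarrow> complex) \<Rightarrow> ('p \<Rightarrow> real) \<Rightarrow> bool" where
  "bigO E P f g \<longleftrightarrow> (\<exists>C\<ge>0. \<forall>p\<in>P. fnorm_le E (f p) (C * g p))"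

lemma bigOI: "0 \<le> C \<Longrightarrow> (\<And>p. p \<in> P \<Longrightarrow> fnorm_le E (f p) (C * g p)) \<Longrightarrow> bigO E P f g"
  by (auto simp: bigO_def)

lemma bigOE: assumes "bigO E P f g" obtains C where "0 \<le> C" "\<And>p. p \<in> P \<Longrightarrow> fnorm_le E (f p) (C * g p)"
  using assms unfolding bigO_def by blast

lemma bigO_wiener: "bigO E P f g \<Longrightarrow> p \<in> P \<Longrightarrow> f p \<in> wiener"
  by (auto simp: bigO_def fnorm_le_def)

lemma bigO_compose: "bigO E P f g \<Longrightarrow> (\<And>q. q \<in> Q \<Longrightarrow> h q \<in> P) \<Longrightarrow> bigO E Q (\<lambda>q. f (h q)) (\<lambda>q. g (h q))"
  by (auto simp: bigO_def)

lemma bigO_cong: "(\<And>p x. p \<in> P \<Longrightarrow> f p x = f' p x) \<Longrightarrow> bigO E P f g \<longleftrightarrow> bigO E P f' g"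
proof -
  assume "\<And>p x. p \<in> P \<Longrightarrow> f p x = f' p x"
  hence "f p = f' p" if "p \<in> P" for p using that by auto
  thus ?thesis by (auto simp: bigO_def)
qed

lemma bigO_weaken:
  assumes E: "test_family E" and f: "bigO E P f g" and "0 \<le> c" "\<And>p. p \<in> P \<Longrightarrow> g p \<le> c * g' p"
  shows "bigO E P f g'"
proof -
  obtain C where C: "0 \<le> C" "\<And>p. p \<in> P \<Longrightarrow> fnorm_le E (f p) (C * g p)" using f by (auto elim!: bigOE)
  show ?thesis
  proof (rule bigOI[of "C * c"])
    fix p assume p: "p \<in> P"
    have "C * g p \<le> C * (c * g' p)" using C(1) assms(4)[OF p] by (rule mult_left_mono[rotated])
    thus "fnorm_le E (f p) (C * c * g' p)" using fnorm_le_mono[OF E C(2)[OF p]] by (simp add: mult.assoc)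
  qed (use assms C in auto)
qed

lemma bigO_add:
  assumes E: "test_family E" and "bigO E P f h" "bigO E P g h"
  shows "bigO E P (\<lambda>p x. f p x + g p x) h"
proof -
  obtain A B where "0 \<le> A" "\<And>p. p \<in> P \<Longrightarrow> fnorm_le E (f p) (A * h p)" "0 \<le> B" "\<And>p. p \<in> P \<Longrightarrow> fnorm_le E (g p) (B * h p)"
    using assms(2,3) by (auto elim!: bigOE)
  thus ?thesis by (intro bigOI[of "A + B"]) (auto simp: distrib_right intro!: fnorm_le_add[OF E])
qed

lemma bigO_diff:
  assumes E: "test_family E" and "bigO E P f h" "bigO E P g h"
  shows "bigO E P (\<lambda>p x. f p x - g p x) h"
proof -
  obtain A B where "0 \<le> A" "\<And>p. p \<in> P \<Longrightarrow> fnorm_le E (f p) (A * h p)" "0 \<le> B" "\<And>p. p \<in> P \<Longrightarrow> fnorm_le E (g p) (B * h p)"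
    using assms(2,3) by (auto elim!: bigOE)
  thus ?thesis by (intro bigOI[of "A + B"]) (auto simp: distrib_right intro!: fnorm_le_diff[OF E])
qed

lemma bigO_cmult:
  assumes E: "test_family E" and f: "bigO E P f h" and c: "\<And>p. p \<in> P \<Longrightarrow> cmod (c p) \<le> d p"
  shows "bigO E P (\<lambda>p x. c p * f p x) (\<lambda>p. d p * h p)"
proof -
  obtain A where A: "0 \<le> A" "\<And>p. p \<in> P \<Longrightarrow> fnorm_le E (f p) (A * h p)"
    using f by (auto elim!: bigOE)
  show ?thesis
  proof (rule bigOI[OF A(1)])
    fix p assume p: "p \<in> P"
    have "cmod (c p) * (A * h p) \<le> d p * (A * h p)"
      by (intro mult_right_mono c p fnorm_le_nonneg[OF E A(2)[OF p]])
    thus "fnorm_le E (\<lambda>x. c p * f p x) (A * (d p * h p))"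
      using fnorm_le_mono[OF E fnorm_le_cmult[OF E A(2)[OF p]]] by (simp add: mult_ac)
  qed
qed

lemma bigO_cmult_const:
  assumes E: "test_family E" and f: "bigO E P f h" and c: "\<And>p. p \<in> P \<Longrightarrow> cmod (c p) \<le> d" and "0 \<le> d"
  shows "bigO E P (\<lambda>p x. c p * f p x) h"
proof -
  have "bigO E P (\<lambda>p x. c p * f p x) (\<lambda>p. d * h p)" by (rule bigO_cmult[OF E f c])
  thus ?thesis by (rule bigO_weaken[OF E _ \<open>0 \<le> d\<close>]) auto
qed

lemma bigO_cnj:
  assumes E: "test_family E" and "bigO E P f h"
  shows "bigO E P (\<lambda>p x. cnj (f p x)) h"
  using assms(2) fnorm_le_cnj[OF E] unfolding bigO_def by blast

lemma bigO_fmult: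
  assumes E: "test_family E" and f: "bigO E P f h" and C: "0 \<le> C" "\<And>p k. p \<in> P \<Longrightarrow> cmod (m p k) \<le> C"
  shows "bigO E P (\<lambda>p. fmult (m p) (f p)) h"
proof -
  obtain A where A: "0 \<le> A" "\<And>p. p \<in> P \<Longrightarrow> fnorm_le E (f p) (A * h p)"
    using f by (auto elim!: bigOE)
  show ?thesis
  proof (rule bigOI[of "C * A"])
    fix p assume p: "p \<in> P"
    show "fnorm_le E (fmult (m p) (f p)) (C * A * h p)"
      using fnorm_le_fmult[OF E A(2)[OF p] C(1) C(2)[OF p]] by (simp add: mult_ac)
  qed (use A C in auto)
qed

lemma bigO_mult:
  assumes Y: "test_family Y" and XY: "conv_bound X Y" and "bigO X P f h" "bigO Y P g h'"
  shows "bigO Y P (\<lambda>p x. f p x * g p x) (\<lambda>p. h p * h' p)"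
proof -
  obtain A B where "0 \<le> A" "\<And>p. p \<in> P \<Longrightarrow> fnorm_le X (f p) (A * h p)" "0 \<le> B" "\<And>p. p \<in> P \<Longrightarrow> fnorm_le Y (g p) (B * h' p)"
    using assms(3,4) by (auto elim!: bigOE)
  hence "fnorm_le Y (\<lambda>x. f p x * g p x) (A * B * (h p * h' p))" if "p \<in> P" for p
    using fnorm_le_mult[OF Y XY, of "f p" "A * h p" "g p" "B * h' p"] that by (simp add: mult_ac)
  thus ?thesis using \<open>0 \<le> A\<close> \<open>0 \<le> B\<close> by (intro bigOI[of "A * B"]) auto
qed

lemma bigO_mult_left:
  assumes "test_family Y" "conv_bound X Y" "bigO X P f (\<lambda>_. 1)" "bigO Y P g h"
  shows "bigO Y P (\<lambda>p x. f p x * g p x) h"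
  using bigO_mult[OF assms] by simp

text \<open>
  Integration in time of a family of functions, given coefficient by coefficient, gains the length of the
  interval.
\<close>

lemma bigO_integral:
  assumes E: "test_family E"
    and G: "bigO E {(p, \<zeta>). p \<in> P \<and> \<zeta> \<in> {0..t p}} (\<lambda>(p, \<zeta>). G p \<zeta>) (\<lambda>(p, \<zeta>). h p)"
    and t: "\<And>p. p \<in> P \<Longrightarrow> 0 \<le> t p" and f: "\<And>p. p \<in> P \<Longrightarrow> f p \<in> wiener"
    and I: "\<And>p k. p \<in> P \<Longrightarrow> ((\<lambda>\<zeta>. fc (G p \<zeta>) k) has_integral fc (f p) k) {0..t p}"
  shows "bigO E P f (\<lambda>p. t p * h p)"
proof -
  obtain C where C: "0 \<le> C" "\<And>p \<zeta>. p \<in> P \<Longrightarrow> \<zeta> \<in> {0..t p} \<Longrightarrow> fnorm_le E (G p \<zeta>) (C * h p)"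
    using G by (auto elim!: bigOE)
  show ?thesis
  proof (rule bigOI[OF C(1)])
    fix p assume p: "p \<in> P"
    show "fnorm_le E (f p) (C * (t p * h p))"
      using fnorm_le_integral[OF E t[OF p] C(2)[OF p] f[OF p] I[OF p]] by (simp add: mult_ac)
  qed
qed

section \<open>Lattice sums\<close>

text \<open>
  Powers of the bracket \<open>1 + |k|\<close> are comparable with the square roots of the Sobolev weights. They are used
  in their place because exponents add under multiplication.
\<close>

definition bracket :: "int ^ 'n::finite \<Rightarrow> real" where
  "bracket k = 1 + norm (freq k)"

lemma bracket_ge_1: "1 \<le> bracket k" and bracket_pos [simp]: "0 < bracket k"
  by (auto simp: bracket_def add_pos_nonneg)

lemma bracket_nonzero [simp]: "bracket k \<noteq> 0"
  using bracket_pos[of k] by linarith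

lemma bracket_minus [simp]: "bracket (- k) = bracket k"
  by (simp add: bracket_def freq_minus)

lemma bracket_le_add: "bracket k \<le> bracket j + bracket (k - j)"
  using norm_triangle_ineq[of "freq j" "freq (k - j)"] by (simp add: bracket_def freq_diff)

lemma bracket_ge_component: "1 + \<bar>real_of_int (k $ i)\<bar> \<le> bracket k"
  using component_le_norm_cart[of "freq k" i] by (simp add: bracket_def freq_def)

lemma sum_symmetric_interval_le:
  fixes g :: "real \<Rightarrow> real"
  assumes "\<And>x. 0 \<le> g x"
  shows "(\<Sum>m\<in>{- int N..int N}. g \<bar>real_of_int m\<bar>) \<le> 2 * (\<Sum>i\<le>N. g (real i))"
proof -
  have sub: "{- int N..int N} \<subseteq> int ` {..N} \<union> (\<lambda>i. - int i) ` {..N}"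
  proof
    fix m assume "m \<in> {- int N..int N}"
    thus "m \<in> int ` {..N} \<union> (\<lambda>i. - int i) ` {..N}"
      by (cases "m \<ge> 0") (auto simp: image_iff intro: bexI[of _ "nat \<bar>m\<bar>"])
  qed
  have "(\<Sum>m\<in>{- int N..int N}. g \<bar>real_of_int m\<bar>) \<le> (\<Sum>m\<in>int ` {..N} \<union> (\<lambda>i. - int i) ` {..N}. g \<bar>real_of_int m\<bar>)"
    using assms by (intro sum_mono2[OF _ sub]) auto
  also have "\<dots> \<le> (\<Sum>m\<in>int ` {..N}. g \<bar>real_of_int m\<bar>) + (\<Sum>m\<in>(\<lambda>i. - int i) ` {..N}. g \<bar>real_of_int m\<bar>)"
    using assms by (subst sum.union_inter[symmetric]) (auto intro!: sum_nonneg)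
  also have "\<dots> = 2 * (\<Sum>i\<le>N. g (real i))"
    by (subst (1 2) sum.reindex) (auto simp: inj_on_def)
  finally show ?thesis .
qed

lemma sum_powr_bounded:
  assumes "p > 1"
  shows "\<exists>C. \<forall>N. (\<Sum>m\<in>{- int N..int N}. (1 + \<bar>real_of_int m\<bar>) powr (- p)) \<le> C"
proof (intro exI allI)
  fix N
  have s: "summable (\<lambda>i. real (Suc i) powr (- p))"
    using summable_real_powr_iff[of "- p"] assms
    by (subst summable_Suc_iff[of "\<lambda>i. real i powr (- p)"]) simp
  have "(\<Sum>m\<in>{- int N..int N}. (1 + \<bar>real_of_int m\<bar>) powr (- p)) \<le> 2 * (\<Sum>i\<le>N. (1 + real i) powr (- p))"
    by (rule sum_symmetric_interval_le) simp
  also have "(\<Sum>i\<le>N. (1 + real i) powr (- p)) \<le> (\<Sum>i. real (Suc i) powr (- p))"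
    using sum_le_suminf[OF s, of "{..N}"] by (simp add: add.commute)
  finally show "(\<Sum>m\<in>{- int N..int N}. (1 + \<bar>real_of_int m\<bar>) powr (- p)) \<le> 2 * (\<Sum>i. real (Suc i) powr (- p))"
    by simp
qed

text \<open>
  The telescoping bound \<open>1 / sqrt (n + 1) \<le> 2 (sqrt (n + 1) - sqrt n)\<close>.
\<close>

lemma sum_inverse_sqrt_le:
  "(\<Sum>m\<in>{- int N..int N}. (1 + \<bar>real_of_int m\<bar>) powr (- 1/2)) \<le> 4 * (1 + real N) powr (1/2)"
proof -
  have "(\<Sum>i\<le>N. 1 / sqrt (1 + real i)) \<le> 2 * sqrt (1 + real N)"
  proof (induction N)
    case (Suc N)
    define x y where "x = sqrt (1 + real N)" and "y = sqrt (1 + real (Suc N))"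
    have xy: "0 < x" "0 < y" "x \<le> y" "y * y = x * x + 1" by (auto simp: x_def y_def)
    have "1 / y \<le> 2 * (y - x)"
    proof -
      have "1 = (y - x) * (y + x)" using xy by (simp add: algebra_simps)
      also have "\<dots> \<le> (y - x) * (2 * y)" using xy by (intro mult_left_mono) auto
      finally show ?thesis using xy by (simp add: field_simps)
    qed
    thus ?case using Suc by (simp add: x_def y_def)
  qed simp
  moreover have "(1 + real i) powr (- 1/2) = 1 / sqrt (1 + real i)" for i
    by (simp add: powr_minus_divide powr_half_sqrt)
  ultimately have "(\<Sum>i\<le>N. (1 + real i) powr (- 1/2)) \<le> 2 * (1 + real N) powr (1/2)"
    by (simp add: powr_half_sqrt)
  moreover have "(\<Sum>m\<in>{- int N..int N}. (1 + \<bar>real_of_int m\<bar>) powr (- 1/2)) \<le> 2 * (\<Sum>i\<le>N. (1 + real i) powr (- 1/2))"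
    by (rule sum_symmetric_interval_le) simp
  ultimately show ?thesis by linarith
qed

lemma sum_tensor_le:
  fixes g :: "int \<Rightarrow> real" and F :: "(int ^ 'n::finite) set"
  assumes g: "\<And>m. 0 \<le> g m" and F: "\<And>k i. k \<in> F \<Longrightarrow> \<bar>k $ i\<bar> \<le> int N"
  shows "(\<Sum>k\<in>F. \<Prod>i\<in>UNIV. g (k $ i)) \<le> (\<Sum>m\<in>{- int N..int N}. g m) ^ CARD('n)"
proof -
  have inj: "inj_on vec_nth F" by (auto simp: inj_on_def vec_eq_iff)
  have "(\<Sum>k\<in>F. \<Prod>i\<in>UNIV. g (k $ i)) = (\<Sum>f\<in>vec_nth ` F. \<Prod>i\<in>UNIV. g (f i))"
    by (subst sum.reindex[OF inj]) simp
  also have "\<dots> \<le> (\<Sum>f\<in>(\<Pi>\<^sub>E i\<in>(UNIV :: 'n set). {- int N..int N}). \<Prod>i\<in>UNIV. g (f i))"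
  proof (rule sum_mono2)
    have "k $ i \<in> {- int N..int N}" if "k \<in> F" for k i using F[OF that, of i] by auto
    thus "vec_nth ` F \<subseteq> (\<Pi>\<^sub>E i\<in>(UNIV :: 'n set). {- int N..int N})" by (auto simp: PiE_def)
  qed (auto intro!: finite_PiE prod_nonneg g)
  also have "\<dots> = (\<Prod>i\<in>(UNIV :: 'n set). \<Sum>m\<in>{- int N..int N}. g m)"
    by (rule prod_sum_PiE[symmetric]) auto
  finally show ?thesis by simp
qed

text \<open>
  Since \<open>|k|\<close> dominates each coordinate, a negative power of the bracket is dominated by a product over the
  coordinates. This reduces lattice sums to sums over the integers.
\<close>

lemma bracket_powr_le_prod:
  fixes k :: "int ^ 'n::finite"
  assumes "0 \<le> p"
  shows "bracket k powr (- (real CARD('n) * p)) \<le> (\<Prod>i\<in>UNIV. (1 + \<bar>real_of_int (k $ i)\<bar>) powr (- p))"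
proof -
  have "bracket k powr (- (real CARD('n) * p)) = (\<Prod>i\<in>(UNIV :: 'n set). bracket k powr (- p))"
    by (simp add: powr_power mult.commute)
  also have "\<dots> \<le> (\<Prod>i\<in>UNIV. (1 + \<bar>real_of_int (k $ i)\<bar>) powr (- p))"
    using assms bracket_ge_component[of k] by (intro prod_mono conjI powr_mono2') (auto intro: add_pos_nonneg)
  finally show ?thesis .
qed

lemma lattice_sum_bounded:
  assumes "s > real CARD('n::finite) / 2"
  shows "\<exists>C>0. \<forall>F :: (int ^ 'n) set. finite F \<longrightarrow> (\<Sum>k\<in>F. bracket k powr (- (2 * s))) \<le> C"
proof -
  define p where "p = 2 * s / real CARD('n)"
  have n: "real CARD('n) > 0" by simp
  have p: "p > 1" using assms by (simp add: p_def field_simps)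
  have np: "2 * s = real CARD('n) * p" by (simp add: p_def)
  obtain C where C: "\<And>N. (\<Sum>m\<in>{- int N..int N}. (1 + \<bar>real_of_int m\<bar>) powr (- p)) \<le> C"
    using sum_powr_bounded[OF p] by blast
  have "(\<Sum>k\<in>F. bracket k powr (- (2 * s))) \<le> \<bar>C\<bar> ^ CARD('n) + 1" if F: "finite F" for F :: "(int ^ 'n) set"
  proof -
    define N where "N = (\<Sum>k\<in>F. \<Sum>i\<in>UNIV. nat \<bar>k $ i\<bar>)"
    have N: "\<bar>k $ i\<bar> \<le> int N" if "k \<in> F" for k i
    proof -
      have "nat \<bar>k $ i\<bar> \<le> (\<Sum>i\<in>UNIV. nat \<bar>k $ i\<bar>)" by (rule member_le_sum) auto
      also have "\<dots> \<le> N" unfolding N_def using F that by (intro member_le_sum) auto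
      finally show ?thesis by linarith
    qed
    have "(\<Sum>k\<in>F. bracket k powr (- (2 * s))) \<le> (\<Sum>k\<in>F. \<Prod>i\<in>UNIV. (1 + \<bar>real_of_int (k $ i)\<bar>) powr (- p))"
      unfolding np using p by (intro sum_mono bracket_powr_le_prod) auto
    also have "\<dots> \<le> (\<Sum>m\<in>{- int N..int N}. (1 + \<bar>real_of_int m\<bar>) powr (- p)) ^ CARD('n)"
      by (rule sum_tensor_le[OF _ N]) auto
    also have "\<dots> \<le> \<bar>C\<bar> ^ CARD('n)"
      using C[of N] by (intro power_mono sum_nonneg) auto
    finally show ?thesis by simp
  qed
  moreover have "0 < \<bar>C\<bar> ^ CARD('n) + 1" by (rule add_nonneg_pos) auto
  ultimately show ?thesis by blast
qed

text \<open>
  The growing lattice sum behind the critical product estimate.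
\<close>

lemma lattice_sum_truncated:
  fixes F :: "(int ^ 'n::finite) set"
  assumes "finite F" "\<And>k. k \<in> F \<Longrightarrow> bracket k \<le> R" "1 \<le> R"
  shows "(\<Sum>k\<in>F. bracket k powr (- (real CARD('n) / 2))) \<le> 4 ^ CARD('n) * R powr (real CARD('n) / 2)"
proof -
  \<comment> \<open>All coordinates of the frequencies in \<open>F\<close> have modulus at most \<open>N\<close>.\<close>
  define N where "N = nat \<lfloor>R - 1\<rfloor>"
  have N: "1 + real N \<le> R" using assms(3) unfolding N_def by linarith
  have F: "\<bar>k $ i\<bar> \<le> int N" if "k \<in> F" for k i
  proof -
    have "real_of_int \<bar>k $ i\<bar> \<le> R - 1" using bracket_ge_component[of k i] assms(2)[OF that] by simp
    hence "\<bar>k $ i\<bar> \<le> \<lfloor>R - 1\<rfloor>" by (simp only: le_floor_iff)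
    thus ?thesis unfolding N_def by linarith
  qed
  have "(\<Sum>k\<in>F. bracket k powr (- (real CARD('n) / 2))) \<le> (\<Sum>k\<in>F. \<Prod>i\<in>UNIV. (1 + \<bar>real_of_int (k $ i)\<bar>) powr (- 1/2))"
    using bracket_powr_le_prod[of "1/2"] by (intro sum_mono) simp
  also have "\<dots> \<le> (\<Sum>m\<in>{- int N..int N}. (1 + \<bar>real_of_int m\<bar>) powr (- 1/2)) ^ CARD('n)"
    by (rule sum_tensor_le[OF _ F]) auto
  also have "\<dots> \<le> (4 * R powr (1/2)) ^ CARD('n)"
  proof (rule power_mono)
    have "(1 + real N) powr (1/2) \<le> R powr (1/2)" using N by (intro powr_mono2) auto
    thus "(\<Sum>m\<in>{- int N..int N}. (1 + \<bar>real_of_int m\<bar>) powr (- 1/2)) \<le> 4 * R powr (1/2)"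
      using sum_inverse_sqrt_le[of N] by simp
  qed (auto intro: sum_nonneg)
  also have "\<dots> = 4 ^ CARD('n) * R powr (real CARD('n) / 2)"
    using assms(3) by (simp add: power_mult_distrib powr_power)
  finally show ?thesis .
qed

section \<open>The Wiener norm and the Sobolev norms\<close>

definition l1_tests :: "(int ^ 'n::finite \<Rightarrow> real) set" where
  "l1_tests = {\<psi>. \<exists>F. finite F \<and> \<psi> = indicator F}"

text \<open>
  Comparable with the \<open>H^s\<close> norm of the part of a Fourier series with frequencies in \<open>F\<close>.
\<close>

definition wnorm :: "real \<Rightarrow> (int ^ 'n::finite \<Rightarrow> real) \<Rightarrow> (int ^ 'n) set \<Rightarrow> real" where
  "wnorm s a F = L2_set (\<lambda>k. bracket k powr s * a k) F"

text \<open>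
  The dual unit ball of the \<open>H^s\<close> norm, scaled by \<open>c\<close>; the associated norm is \<open>c\<close> times the \<open>H^s\<close> norm.
\<close>

definition l2_tests :: "real \<Rightarrow> real \<Rightarrow> (int ^ 'n::finite \<Rightarrow> real) set" where
  "l2_tests c s = {\<psi>. finite {k. \<psi> k \<noteq> 0} \<and> (\<forall>k. 0 \<le> \<psi> k) \<and>
                     L2_set (\<lambda>k. \<psi> k / bracket k powr s) {k. \<psi> k \<noteq> 0} \<le> c}"

lemma dual_le_l1:
  fixes a :: "int ^ 'n::finite \<Rightarrow> real"
  shows "dual_le l1_tests a B \<longleftrightarrow> (\<forall>F. finite F \<longrightarrow> (\<Sum>k\<in>F. a k) \<le> B)"
proof -
  have *: "{k. indicator F k \<noteq> (0 :: real)} = F" for F :: "(int ^ 'n) set"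
    by (auto simp: indicator_def)
  have "(\<Sum>k | indicator F k \<noteq> (0 :: real). indicator F k * a k) = (\<Sum>k\<in>F. a k)" for F
    unfolding * by (intro sum.cong) auto
  thus ?thesis by (auto simp: dual_le_def l1_tests_def)
qed

lemma test_family_l1: "test_family (l1_tests :: (int ^ 'n::finite \<Rightarrow> real) set)"
proof -
  have "(\<lambda>k. indicator F (- k) :: real) = indicator (uminus ` F)" for F :: "(int ^ 'n) set"
  proof
    fix k :: "int ^ 'n"
    have "- k \<in> F \<longleftrightarrow> k \<in> uminus ` F" by (metis image_iff minus_minus)
    thus "indicator F (- k) = (indicator (uminus ` F) k :: real)" by (simp add: indicator_def)
  qed
  moreover have "{k. indicator F k \<noteq> (0 :: real)} = F" for F :: "(int ^ 'n) set"
    by (auto simp: indicator_def)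
  note * = calculation this
  have "(\<lambda>k. indicator F (- k) :: real) \<in> l1_tests" if "finite F" for F :: "(int ^ 'n) set"
    unfolding *(1) l1_tests_def using that by blast
  moreover have "indicator {} \<in> (l1_tests :: (int ^ 'n \<Rightarrow> real) set)" unfolding l1_tests_def by blast
  moreover have "\<exists>F. finite F \<and> \<psi> = indicator F" if "\<psi> \<in> l1_tests" for \<psi> :: "int ^ 'n \<Rightarrow> real"
    using that by (simp add: l1_tests_def)
  ultimately show ?thesis unfolding test_family_def using *(2) by (metis empty_iff indicator_pos_le)
qed

lemma test_family_l2:
  assumes "0 < c"
  shows "test_family (l2_tests c s :: (int ^ 'n::finite \<Rightarrow> real) set)"
proof -
  have "(\<lambda>k. \<psi> (- k)) \<in> l2_tests c s" if "\<psi> \<in> l2_tests c s" for \<psi> :: "int ^ 'n \<Rightarrow> real"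
  proof -
    have eq: "{k. \<psi> (- k) \<noteq> 0} = uminus ` {k. \<psi> k \<noteq> 0}"
      by (auto simp: image_iff) (metis minus_minus)
    have "L2_set (\<lambda>k. \<psi> (- k) / bracket k powr s) {k. \<psi> (- k) \<noteq> 0} = L2_set (\<lambda>k. \<psi> k / bracket k powr s) {k. \<psi> k \<noteq> 0}"
      unfolding L2_set_def eq by (subst sum.reindex) auto
    thus ?thesis using that by (auto simp: l2_tests_def eq)
  qed
  moreover have "(\<lambda>k. 0) \<in> l2_tests c s" using assms by (simp add: l2_tests_def)
  moreover have "finite {k. \<psi> k \<noteq> 0} \<and> (\<forall>k. 0 \<le> \<psi> k)" if "\<psi> \<in> l2_tests c s" for \<psi> :: "int ^ 'n \<Rightarrow> real"
    using that by (simp add: l2_tests_def)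
  ultimately show ?thesis unfolding test_family_def by blast
qed

lemma wnorm_nonneg [simp]: "0 \<le> wnorm s a F" by (simp add: wnorm_def)

text \<open>
  Cauchy-Schwarz, with equality for the test sequence proportional to the squared weight times \<open>a\<close>.
\<close>

lemma dual_le_l2:
  fixes a :: "int ^ 'n::finite \<Rightarrow> real"
  assumes c: "0 < c" and a: "\<And>k. 0 \<le> a k"
  shows "dual_le (l2_tests c s) a B \<longleftrightarrow> (\<forall>F. finite F \<longrightarrow> c * wnorm s a F \<le> B)"
proof (intro iffI allI impI)
  fix F :: "(int ^ 'n) set" assume B: "dual_le (l2_tests c s) a B" and F: "finite F"
  define L where "L = wnorm s a F"
  have B0: "0 \<le> B" using dual_le_nonneg[OF test_family_l2[OF c] B a] .
  show "c * wnorm s a F \<le> B"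
  proof (cases "L = 0")
    case False
    hence L: "L > 0" using wnorm_nonneg[of s a F] unfolding L_def by linarith
    \<comment> \<open>The extremal test sequence in the Cauchy-Schwarz inequality.\<close>
    define \<psi> where "\<psi> k = (if k \<in> F then c * (bracket k powr s)\<^sup>2 * a k / L else 0)" for k
    let ?S = "{k. \<psi> k \<noteq> 0}"
    have sub: "?S \<subseteq> F" by (auto simp: \<psi>_def)
    have "L2_set (\<lambda>k. \<psi> k / bracket k powr s) ?S \<le> L2_set (\<lambda>k. \<psi> k / bracket k powr s) F"
      unfolding L2_set_def using F sub by (intro real_sqrt_le_mono sum_mono2) auto
    also have "\<dots> = L2_set (\<lambda>k. (c / L) * (bracket k powr s * a k)) F"
      by (intro L2_set_cong) (auto simp: \<psi>_def field_simps power2_eq_square)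
    also have "\<dots> = (c / L) * L"
      using c L by (subst L2_set_right_distrib[symmetric]) (auto simp: L_def wnorm_def)
    finally have "L2_set (\<lambda>k. \<psi> k / bracket k powr s) ?S \<le> c" using L by simp
    hence "\<psi> \<in> l2_tests c s"
      using F sub a c L by (auto simp: l2_tests_def \<psi>_def intro: finite_subset)
    hence "(\<Sum>k\<in>?S. \<psi> k * a k) \<le> B" using B by (auto simp: dual_le_def)
    moreover have "(\<Sum>k\<in>?S. \<psi> k * a k) = (\<Sum>k\<in>F. \<psi> k * a k)"
      using F sub by (intro sum.mono_neutral_left) auto
    moreover have "\<dots> = (c / L) * (\<Sum>k\<in>F. (bracket k powr s * a k)\<^sup>2)"
      unfolding sum_distrib_left by (intro sum.cong) (auto simp: \<psi>_def field_simps power2_eq_square)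
    moreover have "(\<Sum>k\<in>F. (bracket k powr s * a k)\<^sup>2) = L * L"
      by (simp add: L_def wnorm_def L2_set_def sum_nonneg power2_eq_square[symmetric])
    ultimately show ?thesis using L by (simp add: L_def)
  qed (use B0 in \<open>simp add: L_def\<close>)
next
  assume B: "\<forall>F. finite F \<longrightarrow> c * wnorm s a F \<le> B"
  show "dual_le (l2_tests c s) a B"
    unfolding dual_le_def
  proof
    fix \<psi> :: "int ^ 'n \<Rightarrow> real" assume \<psi>: "\<psi> \<in> l2_tests c s"
    let ?S = "{k. \<psi> k \<noteq> 0}"
    have "(\<Sum>k\<in>?S. \<psi> k * a k) = (\<Sum>k\<in>?S. \<bar>\<psi> k / bracket k powr s\<bar> * \<bar>bracket k powr s * a k\<bar>)"
      using \<psi> a by (intro sum.cong) (auto simp: l2_tests_def abs_mult)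
    also have "\<dots> \<le> L2_set (\<lambda>k. \<psi> k / bracket k powr s) ?S * wnorm s a ?S"
      unfolding wnorm_def by (rule L2_set_mult_ineq)
    also have "\<dots> \<le> c * wnorm s a ?S"
      using \<psi> by (intro mult_right_mono) (auto simp: l2_tests_def)
    also have "\<dots> \<le> B" using B \<psi> by (auto simp: l2_tests_def)
    finally show "(\<Sum>k\<in>?S. \<psi> k * a k) \<le> B" .
  qed
qed

subsection \<open>Young's inequality\<close>

lemma fconv_commute_sum:
  fixes a b :: "int ^ 'n::finite \<Rightarrow> real"
  shows "(\<Sum>k\<in>F. fconv J a b k) = (\<Sum>j\<in>J. a j * (\<Sum>k\<in>(\<lambda>k. k - j) ` F. b k))"
proof -
  have "(\<Sum>k\<in>F. fconv J a b k) = (\<Sum>j\<in>J. \<Sum>k\<in>F. a j * b (k - j))"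
    unfolding fconv_def by (rule sum.swap)
  also have "\<dots> = (\<Sum>j\<in>J. a j * (\<Sum>k\<in>(\<lambda>k. k - j) ` F. b k))"
    by (simp add: sum.reindex inj_on_def sum_distrib_left)
  finally show ?thesis .
qed

lemma conv_bound_l1: "conv_bound l1_tests (l1_tests :: (int ^ 'n::finite \<Rightarrow> real) set)"
  unfolding conv_bound_def dual_le_l1
proof (intro allI impI)
  fix a b :: "int ^ 'n \<Rightarrow> real" and A B :: real and J F :: "(int ^ 'n) set"
  assume *: "\<forall>k. 0 \<le> a k" "\<forall>k. 0 \<le> b k" "\<forall>F. finite F \<longrightarrow> sum a F \<le> A" "\<forall>F. finite F \<longrightarrow> sum b F \<le> B"
    "finite J" "finite F"
  have "(\<Sum>k\<in>F. fconv J a b k) \<le> (\<Sum>j\<in>J. a j * B)"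
    unfolding fconv_commute_sum using * by (intro sum_mono mult_left_mono) auto
  also have "\<dots> = sum a J * B" by (simp add: sum_distrib_right)
  also have "\<dots> \<le> A * B" using * by (intro mult_right_mono) (auto dest: spec[of _ "{}"])
  finally show "(\<Sum>k\<in>F. fconv J a b k) \<le> A * B" .
qed

lemma wnorm_0: "wnorm 0 a F = L2_set a F"
  by (simp add: wnorm_def powr_zero_eq_one less_imp_neq[OF bracket_pos, symmetric])

lemma L2_set_shift: "L2_set (\<lambda>k. b (k - j :: 'a :: ab_group_add)) F = L2_set b ((\<lambda>k. k - j) ` F)"
  unfolding L2_set_def by (subst sum.reindex) (auto simp: inj_on_def)

text \<open>
  Young's inequality as the triangle inequality for the translates of \<open>b\<close>.
\<close>

lemma L2_set_fconv_le:
  assumes "finite J" "\<And>k. 0 \<le> a k" "\<And>F. finite F \<Longrightarrow> L2_set b F \<le> B" "finite F"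
  shows "L2_set (fconv J a b) F \<le> sum a J * B"
  using assms(1)
proof (induction J rule: finite_induct)
  case empty
  show ?case by (simp add: fconv_def[abs_def] L2_set_def)
next
  case (insert j J)
  have "L2_set (fconv (insert j J) a b) F = L2_set (\<lambda>k. a j * b (k - j) + fconv J a b k) F"
    using insert by (intro L2_set_cong) (auto simp: fconv_def)
  also have "\<dots> \<le> L2_set (\<lambda>k. a j * b (k - j)) F + L2_set (fconv J a b) F"
    by (rule L2_set_triangle_ineq)
  also have "L2_set (\<lambda>k. a j * b (k - j)) F = a j * L2_set b ((\<lambda>k. k - j) ` F)"
    using assms(2) by (subst L2_set_right_distrib[symmetric]) (auto simp: L2_set_shift)
  also have "\<dots> \<le> a j * B" using assms by (intro mult_left_mono) auto
  finally show ?case using insert by (simp add: distrib_right)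
qed

lemma conv_bound_l1_l2:
  assumes c: "0 < c"
  shows "conv_bound l1_tests (l2_tests c 0 :: (int ^ 'n::finite \<Rightarrow> real) set)"
  unfolding conv_bound_def
proof (intro allI impI)
  fix a b :: "int ^ 'n \<Rightarrow> real" and A B :: real and J :: "(int ^ 'n) set"
  assume a: "\<forall>k. 0 \<le> a k" and b: "\<forall>k. 0 \<le> b k" and A: "dual_le l1_tests a A"
    and B: "dual_le (l2_tests c 0) b B" and J: "finite J"
  have B': "c * L2_set b F \<le> B" if "finite F" for F
    using B that b by (subst (asm) dual_le_l2[OF c]) (auto simp: wnorm_0)
  have B0: "0 \<le> B" using B'[of "{}"] by simp
  have "c * L2_set (fconv J a b) F \<le> A * B" if F: "finite F" for F
  proof -
    have "L2_set b F \<le> B / c" if "finite F" for F using B'[OF that] c by (simp add: field_simps)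
    from L2_set_fconv_le[OF J _ this F, of a] a
    have "L2_set (fconv J a b) F \<le> sum a J * (B / c)" by auto
    hence "c * L2_set (fconv J a b) F \<le> sum a J * B" using c by (simp add: field_simps)
    also have "\<dots> \<le> A * B" using A J B0 by (intro mult_right_mono) (auto simp: dual_le_l1)
    finally show ?thesis .
  qed
  thus "dual_le (l2_tests c 0) (fconv J a b) (A * B)"
    using a b by (subst dual_le_l2[OF c]) (auto simp: wnorm_0 fconv_nonneg)
qed

subsection \<open>The algebra property above the critical exponent\<close>

lemma sum_le_wnorm:
  assumes "s > real CARD('n::finite) / 2"
  shows "\<exists>C>0. \<forall>(a :: int ^ 'n \<Rightarrow> real) F. (\<forall>k. 0 \<le> a k) \<longrightarrow> finite F \<longrightarrow> sum a F \<le> C * wnorm s a F"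
proof -
  obtain C where C: "C > 0" "\<And>F :: (int ^ 'n) set. finite F \<Longrightarrow> (\<Sum>k\<in>F. bracket k powr (- (2 * s))) \<le> C"
    using lattice_sum_bounded[OF assms] by blast
  have "sum a F \<le> sqrt C * wnorm s a F" if a: "\<forall>k. 0 \<le> a k" and F: "finite F" for a :: "int ^ 'n \<Rightarrow> real" and F
  proof -
    have "sum a F = (\<Sum>k\<in>F. \<bar>bracket k powr (- s)\<bar> * \<bar>bracket k powr s * a k\<bar>)"
      using a by (intro sum.cong) (auto simp: powr_minus abs_mult field_simps)
    also have "\<dots> \<le> L2_set (\<lambda>k. bracket k powr (- s)) F * wnorm s a F"
      unfolding wnorm_def by (rule L2_set_mult_ineq)
    also have "\<dots> \<le> sqrt C * wnorm s a F"
    proof (rule mult_right_mono)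
      have "(bracket k powr (- s))\<^sup>2 = bracket k powr (- (2 * s))" for k :: "int ^ 'n"
        by (simp add: power2_eq_square powr_add[symmetric])
      thus "L2_set (\<lambda>k. bracket k powr (- s)) F \<le> sqrt C"
        using C(2)[OF F] by (simp add: L2_set_def)
    qed simp
    finally show ?thesis .
  qed
  thus ?thesis using C(1) by (intro exI[of _ "sqrt C"]) auto
qed

lemma bracket_powr_le_add:
  assumes "0 \<le> s"
  shows "bracket k powr s \<le> 2 powr s * (bracket j powr s + bracket (k - j) powr s)"
proof -
  have "bracket k \<le> 2 * max (bracket j) (bracket (k - j))" using bracket_le_add[of k j] by linarith
  hence "bracket k powr s \<le> (2 * max (bracket j) (bracket (k - j))) powr s"
    using assms by (intro powr_mono2) (auto intro: less_imp_le)
  also have "\<dots> = 2 powr s * max (bracket j) (bracket (k - j)) powr s"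
    using bracket_pos[of j] by (subst powr_mult) (auto simp: max_def less_imp_le)
  also have "\<dots> \<le> 2 powr s * (bracket j powr s + bracket (k - j) powr s)"
    by (intro mult_left_mono) (auto simp: max_def)
  finally show ?thesis .
qed

text \<open>
  The weight at \<open>k\<close> is dominated by the sum of the weights at \<open>j\<close> and \<open>k - j\<close>, so it can be moved to
  one of the factors. The other factor has summable coefficients because \<open>s > d/2\<close>, and Young's inequality
  applies.
\<close>

lemma wnorm_algebra:
  assumes s: "s > real CARD('n::finite) / 2"
  shows "\<exists>K>0. \<forall>(a :: int ^ 'n \<Rightarrow> real) b A B J F. (\<forall>k. 0 \<le> a k) \<longrightarrow> (\<forall>k. 0 \<le> b k) \<longrightarrow>
     (\<forall>F. finite F \<longrightarrow> wnorm s a F \<le> A) \<longrightarrow> (\<forall>F. finite F \<longrightarrow> wnorm s b F \<le> B) \<longrightarrow> finite J \<longrightarrow> finite F \<longrightarrow>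
     wnorm s (fconv J a b) F \<le> K * (A * B)"
proof -
  have s0: "0 \<le> s" using s by (meson less_imp_le order_le_less_trans of_nat_0_le_iff divide_nonneg_nonneg zero_le_numeral)
  obtain C where C: "C > 0"
    "\<And>(a :: int ^ 'n \<Rightarrow> real) F. \<forall>k. 0 \<le> a k \<Longrightarrow> finite F \<Longrightarrow> sum a F \<le> C * wnorm s a F"
    using sum_le_wnorm[OF s] by blast
  let ?K = "2 powr s * (2 * C)"
  have "wnorm s (fconv J a b) F \<le> ?K * (A * B)"
    if a: "\<forall>k. 0 \<le> a k" and b: "\<forall>k. 0 \<le> b k" and A: "\<And>F. finite F \<Longrightarrow> wnorm s a F \<le> A"
      and B: "\<And>F. finite F \<Longrightarrow> wnorm s b F \<le> B" and J: "finite J" and F: "finite F"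
    for a b :: "int ^ 'n \<Rightarrow> real" and A B J F
  proof -
    let ?va = "\<lambda>k. bracket k powr s * a k" and ?vb = "\<lambda>k. bracket k powr s * b k"
    have A0: "0 \<le> A" and B0: "0 \<le> B" using A[of "{}"] B[of "{}"] by (auto simp: wnorm_def)
    have va: "0 \<le> ?va k" and vb: "0 \<le> ?vb k" for k using a b by auto
    obtain M where M: "finite M" "\<And>k. k \<in> F \<Longrightarrow> fconv J ?va b k \<le> fconv M b ?va k"
      using fconv_le_swapped[OF F J, of b ?va] va b by blast
    have pt: "bracket k powr s * fconv J a b k \<le> 2 powr s * (fconv M b ?va k + fconv J a ?vb k)" if "k \<in> F" for k
    proof -
      have "bracket k powr s * fconv J a b k = (\<Sum>j\<in>J. bracket k powr s * (a j * b (k - j)))"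
        by (simp add: fconv_def sum_distrib_left)
      also have "\<dots> \<le> (\<Sum>j\<in>J. (2 powr s * (bracket j powr s + bracket (k - j) powr s)) * (a j * b (k - j)))"
        using a b by (intro sum_mono mult_right_mono bracket_powr_le_add s0) auto
      also have "\<dots> = 2 powr s * (fconv J ?va b k + fconv J a ?vb k)"
        unfolding fconv_def sum.distrib[symmetric] sum_distrib_left by (intro sum.cong) (auto simp: algebra_simps)
      also have "\<dots> \<le> 2 powr s * (fconv M b ?va k + fconv J a ?vb k)"
        using M(2)[OF that] by (intro mult_left_mono add_right_mono) auto
      finally show ?thesis .
    qed
    have "wnorm s (fconv J a b) F \<le> L2_set (\<lambda>k. 2 powr s * (fconv M b ?va k + fconv J a ?vb k)) F"
      unfolding wnorm_def using pt a b by (intro L2_set_mono) (auto intro!: mult_nonneg_nonneg fconv_nonneg)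
    also have "\<dots> = 2 powr s * L2_set (\<lambda>k. fconv M b ?va k + fconv J a ?vb k) F"
      by (rule L2_set_right_distrib[symmetric]) simp
    also have "\<dots> \<le> 2 powr s * (L2_set (fconv M b ?va) F + L2_set (fconv J a ?vb) F)"
      by (intro mult_left_mono L2_set_triangle_ineq) auto
    also have "\<dots> \<le> 2 powr s * (sum b M * A + sum a J * B)"
      using a b A B M(1) J F
      by (intro mult_left_mono add_mono L2_set_fconv_le) (auto simp: wnorm_def)
    also have "\<dots> \<le> 2 powr s * ((C * B) * A + (C * A) * B)"
    proof -
      have "sum b M \<le> C * B" using C(2)[OF b M(1)] mult_left_mono[OF B[OF M(1)], of C] C(1) by linarith
      moreover have "sum a J \<le> C * A" using C(2)[OF a J] mult_left_mono[OF A[OF J], of C] C(1) by linarith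
      ultimately show ?thesis using A0 B0 by (intro mult_left_mono add_mono mult_right_mono) auto
    qed
    finally show ?thesis by (simp add: algebra_simps)
  qed
  thus ?thesis using C(1) by (intro exI[of _ ?K]) auto
qed

lemma conv_bound_l2:
  assumes s: "s > real CARD('n::finite) / 2"
  shows "\<exists>c>0. conv_bound (l2_tests c s :: (int ^ 'n \<Rightarrow> real) set) (l2_tests c s)"
proof -
  obtain K where K: "K > 0" "\<And>(a :: int ^ 'n \<Rightarrow> real) b A B J F. \<forall>k. 0 \<le> a k \<Longrightarrow> \<forall>k. 0 \<le> b k \<Longrightarrow>
     \<forall>F. finite F \<longrightarrow> wnorm s a F \<le> A \<Longrightarrow> \<forall>F. finite F \<longrightarrow> wnorm s b F \<le> B \<Longrightarrow> finite J \<Longrightarrow> finite F \<Longrightarrow>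
     wnorm s (fconv J a b) F \<le> K * (A * B)"
    using wnorm_algebra[OF s] by blast
  have "conv_bound (l2_tests K s :: (int ^ 'n \<Rightarrow> real) set) (l2_tests K s)"
    unfolding conv_bound_def
  proof (intro allI impI)
    fix a b :: "int ^ 'n \<Rightarrow> real" and A B :: real and J :: "(int ^ 'n) set"
    assume a: "\<forall>k. 0 \<le> a k" and b: "\<forall>k. 0 \<le> b k" and A: "dual_le (l2_tests K s) a A"
      and B: "dual_le (l2_tests K s) b B" and J: "finite J"
    have A': "\<forall>F. finite F \<longrightarrow> wnorm s a F \<le> A / K"
      using A K(1) a by (subst (asm) dual_le_l2) (auto simp: field_simps)
    have B': "\<forall>F. finite F \<longrightarrow> wnorm s b F \<le> B / K"
      using B K(1) b by (subst (asm) dual_le_l2) (auto simp: field_simps)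
    have "K * wnorm s (fconv J a b) F \<le> A * B" if F: "finite F" for F
      using K(2)[OF a b A' B' J F] K(1) by (simp add: field_simps power2_eq_square)
    thus "dual_le (l2_tests K s) (fconv J a b) (A * B)"
      using a b by (subst dual_le_l2[OF K(1)]) (auto simp: fconv_nonneg)
  qed
  thus ?thesis using K(1) by blast
qed


subsection \<open>The critical product estimate\<close>

text \<open>
  Embedding \<open>H^(d/4)\<close> into \<open>L4\<close> is the endpoint case of Sobolev's inequality. The product estimate itself is
  elementary if the first factor carries the lower frequency: with \<open>v j\<close> the weight, Cauchy-Schwarz in \<open>j\<close>
  leaves \<open>\<Sum>l. (b l)^2 (\<Sum>j with |j| \<le> |l|. (v j)^-2)\<close>, and the inner sum is bounded by a constant times
  \<open>(v l)^2\<close>.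
\<close>

lemma wnorm_critical_half:
  fixes a b :: "int ^ 'n::finite \<Rightarrow> real"
  defines "s \<equiv> real CARD('n) / 4"
  assumes a: "\<And>k. 0 \<le> a k" and b: "\<And>k. 0 \<le> b k" and J: "finite J" and F: "finite F"
    and A: "\<And>F. finite F \<Longrightarrow> wnorm s a F \<le> A" and B: "\<And>F. finite F \<Longrightarrow> wnorm s b F \<le> B"
  shows "L2_set (\<lambda>k. \<Sum>j\<in>J. if bracket j \<le> bracket (k - j) then a j * b (k - j) else 0) F \<le> 2 ^ CARD('n) * (A * B)"
proof -
  let ?v = "\<lambda>k :: int ^ 'n. bracket k powr s"
  have A0: "0 \<le> A" and B0: "0 \<le> B" using A[of "{}"] B[of "{}"] by (auto simp: wnorm_def)
  have sq: "(\<Sum>k\<in>F. (?v k * c k)\<^sup>2) \<le> C\<^sup>2" if "wnorm s c F \<le> C" for c F C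
  proof -
    have "(\<Sum>k\<in>F. (?v k * c k)\<^sup>2) = (wnorm s c F)\<^sup>2" by (simp add: wnorm_def L2_set_def sum_nonneg)
    also have "\<dots> \<le> C\<^sup>2" using that by (intro power_mono) auto
    finally show ?thesis .
  qed
  define L where "L = (\<lambda>(k, j). k - j) ` (F \<times> J)"
  have L: "finite L" using F J by (auto simp: L_def)
  have pt: "(\<Sum>j\<in>J. if bracket j \<le> bracket (k - j) then a j * b (k - j) else 0)\<^sup>2
    \<le> A\<^sup>2 * (\<Sum>j\<in>J. if bracket j \<le> bracket (k - j) then (b (k - j))\<^sup>2 / (?v j)\<^sup>2 else 0)" for k
  proof -
    \<comment> \<open>The weight is split off for the Cauchy-Schwarz inequality.\<close>
    have eq: "(\<Sum>j\<in>J. if bracket j \<le> bracket (k - j) then a j * b (k - j) else 0)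
      = (\<Sum>j\<in>J. (?v j * a j) * (if bracket j \<le> bracket (k - j) then b (k - j) / ?v j else 0))"
      by (intro sum.cong) auto
    have "(\<Sum>j\<in>J. if bracket j \<le> bracket (k - j) then a j * b (k - j) else 0)\<^sup>2 \<le> (\<Sum>j\<in>J. (?v j * a j)\<^sup>2) * (\<Sum>j\<in>J. (if bracket j \<le> bracket (k - j) then b (k - j) / ?v j else 0)\<^sup>2)"
      unfolding eq by (rule Cauchy_Schwarz_ineq_sum)
    also have "\<dots> \<le> A\<^sup>2 * (\<Sum>j\<in>J. (if bracket j \<le> bracket (k - j) then b (k - j) / ?v j else 0)\<^sup>2)"
      by (intro mult_right_mono sq A J sum_nonneg) auto
    also have "(\<Sum>j\<in>J. (if bracket j \<le> bracket (k - j) then b (k - j) / ?v j else 0)\<^sup>2)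
      = (\<Sum>j\<in>J. if bracket j \<le> bracket (k - j) then (b (k - j))\<^sup>2 / (?v j)\<^sup>2 else 0)"
      by (intro sum.cong) (auto simp: power_divide)
    finally show ?thesis .
  qed
  have "(\<Sum>k\<in>F. \<Sum>j\<in>J. if bracket j \<le> bracket (k - j) then (b (k - j))\<^sup>2 / (?v j)\<^sup>2 else 0)
    = (\<Sum>j\<in>J. \<Sum>l\<in>(\<lambda>k. k - j) ` F. if bracket j \<le> bracket l then (b l)\<^sup>2 / (?v j)\<^sup>2 else 0)"
    by (subst sum.swap) (auto simp: sum.reindex inj_on_def)
  also have "\<dots> \<le> (\<Sum>j\<in>J. \<Sum>l\<in>L. if bracket j \<le> bracket l then (b l)\<^sup>2 / (?v j)\<^sup>2 else 0)"
    using L by (intro sum_mono sum_mono2) (auto simp: L_def)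
  also have "\<dots> = (\<Sum>l\<in>L. \<Sum>j\<in>J. if bracket j \<le> bracket l then (b l)\<^sup>2 / (?v j)\<^sup>2 else 0)"
    by (rule sum.swap)
  also have "\<dots> \<le> (\<Sum>l\<in>L. 4 ^ CARD('n) * (?v l * b l)\<^sup>2)"
  proof (rule sum_mono)
    fix l
    have v2: "(?v j)\<^sup>2 = bracket j powr (real CARD('n) / 2)" for j :: "int ^ 'n"
      by (simp add: power2_eq_square powr_add[symmetric] s_def)
    have "(\<Sum>j\<in>J. if bracket j \<le> bracket l then (b l)\<^sup>2 / (?v j)\<^sup>2 else 0)
      = (b l)\<^sup>2 * (\<Sum>j\<in>{j\<in>J. bracket j \<le> bracket l}. bracket j powr (- (real CARD('n) / 2)))"
      unfolding sum_distrib_left sum.inter_filter[OF J] v2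
      by (intro sum.cong) (auto simp: powr_minus field_simps)
    also have "\<dots> \<le> (b l)\<^sup>2 * (4 ^ CARD('n) * bracket l powr (real CARD('n) / 2))"
      using J by (intro mult_left_mono lattice_sum_truncated bracket_ge_1) auto
    also have "\<dots> = 4 ^ CARD('n) * (?v l * b l)\<^sup>2" by (simp add: power_mult_distrib v2)
    finally show "(\<Sum>j\<in>J. if bracket j \<le> bracket l then (b l)\<^sup>2 / (?v j)\<^sup>2 else 0) \<le> 4 ^ CARD('n) * (?v l * b l)\<^sup>2" .
  qed
  also have "\<dots> \<le> 4 ^ CARD('n) * B\<^sup>2"
    unfolding sum_distrib_left[symmetric] by (intro mult_left_mono sq B L) auto
  finally have 1: "(\<Sum>k\<in>F. \<Sum>j\<in>J. if bracket j \<le> bracket (k - j) then (b (k - j))\<^sup>2 / (?v j)\<^sup>2 else 0) \<le> 4 ^ CARD('n) * B\<^sup>2" .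
  have "(\<Sum>k\<in>F. (\<Sum>j\<in>J. if bracket j \<le> bracket (k - j) then a j * b (k - j) else 0)\<^sup>2)
    \<le> (\<Sum>k\<in>F. A\<^sup>2 * (\<Sum>j\<in>J. if bracket j \<le> bracket (k - j) then (b (k - j))\<^sup>2 / (?v j)\<^sup>2 else 0))"
    by (rule sum_mono) (rule pt)
  also have "\<dots> \<le> A\<^sup>2 * (4 ^ CARD('n) * B\<^sup>2)"
    unfolding sum_distrib_left[symmetric] by (rule mult_left_mono[OF 1]) simp
  also have "\<dots> = (2 ^ CARD('n) * (A * B))\<^sup>2"
    by (simp add: power_mult_distrib power2_eq_square power_mult_distrib[symmetric])
  finally have "L2_set (\<lambda>k. \<Sum>j\<in>J. if bracket j \<le> bracket (k - j) then a j * b (k - j) else 0) F \<le> sqrt ((2 ^ CARD('n) * (A * B))\<^sup>2)"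
    unfolding L2_set_def by (rule real_sqrt_le_mono)
  thus ?thesis using A0 B0 by simp
qed

text \<open>
  One of the two interacting frequencies is the lower one, and in the second case the roles of the factors are
  exchanged.
\<close>

lemma wnorm_critical:
  fixes a b :: "int ^ 'n::finite \<Rightarrow> real"
  defines "s \<equiv> real CARD('n) / 4"
  assumes a: "\<And>k. 0 \<le> a k" and b: "\<And>k. 0 \<le> b k" and J: "finite J" and F: "finite F"
    and A: "\<And>F. finite F \<Longrightarrow> wnorm s a F \<le> A" and B: "\<And>F. finite F \<Longrightarrow> wnorm s b F \<le> B"
  shows "L2_set (fconv J a b) F \<le> 2 ^ (CARD('n) + 1) * (A * B)"
proof -
  let ?P = "\<lambda>J (a :: int ^ 'n \<Rightarrow> real) b k. \<Sum>j\<in>J. if bracket j \<le> bracket (k - j) then a j * b (k - j) else 0"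
  define M where "M = (\<lambda>(k, j). k - j) ` (F \<times> J)"
  have M: "finite M" using F J by (auto simp: M_def)
  have "fconv J a b k \<le> ?P J a b k + ?P M b a k" if k: "k \<in> F" for k
  proof -
    have "fconv J a b k \<le> ?P J a b k + (\<Sum>j\<in>J. if bracket (k - j) \<le> bracket j then a j * b (k - j) else 0)"
      unfolding fconv_def sum.distrib[symmetric] using a b by (intro sum_mono) auto
    also have "(\<Sum>j\<in>J. if bracket (k - j) \<le> bracket j then a j * b (k - j) else 0)
       = (\<Sum>i\<in>(\<lambda>j. k - j) ` J. if bracket i \<le> bracket (k - i) then b i * a (k - i) else 0)"
      by (subst sum.reindex) (auto simp: inj_on_def mult.commute intro!: sum.cong)
    also have "\<dots> \<le> ?P M b a k"
      using M k a b by (intro sum_mono2) (auto simp: M_def)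
    finally show ?thesis by simp
  qed
  hence "L2_set (fconv J a b) F \<le> L2_set (\<lambda>k. ?P J a b k + ?P M b a k) F"
    using a b by (intro L2_set_mono) (auto simp: fconv_nonneg)
  also have "\<dots> \<le> L2_set (?P J a b) F + L2_set (?P M b a) F" by (rule L2_set_triangle_ineq)
  also have "\<dots> \<le> 2 ^ CARD('n) * (A * B) + 2 ^ CARD('n) * (B * A)"
    unfolding s_def by (intro add_mono wnorm_critical_half a b J F M A[unfolded s_def] B[unfolded s_def])
  also have "\<dots> = 2 ^ (CARD('n) + 1) * (A * B)" by (simp add: mult_ac)
  finally show ?thesis .
qed

subsection \<open>Comparison with the Sobolev norms\<close>

lemma wnorm_mono_exponent: "r \<le> s \<Longrightarrow> (\<And>k. 0 \<le> a k) \<Longrightarrow> wnorm r a F \<le> wnorm s a F"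
  unfolding wnorm_def by (intro L2_set_mono mult_right_mono powr_mono bracket_ge_1) auto

lemma ksq_le_bracket: "ksq k \<le> bracket k powr 2" "norm (freq k) \<le> bracket k powr 1"
  by (auto simp: ksq_def bracket_def intro!: power_mono)

lemma wnorm_ksq: "(\<And>k. 0 \<le> a k) \<Longrightarrow> wnorm s (\<lambda>k. ksq k * a k) F \<le> wnorm (s + 2) a F"
  unfolding wnorm_def powr_add mult.assoc
  by (intro L2_set_mono mult_left_mono mult_right_mono ksq_le_bracket) (auto simp: ksq_def)

lemma wnorm_freq: "(\<And>k. 0 \<le> a k) \<Longrightarrow> wnorm s (\<lambda>k. norm (freq k) * a k) F \<le> wnorm (s + 1) a F"
  unfolding wnorm_def powr_add mult.assoc
  by (intro L2_set_mono mult_left_mono mult_right_mono ksq_le_bracket) auto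

lemma bracket_powr_le_sobolev_weight:
  assumes "0 \<le> s"
  shows "bracket k powr (2 * s) \<le> 4 powr s * sobolev_weight s k"
proof -
  let ?n = "norm (freq k)"
  have 4: "(2 :: real) powr (2 * s) = 4 powr s" by (simp add: powr_powr[symmetric])
  show ?thesis
  proof (cases "?n \<le> 1")
    case True
    hence "bracket k powr (2 * s) \<le> 2 powr (2 * s)" using assms by (intro powr_mono2) (auto simp: bracket_def)
    also have "\<dots> \<le> 4 powr s * sobolev_weight s k" unfolding 4 by (simp add: sobolev_weight_def)
    finally show ?thesis .
  next
    case False
    hence "bracket k powr (2 * s) \<le> (2 * ?n) powr (2 * s)" using assms by (intro powr_mono2) (auto simp: bracket_def)
    also have "\<dots> = 4 powr s * ?n powr (2 * s)" by (subst powr_mult) (auto simp: 4)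
    also have "\<dots> \<le> 4 powr s * sobolev_weight s k" by (intro mult_left_mono) (auto simp: sobolev_weight_def)
    finally show ?thesis .
  qed
qed

lemma sobolev_weight_le_bracket_powr:
  assumes "0 \<le> s"
  shows "sobolev_weight s k \<le> 2 * bracket k powr (2 * s)"
proof -
  have "norm (freq k) powr (2 * s) \<le> bracket k powr (2 * s)"
    using assms by (intro powr_mono2) (auto simp: bracket_def)
  moreover have "1 \<le> bracket k powr (2 * s)" using assms by (intro ge_one_powr_ge_zero bracket_ge_1) auto
  ultimately show ?thesis by (auto simp: sobolev_weight_def)
qed

lemma sobolev_weight_nonneg [simp]: "0 \<le> sobolev_weight s k"
  by (simp add: sobolev_weight_def)

lemma cmod_fourier_coeff_sq:
  fixes f :: "real ^ 'n::finite \<Rightarrow> complex"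
  shows "(cmod (fourier_coeff f k))\<^sup>2 = (2 * pi) ^ CARD('n) * (cmod (fc f k))\<^sup>2"
  by (simp add: fc_def norm_divide power_divide)

lemma wnorm_le_sobolev_norm:
  fixes f :: "real ^ 'n::finite \<Rightarrow> complex"
  assumes s: "0 \<le> s" and f: "f \<in> sobolev s" and F: "finite F"
  shows "wnorm s (\<lambda>k. cmod (fc f k)) F \<le> 2 powr s * sobolev_norm s f"
proof -
  let ?g = "\<lambda>k. sobolev_weight s k * (cmod (fourier_coeff f k))\<^sup>2"
  have sm: "?g summable_on UNIV" using f by (simp add: sobolev_def)
  have V: "1 \<le> (2 * pi) ^ CARD('n)" using pi_gt3 by (intro one_le_power) simp
  have "(\<Sum>k\<in>F. (bracket k powr s * cmod (fc f k))\<^sup>2) \<le> (\<Sum>k\<in>F. 4 powr s * ?g k)"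
  proof (rule sum_mono)
    fix k
    have "(bracket k powr s * cmod (fc f k))\<^sup>2 = bracket k powr (2 * s) * (cmod (fc f k))\<^sup>2"
      by (simp add: power_mult_distrib power2_eq_square[of "bracket k powr s"] powr_add[symmetric])
    also have "\<dots> \<le> (4 powr s * sobolev_weight s k) * (cmod (fourier_coeff f k))\<^sup>2"
      using V by (intro mult_mono bracket_powr_le_sobolev_weight s)
        (auto simp: cmod_fourier_coeff_sq intro: mult_le_cancel_right1[THEN iffD2])
    finally show "(bracket k powr s * cmod (fc f k))\<^sup>2 \<le> 4 powr s * ?g k" by (simp add: mult.assoc)
  qed
  also have "\<dots> \<le> 4 powr s * (\<Sum>\<^sub>\<infinity>k. ?g k)"
    unfolding sum_distrib_left[symmetric] using F
    by (intro mult_left_mono finite_sum_le_infsum sm) auto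
  finally have "wnorm s (\<lambda>k. cmod (fc f k)) F \<le> sqrt (4 powr s * (\<Sum>\<^sub>\<infinity>k. ?g k))"
    unfolding wnorm_def L2_set_def by (rule real_sqrt_le_mono)
  also have "\<dots> = 2 powr s * sobolev_norm s f"
  proof -
    have "4 powr s = (2 powr s)\<^sup>2" by (simp add: power2_eq_square powr_mult[symmetric])
    thus ?thesis by (simp add: real_sqrt_mult sobolev_norm_def)
  qed
  finally show ?thesis .
qed

lemma sobolevI:
  fixes f :: "real ^ 'n::finite \<Rightarrow> complex"
  assumes s: "0 \<le> s" and f: "f \<in> torus_L2" and B: "\<And>F. finite F \<Longrightarrow> wnorm s (\<lambda>k. cmod (fc f k)) F \<le> B"
  shows "f \<in> sobolev s" "sobolev_norm s f \<le> sqrt (2 * (2 * pi) ^ CARD('n)) * B"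
proof -
  let ?g = "\<lambda>k. sobolev_weight s k * (cmod (fourier_coeff f k))\<^sup>2"
  let ?V = "2 * (2 * pi) ^ CARD('n)"
  have B0: "0 \<le> B" using B[of "{}"] by (simp add: wnorm_def)
  have fin: "sum ?g F \<le> ?V * B\<^sup>2" if F: "finite F" for F
  proof -
    have "sum ?g F \<le> (\<Sum>k\<in>F. ?V * (bracket k powr s * cmod (fc f k))\<^sup>2)"
    proof (rule sum_mono)
      fix k
      have "?g k \<le> (2 * bracket k powr (2 * s)) * (cmod (fourier_coeff f k))\<^sup>2"
        by (intro mult_right_mono sobolev_weight_le_bracket_powr s) auto
      also have "\<dots> = ?V * (bracket k powr s * cmod (fc f k))\<^sup>2"
        by (simp add: power_mult_distrib power2_eq_square[of "bracket k powr s"] powr_add[symmetric] cmod_fourier_coeff_sq)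
      finally show "?g k \<le> ?V * (bracket k powr s * cmod (fc f k))\<^sup>2" .
    qed
    also have "\<dots> = ?V * (wnorm s (\<lambda>k. cmod (fc f k)) F)\<^sup>2"
      by (simp add: wnorm_def L2_set_def sum_nonneg sum_distrib_left)
    also have "\<dots> \<le> ?V * B\<^sup>2" using B[OF F] by (intro mult_left_mono power_mono) auto
    finally show ?thesis .
  qed
  have sm: "?g summable_on UNIV"
    using fin by (intro nonneg_bdd_above_summable_on bdd_aboveI2[where M = "?V * B\<^sup>2"]) auto
  show "f \<in> sobolev s" using f sm by (simp add: sobolev_def)
  have "(\<Sum>\<^sub>\<infinity>k. ?g k) \<le> ?V * B\<^sup>2" using fin by (intro infsum_le_finite_sums sm) auto
  hence "sobolev_norm s f \<le> sqrt (?V * B\<^sup>2)" unfolding sobolev_norm_def by (rule real_sqrt_le_mono)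
  also have "\<dots> = sqrt ?V * B" using B0 by (simp add: real_sqrt_mult)
  finally show "sobolev_norm s f \<le> sqrt ?V * B" .
qed

lemma sobolev_summable:
  fixes f :: "real ^ 'n::finite \<Rightarrow> complex"
  assumes s: "s > real CARD('n) / 2" and f: "f \<in> sobolev s"
  shows "summable_abs (fc f)"
proof -
  have s0: "0 \<le> s" using s by (meson less_imp_le order_le_less_trans of_nat_0_le_iff divide_nonneg_nonneg zero_le_numeral)
  obtain C where C: "C > 0"
    "\<And>(a :: int ^ 'n \<Rightarrow> real) F. \<forall>k. 0 \<le> a k \<Longrightarrow> finite F \<Longrightarrow> sum a F \<le> C * wnorm s a F"
    using sum_le_wnorm[OF s] by blast
  show ?thesis
  proof (rule abs_summable_onI_bdd)
    fix F :: "(int ^ 'n) set" assume F: "finite F"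
    have "(\<Sum>k\<in>F. cmod (fc f k)) \<le> C * wnorm s (\<lambda>k. cmod (fc f k)) F" using F by (intro C(2)) auto
    also have "\<dots> \<le> C * (2 powr s * sobolev_norm s f)"
      using C(1) by (intro mult_left_mono wnorm_le_sobolev_norm s0 f F) auto
    finally show "(\<Sum>k\<in>F. cmod (fc f k)) \<le> C * (2 powr s * sobolev_norm s f)" .
  qed
qed

section \<open>The propagator and the filter functions\<close>

abbreviation symb :: "(complex \<Rightarrow> complex) \<Rightarrow> real \<Rightarrow> int ^ 'n::finite \<Rightarrow> complex" where
  "symb \<phi> \<xi> k \<equiv> \<phi> (- \<i> * complex_of_real (\<xi> * ksq k))"

text \<open>
  All multipliers in the scheme are bounded by one on every norm that depends on the moduli of the
  coefficients only.
\<close>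

definition unit_symbol :: "(complex \<Rightarrow> complex) \<Rightarrow> bool" where
  "unit_symbol \<phi> \<longleftrightarrow> (\<forall>y :: real. cmod (\<phi> (\<i> * of_real y)) \<le> 1)"

lemma unit_symbol_symb: "unit_symbol \<phi> \<Longrightarrow> cmod (symb \<phi> \<xi> k) \<le> 1"
  unfolding unit_symbol_def by (metis mult_minus_left mult_minus_right of_real_minus)

text \<open>
  This integral and the next one make the interpolant of the scheme integrable in closed form. For \<open>\<tau> = 1\<close> they also
  bound the filter functions on the imaginary axis.
\<close>

lemma phi1_integral:
  assumes "0 \<le> \<tau>"
  shows "((\<lambda>\<zeta>. exp (of_real \<zeta> * c)) has_integral of_real \<tau> * phi1 (of_real \<tau> * c)) {0..\<tau>}"
proof (cases "c = 0")
  case True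
  thus ?thesis using has_integral_const_real[of "1 :: complex" 0 \<tau>] assms
    by (simp add: phi1_def scaleR_conv_of_real)
next
  case False
  have "((\<lambda>\<zeta>. exp (of_real \<zeta> * c)) has_integral (exp (of_real \<tau> * c) / c - exp (of_real 0 * c) / c)) {0..\<tau>}"
  proof (rule fundamental_theorem_of_calculus[OF assms])
    fix x :: real
    show "((\<lambda>\<zeta>. exp (of_real \<zeta> * c) / c) has_vector_derivative exp (of_real x * c)) (at x within {0..\<tau>})"
      using False by (auto intro!: derivative_eq_intros has_vector_derivative_real_field)
  qed
  moreover have "of_real \<tau> * phi1 (of_real \<tau> * c) = exp (of_real \<tau> * c) / c - exp (of_real 0 * c) / c"
    using False by (cases "\<tau> = 0") (auto simp: phi1_def field_simps)
  ultimately show ?thesis by simp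
qed

lemma phi2_integral:
  assumes "0 \<le> \<tau>"
  shows "((\<lambda>\<zeta>. of_real \<zeta> * exp (of_real \<zeta> * c)) has_integral of_real (\<tau>\<^sup>2) * phi2 (of_real \<tau> * c)) {0..\<tau>}"
proof (cases "c = 0")
  case True
  have "((\<lambda>\<zeta>. of_real \<zeta> :: complex) has_integral (of_real \<tau>)\<^sup>2 / 2 - (of_real 0)\<^sup>2 / 2) {0..\<tau>}"
    by (rule fundamental_theorem_of_calculus[OF assms])
      (auto intro!: derivative_eq_intros has_vector_derivative_real_field)
  thus ?thesis using True by (simp add: phi2_def)
next
  case False
  have "((\<lambda>\<zeta>. of_real \<zeta> * exp (of_real \<zeta> * c)) has_integral
     ((of_real \<tau> / c - 1 / c\<^sup>2) * exp (of_real \<tau> * c) - (of_real 0 / c - 1 / c\<^sup>2) * exp (of_real 0 * c))) {0..\<tau>}"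
  proof (rule fundamental_theorem_of_calculus[OF assms])
    fix x :: real
    have "((\<lambda>z. (z / c - 1 / c\<^sup>2) * exp (z * c)) has_field_derivative of_real x * exp (of_real x * c)) (at (of_real x))"
      using False by (auto intro!: derivative_eq_intros simp: field_simps power2_eq_square)
    thus "((\<lambda>\<zeta>. (of_real \<zeta> / c - 1 / c\<^sup>2) * exp (of_real \<zeta> * c)) has_vector_derivative of_real x * exp (of_real x * c)) (at x within {0..\<tau>})"
      by (rule has_vector_derivative_real_field)
  qed
  moreover have "of_real (\<tau>\<^sup>2) * phi2 (of_real \<tau> * c) =
      (of_real \<tau> / c - 1 / c\<^sup>2) * exp (of_real \<tau> * c) - (of_real 0 / c - 1 / c\<^sup>2) * exp (of_real 0 * c)"
    using False by (cases "\<tau> = 0") (auto simp: phi1_def phi2_def field_simps power2_eq_square)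
  ultimately show ?thesis by simp
qed

lemma unit_symbol_exp: "unit_symbol exp"
  by (simp add: unit_symbol_def)

lemma unit_symbol_phi1: "unit_symbol phi1"
  unfolding unit_symbol_def
proof
  fix y :: real
  have "cmod (exp (of_real \<zeta> * (\<i> * of_real y))) \<le> 1" for \<zeta> :: real by simp
  with has_integral_bound_real[OF zero_le_one finite.emptyI phi1_integral[OF zero_le_one, of "\<i> * of_real y"]]
  show "cmod (phi1 (\<i> * of_real y)) \<le> 1" by simp
qed

lemma unit_symbol_phi2: "unit_symbol phi2"
  unfolding unit_symbol_def
proof
  fix y :: real
  have "cmod (of_real \<zeta> * exp (of_real \<zeta> * (\<i> * of_real y))) \<le> 1" if "\<zeta> \<in> {0..1}" for \<zeta> :: real
    using that by (simp add: norm_mult)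
  with has_integral_bound_real[OF zero_le_one finite.emptyI phi2_integral[OF zero_le_one, of "\<i> * of_real y"]]
  show "cmod (phi2 (\<i> * of_real y)) \<le> 1" by simp
qed

lemma laplace_wiener:
  assumes "unit_symbol \<phi>" "f \<in> wiener"
  shows "laplace_op \<phi> \<xi> f \<in> wiener" "fc (laplace_op \<phi> \<xi> f) = (\<lambda>k. symb \<phi> \<xi> k * fc f k)"
  unfolding laplace_op_fmult
  using wiener_fmult[OF assms(2) unit_symbol_symb[OF assms(1), of \<xi>]] by auto

lemmas prop_wiener = laplace_wiener[OF unit_symbol_exp]

lemma laplace_cong: "fc f = fc g \<Longrightarrow> laplace_op \<phi> \<xi> f = laplace_op \<phi> \<xi> g"
  unfolding laplace_op_fmult by (rule fmult_cong)

lemma laplace_diff: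
  assumes "unit_symbol \<phi>" "f \<in> wiener" "g \<in> wiener"
  shows "laplace_op \<phi> \<xi> (\<lambda>x. f x - g x) x = laplace_op \<phi> \<xi> f x - laplace_op \<phi> \<xi> g x"
proof -
  have "laplace_op \<phi> \<xi> (\<lambda>x. f x - g x) = (\<lambda>x. laplace_op \<phi> \<xi> f x - laplace_op \<phi> \<xi> g x)"
    by (rule wiener_eqI) (use assms in \<open>auto simp: laplace_wiener wiener_diff algebra_simps\<close>)
  thus ?thesis by (rule fun_cong)
qed

lemma laplace_add:
  assumes "unit_symbol \<phi>" "f \<in> wiener" "g \<in> wiener"
  shows "laplace_op \<phi> \<xi> (\<lambda>x. f x + g x) x = laplace_op \<phi> \<xi> f x + laplace_op \<phi> \<xi> g x"
proof -
  have "laplace_op \<phi> \<xi> (\<lambda>x. f x + g x) = (\<lambda>x. laplace_op \<phi> \<xi> f x + laplace_op \<phi> \<xi> g x)"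
    by (rule wiener_eqI) (use assms in \<open>auto simp: laplace_wiener wiener_add algebra_simps\<close>)
  thus ?thesis by (rule fun_cong)
qed

lemma laplace_cmult:
  assumes "unit_symbol \<phi>" "f \<in> wiener"
  shows "laplace_op \<phi> \<xi> (\<lambda>x. c * f x) x = c * laplace_op \<phi> \<xi> f x"
proof -
  have "laplace_op \<phi> \<xi> (\<lambda>x. c * f x) = (\<lambda>x. c * laplace_op \<phi> \<xi> f x)"
    by (rule wiener_eqI) (use assms in \<open>auto simp: laplace_wiener wiener_cmult algebra_simps\<close>)
  thus ?thesis by (rule fun_cong)
qed

lemma prop_prop:
  assumes "f \<in> wiener"
  shows "laplace_op exp a (laplace_op exp b f) = laplace_op exp (a + b) f"
  by (rule wiener_eqI) (use assms in \<open>auto simp: prop_wiener algebra_simps exp_add[symmetric] fun_eq_iff\<close>)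

lemma prop_0:
  assumes "f \<in> wiener"
  shows "laplace_op exp 0 f = f"
  by (rule wiener_eqI) (use assms in \<open>auto simp: prop_wiener\<close>)

lemma prop_const: "laplace_op exp \<xi> (\<lambda>x. c) = (\<lambda>x. c)"
  by (rule wiener_eqI) (auto simp: prop_wiener wiener_const ksq_def fun_eq_iff)

lemma ksq_minus [simp]: "ksq (- k) = ksq k"
  by (simp add: ksq_def freq_minus)

lemma ksq_nonneg [simp]: "0 \<le> ksq k"
  by (simp add: ksq_def)

lemma cnj_prop:
  assumes "f \<in> wiener"
  shows "cnj (laplace_op exp \<xi> f x) = laplace_op exp (- \<xi>) (\<lambda>x. cnj (f x)) x"
proof -
  have "(\<lambda>x. cnj (laplace_op exp \<xi> f x)) = laplace_op exp (- \<xi>) (\<lambda>x. cnj (f x))"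
    by (rule wiener_eqI) (use assms in \<open>auto simp: prop_wiener wiener_cnj exp_cnj fun_eq_iff\<close>)
  thus ?thesis by (rule fun_cong)
qed

lemma bigO_laplace:
  assumes "test_family E" "unit_symbol \<phi>" "bigO E P f h"
  shows "bigO E P (\<lambda>p. laplace_op \<phi> (\<xi> p) (f p)) h"
  unfolding laplace_op_fmult
  by (rule bigO_fmult[OF assms(1,3), where C = 1]) (use unit_symbol_symb[OF assms(2)] in auto)

section \<open>Norms of the Laplacian\<close>

text \<open>
  The norm of the Laplacian of a function, as a test family; the general rules for such norms apply to it.
\<close>

definition second_order :: "(int ^ 'n::finite \<Rightarrow> real) set \<Rightarrow> (int ^ 'n \<Rightarrow> real) set" where
  "second_order E = (\<lambda>\<psi> k. ksq k * \<psi> k) ` E"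

lemma dual_le_second_order:
  assumes "test_family E"
  shows "dual_le (second_order E) a B \<longleftrightarrow> dual_le E (\<lambda>k. ksq k * a k) B"
proof -
  have "(\<Sum>k\<in>{k. ksq k * \<psi> k \<noteq> 0}. ksq k * \<psi> k * a k) = (\<Sum>k\<in>{k. \<psi> k \<noteq> 0}. \<psi> k * (ksq k * a k))" if "\<psi> \<in> E" for \<psi>
  proof -
    have "finite {k. \<psi> k \<noteq> 0}" using assms that by (auto simp: test_family_def)
    hence "(\<Sum>k\<in>{k. ksq k * \<psi> k \<noteq> 0}. ksq k * \<psi> k * a k) = (\<Sum>k\<in>{k. \<psi> k \<noteq> 0}. ksq k * \<psi> k * a k)"
      by (intro sum.mono_neutral_left) auto
    thus ?thesis by (simp add: mult_ac)
  qed
  thus ?thesis by (auto simp: dual_le_def second_order_def)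
qed

lemma test_family_second_order:
  assumes "test_family E"
  shows "test_family (second_order E)"
  unfolding test_family_def
proof (intro conjI ballI allI)
  show "second_order E \<noteq> {}" using assms by (auto simp: test_family_def second_order_def)
  fix \<theta> assume "\<theta> \<in> second_order E"
  then obtain \<psi> where \<psi>: "\<psi> \<in> E" "\<theta> = (\<lambda>k. ksq k * \<psi> k)" by (auto simp: second_order_def)
  have \<psi>': "finite {k. \<psi> k \<noteq> 0}" "\<And>k. 0 \<le> \<psi> k" "(\<lambda>k. \<psi> (- k)) \<in> E"
    using assms \<psi>(1) by (auto simp: test_family_def)
  show "finite {k. \<theta> k \<noteq> 0}" by (rule finite_subset[OF _ \<psi>'(1)]) (auto simp: \<psi>)
  show "0 \<le> \<theta> k" for k using \<psi>'(2) by (simp add: \<psi>)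
  show "(\<lambda>k. \<theta> (- k)) \<in> second_order E"
    using \<psi>'(3) unfolding second_order_def by (auto simp: \<psi> intro!: image_eqI[of _ _ "\<lambda>k. \<psi> (- k)"])
qed

lemma ksq_le_add: "ksq k \<le> 2 * ksq j + 2 * ksq (k - j)"
proof -
  let ?a = "norm (freq j)" and ?b = "norm (freq (k - j))"
  have "norm (freq k) \<le> ?a + ?b"
    using norm_triangle_ineq[of "freq j" "freq (k - j)"] by (simp add: freq_diff)
  hence "ksq k \<le> (?a + ?b)\<^sup>2" unfolding ksq_def by (intro power_mono) auto
  also have "\<dots> \<le> 2 * ?a\<^sup>2 + 2 * ?b\<^sup>2"
    using zero_le_power2[of "?a - ?b"] by (simp add: power2_eq_square algebra_simps)
  finally show ?thesis by (simp add: ksq_def)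
qed

text \<open>
  By \<open>|k|^2 \<le> 2 |j|^2 + 2 |k - j|^2\<close> both derivatives fall on the same factor, which is measured in \<open>Y\<close>
  while the other one is measured in \<open>X\<close>.
\<close>

lemma fnorm_le_mult_second_order:
  assumes X: "test_family X" and Y: "test_family Y" and XY: "conv_bound X Y"
    and f: "fnorm_le X f A" "fnorm_le (second_order Y) f A" and g: "fnorm_le X g B" "fnorm_le (second_order Y) g B"
  shows "fnorm_le (second_order Y) (\<lambda>x. f x * g x) (4 * (A * B))"
proof -
  have fg: "f \<in> wiener" "g \<in> wiener" using f g by (auto simp: fnorm_le_def)
  let ?a = "\<lambda>k. cmod (fc f k)" and ?b = "\<lambda>k. cmod (fc g k)"
  have J: "dual_le (second_order Y) (fconv J ?a ?b) (4 * (A * B))" if J: "finite J" for J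
  proof -
    have "dual_le Y (fconv J (\<lambda>k. ksq k * ?a k) ?b) (B * A)"
      using f(2) g(1) J by (intro conv_bound_right[OF Y XY]) (auto simp: fnorm_le_def dual_le_second_order[OF Y])
    moreover have "dual_le Y (fconv J ?a (\<lambda>k. ksq k * ?b k)) (A * B)"
      using f(1) g(2) J by (intro conv_bound_left[OF XY]) (auto simp: fnorm_le_def dual_le_second_order[OF Y])
    ultimately have "dual_le Y (\<lambda>k. 2 * (fconv J (\<lambda>k. ksq k * ?a k) ?b k + fconv J ?a (\<lambda>k. ksq k * ?b k) k)) (2 * (B * A + A * B))"
      by (intro dual_le_scale dual_le_add) auto
    moreover have "ksq k * fconv J ?a ?b k \<le> 2 * (fconv J (\<lambda>k. ksq k * ?a k) ?b k + fconv J ?a (\<lambda>k. ksq k * ?b k) k)" for k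
    proof -
      have "ksq k * fconv J ?a ?b k = (\<Sum>j\<in>J. ksq k * (?a j * ?b (k - j)))" by (simp add: fconv_def sum_distrib_left)
      also have "\<dots> \<le> (\<Sum>j\<in>J. (2 * ksq j + 2 * ksq (k - j)) * (?a j * ?b (k - j)))"
        by (intro sum_mono mult_right_mono ksq_le_add) auto
      also have "\<dots> = 2 * (fconv J (\<lambda>k. ksq k * ?a k) ?b k + fconv J ?a (\<lambda>k. ksq k * ?b k) k)"
        unfolding fconv_def sum.distrib[symmetric] sum_distrib_left by (intro sum.cong) (auto simp: algebra_simps)
      finally show ?thesis .
    qed
    ultimately show ?thesis unfolding dual_le_second_order[OF Y]
      by (rule dual_le_mono[OF Y]) (simp add: mult.commute)
  qed
  have "dual_le (second_order Y) (\<lambda>k. \<Sum>\<^sub>\<infinity>j. ?a j * ?b (k - j)) (4 * (A * B))"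
    by (rule dual_le_tendsto[OF _ eventually_finite_subsets_at_top_weakI tendsto_cmod_fconv[OF fg]])
      (use J in auto)
  thus ?thesis
    by (rule fnorm_le_dominated[OF test_family_second_order[OF Y]]) (use fg wiener_mult(1) fc_mult_le in auto)
qed

lemma bigO_mult_second_order:
  assumes X: "test_family X" and Y: "test_family Y" and XY: "conv_bound X Y"
    and f: "bigO X P f (\<lambda>_. 1)" "bigO (second_order Y) P f (\<lambda>_. 1)"
    and g: "bigO X P g (\<lambda>_. 1)" "bigO (second_order Y) P g (\<lambda>_. 1)"
  shows "bigO (second_order Y) P (\<lambda>p x. f p x * g p x) (\<lambda>_. 1)"
proof -
  obtain A1 A2 B1 B2 where
    A: "0 \<le> A1" "\<And>p. p \<in> P \<Longrightarrow> fnorm_le X (f p) A1" "0 \<le> A2" "\<And>p. p \<in> P \<Longrightarrow> fnorm_le (second_order Y) (f p) A2" and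
    B: "0 \<le> B1" "\<And>p. p \<in> P \<Longrightarrow> fnorm_le X (g p) B1" "0 \<le> B2" "\<And>p. p \<in> P \<Longrightarrow> fnorm_le (second_order Y) (g p) B2"
    using f g by (auto elim!: bigOE)
  define A B where "A = max A1 A2" and "B = max B1 B2"
  note Y2 = test_family_second_order[OF Y]
  show ?thesis
  proof (rule bigOI[of "4 * (A * B)"])
    fix p assume p: "p \<in> P"
    have "fnorm_le (second_order Y) (\<lambda>x. f p x * g p x) (4 * (A * B))"
      using fnorm_le_mono[OF X A(2)[OF p], of A] fnorm_le_mono[OF Y2 A(4)[OF p], of A]
         fnorm_le_mono[OF X B(2)[OF p], of B] fnorm_le_mono[OF Y2 B(4)[OF p], of B]
      by (intro fnorm_le_mult_second_order[OF X Y XY]) (auto simp: A_def B_def)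
    thus "fnorm_le (second_order Y) (\<lambda>x. f p x * g p x) (4 * (A * B) * 1)" by simp
  qed (use A(1) B(1) in \<open>auto simp: A_def B_def\<close>)
qed

lemma cmod_cis_diff_le: "cmod (exp (- \<i> * of_real y) - 1) \<le> \<bar>y\<bar>"
  using Taylor_exp[of "- \<i> * of_real y" 0] by (simp add: norm_mult)

text \<open>
  Time differences of the free flow cost two derivatives.
\<close>

lemma bigO_prop_diff:
  assumes Y: "test_family Y" and f: "bigO (second_order Y) P f (\<lambda>_. 1)" and fY: "bigO Y P f (\<lambda>_. 1)"
  shows "bigO Y P (\<lambda>p x. laplace_op exp (\<xi> p) (f p) x - f p x) (\<lambda>p. \<bar>\<xi> p\<bar>)"
proof -
  obtain C where C: "0 \<le> C" "\<And>p. p \<in> P \<Longrightarrow> fnorm_le (second_order Y) (f p) (C * 1)"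
    using f by (auto elim!: bigOE)
  show ?thesis
  proof (rule bigOI[OF C(1)])
    fix p assume p: "p \<in> P"
    have w: "f p \<in> wiener" using C(2)[OF p] by (simp add: fnorm_le_def)
    have "dual_le Y (\<lambda>k. \<bar>\<xi> p\<bar> * (ksq k * cmod (fc (f p) k))) (\<bar>\<xi> p\<bar> * C)"
      using C(2)[OF p] by (intro dual_le_scale) (auto simp: fnorm_le_def dual_le_second_order[OF Y])
    thus "fnorm_le Y (\<lambda>x. laplace_op exp (\<xi> p) (f p) x - f p x) (C * \<bar>\<xi> p\<bar>)"
      unfolding mult.commute[of C]
    proof (rule fnorm_le_dominated[OF Y])
      show "(\<lambda>x. laplace_op exp (\<xi> p) (f p) x - f p x) \<in> wiener"
        by (intro wiener_diff prop_wiener w)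
      fix k
      have "fc (\<lambda>x. laplace_op exp (\<xi> p) (f p) x - f p x) k = (symb exp (\<xi> p) k - 1) * fc (f p) k"
        by (simp add: wiener_diff prop_wiener w algebra_simps)
      also have "cmod \<dots> \<le> \<bar>\<xi> p * ksq k\<bar> * cmod (fc (f p) k)"
        unfolding norm_mult by (intro mult_right_mono cmod_cis_diff_le) auto
      finally show "cmod (fc (\<lambda>x. laplace_op exp (\<xi> p) (f p) x - f p x) k) \<le> \<bar>\<xi> p\<bar> * (ksq k * cmod (fc (f p) k))"
        by (simp add: abs_mult)
    qed
  qed
qed

section \<open>Trilinear forms with bounded symbols\<close>

text \<open>
  Grouping the pairs \<open>(j, l)\<close> by \<open>j + l\<close> puts the factor with the third frequency outside.
\<close>

lemma sum_triple_conv_le: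
  fixes a b c :: "int ^ 'n::finite \<Rightarrow> real"
  assumes "finite J1" "finite J2" "\<And>k. 0 \<le> a k" "\<And>k. 0 \<le> b k" "\<And>k. 0 \<le> c k"
  shows "(\<Sum>(j, l)\<in>J1 \<times> J2. a j * b l * c (k - j - l)) \<le> fconv ((\<lambda>(j, l). j + l) ` (J1 \<times> J2)) (fconv J1 a b) c k"
proof -
  let ?s = "\<lambda>(j, l). j + l :: int ^ 'n" and ?t = "\<lambda>(j, l). a j * b l * c (k - j - l)"
  have fin: "finite (J1 \<times> J2)" using assms by simp
  have "(\<Sum>p\<in>J1 \<times> J2. ?t p) = (\<Sum>m\<in>?s ` (J1 \<times> J2). \<Sum>p\<in>{p \<in> J1 \<times> J2. ?s p = m}. ?t p)"
    by (rule sum.image_gen[OF fin])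
  also have "\<dots> \<le> (\<Sum>m\<in>?s ` (J1 \<times> J2). fconv J1 a b m * c (k - m))"
  proof (rule sum_mono)
    fix m
    have "(\<Sum>p\<in>{p \<in> J1 \<times> J2. ?s p = m}. ?t p) = (\<Sum>j\<in>{j \<in> J1. m - j \<in> J2}. a j * b (m - j) * c (k - m))"
      by (rule sum.reindex_bij_witness[of _ "\<lambda>j. (j, m - j)" fst]) (auto simp: algebra_simps)
    also have "\<dots> \<le> (\<Sum>j\<in>J1. a j * b (m - j) * c (k - m))"
      using assms by (intro sum_mono2) auto
    finally show "(\<Sum>p\<in>{p \<in> J1 \<times> J2. ?s p = m}. ?t p) \<le> fconv J1 a b m * c (k - m)"
      by (simp add: fconv_def sum_distrib_right)
  qed
  finally show ?thesis by (simp add: fconv_def)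
qed

text \<open>
  The symbol \<open>\<sigma>\<close> costs a weight \<open>\<kappa>\<close> on two of the three factors. Their product is bounded in the target norm \<open>N\<close>
  by the assumed bilinear estimates, and the third factor acts on it as a multiplier in \<open>X\<close>. The sums are
  kept finite until the end, because the two weighted factors need not have summable coefficients.
\<close>

lemma fnorm_le_trilinear:
  fixes f g h D :: "real ^ 'n::finite \<Rightarrow> complex" and \<kappa> :: "int ^ 'n \<Rightarrow> real"
  assumes N: "test_family N" and XN: "conv_bound X N" and D: "D \<in> wiener" and c: "0 \<le> c" and \<kappa>: "\<And>k. 0 \<le> \<kappa> k"
    and f: "fnorm_le X f M" and g: "fnorm_le X g M" and h: "fnorm_le X h M"
    and fg: "\<And>J. finite J \<Longrightarrow> dual_le N (fconv J (\<lambda>k. \<kappa> k * cmod (fc f k)) (\<lambda>k. \<kappa> k * cmod (fc g k))) M"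
    and fh: "\<And>J. finite J \<Longrightarrow> dual_le N (fconv J (\<lambda>k. \<kappa> k * cmod (fc f k)) (\<lambda>k. \<kappa> k * cmod (fc h k))) M"
    and gh: "\<And>J. finite J \<Longrightarrow> dual_le N (fconv J (\<lambda>k. \<kappa> k * cmod (fc g k)) (\<lambda>k. \<kappa> k * cmod (fc h k))) M"
    and \<sigma>: "\<And>k j l. cmod (\<sigma> k j l) \<le> c * (\<kappa> j * \<kappa> l + \<kappa> j * \<kappa> (k - j - l) + \<kappa> l * \<kappa> (k - j - l))"
    and fcD: "\<And>k. ((\<lambda>(j, l). fc f j * fc g l * fc h (k - j - l) * \<sigma> k j l) has_sum fc D k) UNIV"
  shows "fnorm_le N D (3 * c * M\<^sup>2)"
proof -
  let ?f = "\<lambda>k. cmod (fc f k)" and ?g = "\<lambda>k. cmod (fc g k)" and ?h = "\<lambda>k. cmod (fc h k)"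
  let ?kf = "\<lambda>k. \<kappa> k * ?f k" and ?kg = "\<lambda>k. \<kappa> k * ?g k" and ?kh = "\<lambda>k. \<kappa> k * ?h k"
  let ?d = "\<lambda>k (j :: int ^ 'n, l :: int ^ 'n). fc f j * fc g l * fc h (k - j - l) * \<sigma> k j l"
  have fin: "dual_le N (\<lambda>k. cmod (sum (?d k) J)) (3 * c * M\<^sup>2)" if J: "finite J" for J
  proof -
    \<comment> \<open>The truncation is enlarged to a product set, where the sums over \<open>j\<close> and \<open>l\<close> separate.\<close>
    define J1 J2 where "J1 = fst ` J" and "J2 = snd ` J"
    have J12: "finite J1" "finite J2" "J \<subseteq> J1 \<times> J2" using J by (auto simp: J1_def J2_def image_iff) force+
    define S where "S = (\<lambda>(j, l). j + l) ` (J1 \<times> J2)"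
    have S: "finite S" using J12 by (auto simp: S_def)
    define T where "T k = fconv S (fconv J1 ?kf ?kg) ?h k + (fconv J2 ?g (fconv J1 ?kf ?kh) k + fconv J1 ?f (fconv J2 ?kg ?kh) k)" for k
    have "dual_le N T (M * M + (M * M + M * M))"
    proof -
      have X: "dual_le X ?f M" "dual_le X ?g M" "dual_le X ?h M" using f g h by (auto simp: fnorm_le_def)
      have pos: "0 \<le> ?kf k" "0 \<le> ?kg k" "0 \<le> ?kh k" for k using \<kappa> by auto
      have "dual_le N (fconv S (fconv J1 ?kf ?kg) ?h) (M * M)"
        by (rule conv_bound_right[OF N XN X(3) fg[OF J12(1)] S]) (simp_all add: pos fconv_nonneg)
      moreover have "dual_le N (fconv J2 ?g (fconv J1 ?kf ?kh)) (M * M)"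
        by (rule conv_bound_left[OF XN X(2) fh[OF J12(1)] J12(2)]) (simp_all add: pos fconv_nonneg)
      moreover have "dual_le N (fconv J1 ?f (fconv J2 ?kg ?kh)) (M * M)"
        by (rule conv_bound_left[OF XN X(1) gh[OF J12(2)] J12(1)]) (simp_all add: pos fconv_nonneg)
      ultimately show ?thesis unfolding T_def by (intro dual_le_add)
    qed
    hence "dual_le N (\<lambda>k. c * T k) (c * (M * M + (M * M + M * M)))" using c by (rule dual_le_scale)
    moreover have "cmod (sum (?d k) J) \<le> c * T k" for k
    proof -
      let ?m = "\<lambda>j l :: int ^ 'n. k - j - l"
      let ?t1 = "\<lambda>(j, l). ?kf j * ?kg l * ?h (?m j l)"
      let ?t2 = "\<lambda>(j, l). ?kf j * ?g l * ?kh (?m j l)"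
      let ?t3 = "\<lambda>(j, l). ?f j * ?kg l * ?kh (?m j l)"
      have "cmod (sum (?d k) J) \<le> (\<Sum>p\<in>J. c * (?t1 p + (?t2 p + ?t3 p)))"
      proof (rule sum_norm_le)
        fix p :: "(int ^ 'n) \<times> (int ^ 'n)"
        obtain j l where p: "p = (j, l)" by (cases p)
        have "cmod (?d k p) = (?f j * ?g l * ?h (?m j l)) * cmod (\<sigma> k j l)" by (simp add: p norm_mult)
        also have "\<dots> \<le> (?f j * ?g l * ?h (?m j l)) * (c * (\<kappa> j * \<kappa> l + \<kappa> j * \<kappa> (?m j l) + \<kappa> l * \<kappa> (?m j l)))"
          by (intro mult_left_mono \<sigma>) auto
        also have "\<dots> = c * (?t1 p + (?t2 p + ?t3 p))" by (simp add: p algebra_simps)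
        finally show "cmod (?d k p) \<le> c * (?t1 p + (?t2 p + ?t3 p))" .
      qed
      also have "\<dots> \<le> (\<Sum>p\<in>J1 \<times> J2. c * (?t1 p + (?t2 p + ?t3 p)))"
        using J12 c \<kappa> by (intro sum_mono2) (auto intro!: mult_nonneg_nonneg add_nonneg_nonneg)
      also have "\<dots> = c * ((\<Sum>p\<in>J1 \<times> J2. ?t1 p) + ((\<Sum>p\<in>J1 \<times> J2. ?t2 p) + (\<Sum>p\<in>J1 \<times> J2. ?t3 p)))"
        by (simp only: sum_distrib_left[symmetric] sum.distrib)
      also have "\<dots> \<le> c * T k"
        unfolding T_def
      proof (intro mult_left_mono add_mono c)
        show "(\<Sum>p\<in>J1 \<times> J2. ?t1 p) \<le> fconv S (fconv J1 ?kf ?kg) ?h k"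
          unfolding S_def using J12 \<kappa> by (intro sum_triple_conv_le) auto
        have "(\<Sum>p\<in>J1 \<times> J2. ?t2 p) = (\<Sum>l\<in>J2. \<Sum>j\<in>J1. ?kf j * ?g l * ?kh (?m j l))"
          by (subst sum.cartesian_product[symmetric]) (rule sum.swap)
        also have "\<dots> = fconv J2 ?g (fconv J1 ?kf ?kh) k"
          unfolding fconv_def sum_distrib_left
          by (intro sum.cong refl) (simp add: algebra_simps)
        finally show "(\<Sum>p\<in>J1 \<times> J2. ?t2 p) \<le> fconv J2 ?g (fconv J1 ?kf ?kh) k" by simp
        have "(\<Sum>p\<in>J1 \<times> J2. ?t3 p) = (\<Sum>j\<in>J1. \<Sum>l\<in>J2. ?f j * ?kg l * ?kh (?m j l))"
          by (subst sum.cartesian_product[symmetric]) simp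
        also have "\<dots> = fconv J1 ?f (fconv J2 ?kg ?kh) k"
          unfolding fconv_def sum_distrib_left
          by (intro sum.cong refl) (simp add: algebra_simps)
        finally show "(\<Sum>p\<in>J1 \<times> J2. ?t3 p) \<le> fconv J1 ?f (fconv J2 ?kg ?kh) k" by simp
      qed
      finally show ?thesis .
    qed
    ultimately show ?thesis by (rule dual_le_mono[OF N]) (simp add: power2_eq_square)
  qed
  have "((\<lambda>J. cmod (sum (?d k) J)) \<longlongrightarrow> cmod (fc D k)) (finite_subsets_at_top UNIV)" for k
    using fcD[of k] unfolding has_sum_def by (rule tendsto_norm)
  hence "dual_le N (\<lambda>k. cmod (fc D k)) (3 * c * M\<^sup>2)"
    by (rule dual_le_tendsto[OF _ eventually_finite_subsets_at_top_weakI, rotated 2]) (use fin in auto)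
  thus ?thesis using D by (simp add: fnorm_le_def)
qed

section \<open>The interpolation error\<close>

text \<open>
  Linear interpolation of \<open>exp (i \<zeta> \<beta>)\<close> between \<open>0\<close> and \<open>\<tau>\<close> is exact on affine functions, so the Taylor
  polynomial of degree zero or one may be subtracted first.
\<close>

lemma interp_error_le:
  assumes "0 < \<tau>" "0 \<le> \<zeta>" "\<zeta> \<le> \<tau>"
  defines "e \<equiv> \<lambda>x. exp (\<i> * of_real x)"
  shows "cmod (e (\<zeta> * \<beta>) - of_real (1 - \<zeta> / \<tau>) - of_real (\<zeta> / \<tau>) * e (\<tau> * \<beta>)) \<le> 2 * (\<tau> * \<bar>\<beta>\<bar>)"
    and "cmod (e (\<zeta> * \<beta>) - of_real (1 - \<zeta> / \<tau>) - of_real (\<zeta> / \<tau>) * e (\<tau> * \<beta>)) \<le> 2 * (\<tau> * \<bar>\<beta>\<bar>)\<^sup>2"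
proof -
  have z: "0 \<le> \<zeta> / \<tau>" "\<zeta> / \<tau> \<le> 1" using assms by auto
  have 1: "cmod (e y - 1) \<le> \<bar>y\<bar>" for y
    using Taylor_exp[of "\<i> * of_real y" 0] by (simp add: norm_mult e_def)
  have 2: "cmod (e y - 1 - \<i> * of_real y) \<le> y\<^sup>2" for y
    using Taylor_exp[of "\<i> * of_real y" 1] by (simp add: norm_mult e_def diff_diff_eq power2_eq_square)
  have le: "\<bar>\<zeta> * \<beta>\<bar> \<le> \<tau> * \<bar>\<beta>\<bar>" using assms by (simp add: abs_mult mult_right_mono)
  have "e (\<zeta> * \<beta>) - of_real (1 - \<zeta> / \<tau>) - of_real (\<zeta> / \<tau>) * e (\<tau> * \<beta>)
    = (e (\<zeta> * \<beta>) - 1) - of_real (\<zeta> / \<tau>) * (e (\<tau> * \<beta>) - 1)" by (simp add: algebra_simps)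
  also have "cmod \<dots> \<le> cmod (e (\<zeta> * \<beta>) - 1) + (\<zeta> / \<tau>) * cmod (e (\<tau> * \<beta>) - 1)"
    using norm_triangle_ineq4[of "e (\<zeta> * \<beta>) - 1" "of_real (\<zeta> / \<tau>) * (e (\<tau> * \<beta>) - 1)"] z
    by (simp only: norm_mult norm_of_real abs_of_nonneg)
  also have "\<dots> \<le> \<bar>\<zeta> * \<beta>\<bar> + 1 * \<bar>\<tau> * \<beta>\<bar>"
    using z by (intro add_mono mult_mono 1) auto
  also have "\<dots> \<le> 2 * (\<tau> * \<bar>\<beta>\<bar>)" using le assms by (simp add: abs_mult)
  finally show "cmod (e (\<zeta> * \<beta>) - of_real (1 - \<zeta> / \<tau>) - of_real (\<zeta> / \<tau>) * e (\<tau> * \<beta>)) \<le> 2 * (\<tau> * \<bar>\<beta>\<bar>)" .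
  have "e (\<zeta> * \<beta>) - of_real (1 - \<zeta> / \<tau>) - of_real (\<zeta> / \<tau>) * e (\<tau> * \<beta>)
    = (e (\<zeta> * \<beta>) - 1 - \<i> * of_real (\<zeta> * \<beta>)) - of_real (\<zeta> / \<tau>) * (e (\<tau> * \<beta>) - 1 - \<i> * of_real (\<tau> * \<beta>))"
    using assms(1) by (simp add: algebra_simps)
  also have "cmod \<dots> \<le> cmod (e (\<zeta> * \<beta>) - 1 - \<i> * of_real (\<zeta> * \<beta>)) + (\<zeta> / \<tau>) * cmod (e (\<tau> * \<beta>) - 1 - \<i> * of_real (\<tau> * \<beta>))"
    using norm_triangle_ineq4[of "e (\<zeta> * \<beta>) - 1 - \<i> * of_real (\<zeta> * \<beta>)" "of_real (\<zeta> / \<tau>) * (e (\<tau> * \<beta>) - 1 - \<i> * of_real (\<tau> * \<beta>))"] z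
    by (simp only: norm_mult norm_of_real abs_of_nonneg)
  also have "\<dots> \<le> (\<zeta> * \<beta>)\<^sup>2 + 1 * (\<tau> * \<beta>)\<^sup>2"
    using z by (intro add_mono mult_mono 2) auto
  also have "\<dots> \<le> 2 * (\<tau> * \<bar>\<beta>\<bar>)\<^sup>2"
    using power_mono[OF le, of 2] by (simp add: power_mult_distrib mult.commute)
  finally show "cmod (e (\<zeta> * \<beta>) - of_real (1 - \<zeta> / \<tau>) - of_real (\<zeta> / \<tau>) * e (\<tau> * \<beta>)) \<le> 2 * (\<tau> * \<bar>\<beta>\<bar>)\<^sup>2" .
qed

text \<open>
  The part of the phase that is left when each factor is propagated separately. It is twice the sum of the
  mixed inner products of the three frequencies; this is the cancellation behind the method.
\<close>

definition resonance :: "int ^ 'n::finite \<Rightarrow> int ^ 'n \<Rightarrow> int ^ 'n \<Rightarrow> real" where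
  "resonance k j l = ksq k - ksq j - ksq l - ksq (k - j - l)"

lemma abs_resonance_le:
  fixes k j l :: "int ^ 'n::finite"
  defines "n \<equiv> \<lambda>k :: int ^ 'n. norm (freq k)"
  shows "\<bar>resonance k j l\<bar> \<le> 2 * (n j * n l + n j * n (k - j - l) + n l * n (k - j - l))"
proof -
  let ?m = "k - j - l"
  have k: "freq k = freq j + freq l + freq ?m" by (simp add: freq_diff)
  have "resonance k j l = 2 * (freq j \<bullet> freq l + freq j \<bullet> freq ?m + freq l \<bullet> freq ?m)"
    unfolding resonance_def ksq_def k power2_norm_eq_inner
    by (simp add: inner_add_left inner_add_right inner_commute)
  also have "\<bar>\<dots>\<bar> \<le> 2 * (\<bar>freq j \<bullet> freq l\<bar> + \<bar>freq j \<bullet> freq ?m\<bar> + \<bar>freq l \<bullet> freq ?m\<bar>)" by simp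
  also have "\<dots> \<le> 2 * (n j * n l + n j * n ?m + n l * n ?m)"
    unfolding n_def by (intro mult_left_mono add_mono Cauchy_Schwarz_ineq2) auto
  finally show ?thesis .
qed

lemma resonance_sq_le:
  "(resonance k j l)\<^sup>2 \<le> 12 * (ksq j * ksq l + ksq j * ksq (k - j - l) + ksq l * ksq (k - j - l))"
proof -
  let ?n = "\<lambda>k. norm (freq k)"
  let ?x = "?n j * ?n l" and ?y = "?n j * ?n (k - j - l)" and ?z = "?n l * ?n (k - j - l)"
  have "(resonance k j l)\<^sup>2 \<le> (2 * (?x + ?y + ?z))\<^sup>2"
    using power_mono[OF abs_resonance_le[of k j l], of 2] by simp
  also have "\<dots> \<le> 12 * (?x\<^sup>2 + ?y\<^sup>2 + ?z\<^sup>2)"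
    using zero_le_power2[of "?x - ?y"] zero_le_power2[of "?x - ?z"] zero_le_power2[of "?y - ?z"]
    by (simp add: power2_eq_square algebra_simps)
  finally show ?thesis by (simp add: ksq_def power_mult_distrib)
qed

text \<open>
  The twisted product of three freely evolving factors, minus its interpolant. The third factor evolves with
  speed \<open>\<mu>\<close>, where \<open>\<mu> = 0\<close> is the potential (with \<open>g = 1\<close>) and \<open>\<mu> = -1\<close> the conjugated factor of the cubic term; its
  own phase \<open>(1 - \<mu>) |k|^2\<close> is kept exact.
\<close>

definition interp_defect :: "real \<Rightarrow> real \<Rightarrow> real \<Rightarrow> (real ^ 'n::finite \<Rightarrow> complex) \<Rightarrow> (real ^ 'n \<Rightarrow> complex) \<Rightarrow>
    (real ^ 'n \<Rightarrow> complex) \<Rightarrow> real ^ 'n \<Rightarrow> complex" where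
  "interp_defect \<mu> \<tau> \<zeta> f g h x =
     laplace_op exp (- \<zeta>) (\<lambda>x. laplace_op exp \<zeta> f x * laplace_op exp \<zeta> g x * laplace_op exp (\<mu> * \<zeta>) h x) x
     - of_real (1 - \<zeta> / \<tau>) * (f x * g x * laplace_op exp (- ((1 - \<mu>) * \<zeta>)) h x)
     - of_real (\<zeta> / \<tau>) * laplace_op exp (- \<tau>)
         (\<lambda>x. laplace_op exp \<tau> f x * laplace_op exp \<tau> g x * laplace_op exp (\<tau> - (1 - \<mu>) * \<zeta>) h x) x"

lemma has_sum_fc_mult3:
  assumes f: "f \<in> wiener" and g: "g \<in> wiener" and h: "h \<in> wiener"
  shows "((\<lambda>(j, l). fc f j * fc g l * fc h (k - j - l)) has_sum fc (\<lambda>x. f x * g x * h x) k) UNIV"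
  unfolding wiener_mult3(2)[OF assms]
  by (rule has_sum_infsum, rule abs_summable_summable, rule wiener_mult3(1)[OF assms])

text \<open>
  The common factor of modulus one is the exact phase of the third factor; the rest is the scalar
  interpolation error at the resonance.
\<close>

lemma fc_interp_defect:
  assumes f: "f \<in> wiener" and g: "g \<in> wiener" and h: "h \<in> wiener"
  defines "e \<equiv> \<lambda>x. exp (\<i> * of_real x)"
  shows "interp_defect \<mu> \<tau> \<zeta> f g h \<in> wiener"
    and "((\<lambda>(j, l). fc f j * fc g l * fc h (k - j - l) *
            (e ((1 - \<mu>) * \<zeta> * ksq (k - j - l)) *
             (e (\<zeta> * resonance k j l) - of_real (1 - \<zeta> / \<tau>) - of_real (\<zeta> / \<tau>) * e (\<tau> * resonance k j l))))
          has_sum fc (interp_defect \<mu> \<tau> \<zeta> f g h) k) UNIV"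
proof -
  let ?S = "laplace_op exp"
  let ?A = "\<lambda>x. ?S \<zeta> f x * ?S \<zeta> g x * ?S (\<mu> * \<zeta>) h x"
  let ?B = "\<lambda>x. f x * g x * ?S (- ((1 - \<mu>) * \<zeta>)) h x"
  let ?C = "\<lambda>x. ?S \<tau> f x * ?S \<tau> g x * ?S (\<tau> - (1 - \<mu>) * \<zeta>) h x"
  have w: "?A \<in> wiener" "?B \<in> wiener" "?C \<in> wiener"
    by (intro wiener_mult prop_wiener f g h)+
  let ?D = "\<lambda>x. ?S (- \<zeta>) ?A x - of_real (1 - \<zeta> / \<tau>) * ?B x - of_real (\<zeta> / \<tau>) * ?S (- \<tau>) ?C x"
  have D: "interp_defect \<mu> \<tau> \<zeta> f g h = ?D" by (simp add: fun_eq_iff interp_defect_def)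
  show "interp_defect \<mu> \<tau> \<zeta> f g h \<in> wiener" unfolding D
    by (intro wiener_diff wiener_cmult prop_wiener w)
  have "fc (\<lambda>x. ?S (- \<zeta>) ?A x - c * ?B x - d * ?S (- \<tau>) ?C x) k =
      symb exp (- \<zeta>) k * fc ?A k - c * fc ?B k - d * (symb exp (- \<tau>) k * fc ?C k)" for c d
    using w by (simp add: wiener_diff wiener_cmult prop_wiener)
  note fcD = this[of "of_real (1 - \<zeta> / \<tau>)" "of_real (\<zeta> / \<tau>)"]
  have sA: "((\<lambda>(j, l). fc (?S \<zeta> f) j * fc (?S \<zeta> g) l * fc (?S (\<mu> * \<zeta>) h) (k - j - l)) has_sum fc ?A k) UNIV"
    by (rule has_sum_fc_mult3; intro prop_wiener f g h)
  have sB: "((\<lambda>(j, l). fc f j * fc g l * fc (?S (- ((1 - \<mu>) * \<zeta>)) h) (k - j - l)) has_sum fc ?B k) UNIV"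
    by (rule has_sum_fc_mult3; intro prop_wiener f g h)
  have sC: "((\<lambda>(j, l). fc (?S \<tau> f) j * fc (?S \<tau> g) l * fc (?S (\<tau> - (1 - \<mu>) * \<zeta>) h) (k - j - l)) has_sum fc ?C k) UNIV"
    by (rule has_sum_fc_mult3; intro prop_wiener f g h)
  have e_add: "e x * e y = e (x + y)" for x y by (simp add: e_def exp_add[symmetric] distrib_left)
  have symb_e: "symb exp \<xi> m = e (- (\<xi> * ksq m))" for \<xi> and m :: "int ^ 'a" by (simp add: e_def)
  have "((\<lambda>p. symb exp (- \<zeta>) k * (case p of (j, l) \<Rightarrow> fc (?S \<zeta> f) j * fc (?S \<zeta> g) l * fc (?S (\<mu> * \<zeta>) h) (k - j - l))
      + - (of_real (1 - \<zeta> / \<tau>) * (case p of (j, l) \<Rightarrow> fc f j * fc g l * fc (?S (- ((1 - \<mu>) * \<zeta>)) h) (k - j - l)))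
      + - (of_real (\<zeta> / \<tau>) * (symb exp (- \<tau>) k * (case p of (j, l) \<Rightarrow> fc (?S \<tau> f) j * fc (?S \<tau> g) l * fc (?S (\<tau> - (1 - \<mu>) * \<zeta>) h) (k - j - l)))))
     has_sum (symb exp (- \<zeta>) k * fc ?A k + - (of_real (1 - \<zeta> / \<tau>) * fc ?B k) + - (of_real (\<zeta> / \<tau>) * (symb exp (- \<tau>) k * fc ?C k)))) UNIV"
    by (intro has_sum_add has_sum_uminusI has_sum_cmult_right sA sB sC)
  moreover have "symb exp (- \<zeta>) k * (case p of (j, l) \<Rightarrow> fc (?S \<zeta> f) j * fc (?S \<zeta> g) l * fc (?S (\<mu> * \<zeta>) h) (k - j - l))
      + - (of_real (1 - \<zeta> / \<tau>) * (case p of (j, l) \<Rightarrow> fc f j * fc g l * fc (?S (- ((1 - \<mu>) * \<zeta>)) h) (k - j - l)))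
      + - (of_real (\<zeta> / \<tau>) * (symb exp (- \<tau>) k * (case p of (j, l) \<Rightarrow> fc (?S \<tau> f) j * fc (?S \<tau> g) l * fc (?S (\<tau> - (1 - \<mu>) * \<zeta>) h) (k - j - l))))
     = (case p of (j, l) \<Rightarrow> fc f j * fc g l * fc h (k - j - l) *
            (e ((1 - \<mu>) * \<zeta> * ksq (k - j - l)) *
             (e (\<zeta> * resonance k j l) - of_real (1 - \<zeta> / \<tau>) - of_real (\<zeta> / \<tau>) * e (\<tau> * resonance k j l))))" for p
  proof (cases p)
    case (Pair j l)
    let ?m = "k - j - l"
    let ?P = "fc f j * fc g l * fc h ?m"
    have 1: "symb exp (- \<zeta>) k * (symb exp \<zeta> j * symb exp \<zeta> l * symb exp (\<mu> * \<zeta>) ?m)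
      = e ((1 - \<mu>) * \<zeta> * ksq ?m) * e (\<zeta> * resonance k j l)"
      unfolding symb_e e_add by (rule arg_cong[where f = e]) (simp add: resonance_def algebra_simps)
    have 2: "symb exp (- ((1 - \<mu>) * \<zeta>)) ?m = e ((1 - \<mu>) * \<zeta> * ksq ?m)"
      unfolding symb_e by simp
    have 3: "symb exp (- \<tau>) k * (symb exp \<tau> j * symb exp \<tau> l * symb exp (\<tau> - (1 - \<mu>) * \<zeta>) ?m)
      = e ((1 - \<mu>) * \<zeta> * ksq ?m) * e (\<tau> * resonance k j l)"
      unfolding symb_e e_add by (rule arg_cong[where f = e]) (simp add: resonance_def algebra_simps)
    have "symb exp (- \<zeta>) k * (fc (?S \<zeta> f) j * fc (?S \<zeta> g) l * fc (?S (\<mu> * \<zeta>) h) ?m) = ?P * (e ((1 - \<mu>) * \<zeta> * ksq ?m) * e (\<zeta> * resonance k j l))"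
      unfolding 1[symmetric] prop_wiener(2)[OF f] prop_wiener(2)[OF g] prop_wiener(2)[OF h] by (simp only: mult_ac)
    moreover have "fc f j * fc g l * fc (?S (- ((1 - \<mu>) * \<zeta>)) h) ?m = ?P * e ((1 - \<mu>) * \<zeta> * ksq ?m)"
      unfolding 2[symmetric] prop_wiener(2)[OF h] by (simp only: mult_ac)
    moreover have "symb exp (- \<tau>) k * (fc (?S \<tau> f) j * fc (?S \<tau> g) l * fc (?S (\<tau> - (1 - \<mu>) * \<zeta>) h) ?m) = ?P * (e ((1 - \<mu>) * \<zeta> * ksq ?m) * e (\<tau> * resonance k j l))"
      unfolding 3[symmetric] prop_wiener(2)[OF f] prop_wiener(2)[OF g] prop_wiener(2)[OF h] by (simp only: mult_ac)
    moreover have alg: "A = P * (E * x) \<Longrightarrow> B = P * E \<Longrightarrow> C = P * (E * y) \<Longrightarrow>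
        A + - (c * B) + - (d * C) = P * (E * (x - c - d * y))" for A B C P E x y c d :: complex
      by (simp add: algebra_simps)
    ultimately show ?thesis unfolding Pair prod.case by (intro alg)
  qed
  ultimately show "((\<lambda>(j, l). fc f j * fc g l * fc h (k - j - l) *
            (e ((1 - \<mu>) * \<zeta> * ksq (k - j - l)) *
             (e (\<zeta> * resonance k j l) - of_real (1 - \<zeta> / \<tau>) - of_real (\<zeta> / \<tau>) * e (\<tau> * resonance k j l))))
          has_sum fc (interp_defect \<mu> \<tau> \<zeta> f g h) k) UNIV"
    unfolding D fcD by (simp only: diff_conv_add_uminus)
qed

text \<open>
  The weighted product estimate that decides how much regularity is used: \<open>\<kappa> = |k|\<close> gives first order,
  \<open>\<kappa> = |k|^2\<close> second order.
\<close>

definition bilinear_le :: "(int ^ 'n::finite \<Rightarrow> real) set \<Rightarrow> (int ^ 'n \<Rightarrow> real) \<Rightarrow> real \<Rightarrow>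
   (real ^ 'n \<Rightarrow> complex) \<Rightarrow> (real ^ 'n \<Rightarrow> complex) \<Rightarrow> bool" where
  "bilinear_le N \<kappa> M f g \<longleftrightarrow> (\<forall>J. finite J \<longrightarrow>
     dual_le N (fconv J (\<lambda>k. \<kappa> k * cmod (fc f k)) (\<lambda>k. \<kappa> k * cmod (fc g k))) M)"

lemma fnorm_le_interp_defect:
  fixes f g h :: "real ^ 'n::finite \<Rightarrow> complex"
  assumes N: "test_family N" and XN: "conv_bound X N"
    and f: "fnorm_le X f M" and g: "fnorm_le X g M" and h: "fnorm_le X h M"
    and t: "0 < \<tau>" "0 \<le> \<zeta>" "\<zeta> \<le> \<tau>"
  shows "bilinear_le N (\<lambda>k. norm (freq k)) M f g \<Longrightarrow> bilinear_le N (\<lambda>k. norm (freq k)) M f h \<Longrightarrow>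
      bilinear_le N (\<lambda>k. norm (freq k)) M g h \<Longrightarrow> fnorm_le N (interp_defect \<mu> \<tau> \<zeta> f g h) (12 * M\<^sup>2 * \<tau>)" (is "?A \<Longrightarrow> ?B \<Longrightarrow> ?C \<Longrightarrow> ?D")
    and "bilinear_le N ksq M f g \<Longrightarrow> bilinear_le N ksq M f h \<Longrightarrow>
      bilinear_le N ksq M g h \<Longrightarrow> fnorm_le N (interp_defect \<mu> \<tau> \<zeta> f g h) (72 * M\<^sup>2 * \<tau>\<^sup>2)" (is "?A' \<Longrightarrow> ?B' \<Longrightarrow> ?C' \<Longrightarrow> ?D'")
proof -
  have w: "f \<in> wiener" "g \<in> wiener" "h \<in> wiener" using f g h by (auto simp: fnorm_le_def)
  note * = fc_interp_defect[OF w, where \<mu> = \<mu> and \<tau> = \<tau> and \<zeta> = \<zeta>]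
  let ?e = "\<lambda>x. exp (\<i> * of_real x)"
  let ?r = "\<lambda>k j l. ?e (\<zeta> * resonance k j l) - of_real (1 - \<zeta> / \<tau>) - of_real (\<zeta> / \<tau>) * ?e (\<tau> * resonance k j l)"
  have e1: "cmod (?e x * y) = cmod y" for x y by (simp add: norm_mult)
  show ?D if ?A ?B ?C
  proof -
    have "fnorm_le N (interp_defect \<mu> \<tau> \<zeta> f g h) (3 * (4 * \<tau>) * M\<^sup>2)"
    proof (rule fnorm_le_trilinear[OF N XN *(1) _ _ f g h _ _ _ _ *(2), where \<kappa> = "\<lambda>k. norm (freq k)"])
      fix k j l :: "int ^ 'n"
      have "cmod (?r k j l) \<le> 2 * (\<tau> * \<bar>resonance k j l\<bar>)" by (rule interp_error_le(1)[OF t])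
      also have "\<dots> \<le> 2 * (\<tau> * (2 * (norm (freq j) * norm (freq l) + norm (freq j) * norm (freq (k - j - l)) + norm (freq l) * norm (freq (k - j - l)))))"
        using t by (intro mult_left_mono abs_resonance_le) auto
      also have "\<dots> = 4 * \<tau> * (norm (freq j) * norm (freq l) + norm (freq j) * norm (freq (k - j - l)) + norm (freq l) * norm (freq (k - j - l)))"
        by (simp add: algebra_simps)
      finally show "cmod (?e ((1 - \<mu>) * \<zeta> * ksq (k - j - l)) * ?r k j l)
        \<le> 4 * \<tau> * (norm (freq j) * norm (freq l) + norm (freq j) * norm (freq (k - j - l)) + norm (freq l) * norm (freq (k - j - l)))"
        unfolding e1 .
    qed (use that t in \<open>auto simp: bilinear_le_def\<close>)
    thus ?thesis by (simp add: mult_ac)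
  qed
  show ?D' if ?A' ?B' ?C'
  proof -
    have "fnorm_le N (interp_defect \<mu> \<tau> \<zeta> f g h) (3 * (24 * \<tau>\<^sup>2) * M\<^sup>2)"
    proof (rule fnorm_le_trilinear[OF N XN *(1) _ _ f g h _ _ _ _ *(2), where \<kappa> = ksq])
      fix k j l :: "int ^ 'n"
      have "cmod (?r k j l) \<le> 2 * (\<tau> * \<bar>resonance k j l\<bar>)\<^sup>2" by (rule interp_error_le(2)[OF t])
      also have "\<dots> = 2 * \<tau>\<^sup>2 * (resonance k j l)\<^sup>2" by (simp add: power_mult_distrib)
      also have "\<dots> \<le> 2 * \<tau>\<^sup>2 * (12 * (ksq j * ksq l + ksq j * ksq (k - j - l) + ksq l * ksq (k - j - l)))"
        by (intro mult_left_mono resonance_sq_le) auto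
      also have "\<dots> = 24 * \<tau>\<^sup>2 * (ksq j * ksq l + ksq j * ksq (k - j - l) + ksq l * ksq (k - j - l))"
        by (simp add: algebra_simps)
      finally show "cmod (?e ((1 - \<mu>) * \<zeta> * ksq (k - j - l)) * ?r k j l)
        \<le> 24 * \<tau>\<^sup>2 * (ksq j * ksq l + ksq j * ksq (k - j - l) + ksq l * ksq (k - j - l))"
        unfolding e1 .
    qed (use that t in \<open>auto simp: bilinear_le_def\<close>)
    thus ?thesis by (simp add: mult_ac)
  qed
qed

section \<open>The nonlinearity and the numerical flow\<close>

definition gpF :: "(real ^ 'n::finite \<Rightarrow> complex) \<Rightarrow> (real ^ 'n \<Rightarrow> complex) \<Rightarrow> real ^ 'n \<Rightarrow> complex" where
  "gpF V w x = V x * w x + (w x)\<^sup>2 * cnj (w x)"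

text \<open>
  If \<open>D\<close> is the real derivative of \<open>gpF V\<close> at \<open>w\<close>, then this is \<open>i D (-i gpF V w)\<close>. It is the quintic correction
  term of the scheme.
\<close>

definition gpG :: "(real ^ 'n::finite \<Rightarrow> complex) \<Rightarrow> (real ^ 'n \<Rightarrow> complex) \<Rightarrow> real ^ 'n \<Rightarrow> complex" where
  "gpG V w x = V x * gpF V w x + 2 * (w x * cnj (w x) * gpF V w x) - w x * w x * cnj (gpF V w x)"

text \<open>
  The last argument is separate from \<open>w\<close> because, after propagation, the scheme uses the propagated conjugate, which is
  not the conjugate of the propagated function.
\<close>

definition filtered :: "(complex \<Rightarrow> complex) \<Rightarrow> real \<Rightarrow> (real ^ 'n::finite \<Rightarrow> complex) \<Rightarrow> (real ^ 'n \<Rightarrow> complex) \<Rightarrow>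
    (real ^ 'n \<Rightarrow> complex) \<Rightarrow> real ^ 'n \<Rightarrow> complex" where
  "filtered \<phi> \<tau> w V wb x = w x * laplace_op \<phi> (- \<tau>) V x + w x * w x * laplace_op \<phi> (- 2 * \<tau>) wb x"

lemma gpF_wiener: "V \<in> wiener \<Longrightarrow> w \<in> wiener \<Longrightarrow> gpF V w \<in> wiener"
  unfolding gpF_def[abs_def] power2_eq_square by (intro wiener_add wiener_mult wiener_cnj)

lemma gpG_wiener: "V \<in> wiener \<Longrightarrow> w \<in> wiener \<Longrightarrow> gpG V w \<in> wiener"
  unfolding gpG_def[abs_def] by (intro wiener_add wiener_diff wiener_mult wiener_cnj wiener_cmult gpF_wiener)

lemma filtered_wiener:
  "unit_symbol \<phi> \<Longrightarrow> w \<in> wiener \<Longrightarrow> V \<in> wiener \<Longrightarrow> wb \<in> wiener \<Longrightarrow> filtered \<phi> \<tau> w V wb \<in> wiener"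
  unfolding filtered_def[abs_def] by (intro wiener_add wiener_mult laplace_wiener)

lemma gp_step_eq:
  fixes V w :: "real ^ 'a::finite \<Rightarrow> complex"
  shows
  "gp_step \<tau> V w x =
     laplace_op exp \<tau> w x
     - \<i> * of_real \<tau> * laplace_op exp \<tau> (filtered phi1 \<tau> w V (\<lambda>y. cnj (w y))) x
     - \<i> * of_real \<tau> * filtered phi2 \<tau> (laplace_op exp \<tau> w) (laplace_op exp \<tau> V) (laplace_op exp \<tau> (\<lambda>y. cnj (w y))) x
     + \<i> * of_real \<tau> * laplace_op exp \<tau> (filtered phi2 \<tau> w V (\<lambda>y. cnj (w y))) x
     - of_real (\<tau>\<^sup>2 / 2) * laplace_op exp \<tau> (gpG V w) x"
proof -
  have G: "(\<lambda>y. complex_of_real (cmod (w y) ^ 4) * w y + 3 * w y * complex_of_real ((cmod (w y))\<^sup>2) * V y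
                 - complex_of_real ((cmod (w y))\<^sup>2) * w y * cnj (V y) + w y * (V y)\<^sup>2) = gpG V w"
  proof
    fix y
    have 2: "complex_of_real ((cmod (w y))\<^sup>2) = w y * cnj (w y)" by (rule complex_norm_square)
    have "complex_of_real (cmod (w y) ^ 4) = (complex_of_real ((cmod (w y))\<^sup>2))\<^sup>2" by (simp flip: power_mult of_real_power)
    hence 4: "complex_of_real (cmod (w y) ^ 4) = (w y * cnj (w y))\<^sup>2" unfolding 2 .
    show "complex_of_real (cmod (w y) ^ 4) * w y + 3 * w y * complex_of_real ((cmod (w y))\<^sup>2) * V y
                 - complex_of_real ((cmod (w y))\<^sup>2) * w y * cnj (V y) + w y * (V y)\<^sup>2 = gpG V w y"
      unfolding 4 2 gpG_def gpF_def by (simp add: power2_eq_square algebra_simps)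
  qed
  have F: "filtered \<phi> \<tau> w V wb = (\<lambda>y. w y * laplace_op \<phi> (- \<tau>) V y + (w y)\<^sup>2 * laplace_op \<phi> (- 2 * \<tau>) wb y)"
    for \<phi> and w V wb :: "real ^ 'a \<Rightarrow> complex"
    by (simp add: filtered_def[abs_def] power2_eq_square)
  show ?thesis
    unfolding gp_step_def Let_def G F by simp
qed

lemma gp_step_wiener: "V \<in> wiener \<Longrightarrow> w \<in> wiener \<Longrightarrow> gp_step \<tau> V w \<in> wiener"
  unfolding gp_step_eq[abs_def]
  by (intro wiener_add wiener_diff wiener_cmult prop_wiener filtered_wiener gpG_wiener wiener_cnj
      unit_symbol_phi1 unit_symbol_phi2)

lemma prop_gp_step:
  fixes V w :: "real ^ 'n::finite \<Rightarrow> complex"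
  assumes V: "V \<in> wiener" and w: "w \<in> wiener"
  shows "laplace_op exp (- \<tau>) (gp_step \<tau> V w) x =
     w x
     - \<i> * of_real \<tau> * filtered phi1 \<tau> w V (\<lambda>y. cnj (w y)) x
     - \<i> * of_real \<tau> * laplace_op exp (- \<tau>) (filtered phi2 \<tau> (laplace_op exp \<tau> w) (laplace_op exp \<tau> V) (laplace_op exp \<tau> (\<lambda>y. cnj (w y)))) x
     + \<i> * of_real \<tau> * filtered phi2 \<tau> w V (\<lambda>y. cnj (w y)) x
     - of_real (\<tau>\<^sup>2 / 2) * gpG V w x"
proof -
  define S :: "(real ^ 'n \<Rightarrow> complex) \<Rightarrow> real ^ 'n \<Rightarrow> complex" where "S = laplace_op exp \<tau>"
  define a where "a = filtered phi1 \<tau> w V (\<lambda>y. cnj (w y))"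
  define b where "b = filtered phi2 \<tau> (S w) (S V) (S (\<lambda>y. cnj (w y)))"
  define c where "c = filtered phi2 \<tau> w V (\<lambda>y. cnj (w y))"
  define g where "g = gpG V w"
  define e where "e = complex_of_real (\<tau>\<^sup>2 / 2)"
  note ws = filtered_wiener[OF unit_symbol_phi1] filtered_wiener[OF unit_symbol_phi2] wiener_cnj gpG_wiener
  have wi: "a \<in> wiener" "b \<in> wiener" "c \<in> wiener" "g \<in> wiener"
    unfolding a_def b_def c_def g_def S_def by (intro ws prop_wiener V w)+
  have wS: "S f \<in> wiener" if "f \<in> wiener" for f unfolding S_def by (intro prop_wiener that)
  have step: "gp_step \<tau> V w = (\<lambda>x. S w x - \<i> * of_real \<tau> * S a x - \<i> * of_real \<tau> * b x + \<i> * of_real \<tau> * S c x - e * S g x)"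
    unfolding gp_step_eq[abs_def] a_def b_def c_def g_def S_def e_def ..
  have inv: "laplace_op exp (- \<tau>) (S f) = f" if "f \<in> wiener" for f
    unfolding S_def by (simp add: prop_prop prop_0 that)
  have "laplace_op exp (- \<tau>) (gp_step \<tau> V w) x =
      laplace_op exp (- \<tau>) (S w) x - \<i> * of_real \<tau> * laplace_op exp (- \<tau>) (S a) x - \<i> * of_real \<tau> * laplace_op exp (- \<tau>) b x
      + \<i> * of_real \<tau> * laplace_op exp (- \<tau>) (S c) x - e * laplace_op exp (- \<tau>) (S g) x"
    unfolding step using wi w wS
    by (simp add: laplace_diff laplace_add laplace_cmult unit_symbol_exp wiener_diff wiener_add wiener_cmult)
  thus ?thesis unfolding inv[OF w] inv[OF wi(1)] inv[OF wi(3)] inv[OF wi(4)]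
    unfolding a_def b_def c_def g_def e_def S_def .
qed

section \<open>Integrating the interpolant\<close>

text \<open>
  Averaging the propagated factor \<open>h\<close> over time inside a product amounts to applying the averaged multiplier to
  \<open>h\<close>.
\<close>

lemma has_integral_fc_mult_prop:
  fixes Q h g :: "real ^ 'n::finite \<Rightarrow> complex"
  assumes Q: "Q \<in> wiener" and h: "h \<in> wiener" and g: "g \<in> wiener" "fc g = (\<lambda>j. m j * fc h j)"
    and \<rho>: "continuous_on {0..\<tau>} \<rho>" "\<And>\<zeta>. \<zeta> \<in> {0..\<tau>} \<Longrightarrow> cmod (\<rho> \<zeta>) \<le> 1"
    and I: "\<And>j. ((\<lambda>\<zeta>. \<rho> \<zeta> * symb exp (- (a * \<zeta>)) j) has_integral c * m j) {0..\<tau>}"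
  shows "((\<lambda>\<zeta>. \<rho> \<zeta> * fc (\<lambda>x. Q x * laplace_op exp (- (a * \<zeta>)) h x) k) has_integral c * fc (\<lambda>x. Q x * g x) k) {0..\<tau>}"
proof -
  define f where "f j \<zeta> = (fc Q j * fc h (k - j)) * (\<rho> \<zeta> * symb exp (- (a * \<zeta>)) (k - j))" for j \<zeta>
  define B where "B = (\<Sum>\<^sub>\<infinity>j. cmod (fc Q j * fc h (k - j)))"
  have S: "summable_abs (\<lambda>j. fc Q j * fc h (k - j))"
    by (rule summable_abs_conv; intro wiener_summable Q h)
  have cont: "continuous_on {0..\<tau>} (f j)" for j
    unfolding f_def by (intro continuous_intros \<rho>)
  have bd: "(\<Sum>j\<in>F. cmod (f j \<zeta>)) \<le> B" if "finite F" "\<zeta> \<in> {0..\<tau>}" for F \<zeta>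
  proof -
    have "cmod (f j \<zeta>) \<le> cmod (fc Q j * fc h (k - j))" for j
    proof -
      have "cmod (f j \<zeta>) = cmod (fc Q j * fc h (k - j)) * cmod (\<rho> \<zeta>)" by (simp add: f_def norm_mult)
      thus ?thesis using \<rho>(2)[OF that(2)] by (simp add: mult_left_le)
    qed
    hence "(\<Sum>j\<in>F. cmod (f j \<zeta>)) \<le> (\<Sum>j\<in>F. cmod (fc Q j * fc h (k - j)))" by (intro sum_mono)
    also have "\<dots> \<le> B" unfolding B_def using S that(1) by (rule sum_le_infsum_abs)
    finally show ?thesis .
  qed
  have "((\<lambda>\<zeta>. \<Sum>\<^sub>\<infinity>j. f j \<zeta>) has_integral (\<Sum>\<^sub>\<infinity>j. integral {0..\<tau>} (f j))) {0..\<tau>}"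
    by (rule has_integral_infsum_bounded[OF cont bd])
  moreover have "(\<Sum>\<^sub>\<infinity>j. f j \<zeta>) = \<rho> \<zeta> * fc (\<lambda>x. Q x * laplace_op exp (- (a * \<zeta>)) h x) k" for \<zeta>
    unfolding f_def wiener_mult(2)[OF Q prop_wiener(1)[OF h]] infsum_cmult_right'[symmetric] prop_wiener(2)[OF h]
    by (simp only: mult_ac)
  moreover have "(\<Sum>\<^sub>\<infinity>j. integral {0..\<tau>} (f j)) = c * fc (\<lambda>x. Q x * g x) k"
  proof -
    have "integral {0..\<tau>} (f j) = (fc Q j * fc h (k - j)) * (c * m (k - j))" for j
      unfolding f_def by (intro integral_unique has_integral_mult_right I)
    thus ?thesis unfolding wiener_mult(2)[OF Q g(1)] infsum_cmult_right'[symmetric] g(2) by (simp add: mult_ac)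
  qed
  ultimately show ?thesis by simp
qed

lemma symb_neg_eq: "symb exp (- (a * \<zeta>)) j = exp (of_real \<zeta> * (\<i> * of_real (a * ksq j)))"
  by (simp add: mult_ac)

lemma symb_phi_neg_eq: "symb \<phi> (- (a * \<tau>)) j = \<phi> (of_real \<tau> * (\<i> * of_real (a * ksq j)))"
  by (rule arg_cong[where f = \<phi>]) (simp add: mult_ac)

lemma has_integral_weight_up:
  assumes "0 < \<tau>"
  shows "((\<lambda>\<zeta>. of_real (\<zeta> / \<tau>) * symb exp (- (a * \<zeta>)) j) has_integral of_real \<tau> * symb phi2 (- (a * \<tau>)) j) {0..\<tau>}"
proof -
  have "((\<lambda>\<zeta>. (1 / of_real \<tau>) * (of_real \<zeta> * exp (of_real \<zeta> * (\<i> * of_real (a * ksq j))))) has_integral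
     (1 / of_real \<tau>) * (of_real (\<tau>\<^sup>2) * phi2 (of_real \<tau> * (\<i> * of_real (a * ksq j))))) {0..\<tau>}"
    by (intro has_integral_mult_right phi2_integral) (use assms in auto)
  thus ?thesis unfolding symb_neg_eq symb_phi_neg_eq using assms by (simp add: power2_eq_square)
qed

lemma has_integral_weight_down:
  assumes "0 < \<tau>"
  shows "((\<lambda>\<zeta>. of_real (1 - \<zeta> / \<tau>) * symb exp (- (a * \<zeta>)) j) has_integral
     of_real \<tau> * (symb phi1 (- (a * \<tau>)) j - symb phi2 (- (a * \<tau>)) j)) {0..\<tau>}"
proof -
  have "((\<lambda>\<zeta>. exp (of_real \<zeta> * (\<i> * of_real (a * ksq j))) - of_real (\<zeta> / \<tau>) * symb exp (- (a * \<zeta>)) j) has_integral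
     of_real \<tau> * phi1 (of_real \<tau> * (\<i> * of_real (a * ksq j))) - of_real \<tau> * symb phi2 (- (a * \<tau>)) j) {0..\<tau>}"
    by (intro has_integral_diff phi1_integral has_integral_weight_up) (use assms in auto)
  moreover have "exp (of_real \<zeta> * (\<i> * of_real (a * ksq j))) - of_real (\<zeta> / \<tau>) * symb exp (- (a * \<zeta>)) j
     = of_real (1 - \<zeta> / \<tau>) * symb exp (- (a * \<zeta>)) j" for \<zeta>
    unfolding symb_neg_eq by (simp add: left_diff_distrib)
  moreover have "of_real \<tau> * phi1 (of_real \<tau> * (\<i> * of_real (a * ksq j))) - of_real \<tau> * symb phi2 (- (a * \<tau>)) j
     = of_real \<tau> * (symb phi1 (- (a * \<tau>)) j - symb phi2 (- (a * \<tau>)) j)"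
    unfolding symb_phi_neg_eq by (simp add: right_diff_distrib)
  ultimately show ?thesis by simp
qed

lemma has_integral_up:
  assumes "0 < \<tau>" "Q \<in> wiener" "h \<in> wiener"
  shows "((\<lambda>\<zeta>. of_real (\<zeta> / \<tau>) * fc (\<lambda>x. Q x * laplace_op exp (- (a * \<zeta>)) h x) k) has_integral
     of_real \<tau> * fc (\<lambda>x. Q x * laplace_op phi2 (- (a * \<tau>)) h x) k) {0..\<tau>}"
proof (rule has_integral_fc_mult_prop[OF assms(2,3) _ _ _ _ has_integral_weight_up[OF assms(1)]])
  show "continuous_on {0..\<tau>} (\<lambda>\<zeta>. complex_of_real (\<zeta> / \<tau>))" by (intro continuous_intros) (use assms in auto)
  show "cmod (complex_of_real (\<zeta> / \<tau>)) \<le> 1" if "\<zeta> \<in> {0..\<tau>}" for \<zeta>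
    unfolding norm_of_real using that assms by (auto simp: abs_le_iff)
qed (use laplace_wiener[OF unit_symbol_phi2 assms(3)] in auto)

lemma has_integral_down:
  assumes "0 < \<tau>" "Q \<in> wiener" "h \<in> wiener"
  shows "((\<lambda>\<zeta>. of_real (1 - \<zeta> / \<tau>) * fc (\<lambda>x. Q x * laplace_op exp (- (a * \<zeta>)) h x) k) has_integral
     of_real \<tau> * fc (\<lambda>x. Q x * (laplace_op phi1 (- (a * \<tau>)) h x - laplace_op phi2 (- (a * \<tau>)) h x)) k) {0..\<tau>}"
proof (rule has_integral_fc_mult_prop[OF assms(2,3) _ _ _ _ has_integral_weight_down[OF assms(1)]])
  show "continuous_on {0..\<tau>} (\<lambda>\<zeta>. complex_of_real (1 - \<zeta> / \<tau>))" by (intro continuous_intros) (use assms in auto)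
  show "cmod (complex_of_real (1 - \<zeta> / \<tau>)) \<le> 1" if "\<zeta> \<in> {0..\<tau>}" for \<zeta>
    unfolding norm_of_real using that assms by (auto simp: abs_le_iff)
  note l = laplace_wiener[OF unit_symbol_phi1 assms(3)] laplace_wiener[OF unit_symbol_phi2 assms(3)]
  show "(\<lambda>x. laplace_op phi1 (- (a * \<tau>)) h x - laplace_op phi2 (- (a * \<tau>)) h x) \<in> wiener"
    by (intro wiener_diff l)
  show "fc (\<lambda>x. laplace_op phi1 (- (a * \<tau>)) h x - laplace_op phi2 (- (a * \<tau>)) h x) =
    (\<lambda>j. (symb phi1 (- (a * \<tau>)) j - symb phi2 (- (a * \<tau>)) j) * fc h j)"
    by (simp add: wiener_diff l left_diff_distrib)
qed

text \<open>
  The integrand of the numerical scheme: the exact phase of \<open>V\<close> and of the conjugate is kept, the rest of the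
  product is interpolated between its untwisted value and its value after one step.
\<close>

definition interpolant :: "real \<Rightarrow> real \<Rightarrow> (real ^ 'n::finite \<Rightarrow> complex) \<Rightarrow> (real ^ 'n \<Rightarrow> complex) \<Rightarrow> real ^ 'n \<Rightarrow> complex" where
  "interpolant \<tau> \<zeta> V w x =
     of_real (1 - \<zeta> / \<tau>) * (w x * laplace_op exp (- \<zeta>) V x + w x * w x * laplace_op exp (- (2 * \<zeta>)) (\<lambda>y. cnj (w y)) x)
     + of_real (\<zeta> / \<tau>) * laplace_op exp (- \<tau>)
         (\<lambda>x. laplace_op exp \<tau> w x * laplace_op exp (\<tau> - \<zeta>) V x
            + laplace_op exp \<tau> w x * laplace_op exp \<tau> w x * laplace_op exp (\<tau> - 2 * \<zeta>) (\<lambda>y. cnj (w y)) x) x"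

lemma interpolant_wiener: "V \<in> wiener \<Longrightarrow> w \<in> wiener \<Longrightarrow> interpolant \<tau> \<zeta> V w \<in> wiener"
  unfolding interpolant_def[abs_def]
  by (intro wiener_add wiener_cmult wiener_mult prop_wiener wiener_cnj)

text \<open>
  The numerical step is the Duhamel formula with the interpolant as the integrand, corrected by the integral of
  \<open>-i \<zeta> gpG V w\<close>. It has therefore the same form as the exact step.
\<close>

lemma has_integral_interpolant:
  fixes V w :: "real ^ 'n::finite \<Rightarrow> complex"
  assumes \<tau>: "0 < \<tau>" and V: "V \<in> wiener" and w: "w \<in> wiener"
  shows "((\<lambda>\<zeta>. fc (interpolant \<tau> \<zeta> V w) k + - \<i> * of_real \<zeta> * fc (gpG V w) k) has_integral
     fc (\<lambda>x. \<i> * (laplace_op exp (- \<tau>) (gp_step \<tau> V w) x - w x)) k) {0..\<tau>}"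
proof -
  define wb where "wb = (\<lambda>y. cnj (w y))"
  define S :: "(real ^ 'n \<Rightarrow> complex) \<Rightarrow> real ^ 'n \<Rightarrow> complex" where "S = laplace_op exp \<tau>"
  have wb: "wb \<in> wiener" unfolding wb_def by (intro wiener_cnj w)
  have ww: "(\<lambda>x. w x * w x) \<in> wiener" by (intro wiener_mult w)
  have S: "S w \<in> wiener" "S V \<in> wiener" "S wb \<in> wiener" unfolding S_def by (intro prop_wiener w V wb)+
  have SS: "(\<lambda>x. S w x * S w x) \<in> wiener" by (intro wiener_mult S)
  have shift: "laplace_op exp (\<tau> - \<xi>) h = laplace_op exp (- \<xi>) (S h)" if "h \<in> wiener" for \<xi> h
    unfolding S_def by (simp add: prop_prop that)
  note l1 = laplace_wiener[OF unit_symbol_phi1] and l2 = laplace_wiener[OF unit_symbol_phi2]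
  let ?A = "\<lambda>\<zeta>. fc (\<lambda>x. w x * laplace_op exp (- (1 * \<zeta>)) V x) k"
  let ?B = "\<lambda>\<zeta>. fc (\<lambda>x. w x * w x * laplace_op exp (- (2 * \<zeta>)) wb x) k"
  let ?C = "\<lambda>\<zeta>. fc (\<lambda>x. S w x * laplace_op exp (- (1 * \<zeta>)) (S V) x) k"
  let ?D = "\<lambda>\<zeta>. fc (\<lambda>x. S w x * S w x * laplace_op exp (- (2 * \<zeta>)) (S wb) x) k"
  let ?a = "fc (\<lambda>x. w x * (laplace_op phi1 (- (1 * \<tau>)) V x - laplace_op phi2 (- (1 * \<tau>)) V x)) k"
  let ?b = "fc (\<lambda>x. w x * w x * (laplace_op phi1 (- (2 * \<tau>)) wb x - laplace_op phi2 (- (2 * \<tau>)) wb x)) k"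
  let ?c = "fc (\<lambda>x. S w x * laplace_op phi2 (- (1 * \<tau>)) (S V) x) k"
  let ?d = "fc (\<lambda>x. S w x * S w x * laplace_op phi2 (- (2 * \<tau>)) (S wb) x) k"
  let ?s = "symb exp (- \<tau>) k"
  have h1: "((\<lambda>\<zeta>. (of_real (1 - \<zeta> / \<tau>) * ?A \<zeta> + of_real (1 - \<zeta> / \<tau>) * ?B \<zeta>
      + ?s * (of_real (\<zeta> / \<tau>) * ?C \<zeta> + of_real (\<zeta> / \<tau>) * ?D \<zeta>))
      + - \<i> * fc (gpG V w) k * (of_real \<zeta> * exp (of_real \<zeta> * 0)))
     has_integral (of_real \<tau> * ?a + of_real \<tau> * ?b + ?s * (of_real \<tau> * ?c + of_real \<tau> * ?d))
       + - \<i> * fc (gpG V w) k * (of_real (\<tau>\<^sup>2) * phi2 (of_real \<tau> * 0))) {0..\<tau>}"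
    using \<tau> by (intro has_integral_add has_integral_mult_right has_integral_up has_integral_down phi2_integral w V wb ww S SS) auto
  have h2: "(of_real (1 - \<zeta> / \<tau>) * ?A \<zeta> + of_real (1 - \<zeta> / \<tau>) * ?B \<zeta>
      + ?s * (of_real (\<zeta> / \<tau>) * ?C \<zeta> + of_real (\<zeta> / \<tau>) * ?D \<zeta>))
      + - \<i> * fc (gpG V w) k * (of_real \<zeta> * exp (of_real \<zeta> * 0)) = fc (interpolant \<tau> \<zeta> V w) k + - \<i> * of_real \<zeta> * fc (gpG V w) k" for \<zeta>
  proof -
    have I: "interpolant \<tau> \<zeta> V w = (\<lambda>x. c * (w x * laplace_op exp (- (1 * \<zeta>)) V x + w x * w x * laplace_op exp (- (2 * \<zeta>)) wb x)
        + d * laplace_op exp (- \<tau>) (\<lambda>x. S w x * laplace_op exp (- (1 * \<zeta>)) (S V) x + S w x * S w x * laplace_op exp (- (2 * \<zeta>)) (S wb) x) x)"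
      if "c = of_real (1 - \<zeta> / \<tau>)" "d = of_real (\<zeta> / \<tau>)" for c d
      unfolding interpolant_def[abs_def] that wb_def[symmetric] S_def[symmetric] shift[OF V] shift[OF wb] by simp
    have "fc (interpolant \<tau> \<zeta> V w) k = c * (?A \<zeta> + ?B \<zeta>) + d * (?s * (?C \<zeta> + ?D \<zeta>))"
      if "c = of_real (1 - \<zeta> / \<tau>)" "d = of_real (\<zeta> / \<tau>)" for c d
      unfolding I[OF that] using w V wb S
      by (simp add: wiener_add wiener_cmult wiener_mult(1) prop_wiener del: of_real_diff of_real_divide)
    from this[OF refl refl] show ?thesis by (simp only: exp_zero mult_zero_right mult_1_right) (simp add: algebra_simps)
  qed
  have h3: "(of_real \<tau> * ?a + of_real \<tau> * ?b + ?s * (of_real \<tau> * ?c + of_real \<tau> * ?d))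
       + - \<i> * fc (gpG V w) k * (of_real (\<tau>\<^sup>2) * phi2 (of_real \<tau> * 0))
     = fc (\<lambda>x. \<i> * (laplace_op exp (- \<tau>) (gp_step \<tau> V w) x - w x)) k"
  proof -
    let ?L = "\<lambda>x. of_real \<tau> * ((w x * (laplace_op phi1 (- (1 * \<tau>)) V x - laplace_op phi2 (- (1 * \<tau>)) V x))
       + (w x * w x * (laplace_op phi1 (- (2 * \<tau>)) wb x - laplace_op phi2 (- (2 * \<tau>)) wb x))
       + laplace_op exp (- \<tau>) (\<lambda>x. S w x * laplace_op phi2 (- (1 * \<tau>)) (S V) x + S w x * S w x * laplace_op phi2 (- (2 * \<tau>)) (S wb) x) x)
       + - \<i> * of_real (\<tau>\<^sup>2 / 2) * gpG V w x"
    have eq: "(\<lambda>x. \<i> * (laplace_op exp (- \<tau>) (gp_step \<tau> V w) x - w x)) = ?L"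
    proof
      fix x
      have f: "filtered phi2 \<tau> (S w) (S V) (S wb) = (\<lambda>x. S w x * laplace_op phi2 (- (1 * \<tau>)) (S V) x + S w x * S w x * laplace_op phi2 (- (2 * \<tau>)) (S wb) x)"
        by (simp add: filtered_def[abs_def])
      have alg: "\<i> * (w0 - \<i> * t * a1 - \<i> * t * b + \<i> * t * a2 - e * g - w0) = t * ((a1 - a2) + b) + - \<i> * e * g" for w0 t a1 a2 b e g
        by (simp add: algebra_simps)
      show "\<i> * (laplace_op exp (- \<tau>) (gp_step \<tau> V w) x - w x) = ?L x"
        unfolding prop_gp_step[OF V w] wb_def[symmetric] S_def[symmetric] f alg
        by (simp add: filtered_def algebra_simps)
    qed
    have "fc (\<lambda>x. of_real \<tau> * ((w x * (laplace_op phi1 (- (1 * \<tau>)) V x - laplace_op phi2 (- (1 * \<tau>)) V x))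
       + (w x * w x * (laplace_op phi1 (- (2 * \<tau>)) wb x - laplace_op phi2 (- (2 * \<tau>)) wb x))
       + laplace_op exp (- \<tau>) (\<lambda>x. S w x * laplace_op phi2 (- (1 * \<tau>)) (S V) x + S w x * S w x * laplace_op phi2 (- (2 * \<tau>)) (S wb) x) x)
       + c * gpG V w x) k = of_real \<tau> * ((?a + ?b) + ?s * (?c + ?d)) + c * fc (gpG V w) k" for c
    proof -
      have wa: "(\<lambda>x. w x * (laplace_op phi1 (- (1 * \<tau>)) V x - laplace_op phi2 (- (1 * \<tau>)) V x)) \<in> wiener"
        by (intro wiener_mult wiener_diff l1 l2 w V)
      have wb': "(\<lambda>x. w x * w x * (laplace_op phi1 (- (2 * \<tau>)) wb x - laplace_op phi2 (- (2 * \<tau>)) wb x)) \<in> wiener"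
        by (intro wiener_mult wiener_diff l1 l2 w wb)
      have wc: "(\<lambda>x. S w x * laplace_op phi2 (- (1 * \<tau>)) (S V) x) \<in> wiener"
        by (intro wiener_mult l2 S)
      have wd: "(\<lambda>x. S w x * S w x * laplace_op phi2 (- (2 * \<tau>)) (S wb) x) \<in> wiener"
        by (intro wiener_mult l2 S)
      note g = gpG_wiener[OF V w]
      show ?thesis
        unfolding wiener_add(2)[OF wiener_cmult(1)[OF wiener_add(1)[OF wiener_add(1)[OF wa wb'] prop_wiener(1)[OF wiener_add(1)[OF wc wd]]]] wiener_cmult(1)[OF g]]
          wiener_cmult(2)[OF wiener_add(1)[OF wiener_add(1)[OF wa wb'] prop_wiener(1)[OF wiener_add(1)[OF wc wd]]]]
          wiener_add(2)[OF wiener_add(1)[OF wa wb'] prop_wiener(1)[OF wiener_add(1)[OF wc wd]]]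
          wiener_add(2)[OF wa wb'] prop_wiener(2)[OF wiener_add(1)[OF wc wd]] wiener_add(2)[OF wc wd] wiener_cmult(2)[OF g] ..
    qed
    from this[of "- \<i> * of_real (\<tau>\<^sup>2 / 2)"] show ?thesis unfolding eq by (simp add: phi2_def algebra_simps)
  qed
  from h1 show ?thesis unfolding h2 h3 .
qed

section \<open>The local error\<close>

text \<open>
  What consistency and stability use. The set \<open>G\<close> contains the solution at all times, the potential and the
  constant \<open>1\<close>, with uniform bounds in \<open>X\<close>, in \<open>Y\<close> up to two derivatives, and for the weighted products. The
  assumption \<open>duhamel\<close> is the mild formulation between \<open>t\<close> and \<open>t + s\<close>, twisted by the propagator.
\<close>

locale gp_setting =
  fixes X Y :: "(int ^ 'n::finite \<Rightarrow> real) set" and G :: "(real ^ 'n \<Rightarrow> complex) set"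
    and V :: "real ^ 'n \<Rightarrow> complex" and u :: "real \<Rightarrow> real ^ 'n \<Rightarrow> complex" and T M :: real
  assumes tX: "test_family X" and tY: "test_family Y" and XX: "conv_bound X X" and XY: "conv_bound X Y"
    and T: "0 < T"
    and G_V: "V \<in> G" and G_one: "(\<lambda>x. 1) \<in> G" and G_u: "\<And>t. t \<in> {0..T} \<Longrightarrow> u t \<in> G"
    and G_cnj: "\<And>f. f \<in> G \<Longrightarrow> (\<lambda>x. cnj (f x)) \<in> G"
    and GX: "\<And>f. f \<in> G \<Longrightarrow> fnorm_le X f M" and GY: "\<And>f. f \<in> G \<Longrightarrow> fnorm_le Y f M"
    and GY2: "\<And>f. f \<in> G \<Longrightarrow> fnorm_le (second_order Y) f M"
    and bilX: "\<And>f g. f \<in> G \<Longrightarrow> g \<in> G \<Longrightarrow> bilinear_le X (\<lambda>k. norm (freq k)) M f g"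
    and bilY: "\<And>f g. f \<in> G \<Longrightarrow> g \<in> G \<Longrightarrow> bilinear_le Y ksq M f g"
    and duhamel: "\<And>t s k. 0 \<le> t \<Longrightarrow> 0 \<le> s \<Longrightarrow> t + s \<le> T \<Longrightarrow>
       ((\<lambda>\<zeta>. fc (laplace_op exp (- \<zeta>) (gpF V (u (t + \<zeta>)))) k) has_integral
        fc (\<lambda>x. \<i> * (laplace_op exp (- s) (u (t + s)) x - u t x)) k) {0..s}"
begin

lemma M_nonneg: "0 \<le> M"
  by (rule fnorm_le_nonneg[OF tX GX[OF G_V]])

lemma G_wiener: "f \<in> G \<Longrightarrow> f \<in> wiener"
  by (rule fnorm_le_wiener[OF GX])

lemmas tY2 = test_family_second_order[OF tY]

lemma bigO_G:
  assumes "\<And>p. p \<in> P \<Longrightarrow> f p \<in> G"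
  shows "bigO X P f (\<lambda>_. 1)" "bigO Y P f (\<lambda>_. 1)" "bigO (second_order Y) P f (\<lambda>_. 1)"
  using assms GX GY GY2 M_nonneg by (auto intro!: bigOI[of M])

lemma bigO_const: "bigO X P (\<lambda>p x. c) (\<lambda>_. 1)" "bigO Y P (\<lambda>p x. c) (\<lambda>_. 1)" "bigO (second_order Y) P (\<lambda>p x. c) (\<lambda>_. 1)"
  using bigO_cmult_const[OF tX bigO_G(1)[of P "\<lambda>_ _. 1"], of "\<lambda>_. c" "cmod c"]
    bigO_cmult_const[OF tY bigO_G(2)[of P "\<lambda>_ _. 1"], of "\<lambda>_. c" "cmod c"]
    bigO_cmult_const[OF tY2 bigO_G(3)[of P "\<lambda>_ _. 1"], of "\<lambda>_. c" "cmod c"] G_one by simp_all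

lemma bigO_V: "bigO X P (\<lambda>p. V) (\<lambda>_. 1)" "bigO Y P (\<lambda>p. V) (\<lambda>_. 1)" "bigO (second_order Y) P (\<lambda>p. V) (\<lambda>_. 1)"
  using bigO_G[of P "\<lambda>_. V"] G_V by auto

lemma bigO_zero:
  assumes "\<And>p. p \<in> P \<Longrightarrow> 0 \<le> h p" and E: "test_family E"
  shows "bigO E P (\<lambda>p x. 0) h"
proof (rule bigOI[of 1])
  fix p assume p: "p \<in> P"
  show "fnorm_le E (\<lambda>x. 0) (1 * h p)"
    using wiener_const[where c = 0 and 'n = 'b] assms(1)[OF p] by (simp add: fnorm_le_def dual_le_def)
qed simp

text \<open>
  The estimates that use products only hold in both norms. A common proof for the two is phrased for an
  arbitrary target.
\<close>

definition target :: "(int ^ 'n \<Rightarrow> real) set \<Rightarrow> bool" where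
  "target N \<longleftrightarrow> N = X \<or> N = Y"

lemma target_X: "target X" and target_Y: "target Y" by (auto simp: target_def)

lemma targetD: "target N \<Longrightarrow> test_family N" "target N \<Longrightarrow> conv_bound X N"
  using tX tY XX XY by (auto simp: target_def)

lemma target_G: "target N \<Longrightarrow> (\<And>p. p \<in> P \<Longrightarrow> f p \<in> G) \<Longrightarrow> bigO N P f (\<lambda>_. 1)"
  using bigO_G[of P f] by (auto simp: target_def)

lemmas target_mult = bigO_mult_left[OF targetD]

lemma bigO_gpF:
  assumes N: "target N" and X: "bigO X P w (\<lambda>_. 1)" and wN: "bigO N P w (\<lambda>_. 1)"
  shows "bigO N P (\<lambda>p. gpF V (w p)) (\<lambda>_. 1)"
  unfolding gpF_def[abs_def] power2_eq_square
  by (intro bigO_add targetD N target_mult[OF N N] X wN bigO_V bigO_cnj tX target_mult[OF target_X target_X])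

lemma bigO_gpF2:
  assumes X: "bigO X P w (\<lambda>_. 1)" and wN: "bigO (second_order Y) P w (\<lambda>_. 1)"
  shows "bigO (second_order Y) P (\<lambda>p. gpF V (w p)) (\<lambda>_. 1)"
  unfolding gpF_def[abs_def] power2_eq_square
  by (intro bigO_add tY2 bigO_mult_second_order[OF tX tY XY] X wN bigO_V bigO_cnj tX target_mult[OF target_X target_X])

lemma bigO_gpG:
  assumes N: "target N" and X: "bigO X P w (\<lambda>_. 1)" and wN: "bigO N P w (\<lambda>_. 1)"
  shows "bigO N P (\<lambda>p. gpG V (w p)) (\<lambda>_. 1)"
  unfolding gpG_def[abs_def]
  by (intro bigO_add bigO_diff targetD N target_mult[OF N N] X wN bigO_V bigO_cnj tX target_mult[OF target_X target_X] bigO_const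
      bigO_gpF target_X)

lemma bigO_gpG2:
  assumes X: "bigO X P w (\<lambda>_. 1)" and wN: "bigO (second_order Y) P w (\<lambda>_. 1)"
  shows "bigO (second_order Y) P (\<lambda>p. gpG V (w p)) (\<lambda>_. 1)"
  unfolding gpG_def[abs_def]
  by (intro bigO_add bigO_diff tY2 bigO_mult_second_order[OF tX tY XY] X wN bigO_V bigO_cnj tX target_mult[OF target_X target_X]
      bigO_const bigO_gpF2 bigO_gpF target_X)

text \<open>
  The difference is factored so that every term contains \<open>v - w\<close> or its conjugate once, and otherwise functions
  that are bounded in \<open>X\<close>.
\<close>

lemma bigO_gpF_diff:
  assumes N: "target N" and v: "bigO X P v (\<lambda>_. 1)" and w: "bigO X P w (\<lambda>_. 1)"
    and d: "bigO N P (\<lambda>p x. v p x - w p x) h"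
  shows "bigO N P (\<lambda>p x. gpF V (v p) x - gpF V (w p) x) h"
proof -
  have "bigO N P (\<lambda>p x. (V x + (v p x + w p x) * cnj (v p x)) * (v p x - w p x) + w p x * w p x * cnj (v p x - w p x)) h"
    by (intro bigO_add targetD N target_mult[OF N N] d bigO_cnj v w bigO_V tX target_mult[OF target_X target_X])
  thus ?thesis
    by (rule bigO_cong[THEN iffD1, rotated]) (simp add: gpF_def power2_eq_square algebra_simps)
qed

text \<open>
  A pair consists of a time \<open>t\<close> and an elapsed time \<open>\<zeta>\<close>.
\<close>

definition time_pairs :: "(real \<times> real) set" where
  "time_pairs = {(t, \<zeta>). 0 \<le> t \<and> 0 \<le> \<zeta> \<and> \<zeta> \<le> 1 \<and> t + \<zeta> \<le> T}"

abbreviation "u_start \<equiv> \<lambda>p :: real \<times> real. u (fst p)"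
abbreviation "u_end \<equiv> \<lambda>p :: real \<times> real. u (fst p + snd p)"
abbreviation "u_free \<equiv> \<lambda>p :: real \<times> real. laplace_op exp (snd p) (u (fst p))"

lemma u_G: "p \<in> time_pairs \<Longrightarrow> u_start p \<in> G" "p \<in> time_pairs \<Longrightarrow> u_end p \<in> G"
  by (auto simp: time_pairs_def intro!: G_u)

lemma bigO_exact_free: "bigO X time_pairs u_start (\<lambda>_. 1)" "bigO X time_pairs u_end (\<lambda>_. 1)" "bigO X time_pairs u_free (\<lambda>_. 1)"
  by (intro bigO_laplace tX unit_symbol_exp bigO_G(1) u_G; assumption)+

text \<open>
  In the twisted variable the solution moves only by the nonlinearity, which is bounded. No derivatives are
  lost.
\<close>

lemma twisted_increment:
  assumes N: "target N"
  shows "bigO N time_pairs (\<lambda>p x. laplace_op exp (- snd p) (u_end p) x - u_start p x) (\<lambda>p. snd p)"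
proof -
  let ?f = "\<lambda>p x. \<i> * (laplace_op exp (- snd p) (u_end p) x - u_start p x)"
  have "bigO N {(p, \<zeta>). p \<in> time_pairs \<and> \<zeta> \<in> {0..snd p}} (\<lambda>q. laplace_op exp (- snd q) (gpF V (u (fst (fst q) + snd q)))) (\<lambda>_. 1)"
    by (intro bigO_laplace targetD N unit_symbol_exp bigO_gpF target_G target_X) (auto simp: time_pairs_def intro!: G_u bigO_G(1))
  hence "bigO N {(p, \<zeta>). p \<in> time_pairs \<and> \<zeta> \<in> {0..snd p}} (\<lambda>(p, \<zeta>). laplace_op exp (- \<zeta>) (gpF V (u (fst p + \<zeta>)))) (\<lambda>(p, \<zeta>). 1)"
    by (simp add: case_prod_unfold)
  hence "bigO N time_pairs ?f (\<lambda>p. snd p * 1)"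
  proof (rule bigO_integral[OF targetD(1)[OF N]])
    fix p k assume p: "p \<in> time_pairs"
    show "0 \<le> snd p" using p by (auto simp: time_pairs_def)
    show "?f p \<in> wiener" using u_G[OF p] by (intro wiener_cmult wiener_diff prop_wiener G_wiener)
    show "((\<lambda>\<zeta>. fc (laplace_op exp (- \<zeta>) (gpF V (u (fst p + \<zeta>)))) k) has_integral fc (?f p) k) {0..snd p}"
      using p by (intro duhamel) (auto simp: time_pairs_def)
  qed
  hence "bigO N time_pairs (\<lambda>p x. - \<i> * ?f p x) (\<lambda>p. snd p * 1)"
    by (rule bigO_cmult_const[OF targetD(1)[OF N], where d = 1]) auto
  thus ?thesis by (simp add: mult.assoc[symmetric])
qed

lemma prop_twisted: "p \<in> time_pairs \<Longrightarrow> laplace_op exp (snd p) (\<lambda>x. laplace_op exp (- snd p) (u_end p) x - u_start p x) = (\<lambda>x. u_end p x - u_free p x)"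
proof
  fix x assume p: "p \<in> time_pairs"
  have w: "u_end p \<in> wiener" "u_start p \<in> wiener" using u_G[OF p] by (auto intro: G_wiener)
  show "laplace_op exp (snd p) (\<lambda>x. laplace_op exp (- snd p) (u_end p) x - u_start p x) x = u_end p x - u_free p x"
    unfolding laplace_diff[OF unit_symbol_exp prop_wiener(1)[OF w(1)] w(2)] prop_prop[OF w(1)]
    using prop_0[OF w(1)] by simp
qed

lemma increment:
  assumes N: "target N"
  shows "bigO N time_pairs (\<lambda>p x. u_end p x - u_free p x) (\<lambda>p. snd p)"
proof -
  have "bigO N time_pairs (\<lambda>p. laplace_op exp (snd p) (\<lambda>x. laplace_op exp (- snd p) (u_end p) x - u_start p x)) (\<lambda>p. snd p)"
    by (intro bigO_laplace targetD N unit_symbol_exp twisted_increment)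
  thus ?thesis by (rule bigO_cong[THEN iffD1, rotated]) (simp add: prop_twisted)
qed

lemma bigO_abs_snd:
  assumes "test_family E" "bigO E time_pairs f (\<lambda>p. \<bar>c * snd p\<bar>)"
  shows "bigO E time_pairs f (\<lambda>p. snd p)"
  by (rule bigO_weaken[OF assms, of "\<bar>c\<bar>"]) (auto simp: time_pairs_def abs_mult)

text \<open>
  This step loses two derivatives, and therefore it is stated in \<open>Y\<close> only.
\<close>

lemma free_increment: "bigO Y time_pairs (\<lambda>p x. u_free p x - u_start p x) (\<lambda>p. snd p)"
proof (rule bigO_abs_snd[OF tY, of _ 1])
  have "bigO Y time_pairs (\<lambda>p x. laplace_op exp (snd p) (u_start p) x - u_start p x) (\<lambda>p. \<bar>snd p\<bar>)"
    by (intro bigO_prop_diff tY bigO_G u_G)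
  thus "bigO Y time_pairs (\<lambda>p x. u_free p x - u_start p x) (\<lambda>p. \<bar>1 * snd p\<bar>)" by simp
qed

lemma total_increment: "bigO Y time_pairs (\<lambda>p x. u_end p x - u_start p x) (\<lambda>p. snd p)"
proof -
  have "bigO Y time_pairs (\<lambda>p x. (u_end p x - u_free p x) + (u_free p x - u_start p x)) (\<lambda>p. snd p)"
    by (intro bigO_add tY increment free_increment target_Y)
  thus ?thesis by simp
qed

lemma twisted_gpF_increment:
  "bigO Y time_pairs (\<lambda>p x. laplace_op exp (- snd p) (gpF V (u_end p)) x - gpF V (u_start p) x) (\<lambda>p. snd p)"
proof -
  have "bigO Y time_pairs (\<lambda>p x. laplace_op exp (- snd p) (gpF V (u_end p)) x - gpF V (u_end p) x) (\<lambda>p. \<bar>- snd p\<bar>)"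
    by (intro bigO_prop_diff tY bigO_gpF2 bigO_gpF target_Y bigO_G u_G)
  hence "bigO Y time_pairs (\<lambda>p x. laplace_op exp (- snd p) (gpF V (u_end p)) x - gpF V (u_end p) x) (\<lambda>p. snd p)"
    by (intro bigO_abs_snd[OF tY, of _ "- 1"]) simp
  moreover have "bigO Y time_pairs (\<lambda>p x. gpF V (u_end p) x - gpF V (u_start p) x) (\<lambda>p. snd p)"
    by (intro bigO_gpF_diff target_Y bigO_exact_free total_increment)
  ultimately have "bigO Y time_pairs (\<lambda>p x. (laplace_op exp (- snd p) (gpF V (u_end p)) x - gpF V (u_end p) x) + (gpF V (u_end p) x - gpF V (u_start p) x)) (\<lambda>p. snd p)"
    by (rule bigO_add[OF tY])
  thus ?thesis by simp
qed

text \<open>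
  The time integral of the increment of the twisted nonlinearity, which itself is of first order.
\<close>

lemma twisted_first_order:
  "bigO Y time_pairs (\<lambda>p x. laplace_op exp (- snd p) (u_end p) x - u_start p x + \<i> * of_real (snd p) * gpF V (u_start p) x) (\<lambda>p. (snd p)\<^sup>2)"
proof -
  note V = G_wiener[OF G_V]
  let ?f = "\<lambda>p x. \<i> * (laplace_op exp (- snd p) (u_end p) x - u_start p x) - of_real (snd p) * gpF V (u_start p) x"
  let ?Q = "{(p, \<zeta>). p \<in> time_pairs \<and> \<zeta> \<in> {0..snd p}}"
  have "bigO Y ?Q (\<lambda>q x. laplace_op exp (- snd q) (gpF V (u (fst (fst q) + snd q))) x - gpF V (u (fst (fst q))) x) (\<lambda>q. snd q)"
    using bigO_compose[OF twisted_gpF_increment, of ?Q "\<lambda>q. (fst (fst q), snd q)"] by (force simp: time_pairs_def)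
  hence "bigO Y ?Q (\<lambda>q x. laplace_op exp (- snd q) (gpF V (u (fst (fst q) + snd q))) x - gpF V (u (fst (fst q))) x) (\<lambda>q. snd (fst q))"
    by (rule bigO_weaken[OF tY, of _ _ _ 1]) auto
  hence "bigO Y ?Q (\<lambda>(p, \<zeta>) x. laplace_op exp (- \<zeta>) (gpF V (u (fst p + \<zeta>))) x - gpF V (u_start p) x) (\<lambda>(p, \<zeta>). snd p)"
    by (simp add: case_prod_unfold)
  hence "bigO Y time_pairs ?f (\<lambda>p. snd p * snd p)"
  proof (rule bigO_integral[OF tY])
    fix p k assume p: "p \<in> time_pairs"
    show "0 \<le> snd p" using p by (auto simp: time_pairs_def)
    note g = G_wiener[OF u_G(1)[OF p]] G_wiener[OF u_G(2)[OF p]]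
    have w: "(\<lambda>x. \<i> * (laplace_op exp (- snd p) (u_end p) x - u_start p x)) \<in> wiener" "gpF V (u_start p) \<in> wiener"
      by (intro wiener_cmult wiener_diff prop_wiener gpF_wiener V g)+
    show "?f p \<in> wiener" by (intro wiener_diff wiener_cmult w)
    have 1: "((\<lambda>\<zeta>. fc (laplace_op exp (- \<zeta>) (gpF V (u (fst p + \<zeta>)))) k - fc (gpF V (u_start p)) k) has_integral
        fc (\<lambda>x. \<i> * (laplace_op exp (- snd p) (u_end p) x - u_start p x)) k - of_real (snd p) * fc (gpF V (u_start p)) k) {0..snd p}"
    proof (rule has_integral_diff)
      show "((\<lambda>\<zeta>. fc (laplace_op exp (- \<zeta>) (gpF V (u (fst p + \<zeta>)))) k) has_integral
        fc (\<lambda>x. \<i> * (laplace_op exp (- snd p) (u_end p) x - u_start p x)) k) {0..snd p}"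
        using p by (intro duhamel) (auto simp: time_pairs_def)
      show "((\<lambda>\<zeta>. fc (gpF V (u_start p)) k) has_integral of_real (snd p) * fc (gpF V (u_start p)) k) {0..snd p}"
        using has_integral_const_real[of "fc (gpF V (u_start p)) k" 0 "snd p"] p by (simp add: time_pairs_def scaleR_conv_of_real case_prod_unfold)
    qed
    have 2: "fc (?f p) k = fc (\<lambda>x. \<i> * (laplace_op exp (- snd p) (u_end p) x - u_start p x)) k - of_real (snd p) * fc (gpF V (u_start p)) k"
      unfolding wiener_diff(2)[OF w(1) wiener_cmult(1)[OF w(2)]] wiener_cmult(2)[OF w(2)] ..
    show "((\<lambda>\<zeta>. fc (\<lambda>x. laplace_op exp (- \<zeta>) (gpF V (u (fst p + \<zeta>))) x - gpF V (u_start p) x) k) has_integral fc (?f p) k) {0..snd p}"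
      unfolding 2
    proof (rule has_integral_eq[OF _ 1])
      fix \<zeta> assume \<zeta>: "\<zeta> \<in> {0..snd p}"
      have "u (fst p + \<zeta>) \<in> G" using p \<zeta> by (auto simp: time_pairs_def intro!: G_u)
      thus "fc (laplace_op exp (- \<zeta>) (gpF V (u (fst p + \<zeta>)))) k - fc (gpF V (u_start p)) k
        = fc (\<lambda>x. laplace_op exp (- \<zeta>) (gpF V (u (fst p + \<zeta>))) x - gpF V (u_start p) x) k"
        using w(2) by (simp add: wiener_diff prop_wiener gpF_wiener V G_wiener)
    qed
  qed
  hence "bigO Y time_pairs (\<lambda>p x. - \<i> * ?f p x) (\<lambda>p. snd p * snd p)"
    by (rule bigO_cmult_const[OF tY, where d = 1]) auto
  thus ?thesis
    by (simp add: power2_eq_square algebra_simps)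
qed

lemma first_order:
  "bigO Y time_pairs (\<lambda>p x. u_end p x - u_free p x + \<i> * of_real (snd p) * gpF V (u_start p) x) (\<lambda>p. (snd p)\<^sup>2)"
proof -
  note V = G_wiener[OF G_V]
  let ?a = "\<lambda>p x. laplace_op exp (- snd p) (u_end p) x - u_start p x + \<i> * of_real (snd p) * gpF V (u_start p) x"
  have 1: "bigO Y time_pairs (\<lambda>p. laplace_op exp (snd p) (?a p)) (\<lambda>p. (snd p)\<^sup>2)"
    by (intro bigO_laplace tY unit_symbol_exp twisted_first_order)
  have "bigO Y time_pairs (\<lambda>p x. laplace_op exp (snd p) (gpF V (u_start p)) x - gpF V (u_start p) x) (\<lambda>p. \<bar>snd p\<bar>)"
    by (intro bigO_prop_diff tY bigO_gpF2 bigO_gpF target_Y bigO_G u_G)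
  hence "bigO Y time_pairs (\<lambda>p x. laplace_op exp (snd p) (gpF V (u_start p)) x - gpF V (u_start p) x) (\<lambda>p. snd p)"
    by (intro bigO_abs_snd[OF tY, of _ 1]) simp
  hence "bigO Y time_pairs (\<lambda>p x. (\<i> * of_real (snd p)) * (laplace_op exp (snd p) (gpF V (u_start p)) x - gpF V (u_start p) x)) (\<lambda>p. snd p * snd p)"
    by (rule bigO_cmult[OF tY]) (auto simp: time_pairs_def norm_mult)
  hence 2: "bigO Y time_pairs (\<lambda>p x. (\<i> * of_real (snd p)) * (laplace_op exp (snd p) (gpF V (u_start p)) x - gpF V (u_start p) x)) (\<lambda>p. (snd p)\<^sup>2)"
    by (simp add: power2_eq_square)
  have "bigO Y time_pairs (\<lambda>p x. laplace_op exp (snd p) (?a p) x - (\<i> * of_real (snd p)) * (laplace_op exp (snd p) (gpF V (u_start p)) x - gpF V (u_start p) x)) (\<lambda>p. (snd p)\<^sup>2)"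
    by (rule bigO_diff[OF tY 1 2])
  thus ?thesis
  proof (rule bigO_cong[THEN iffD1, rotated])
    fix p x assume p: "p \<in> time_pairs"
    have w: "laplace_op exp (- snd p) (u_end p) \<in> wiener" "u_start p \<in> wiener" "gpF V (u_start p) \<in> wiener"
      by (intro prop_wiener gpF_wiener V G_wiener[OF u_G(1)[OF p]] G_wiener[OF u_G(2)[OF p]])+
    have "laplace_op exp (snd p) (?a p) x = laplace_op exp (snd p) (\<lambda>x. laplace_op exp (- snd p) (u_end p) x - u_start p x) x
        + \<i> * of_real (snd p) * laplace_op exp (snd p) (gpF V (u_start p)) x"
      using w by (simp add: laplace_add laplace_cmult unit_symbol_exp wiener_diff wiener_cmult)
    thus "laplace_op exp (snd p) (?a p) x - (\<i> * of_real (snd p)) * (laplace_op exp (snd p) (gpF V (u_start p)) x - gpF V (u_start p) x)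
      = u_end p x - u_free p x + \<i> * of_real (snd p) * gpF V (u_start p) x"
      unfolding prop_twisted[OF p] by (simp add: algebra_simps)
  qed
qed

lemma bigO_mult_snd:
  assumes E: "test_family E" and "bigO E time_pairs f h"
  shows "bigO E time_pairs (\<lambda>p x. (\<i> * of_real (snd p)) * f p x) (\<lambda>p. snd p * h p)"
  using assms(2) by (rule bigO_cmult[OF E]) (auto simp: time_pairs_def norm_mult)

text \<open>
  Taylor expansion of the nonlinearity at the freely evolved solution: the terms linear in the increment are
  replaced by their value on \<open>-i \<zeta> gpF V u\<close> at the initial time, and those of higher order are of the
  size \<open>\<zeta>^2\<close> as products of two increments, one of them measured in \<open>X\<close>.
\<close>

lemma gpF_second_order:
  "bigO Y time_pairs (\<lambda>p x. gpF V (u_end p) x - gpF V (u_free p) x + \<i> * of_real (snd p) * gpG V (u_start p) x) (\<lambda>p. (snd p)\<^sup>2)"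
proof -
  let ?d = "\<lambda>p x. u_end p x - u_free p x" and ?F = "\<lambda>p. gpF V (u_start p)"
  let ?e = "\<lambda>p x. u_end p x - u_free p x + \<i> * of_real (snd p) * gpF V (u_start p) x"
  have F: "bigO X time_pairs ?F (\<lambda>_. 1)" by (intro bigO_gpF target_X bigO_exact_free)
  have dX: "bigO X time_pairs ?d (\<lambda>p. snd p)" and dY: "bigO Y time_pairs ?d (\<lambda>p. snd p)"
    by (intro increment target_X target_Y)+
  have dX1: "bigO X time_pairs ?d (\<lambda>_. 1)" by (intro bigO_diff tX bigO_exact_free)
  \<comment> \<open>The derivative of the nonlinearity at the free evolution, applied to the first-order remainder.\<close>
  have lin: "bigO Y time_pairs (\<lambda>p x. (V x + 2 * (u_free p x * cnj (u_free p x))) * ?e p x + u_free p x * u_free p x * cnj (?e p x)) (\<lambda>p. (snd p)\<^sup>2)"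
    by (intro bigO_add tX tY target_mult[OF target_Y target_Y] target_mult[OF target_X target_X] bigO_V bigO_const bigO_exact_free bigO_cnj first_order)
  have dd: "bigO Y time_pairs (\<lambda>p x. ?d p x * ?d p x) (\<lambda>p. (snd p)\<^sup>2)"
    using bigO_mult[OF tY XY dX dY] by (simp add: power2_eq_square)
  have ddc: "bigO Y time_pairs (\<lambda>p x. ?d p x * cnj (?d p x)) (\<lambda>p. (snd p)\<^sup>2)"
    using bigO_mult[OF tY XY dX bigO_cnj[OF tY dY]] by (simp add: power2_eq_square)
  have quad: "bigO Y time_pairs (\<lambda>p x. (2 * u_free p x + ?d p x) * (?d p x * cnj (?d p x)) + cnj (u_free p x) * (?d p x * ?d p x)) (\<lambda>p. (snd p)\<^sup>2)"
    by (intro bigO_add tX tY target_mult[OF target_Y target_Y] target_mult[OF target_X target_X] bigO_const bigO_exact_free bigO_cnj dd ddc dX1)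
  let ?h = "\<lambda>p x. u_free p x - u_start p x"
  let ?r = "\<lambda>p x. (cnj (u_start p x) * ?F p x) * ?h p x + (u_free p x * ?F p x) * cnj (?h p x)"
  let ?s = "\<lambda>p x. ((u_free p x + u_start p x) * cnj (?F p x)) * ?h p x"
  have "bigO Y time_pairs (\<lambda>p x. 2 * ?r p x - ?s p x) (\<lambda>p. snd p)"
    by (intro bigO_add bigO_diff tX tY target_mult[OF target_Y target_Y] target_mult[OF target_X target_X] bigO_const bigO_exact_free F bigO_cnj free_increment)
  from bigO_mult_snd[OF tY this]
  \<comment> \<open>The change of the derivative between the initial value and the free evolution, applied to the first-order term.\<close>
  have drift: "bigO Y time_pairs (\<lambda>p x. (\<i> * of_real (snd p)) * (2 * ?r p x - ?s p x)) (\<lambda>p. (snd p)\<^sup>2)"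
    by (simp only: power2_eq_square)
  have "bigO Y time_pairs (\<lambda>p x. (((V x + 2 * (u_free p x * cnj (u_free p x))) * ?e p x + u_free p x * u_free p x * cnj (?e p x))
      - (\<i> * of_real (snd p)) * (2 * ?r p x - ?s p x))
      + ((2 * u_free p x + ?d p x) * (?d p x * cnj (?d p x)) + cnj (u_free p x) * (?d p x * ?d p x))) (\<lambda>p. (snd p)\<^sup>2)"
    by (intro bigO_add[OF tY] bigO_diff[OF tY] lin drift quad)
  thus ?thesis
  proof (rule bigO_cong[THEN iffD1, rotated])
    fix p x assume "p \<in> time_pairs"
    \<comment> \<open>With \<open>q\<close> the free evolution, \<open>d\<close> the increment, \<open>w\<close> the initial value and \<open>F\<close> the nonlinearity at \<open>w\<close>.\<close>
    have id: "(((V0 + 2 * (q * cnj q)) * (d + \<i> * of_real s * F) + q * q * cnj (d + \<i> * of_real s * F))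
      - (\<i> * of_real s) * (2 * ((cnj w * F) * (q - w) + (q * F) * cnj (q - w)) - ((q + w) * cnj F) * (q - w)))
      + ((2 * q + d) * (d * cnj d) + cnj q * (d * d))
      = (V0 * (q + d) + (q + d)\<^sup>2 * cnj (q + d)) - (V0 * q + q\<^sup>2 * cnj q)
        + \<i> * of_real s * (V0 * F + 2 * (w * cnj w * F) - w * w * cnj F)" for V0 q d F w :: complex and s :: real
      by (simp add: power2_eq_square algebra_simps)
    show "(((V x + 2 * (u_free p x * cnj (u_free p x))) * ?e p x + u_free p x * u_free p x * cnj (?e p x))
      - (\<i> * of_real (snd p)) * (2 * ?r p x - ?s p x))
      + ((2 * u_free p x + ?d p x) * (?d p x * cnj (?d p x)) + cnj (u_free p x) * (?d p x * ?d p x))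
      = gpF V (u_end p) x - gpF V (u_free p) x + \<i> * of_real (snd p) * gpG V (u_start p) x"
      using id[of "V x" "u_free p x" "?d p x" "snd p" "?F p x" "u_start p x"]
      by (simp only: gpG_def gpF_def[of V "u_end p"] gpF_def[of V "u_free p"]) simp
  qed
qed

lemma gpF_first_order:
  "bigO X time_pairs (\<lambda>p x. gpF V (u_end p) x - gpF V (u_free p) x + \<i> * of_real (snd p) * gpG V (u_start p) x) (\<lambda>p. snd p)"
proof -
  have "bigO X time_pairs (\<lambda>p x. (\<i> * of_real (snd p)) * gpG V (u_start p) x) (\<lambda>p. snd p * 1)"
    by (intro bigO_mult_snd tX bigO_gpG target_X bigO_exact_free)
  hence "bigO X time_pairs (\<lambda>p x. (\<i> * of_real (snd p)) * gpG V (u_start p) x) (\<lambda>p. snd p)" by simp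
  thus ?thesis
    by (intro bigO_add tX bigO_gpF_diff target_X bigO_exact_free increment)
qed

lemma gpG_drift:
  "bigO Y time_pairs (\<lambda>p x. (\<i> * of_real (snd p)) * (laplace_op exp (- snd p) (gpG V (u_start p)) x - gpG V (u_start p) x)) (\<lambda>p. (snd p)\<^sup>2)"
  "bigO X time_pairs (\<lambda>p x. (\<i> * of_real (snd p)) * (laplace_op exp (- snd p) (gpG V (u_start p)) x - gpG V (u_start p) x)) (\<lambda>p. snd p)"
proof -
  have "bigO Y time_pairs (\<lambda>p x. laplace_op exp (- snd p) (gpG V (u_start p)) x - gpG V (u_start p) x) (\<lambda>p. \<bar>- snd p\<bar>)"
    by (intro bigO_prop_diff tY bigO_gpG2 bigO_gpG target_Y bigO_G u_G)
  hence "bigO Y time_pairs (\<lambda>p x. laplace_op exp (- snd p) (gpG V (u_start p)) x - gpG V (u_start p) x) (\<lambda>p. snd p)"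
    by (intro bigO_abs_snd[OF tY, of _ "- 1"]) simp
  from bigO_mult_snd[OF tY this]
  show "bigO Y time_pairs (\<lambda>p x. (\<i> * of_real (snd p)) * (laplace_op exp (- snd p) (gpG V (u_start p)) x - gpG V (u_start p) x)) (\<lambda>p. (snd p)\<^sup>2)"
    by (simp only: power2_eq_square)
  have "bigO X time_pairs (\<lambda>p x. laplace_op exp (- snd p) (gpG V (u_start p)) x - gpG V (u_start p) x) (\<lambda>_. 1)"
    by (intro bigO_diff bigO_laplace tX unit_symbol_exp bigO_gpG target_X bigO_exact_free)
  from bigO_mult_snd[OF tX this]
  show "bigO X time_pairs (\<lambda>p x. (\<i> * of_real (snd p)) * (laplace_op exp (- snd p) (gpG V (u_start p)) x - gpG V (u_start p) x)) (\<lambda>p. snd p)"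
    by simp
qed

definition steps :: "(real \<times> real) set" where
  "steps = {(t, \<tau>). 0 \<le> t \<and> 0 < \<tau> \<and> \<tau> \<le> 1 \<and> t + \<tau> \<le> T}"

definition substeps :: "((real \<times> real) \<times> real) set" where
  "substeps = {(p, \<zeta>). p \<in> steps \<and> \<zeta> \<in> {0..snd p}}"

lemma substepsD:
  assumes "q \<in> substeps"
  shows "(fst (fst q), snd q) \<in> time_pairs" "0 < snd (fst q)" "0 \<le> snd q" "snd q \<le> snd (fst q)" "snd (fst q) \<le> 1" "u (fst (fst q)) \<in> G"
  using assms by (auto simp: substeps_def steps_def time_pairs_def intro!: G_u)

lemma bigO_substeps:
  assumes "bigO E time_pairs f h"
  shows "bigO E substeps (\<lambda>q. f (fst (fst q), snd q)) (\<lambda>q. h (fst (fst q), snd q))"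
  by (rule bigO_compose[OF assms]) (use substepsD in auto)

lemma interpolation_error:
  shows "bigO X substeps (\<lambda>q x. interp_defect 0 (snd (fst q)) (snd q) (u (fst (fst q))) (\<lambda>x. 1) V x
      + interp_defect (- 1) (snd (fst q)) (snd q) (u (fst (fst q))) (u (fst (fst q))) (\<lambda>x. cnj (u (fst (fst q)) x)) x) (\<lambda>q. snd (fst q))"
    (is "bigO X _ ?f _")
    and "bigO Y substeps (\<lambda>q x. interp_defect 0 (snd (fst q)) (snd q) (u (fst (fst q))) (\<lambda>x. 1) V x
      + interp_defect (- 1) (snd (fst q)) (snd q) (u (fst (fst q))) (u (fst (fst q))) (\<lambda>x. cnj (u (fst (fst q)) x)) x) (\<lambda>q. (snd (fst q))\<^sup>2)"
proof -
  have 1: "fnorm_le X (interp_defect \<mu> (snd (fst q)) (snd q) f g h) (12 * M\<^sup>2 * snd (fst q))"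
    and 2: "fnorm_le Y (interp_defect \<mu> (snd (fst q)) (snd q) f g h) (72 * M\<^sup>2 * (snd (fst q))\<^sup>2)"
    if "q \<in> substeps" "f \<in> G" "g \<in> G" "h \<in> G" for \<mu> q f g h
    using fnorm_le_interp_defect(1)[OF tX XX GX[OF that(2)] GX[OF that(3)] GX[OF that(4)] substepsD(2-4)[OF that(1)]
        bilX[OF that(2,3)] bilX[OF that(2,4)] bilX[OF that(3,4)]]
      fnorm_le_interp_defect(2)[OF tY XY GX[OF that(2)] GX[OF that(3)] GX[OF that(4)] substepsD(2-4)[OF that(1)]
        bilY[OF that(2,3)] bilY[OF that(2,4)] bilY[OF that(3,4)]] by auto
  show "bigO X substeps ?f (\<lambda>q. snd (fst q))"
    by (rule bigO_add[OF tX]; rule bigOI[of "12 * M\<^sup>2"])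
      (auto intro!: 1 substepsD(6) G_one G_V G_cnj)
  show "bigO Y substeps ?f (\<lambda>q. (snd (fst q))\<^sup>2)"
    by (rule bigO_add[OF tY]; rule bigOI[of "72 * M\<^sup>2"])
      (auto intro!: 2 substepsD(6) G_one G_V G_cnj)
qed

lemma interp_defect_sum:
  assumes w: "w \<in> wiener"
  shows "interp_defect 0 \<tau> \<zeta> w (\<lambda>x. 1) V x + interp_defect (- 1) \<tau> \<zeta> w w (\<lambda>x. cnj (w x)) x =
    laplace_op exp (- \<zeta>) (gpF V (laplace_op exp \<zeta> w)) x - interpolant \<tau> \<zeta> V w x"
proof -
  note V = G_wiener[OF G_V]
  define wb where "wb = (\<lambda>x. cnj (w x))"
  have wb: "wb \<in> wiener" unfolding wb_def by (intro wiener_cnj w)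
  have F: "gpF V (laplace_op exp \<zeta> w) = (\<lambda>x. laplace_op exp \<zeta> w x * V x + laplace_op exp \<zeta> w x * laplace_op exp \<zeta> w x * laplace_op exp (- \<zeta>) wb x)"
    unfolding gpF_def[abs_def] by (simp add: power2_eq_square cnj_prop[OF w] wb_def mult.commute[of "V _"])
  note S = prop_wiener(1)[OF w] prop_wiener(1)[OF V] prop_wiener(1)[OF wb]
  have 1: "laplace_op exp (- \<zeta>) (gpF V (laplace_op exp \<zeta> w)) x = laplace_op exp (- \<zeta>) (\<lambda>x. laplace_op exp \<zeta> w x * V x) x
    + laplace_op exp (- \<zeta>) (\<lambda>x. laplace_op exp \<zeta> w x * laplace_op exp \<zeta> w x * laplace_op exp (- \<zeta>) wb x) x"
    unfolding F by (intro laplace_add unit_symbol_exp wiener_mult S V)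
  have 2: "laplace_op exp (- \<tau>)
         (\<lambda>x. laplace_op exp \<tau> w x * laplace_op exp (\<tau> - \<zeta>) V x
            + laplace_op exp \<tau> w x * laplace_op exp \<tau> w x * laplace_op exp (\<tau> - 2 * \<zeta>) wb x) x
     = laplace_op exp (- \<tau>) (\<lambda>x. laplace_op exp \<tau> w x * laplace_op exp (\<tau> - \<zeta>) V x) x
      + laplace_op exp (- \<tau>) (\<lambda>x. laplace_op exp \<tau> w x * laplace_op exp \<tau> w x * laplace_op exp (\<tau> - 2 * \<zeta>) wb x) x"
    by (intro laplace_add unit_symbol_exp wiener_mult S)
  show ?thesis
    unfolding 1 interpolant_def wb_def[symmetric] 2 interp_defect_def
    by (simp add: prop_const prop_0[OF V] ring_distribs)
qed

text \<open>
  The exact minus the numerical integrand in the twisted Duhamel formula.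
\<close>

definition residual :: "real \<times> real \<Rightarrow> real \<Rightarrow> real ^ 'n \<Rightarrow> complex" where
  "residual p \<zeta> x = laplace_op exp (- \<zeta>) (gpF V (u (fst p + \<zeta>))) x - (interpolant (snd p) \<zeta> V (u (fst p)) x
     + - \<i> * of_real \<zeta> * gpG V (u (fst p)) x)"

text \<open>
  The residual as interpolation error, Taylor remainder, and the error from keeping the propagator off the
  quintic term.
\<close>

lemma residual_eq:
  assumes q: "q \<in> substeps"
  defines "p \<equiv> (fst (fst q), snd q)"
  shows "residual (fst q) (snd q) x =
    (interp_defect 0 (snd (fst q)) (snd q) (u (fst (fst q))) (\<lambda>x. 1) V x
      + interp_defect (- 1) (snd (fst q)) (snd q) (u (fst (fst q))) (u (fst (fst q))) (\<lambda>x. cnj (u (fst (fst q)) x)) x)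
    + (laplace_op exp (- snd p) (\<lambda>x. gpF V (u_end p) x - gpF V (u_free p) x + \<i> * of_real (snd p) * gpG V (u_start p) x) x
    - (\<i> * of_real (snd p)) * (laplace_op exp (- snd p) (gpG V (u_start p)) x - gpG V (u_start p) x))"
proof -
  note V = G_wiener[OF G_V]
  have p: "p \<in> time_pairs" unfolding p_def by (rule substepsD[OF q])
  have w: "u_start p \<in> wiener" "u_end p \<in> wiener" using u_G[OF p] by (auto intro: G_wiener)
  have A: "laplace_op exp (- snd p) (\<lambda>x. gpF V (u_end p) x - gpF V (u_free p) x + \<i> * of_real (snd p) * gpG V (u_start p) x) x
    = laplace_op exp (- snd p) (gpF V (u_end p)) x - laplace_op exp (- snd p) (gpF V (u_free p)) x + \<i> * of_real (snd p) * laplace_op exp (- snd p) (gpG V (u_start p)) x"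
    using w by (simp add: laplace_add laplace_diff laplace_cmult unit_symbol_exp wiener_diff wiener_cmult gpF_wiener gpG_wiener prop_wiener V)
  have alg: "a - (j + - \<i> * z * g) = (b - j) + ((a - b + \<i> * z * c) - (\<i> * z) * (c - g))" for a b c g j z :: complex
    by (simp add: algebra_simps)
  have "u (fst (fst q)) \<in> wiener" using w(1) by (simp add: p_def)
  from interp_defect_sum[OF this] show ?thesis
    unfolding A unfolding residual_def p_def fst_conv snd_conv by (simp only: alg)
qed

lemma residual_bound:
  "bigO X substeps (\<lambda>q. residual (fst q) (snd q)) (\<lambda>q. snd (fst q))"
  "bigO Y substeps (\<lambda>q. residual (fst q) (snd q)) (\<lambda>q. (snd (fst q))\<^sup>2)"
proof -
  let ?f = "\<lambda>p x. laplace_op exp (- snd p) (\<lambda>x. gpF V (u_end p) x - gpF V (u_free p) x + \<i> * of_real (snd p) * gpG V (u_start p) x) x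
    - (\<i> * of_real (snd p)) * (laplace_op exp (- snd p) (gpG V (u_start p)) x - gpG V (u_start p) x)"
  have "bigO X time_pairs ?f (\<lambda>p. snd p)"
    by (intro bigO_diff tX bigO_laplace unit_symbol_exp gpF_first_order gpG_drift)
  from bigO_substeps[OF this]
  have X: "bigO X substeps (\<lambda>q. ?f (fst (fst q), snd q)) (\<lambda>q. snd (fst q))"
    by (rule bigO_weaken[OF tX, of _ _ _ 1]) (use substepsD in auto)
  have "bigO Y time_pairs ?f (\<lambda>p. (snd p)\<^sup>2)"
    by (intro bigO_diff tY bigO_laplace unit_symbol_exp gpF_second_order gpG_drift)
  from bigO_substeps[OF this]
  have Y: "bigO Y substeps (\<lambda>q. ?f (fst (fst q), snd q)) (\<lambda>q. (snd (fst q))\<^sup>2)"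
    by (rule bigO_weaken[OF tY, of _ _ _ 1]) (use substepsD in \<open>auto intro!: power_mono\<close>)
  show "bigO X substeps (\<lambda>q. residual (fst q) (snd q)) (\<lambda>q. snd (fst q))"
    using bigO_add[OF tX interpolation_error(1) X]
    by (rule bigO_cong[THEN iffD1, rotated]) (simp only: residual_eq)
  show "bigO Y substeps (\<lambda>q. residual (fst q) (snd q)) (\<lambda>q. (snd (fst q))\<^sup>2)"
    using bigO_add[OF tY interpolation_error(2) Y]
    by (rule bigO_cong[THEN iffD1, rotated]) (simp only: residual_eq)
qed

lemma steps_G: "p \<in> steps \<Longrightarrow> u_start p \<in> G" "p \<in> steps \<Longrightarrow> u_end p \<in> G"
  by (auto simp: steps_def intro!: G_u)

text \<open>
  The local error, twisted back, is the time integral of the residual, which gains one power of the step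
  size.
\<close>

lemma local_error_target:
  assumes N: "target N" and R: "bigO N substeps (\<lambda>q. residual (fst q) (snd q)) (\<lambda>q. h (fst q))"
  shows "bigO N steps (\<lambda>p x. gp_step (snd p) V (u_start p) x - u_end p x) (\<lambda>p. snd p * h p)"
proof -
  note V = G_wiener[OF G_V]
  let ?f = "\<lambda>p x. \<i> * (laplace_op exp (- snd p) (u_end p) x - u_start p x) - \<i> * (laplace_op exp (- snd p) (gp_step (snd p) V (u_start p)) x - u_start p x)"
  have "bigO N {(p, \<zeta>). p \<in> steps \<and> \<zeta> \<in> {0..snd p}} (\<lambda>(p, \<zeta>). residual p \<zeta>) (\<lambda>(p, \<zeta>). h p)"
    using R unfolding substeps_def by (simp add: case_prod_unfold)
  hence "bigO N steps ?f (\<lambda>p. snd p * h p)"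
  proof (rule bigO_integral[OF targetD(1)[OF N]])
    fix p k assume p: "p \<in> steps"
    have pos: "0 < snd p" using p by (auto simp: steps_def)
    thus "0 \<le> snd p" by simp
    note G = steps_G[OF p]
    note w = G_wiener[OF G(1)] G_wiener[OF G(2)]
    have w1: "(\<lambda>x. \<i> * (laplace_op exp (- snd p) (u_end p) x - u_start p x)) \<in> wiener"
      and w2: "(\<lambda>x. \<i> * (laplace_op exp (- snd p) (gp_step (snd p) V (u_start p)) x - u_start p x)) \<in> wiener"
      by (intro wiener_cmult wiener_diff prop_wiener gp_step_wiener V w)+
    show "?f p \<in> wiener" by (intro wiener_diff w1 w2)
    have "((\<lambda>\<zeta>. fc (laplace_op exp (- \<zeta>) (gpF V (u (fst p + \<zeta>)))) k - (fc (interpolant (snd p) \<zeta> V (u_start p)) k + - \<i> * of_real \<zeta> * fc (gpG V (u_start p)) k))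
       has_integral fc (\<lambda>x. \<i> * (laplace_op exp (- snd p) (u_end p) x - u_start p x)) k
         - fc (\<lambda>x. \<i> * (laplace_op exp (- snd p) (gp_step (snd p) V (u_start p)) x - u_start p x)) k) {0..snd p}"
      using p by (intro has_integral_diff duhamel has_integral_interpolant pos V w) (auto simp: steps_def)
    hence *: "((\<lambda>\<zeta>. fc (laplace_op exp (- \<zeta>) (gpF V (u (fst p + \<zeta>)))) k - (fc (interpolant (snd p) \<zeta> V (u_start p)) k + - \<i> * of_real \<zeta> * fc (gpG V (u_start p)) k))
       has_integral fc (?f p) k) {0..snd p}"
      unfolding wiener_diff(2)[OF w1 w2] .
    show "((\<lambda>\<zeta>. fc (residual p \<zeta>) k) has_integral fc (?f p) k) {0..snd p}"
    proof (rule has_integral_eq[OF _ *])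
      fix \<zeta> assume \<zeta>: "\<zeta> \<in> {0..snd p}"
      have "u (fst p + \<zeta>) \<in> G" using p \<zeta> by (auto simp: steps_def intro!: G_u)
      hence a: "laplace_op exp (- \<zeta>) (gpF V (u (fst p + \<zeta>))) \<in> wiener" by (intro prop_wiener gpF_wiener V G_wiener)
      note b = interpolant_wiener[OF V w(1), of "snd p" \<zeta>] and g = gpG_wiener[OF V w(1)]
      show "fc (laplace_op exp (- \<zeta>) (gpF V (u (fst p + \<zeta>)))) k - (fc (interpolant (snd p) \<zeta> V (u_start p)) k + - \<i> * of_real \<zeta> * fc (gpG V (u_start p)) k) = fc (residual p \<zeta>) k"
        unfolding residual_def[abs_def] wiener_diff(2)[OF a wiener_add(1)[OF b wiener_cmult(1)[OF g]]]
          wiener_add(2)[OF b wiener_cmult(1)[OF g]] wiener_cmult(2)[OF g] ..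
    qed
  qed
  hence "bigO N steps (\<lambda>p. laplace_op exp (snd p) (?f p)) (\<lambda>p. snd p * h p)"
    by (intro bigO_laplace targetD N unit_symbol_exp)
  hence "bigO N steps (\<lambda>p x. \<i> * laplace_op exp (snd p) (?f p) x) (\<lambda>p. snd p * h p)"
    by (rule bigO_cmult_const[OF targetD(1)[OF N], where d = 1]) auto
  thus ?thesis
  proof (rule bigO_cong[THEN iffD1, rotated])
    fix p x assume p: "p \<in> steps"
    note G = steps_G[OF p]
    note w = G_wiener[OF G(1)] G_wiener[OF G(2)]
    note s = gp_step_wiener[OF V w(1), of "snd p"]
    have f: "?f p = (\<lambda>x. \<i> * (laplace_op exp (- snd p) (u_end p) x - laplace_op exp (- snd p) (gp_step (snd p) V (u_start p)) x))"
      by (simp add: algebra_simps)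
    have "laplace_op exp (snd p) (?f p) x = \<i> * (laplace_op exp (snd p) (laplace_op exp (- snd p) (u_end p)) x
      - laplace_op exp (snd p) (laplace_op exp (- snd p) (gp_step (snd p) V (u_start p))) x)"
      unfolding f using w s by (simp add: laplace_cmult laplace_diff unit_symbol_exp wiener_diff prop_wiener)
    also have "\<dots> = \<i> * (u_end p x - gp_step (snd p) V (u_start p) x)"
      using w s by (simp add: prop_prop prop_0)
    finally have E: "laplace_op exp (snd p) (?f p) x = \<i> * (u_end p x - gp_step (snd p) V (u_start p) x)" .
    show "\<i> * laplace_op exp (snd p) (?f p) x = gp_step (snd p) V (u_start p) x - u_end p x"
      unfolding E by (simp add: algebra_simps)
  qed
qed

theorem local_error:
  "bigO X steps (\<lambda>p x. gp_step (snd p) V (u_start p) x - u_end p x) (\<lambda>p. (snd p)\<^sup>2)"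
  "bigO Y steps (\<lambda>p x. gp_step (snd p) V (u_start p) x - u_end p x) (\<lambda>p. (snd p) ^ 3)"
  using local_error_target[OF target_X residual_bound(1)] local_error_target[OF target_Y residual_bound(2)]
  by (simp_all add: power2_eq_square power3_eq_cube mult.assoc)

end

section \<open>Stability and convergence\<close>

context gp_setting
begin

text \<open>
  Two families bounded in \<open>X\<close> whose difference is controlled in \<open>N\<close>. This relation is preserved by all
  operations from which the numerical flow is built, so the Lipschitz bound is found by following the
  structure of the scheme.
\<close>

definition lipO :: "(int ^ 'n \<Rightarrow> real) set \<Rightarrow> 'p set \<Rightarrow> ('p \<Rightarrow> real ^ 'n \<Rightarrow> complex) \<Rightarrow> ('p \<Rightarrow> real ^ 'n \<Rightarrow> complex) \<Rightarrow>
    ('p \<Rightarrow> real) \<Rightarrow> bool" where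
  "lipO N P f g h \<longleftrightarrow> bigO X P f (\<lambda>_. 1) \<and> bigO X P g (\<lambda>_. 1) \<and> bigO N P (\<lambda>p x. f p x - g p x) h"

lemma lipO_mult:
  assumes N: "target N" and f: "lipO N P f g h" and f': "lipO N P f' g' h"
  shows "lipO N P (\<lambda>p x. f p x * f' p x) (\<lambda>p x. g p x * g' p x) h"
proof -
  have "bigO N P (\<lambda>p x. f' p x * (f p x - g p x) + g p x * (f' p x - g' p x)) h"
    by (intro bigO_add targetD N target_mult[OF N N]) (use f f' in \<open>auto simp: lipO_def\<close>)
  hence "bigO N P (\<lambda>p x. f p x * f' p x - g p x * g' p x) h"
    by (simp add: algebra_simps)
  moreover have "bigO X P (\<lambda>p x. f p x * f' p x) (\<lambda>_. 1)" "bigO X P (\<lambda>p x. g p x * g' p x) (\<lambda>_. 1)"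
    by (intro target_mult[OF target_X target_X]; use f f' in \<open>simp add: lipO_def\<close>)+
  ultimately show ?thesis by (simp add: lipO_def)
qed

lemma lipO_add:
  assumes N: "target N" and f: "lipO N P f g h" and f': "lipO N P f' g' h"
  shows "lipO N P (\<lambda>p x. f p x + f' p x) (\<lambda>p x. g p x + g' p x) h"
proof -
  have "bigO N P (\<lambda>p x. (f p x - g p x) + (f' p x - g' p x)) h"
    by (intro bigO_add targetD N) (use f f' in \<open>auto simp: lipO_def\<close>)
  hence "bigO N P (\<lambda>p x. f p x + f' p x - (g p x + g' p x)) h"
    by (simp add: algebra_simps)
  moreover have "bigO X P (\<lambda>p x. f p x + f' p x) (\<lambda>_. 1)" "bigO X P (\<lambda>p x. g p x + g' p x) (\<lambda>_. 1)"
    by (intro bigO_add tX; use f f' in \<open>simp add: lipO_def\<close>)+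
  ultimately show ?thesis by (simp add: lipO_def)
qed

lemma lipO_cmult:
  assumes N: "target N" and f: "lipO N P f g h" and c: "\<And>p. p \<in> P \<Longrightarrow> cmod (c p) \<le> d" "0 \<le> d"
  shows "lipO N P (\<lambda>p x. c p * f p x) (\<lambda>p x. c p * g p x) h"
proof -
  have "bigO N P (\<lambda>p x. c p * (f p x - g p x)) h"
    by (rule bigO_cmult_const[OF _ _ c]) (use targetD N f in \<open>auto simp: lipO_def\<close>)
  hence "bigO N P (\<lambda>p x. c p * f p x - c p * g p x) h"
    by (simp add: algebra_simps)
  moreover have "bigO X P (\<lambda>p x. c p * f p x) (\<lambda>_. 1)" "bigO X P (\<lambda>p x. c p * g p x) (\<lambda>_. 1)"
    by (rule bigO_cmult_const[OF tX _ c]; use f in \<open>simp add: lipO_def\<close>)+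
  ultimately show ?thesis by (simp add: lipO_def)
qed

lemma lipO_diff:
  assumes N: "target N" and f: "lipO N P f g h" and f': "lipO N P f' g' h"
  shows "lipO N P (\<lambda>p x. f p x - f' p x) (\<lambda>p x. g p x - g' p x) h"
  using lipO_add[OF N f lipO_cmult[OF N f', where c = "\<lambda>_. - 1" and d = 1]] by simp

lemma lipO_cnj:
  assumes N: "target N" and f: "lipO N P f g h"
  shows "lipO N P (\<lambda>p x. cnj (f p x)) (\<lambda>p x. cnj (g p x)) h"
proof -
  have "bigO N P (\<lambda>p x. cnj (f p x - g p x)) h"
    by (rule bigO_cnj) (use targetD N f in \<open>auto simp: lipO_def\<close>)
  moreover have "bigO X P (\<lambda>p x. cnj (f p x)) (\<lambda>_. 1)" "bigO X P (\<lambda>p x. cnj (g p x)) (\<lambda>_. 1)"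
    by (rule bigO_cnj[OF tX]; use f in \<open>simp add: lipO_def\<close>)+
  ultimately show ?thesis by (simp add: lipO_def)
qed

lemma lipO_laplace:
  assumes N: "target N" and \<phi>: "unit_symbol \<phi>" and f: "lipO N P f g h"
  shows "lipO N P (\<lambda>p. laplace_op \<phi> (\<xi> p) (f p)) (\<lambda>p. laplace_op \<phi> (\<xi> p) (g p)) h"
proof -
  have X: "bigO X P f (\<lambda>_. 1)" "bigO X P g (\<lambda>_. 1)" and d: "bigO N P (\<lambda>p x. f p x - g p x) h"
    using f by (auto simp: lipO_def)
  have "bigO N P (\<lambda>p. laplace_op \<phi> (\<xi> p) (\<lambda>x. f p x - g p x)) h"
    by (rule bigO_laplace[OF targetD(1)[OF N] \<phi> d])
  hence "bigO N P (\<lambda>p x. laplace_op \<phi> (\<xi> p) (f p) x - laplace_op \<phi> (\<xi> p) (g p) x) h"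
    by (rule bigO_cong[THEN iffD1, rotated]) (use X \<phi> in \<open>auto simp: laplace_diff bigO_wiener\<close>)
  moreover have "bigO X P (\<lambda>p. laplace_op \<phi> (\<xi> p) (f p)) (\<lambda>_. 1)" "bigO X P (\<lambda>p. laplace_op \<phi> (\<xi> p) (g p)) (\<lambda>_. 1)"
    by (intro bigO_laplace tX \<phi> X)+
  ultimately show ?thesis by (simp add: lipO_def)
qed

lemma lipO_same:
  assumes N: "target N" and f: "bigO X P f (\<lambda>_. 1)" and h: "\<And>p. p \<in> P \<Longrightarrow> 0 \<le> h p"
  shows "lipO N P f f h"
  using f bigO_zero[OF h targetD(1)[OF N]] by (simp add: lipO_def)

lemma lipO_filtered:
  assumes N: "target N" and \<phi>: "unit_symbol \<phi>" and "lipO N P w w' h" "lipO N P v v' h" "lipO N P wb wb' h"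
  shows "lipO N P (\<lambda>p. filtered \<phi> (\<tau> p) (w p) (v p) (wb p)) (\<lambda>p. filtered \<phi> (\<tau> p) (w' p) (v' p) (wb' p)) h"
  unfolding filtered_def[abs_def]
  by (intro lipO_add[OF N] lipO_mult[OF N] lipO_laplace[OF N \<phi>] assms)

lemma lipO_gpG:
  assumes N: "target N" and w: "lipO N P w w' h" and h: "\<And>p. p \<in> P \<Longrightarrow> 0 \<le> h p"
  shows "lipO N P (\<lambda>p. gpG V (w p)) (\<lambda>p. gpG V (w' p)) h"
  unfolding gpG_def[abs_def] gpF_def[abs_def] power2_eq_square
  by (intro lipO_add[OF N] lipO_diff[OF N] lipO_mult[OF N] lipO_cnj[OF N] lipO_same[OF N] bigO_V bigO_const w h)

text \<open>
  The increment function of the scheme as a one-step method. The linear part is an isometry of every norm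
  considered here, so only this part contributes to the growth of errors.
\<close>

definition increment_fn :: "real \<Rightarrow> (real ^ 'n \<Rightarrow> complex) \<Rightarrow> real ^ 'n \<Rightarrow> complex" where
  "increment_fn \<tau> w x =
     - \<i> * laplace_op exp \<tau> (filtered phi1 \<tau> w V (\<lambda>y. cnj (w y))) x
     + - \<i> * filtered phi2 \<tau> (laplace_op exp \<tau> w) (laplace_op exp \<tau> V) (laplace_op exp \<tau> (\<lambda>y. cnj (w y))) x
     + \<i> * laplace_op exp \<tau> (filtered phi2 \<tau> w V (\<lambda>y. cnj (w y))) x
     + - of_real (\<tau> / 2) * laplace_op exp \<tau> (gpG V w) x"

lemma gp_step_increment: "gp_step \<tau> V w x = laplace_op exp \<tau> w x + of_real \<tau> * increment_fn \<tau> w x"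
  unfolding gp_step_eq increment_fn_def by (simp add: algebra_simps power2_eq_square)

lemma stability:
  assumes N: "target N"
  shows "\<exists>L\<ge>0. \<forall>\<tau> v w e. 0 \<le> \<tau> \<longrightarrow> \<tau> \<le> 1 \<longrightarrow> fnorm_le X v (M + 1) \<longrightarrow> fnorm_le X w (M + 1) \<longrightarrow>
     fnorm_le N (\<lambda>x. v x - w x) e \<longrightarrow> fnorm_le N (\<lambda>x. gp_step \<tau> V v x - gp_step \<tau> V w x) ((1 + L * \<tau>) * e)"
proof -
  define P where "P = {p :: real \<times> (real ^ 'n \<Rightarrow> complex) \<times> (real ^ 'n \<Rightarrow> complex) \<times> real. case p of (\<tau>, v, w, e) \<Rightarrow>
     0 \<le> \<tau> \<and> \<tau> \<le> 1 \<and> fnorm_le X v (M + 1) \<and> fnorm_le X w (M + 1) \<and> fnorm_le N (\<lambda>x. v x - w x) e}"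
  let ?\<tau> = "\<lambda>p. fst p" and ?v = "\<lambda>p. fst (snd p)" and ?w = "\<lambda>p. fst (snd (snd p))" and ?e = "\<lambda>p. snd (snd (snd p))"
  have e0: "0 \<le> ?e p" if "p \<in> P" for p using that fnorm_le_nonneg[OF targetD(1)[OF N]] by (auto simp: P_def)
  have vw: "lipO N P ?v ?w ?e"
    unfolding lipO_def using M_nonneg
    by (intro conjI bigOI[of "M + 1"] bigOI[of 1]) (auto simp: P_def)
  have "lipO N P (\<lambda>p. increment_fn (?\<tau> p) (?v p)) (\<lambda>p. increment_fn (?\<tau> p) (?w p)) ?e"
    unfolding increment_fn_def[abs_def]
  proof (intro lipO_add[OF N])
    note V = lipO_same[OF N bigO_V(1) e0]
    show "lipO N P (\<lambda>p x. - \<i> * laplace_op exp (?\<tau> p) (filtered phi1 (?\<tau> p) (?v p) V (\<lambda>y. cnj (?v p y))) x)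
      (\<lambda>p x. - \<i> * laplace_op exp (?\<tau> p) (filtered phi1 (?\<tau> p) (?w p) V (\<lambda>y. cnj (?w p y))) x) ?e"
      by (intro lipO_cmult[OF N, where d = 1] lipO_laplace[OF N] lipO_filtered[OF N] lipO_cnj[OF N] unit_symbol_exp unit_symbol_phi1 vw V) auto
    show "lipO N P (\<lambda>p x. - \<i> * filtered phi2 (?\<tau> p) (laplace_op exp (?\<tau> p) (?v p)) (laplace_op exp (?\<tau> p) V) (laplace_op exp (?\<tau> p) (\<lambda>y. cnj (?v p y))) x)
      (\<lambda>p x. - \<i> * filtered phi2 (?\<tau> p) (laplace_op exp (?\<tau> p) (?w p)) (laplace_op exp (?\<tau> p) V) (laplace_op exp (?\<tau> p) (\<lambda>y. cnj (?w p y))) x) ?e"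
      by (intro lipO_cmult[OF N, where d = 1] lipO_laplace[OF N] lipO_filtered[OF N] lipO_cnj[OF N] unit_symbol_exp unit_symbol_phi2 vw V) auto
    show "lipO N P (\<lambda>p x. \<i> * laplace_op exp (?\<tau> p) (filtered phi2 (?\<tau> p) (?v p) V (\<lambda>y. cnj (?v p y))) x)
      (\<lambda>p x. \<i> * laplace_op exp (?\<tau> p) (filtered phi2 (?\<tau> p) (?w p) V (\<lambda>y. cnj (?w p y))) x) ?e"
      by (intro lipO_cmult[OF N, where d = 1] lipO_laplace[OF N] lipO_filtered[OF N] lipO_cnj[OF N] unit_symbol_exp unit_symbol_phi2 vw V) auto
    show "lipO N P (\<lambda>p x. - of_real (?\<tau> p / 2) * laplace_op exp (?\<tau> p) (gpG V (?v p)) x)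
      (\<lambda>p x. - of_real (?\<tau> p / 2) * laplace_op exp (?\<tau> p) (gpG V (?w p)) x) ?e"
      by (intro lipO_cmult[OF N, where d = 1] lipO_laplace[OF N] lipO_gpG[OF N] unit_symbol_exp vw e0) (auto simp: P_def norm_divide)
  qed
  then obtain L where L: "0 \<le> L" "\<And>p. p \<in> P \<Longrightarrow> fnorm_le N (\<lambda>x. increment_fn (?\<tau> p) (?v p) x - increment_fn (?\<tau> p) (?w p) x) (L * ?e p)"
    unfolding lipO_def by (auto elim!: bigOE)
  show ?thesis
  proof (intro exI[of _ L] conjI allI impI L(1))
    fix \<tau> :: real and v w e assume *: "0 \<le> \<tau>" "\<tau> \<le> 1" "fnorm_le X v (M + 1)" "fnorm_le X w (M + 1)" "fnorm_le N (\<lambda>x. v x - w x) e"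
    have "(\<tau>, v, w, e) \<in> P" using * by (simp add: P_def)
    from L(2)[OF this] have 1: "fnorm_le N (\<lambda>x. increment_fn \<tau> v x - increment_fn \<tau> w x) (L * e)" by simp
    have vw: "v \<in> wiener" "w \<in> wiener" using * by (auto simp: fnorm_le_def)
    have "fnorm_le N (laplace_op exp \<tau> (\<lambda>x. v x - w x)) (1 * e)"
      unfolding laplace_op_fmult
      by (rule fnorm_le_fmult[OF targetD(1)[OF N] *(5)]) (use unit_symbol_symb[OF unit_symbol_exp] in auto)
    hence "fnorm_le N (\<lambda>x. laplace_op exp \<tau> (\<lambda>x. v x - w x) x + of_real \<tau> * (increment_fn \<tau> v x - increment_fn \<tau> w x))
       (1 * e + cmod (of_real \<tau>) * (L * e))"
      by (intro fnorm_le_add fnorm_le_cmult targetD N 1)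
    moreover have "laplace_op exp \<tau> (\<lambda>x. v x - w x) x + of_real \<tau> * (increment_fn \<tau> v x - increment_fn \<tau> w x)
       = gp_step \<tau> V v x - gp_step \<tau> V w x" for x
      unfolding gp_step_increment laplace_diff[OF unit_symbol_exp vw] by (simp add: algebra_simps)
    moreover have "1 * e + cmod (of_real \<tau>) * (L * e) = (1 + L * \<tau>) * e" using *(1) by (simp add: algebra_simps)
    ultimately show "fnorm_le N (\<lambda>x. gp_step \<tau> V v x - gp_step \<tau> V w x) ((1 + L * \<tau>) * e)" by simp
  qed
qed

lemma gronwall_bound:
  fixes L \<tau> :: real
  assumes "0 \<le> L" "0 \<le> \<tau>" "real n * \<tau> \<le> T"
  shows "(1 + L * \<tau>) ^ n \<le> exp (L * T)"
proof -
  have "(1 + L * \<tau>) ^ n \<le> exp (L * \<tau>) ^ n"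
    using assms by (intro power_mono exp_ge_add_one_self) auto
  also have "\<dots> = exp (L * (real n * \<tau>))" by (simp add: exp_of_nat_mult[symmetric] mult_ac)
  also have "\<dots> \<le> exp (L * T)" using assms by (auto intro: mult_left_mono)
  finally show ?thesis .
qed

text \<open>
  The bound in \<open>X\<close> and the bound in \<open>Y\<close> are propagated together: the former, of order \<open>\<tau>\<close>, keeps the numerical
  solution in the ball of radius \<open>M + 1\<close> on which the flow is Lipschitz in both norms.
\<close>

theorem convergence:
  "\<exists>\<tau>min>0. \<exists>C\<ge>0. \<forall>\<tau> n. 0 < \<tau> \<longrightarrow> \<tau> \<le> \<tau>min \<longrightarrow> real n * \<tau> \<le> T \<longrightarrow>
     fnorm_le Y (\<lambda>x. gp_scheme \<tau> V (u 0) n x - u (real n * \<tau>) x) (C * \<tau>\<^sup>2)"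
proof -
  obtain LX where LX: "0 \<le> LX" "\<And>\<tau> v w e. 0 \<le> \<tau> \<Longrightarrow> \<tau> \<le> 1 \<Longrightarrow> fnorm_le X v (M + 1) \<Longrightarrow> fnorm_le X w (M + 1) \<Longrightarrow>
     fnorm_le X (\<lambda>x. v x - w x) e \<Longrightarrow> fnorm_le X (\<lambda>x. gp_step \<tau> V v x - gp_step \<tau> V w x) ((1 + LX * \<tau>) * e)"
    using stability[OF target_X] by blast
  obtain LY where LY: "0 \<le> LY" "\<And>\<tau> v w e. 0 \<le> \<tau> \<Longrightarrow> \<tau> \<le> 1 \<Longrightarrow> fnorm_le X v (M + 1) \<Longrightarrow> fnorm_le X w (M + 1) \<Longrightarrow>
     fnorm_le Y (\<lambda>x. v x - w x) e \<Longrightarrow> fnorm_le Y (\<lambda>x. gp_step \<tau> V v x - gp_step \<tau> V w x) ((1 + LY * \<tau>) * e)"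
    using stability[OF target_Y] by blast
  obtain KX where KX: "0 \<le> KX" "\<And>p. p \<in> steps \<Longrightarrow> fnorm_le X (\<lambda>x. gp_step (snd p) V (u_start p) x - u_end p x) (KX * (snd p)\<^sup>2)"
    using local_error(1) by (auto elim!: bigOE)
  obtain KY where KY: "0 \<le> KY" "\<And>p. p \<in> steps \<Longrightarrow> fnorm_le Y (\<lambda>x. gp_step (snd p) V (u_start p) x - u_end p x) (KY * (snd p) ^ 3)"
    using local_error(2) by (auto elim!: bigOE)
  define A where "A = T * KX * exp (LX * T)"
  have A: "0 \<le> A" using KX(1) T by (simp add: A_def)
  \<comment> \<open>For steps up to this size the error in \<open>X\<close> is at most one.\<close>
  define \<tau>min where "\<tau>min = min 1 (1 / (A + 1))"
  have \<tau>min: "0 < \<tau>min" "\<tau>min \<le> 1" using A by (auto simp: \<tau>min_def)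
  have A\<tau>: "A * \<tau> \<le> 1" if "0 < \<tau>" "\<tau> \<le> \<tau>min" for \<tau>
  proof -
    have "\<tau> \<le> 1 / (A + 1)" using that by (simp add: \<tau>min_def)
    hence "A * \<tau> \<le> A * (1 / (A + 1))" using A by (rule mult_left_mono)
    also have "\<dots> \<le> 1" using A by (simp add: field_simps)
    finally show ?thesis .
  qed
  have main: "fnorm_le X (\<lambda>x. gp_scheme \<tau> V (u 0) n x - u (real n * \<tau>) x) (real n * (KX * \<tau>\<^sup>2) * (1 + LX * \<tau>) ^ n) \<and>
      fnorm_le Y (\<lambda>x. gp_scheme \<tau> V (u 0) n x - u (real n * \<tau>) x) (real n * (KY * \<tau> ^ 3) * (1 + LY * \<tau>) ^ n)"
    if \<tau>: "0 < \<tau>" "\<tau> \<le> \<tau>min" and n: "real n * \<tau> \<le> T" for \<tau> n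
    using n
  proof (induction n)
    case 0
    show ?case using wiener_const[where c = 0 and 'n = 'n] by (simp add: fnorm_le_def dual_le_def)
  next
    case (Suc n)
    let ?w = "gp_scheme \<tau> V (u 0) n" and ?t = "real n * \<tau>"
    have n: "?t + \<tau> \<le> T" "0 \<le> ?t" using Suc.prems \<tau> by (auto simp: algebra_simps)
    hence nT: "?t \<le> T" using \<tau> by linarith
    note IH = Suc.IH[OF nT]
    have G: "u ?t \<in> G" using n nT by (intro G_u) auto
    have s: "(?t, \<tau>) \<in> steps" using n \<tau> \<tau>min by (auto simp: steps_def)
    have t1: "0 \<le> \<tau>" "\<tau> \<le> 1" using \<tau> \<tau>min by auto
    have small: "real n * (KX * \<tau>\<^sup>2) * (1 + LX * \<tau>) ^ n \<le> 1"
    proof -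
      have "real n * (KX * \<tau>\<^sup>2) * (1 + LX * \<tau>) ^ n = ?t * (KX * (1 + LX * \<tau>) ^ n) * \<tau>" by (simp add: power2_eq_square)
      also have "\<dots> \<le> T * (KX * exp (LX * T)) * \<tau>"
        using KX(1) LX(1) \<tau> n nT T by (intro mult_right_mono mult_mono gronwall_bound) auto
      also have "\<dots> = A * \<tau>" by (simp add: A_def)
      also have "\<dots> \<le> 1" by (rule A\<tau>[OF \<tau>])
      finally show ?thesis .
    qed
    have wM: "fnorm_le X ?w (M + 1)"
    proof -
      have "fnorm_le X (\<lambda>x. (?w x - u ?t x) + u ?t x) (real n * (KX * \<tau>\<^sup>2) * (1 + LX * \<tau>) ^ n + M)"
        by (rule fnorm_le_add[OF tX conjunct1[OF IH] GX[OF G]])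
      hence "fnorm_le X ?w (real n * (KX * \<tau>\<^sup>2) * (1 + LX * \<tau>) ^ n + M)" by simp
      thus ?thesis by (rule fnorm_le_mono[OF tX]) (use small in auto)
    qed
    have uM: "fnorm_le X (u ?t) (M + 1)" by (rule fnorm_le_mono[OF tX GX[OF G]]) simp
    have split: "(\<lambda>x. gp_scheme \<tau> V (u 0) (Suc n) x - u (real (Suc n) * \<tau>) x) =
       (\<lambda>x. (gp_step \<tau> V ?w x - gp_step \<tau> V (u ?t) x) + (gp_step \<tau> V (u ?t) x - u (?t + \<tau>) x))"
      by (simp add: algebra_simps)
    have grow: "(1 + L * \<tau>) * (real n * K * (1 + L * \<tau>) ^ n) + K \<le> real (Suc n) * K * (1 + L * \<tau>) ^ Suc n"
      if "0 \<le> L" "0 \<le> K" for L K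
    proof -
      have "K * 1 \<le> K * (1 + L * \<tau>) ^ Suc n" using that t1 by (intro mult_left_mono one_le_power) auto
      thus ?thesis by (simp add: algebra_simps)
    qed
    have K: "0 \<le> KX * \<tau>\<^sup>2" "0 \<le> KY * \<tau> ^ 3" using KX(1) KY(1) t1 by auto
    have "fnorm_le X (\<lambda>x. gp_scheme \<tau> V (u 0) (Suc n) x - u (real (Suc n) * \<tau>) x)
      ((1 + LX * \<tau>) * (real n * (KX * \<tau>\<^sup>2) * (1 + LX * \<tau>) ^ n) + KX * \<tau>\<^sup>2)"
      unfolding split using KX(2)[OF s]
      by (intro fnorm_le_add tX LX(2) t1 wM uM conjunct1[OF IH]) simp
    moreover have "fnorm_le Y (\<lambda>x. gp_scheme \<tau> V (u 0) (Suc n) x - u (real (Suc n) * \<tau>) x)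
      ((1 + LY * \<tau>) * (real n * (KY * \<tau> ^ 3) * (1 + LY * \<tau>) ^ n) + KY * \<tau> ^ 3)"
      unfolding split using KY(2)[OF s]
      by (intro fnorm_le_add tY LY(2) t1 wM uM conjunct2[OF IH]) simp
    ultimately show ?case
      using fnorm_le_mono[OF tX _ grow[OF LX(1) K(1)]] fnorm_le_mono[OF tY _ grow[OF LY(1) K(2)]] by blast
  qed
  define C where "C = T * KY * exp (LY * T)"
  have "fnorm_le Y (\<lambda>x. gp_scheme \<tau> V (u 0) n x - u (real n * \<tau>) x) (C * \<tau>\<^sup>2)"
    if \<tau>: "0 < \<tau>" "\<tau> \<le> \<tau>min" and n: "real n * \<tau> \<le> T" for \<tau> n
  proof (rule fnorm_le_mono[OF tY conjunct2[OF main[OF that]]])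
    have "real n * (KY * \<tau> ^ 3) * (1 + LY * \<tau>) ^ n = (real n * \<tau>) * (KY * (1 + LY * \<tau>) ^ n) * \<tau>\<^sup>2"
      by (simp add: power2_eq_square power3_eq_cube)
    also have "\<dots> \<le> T * (KY * exp (LY * T)) * \<tau>\<^sup>2"
      using KY(1) LY(1) \<tau> n T by (intro mult_right_mono mult_mono gronwall_bound) auto
    finally show "real n * (KY * \<tau> ^ 3) * (1 + LY * \<tau>) ^ n \<le> C * \<tau>\<^sup>2" by (simp add: C_def mult.assoc)
  qed
  moreover have "0 \<le> C" using KY(1) T by (simp add: C_def)
  ultimately show ?thesis using \<tau>min(1) by blast
qed

end

section \<open>Choice of the norms\<close>

text \<open>
  A pair of norms that fits data in \<open>H^s\<close> and an error bound in \<open>H^r\<close>.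
\<close>

definition good_norms :: "real \<Rightarrow> real \<Rightarrow> (int ^ 'n::finite \<Rightarrow> real) set \<Rightarrow> (int ^ 'n \<Rightarrow> real) set \<Rightarrow> bool" where
  "good_norms s r X Y \<longleftrightarrow> test_family X \<and> test_family Y \<and> conv_bound X X \<and> conv_bound X Y \<and>
     (\<forall>B. \<exists>M. \<forall>f g. fnorm_le (l2_tests 1 s) f B \<longrightarrow> fnorm_le (l2_tests 1 s) g B \<longrightarrow>
        fnorm_le X f M \<and> fnorm_le Y f M \<and> fnorm_le (second_order Y) f M \<and>
        bilinear_le X (\<lambda>k. norm (freq k)) M f g \<and> bilinear_le Y ksq M f g) \<and>
     (\<exists>K\<ge>0. \<forall>a B. (\<forall>k. 0 \<le> a k) \<longrightarrow> dual_le Y a B \<longrightarrow> (\<forall>F. finite F \<longrightarrow> wnorm r a F \<le> K * B))"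

lemma fnorm_le_l2:
  "0 < c \<Longrightarrow> fnorm_le (l2_tests c s) f B \<longleftrightarrow> f \<in> wiener \<and> (\<forall>F. finite F \<longrightarrow> c * wnorm s (\<lambda>k. cmod (fc f k)) F \<le> B)"
  by (simp add: fnorm_le_def dual_le_l2)

lemma good_norms_supercritical:
  assumes \<sigma>: "\<sigma> > real CARD('n::finite) / 2" and r: "r \<le> \<sigma>"
  shows "\<exists>X Y :: (int ^ 'n \<Rightarrow> real) set. good_norms (\<sigma> + 2) r X Y"
proof -
  obtain c where c: "c > 0" and alg: "conv_bound (l2_tests c \<sigma> :: (int ^ 'n \<Rightarrow> real) set) (l2_tests c \<sigma>)"
    using conv_bound_l2[OF \<sigma>] by blast
  define X where "X = (l2_tests c \<sigma> :: (int ^ 'n \<Rightarrow> real) set)"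
  have tX: "test_family X" unfolding X_def by (rule test_family_l2[OF c])
  have alg: "conv_bound X X" using alg by (simp add: X_def)
  have bounds: "\<exists>M. \<forall>f g. fnorm_le (l2_tests 1 (\<sigma> + 2)) f B \<longrightarrow> fnorm_le (l2_tests 1 (\<sigma> + 2)) g B \<longrightarrow>
        fnorm_le X f M \<and> fnorm_le X f M \<and> fnorm_le (second_order X) f M \<and>
        bilinear_le X (\<lambda>k. norm (freq k)) M f g \<and> bilinear_le X ksq M f g" for B
  proof (intro exI allI impI)
    let ?M = "max (c * B) ((c * B) * (c * B))"
    fix f g :: "real ^ 'n \<Rightarrow> complex" assume f: "fnorm_le (l2_tests 1 (\<sigma> + 2)) f B" and g: "fnorm_le (l2_tests 1 (\<sigma> + 2)) g B"
    have dl: "dual_le X a (c * B)" if "\<And>k. 0 \<le> a k" "\<And>F. finite F \<Longrightarrow> wnorm \<sigma> a F \<le> B" for a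
      unfolding X_def using that c by (subst dual_le_l2[OF c]) (auto intro!: mult_left_mono)
    have w: "wnorm (\<sigma> + 2) (\<lambda>k. cmod (fc h k)) F \<le> B" if "fnorm_le (l2_tests 1 (\<sigma> + 2)) h B" "finite F"
      for h :: "real ^ 'n \<Rightarrow> complex" and F
      using that by (simp add: fnorm_le_l2)
    have 0: "dual_le X (\<lambda>k. cmod (fc h k)) (c * B)" if "fnorm_le (l2_tests 1 (\<sigma> + 2)) h B" for h
      by (intro dl order_trans[OF wnorm_mono_exponent w[OF that]]) auto
    have 2: "dual_le X (\<lambda>k. ksq k * cmod (fc h k)) (c * B)" if "fnorm_le (l2_tests 1 (\<sigma> + 2)) h B" for h
      by (intro dl order_trans[OF wnorm_ksq w[OF that]]) auto
    have 1: "dual_le X (\<lambda>k. norm (freq k) * cmod (fc h k)) (c * B)" if "fnorm_le (l2_tests 1 (\<sigma> + 2)) h B" for h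
      by (intro dl order_trans[OF wnorm_freq order_trans[OF wnorm_mono_exponent w[OF that]]]) auto
    have fX: "fnorm_le X f ?M"
      by (rule fnorm_le_mono[OF tX, of _ "c * B"]) (use f 0[OF f] in \<open>auto simp: fnorm_le_def\<close>)
    moreover have "fnorm_le (second_order X) f ?M"
      by (rule fnorm_le_mono[OF test_family_second_order[OF tX], of _ "c * B"])
        (use f 2[OF f] in \<open>auto simp: fnorm_le_def dual_le_second_order[OF tX]\<close>)
    moreover have "bilinear_le X (\<lambda>k. norm (freq k)) ?M f g"
      unfolding bilinear_le_def
      by (intro allI impI dual_le_mono[OF tX conv_bound_left[OF alg 1[OF f] 1[OF g]]]) auto
    moreover have "bilinear_le X ksq ?M f g"
      unfolding bilinear_le_def
      by (intro allI impI dual_le_mono[OF tX conv_bound_left[OF alg 2[OF f] 2[OF g]]]) auto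
    ultimately show "fnorm_le X f ?M \<and> fnorm_le X f ?M \<and> fnorm_le (second_order X) f ?M \<and>
        bilinear_le X (\<lambda>k. norm (freq k)) ?M f g \<and> bilinear_le X ksq ?M f g" by blast
  qed
  have control: "wnorm r a F \<le> (1 / c) * B" if a: "\<forall>k. 0 \<le> a k" "dual_le X a B" "finite F" for a B F
  proof -
    have "c * wnorm \<sigma> a F \<le> B" using a c unfolding X_def by (subst (asm) dual_le_l2[OF c]) auto
    moreover have "c * wnorm r a F \<le> c * wnorm \<sigma> a F"
      using a r c by (intro mult_left_mono wnorm_mono_exponent) auto
    ultimately have "c * wnorm r a F \<le> B" by linarith
    thus ?thesis using c by (simp add: pos_le_divide_eq mult.commute)
  qed
  have "good_norms (\<sigma> + 2) r X X"
    unfolding good_norms_def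
  proof (intro conjI tX alg allI bounds exI[of _ "1 / c"] impI)
    show "0 \<le> 1 / c" using c by simp
  qed (rule control)
  thus ?thesis by blast
qed

text \<open>
  For \<open>s = 2 + d/4\<close>, two derivatives leave \<open>H^(d/4)\<close>, on which the critical product estimate gives \<open>L2\<close>. One
  derivative leaves \<open>H^(1 + d/4)\<close>, which embeds into the Wiener algebra if \<open>1 + d/4 > d/2\<close>, that is, \<open>d < 4\<close>.
\<close>

lemma good_norms_L2:
  assumes d: "CARD('n::finite) \<in> {1, 2, 3}"
  shows "good_norms (2 + real CARD('n) / 4) 0 (l1_tests :: (int ^ 'n \<Rightarrow> real) set) (l2_tests 1 0)"
proof -
  let ?X = "l1_tests :: (int ^ 'n \<Rightarrow> real) set" and ?Y = "l2_tests 1 0 :: (int ^ 'n \<Rightarrow> real) set"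
  define d4 where "d4 = real CARD('n) / 4"
  have d4: "0 \<le> d4" by (simp add: d4_def)
  have s: "2 + d4 > real CARD('n) / 2" "1 + d4 > real CARD('n) / 2" using d by (auto simp: d4_def)
  have tX: "test_family ?X" by (rule test_family_l1)
  have tY: "test_family ?Y" by (rule test_family_l2) simp
  obtain C where C: "C > 0" "\<And>(a :: int ^ 'n \<Rightarrow> real) F. \<forall>k. 0 \<le> a k \<Longrightarrow> finite F \<Longrightarrow> sum a F \<le> C * wnorm (1 + d4) a F"
    using sum_le_wnorm[OF s(2)] by blast
  have bounds: "\<exists>M. \<forall>f g. fnorm_le (l2_tests 1 (2 + d4)) f B \<longrightarrow> fnorm_le (l2_tests 1 (2 + d4)) g B \<longrightarrow>
        fnorm_le ?X f M \<and> fnorm_le ?Y f M \<and> fnorm_le (second_order ?Y) f M \<and>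
        bilinear_le ?X (\<lambda>k. norm (freq k)) M f g \<and> bilinear_le ?Y ksq M f g" for B
  proof (intro exI allI impI)
    let ?M = "max (max (C * B) B) (max ((C * B) * (C * B)) (2 ^ (CARD('n) + 1) * (B * B)))"
    fix f g :: "real ^ 'n \<Rightarrow> complex" assume f: "fnorm_le (l2_tests 1 (2 + d4)) f B" and g: "fnorm_le (l2_tests 1 (2 + d4)) g B"
    have w: "wnorm (2 + d4) (\<lambda>k. cmod (fc h k)) F \<le> B" if "fnorm_le (l2_tests 1 (2 + d4)) h B" "finite F"
      for h :: "real ^ 'n \<Rightarrow> complex" and F
      using that by (simp add: fnorm_le_l2)
    have dX: "dual_le ?X a (C * B)" if "\<And>k. 0 \<le> a k" "\<And>F. finite F \<Longrightarrow> wnorm (1 + d4) a F \<le> B" for a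
      unfolding dual_le_l1
    proof (intro allI impI)
      fix F :: "(int ^ 'n) set" assume F: "finite F"
      have "sum a F \<le> C * wnorm (1 + d4) a F" using that(1) F by (intro C(2)) auto
      also have "\<dots> \<le> C * B" using C(1) that(2)[OF F] by (intro mult_left_mono) auto
      finally show "sum a F \<le> C * B" .
    qed
    have dY: "dual_le ?Y a B" if "\<And>k. 0 \<le> a k" "\<And>F. finite F \<Longrightarrow> wnorm 0 a F \<le> B" for a
      using that by (subst dual_le_l2) auto
    have w2: "wnorm d4 (\<lambda>k. ksq k * cmod (fc h k)) F \<le> B" if "fnorm_le (l2_tests 1 (2 + d4)) h B" "finite F"
      for h :: "real ^ 'n \<Rightarrow> complex" and F
      using order_trans[OF wnorm_ksq w[OF that, unfolded add.commute[of 2]]] by simp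
    have 0: "dual_le ?X (\<lambda>k. cmod (fc f k)) (C * B)"
      by (intro dX order_trans[OF wnorm_mono_exponent w[OF f]]) auto
    have zY: "dual_le ?Y (\<lambda>k. cmod (fc f k)) B"
      by (intro dY order_trans[OF wnorm_mono_exponent w[OF f]]) (use d4 in auto)
    have 2: "dual_le ?Y (\<lambda>k. ksq k * cmod (fc f k)) B"
      by (intro dY order_trans[OF wnorm_mono_exponent w2[OF f]]) (use d4 in auto)
    have 1: "dual_le ?X (\<lambda>k. norm (freq k) * cmod (fc h k)) (C * B)" if "fnorm_le (l2_tests 1 (2 + d4)) h B" for h
    proof (rule dX)
      fix F :: "(int ^ 'n) set" assume F: "finite F"
      have "wnorm (1 + d4) (\<lambda>k. norm (freq k) * cmod (fc h k)) F \<le> wnorm (1 + d4 + 1) (\<lambda>k. cmod (fc h k)) F"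
        by (rule wnorm_freq) simp
      also have "1 + d4 + 1 = 2 + d4" by simp
      also have "wnorm (2 + d4) (\<lambda>k. cmod (fc h k)) F \<le> B" by (rule w[OF that F])
      finally show "wnorm (1 + d4) (\<lambda>k. norm (freq k) * cmod (fc h k)) F \<le> B" .
    qed simp
    have "fnorm_le ?X f ?M"
      by (rule fnorm_le_mono[OF tX, of _ "C * B"]) (use f 0 in \<open>auto simp: fnorm_le_def\<close>)
    moreover have "fnorm_le ?Y f ?M"
      by (rule fnorm_le_mono[OF tY, of _ B]) (use f zY in \<open>auto simp: fnorm_le_def\<close>)
    moreover have "fnorm_le (second_order ?Y) f ?M"
      by (rule fnorm_le_mono[OF test_family_second_order[OF tY], of _ B])
        (use f 2 in \<open>auto simp: fnorm_le_def dual_le_second_order[OF tY]\<close>)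
    moreover have "bilinear_le ?X (\<lambda>k. norm (freq k)) ?M f g"
      unfolding bilinear_le_def
      by (intro allI impI dual_le_mono[OF tX conv_bound_left[OF conv_bound_l1 1[OF f] 1[OF g]]]) auto
    moreover have "bilinear_le ?Y ksq ?M f g"
      unfolding bilinear_le_def
    proof (intro allI impI)
      fix J :: "(int ^ 'n) set" assume J: "finite J"
      have "L2_set (fconv J (\<lambda>k. ksq k * cmod (fc f k)) (\<lambda>k. ksq k * cmod (fc g k))) F \<le> 2 ^ (CARD('n) + 1) * (B * B)"
        if F: "finite F" for F
        by (rule wnorm_critical[OF _ _ J F w2[OF f, unfolded d4_def] w2[OF g, unfolded d4_def]]) auto
      hence "dual_le ?Y (fconv J (\<lambda>k. ksq k * cmod (fc f k)) (\<lambda>k. ksq k * cmod (fc g k))) (2 ^ (CARD('n) + 1) * (B * B))"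
        by (subst dual_le_l2) (auto simp: wnorm_0 fconv_nonneg)
      thus "dual_le ?Y (fconv J (\<lambda>k. ksq k * cmod (fc f k)) (\<lambda>k. ksq k * cmod (fc g k))) ?M"
        by (rule dual_le_mono[OF tY]) auto
    qed
    ultimately show "fnorm_le ?X f ?M \<and> fnorm_le ?Y f ?M \<and> fnorm_le (second_order ?Y) f ?M \<and>
        bilinear_le ?X (\<lambda>k. norm (freq k)) ?M f g \<and> bilinear_le ?Y ksq ?M f g" by blast
  qed
  show ?thesis
    unfolding good_norms_def d4_def[symmetric]
  proof (intro conjI tX tY conv_bound_l1 conv_bound_l1_l2 allI bounds exI[of _ 1] impI)
    fix a :: "int ^ 'n \<Rightarrow> real" and B and F :: "(int ^ 'n) set" assume "\<forall>k. 0 \<le> a k" "dual_le ?Y a B" "finite F"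
    thus "wnorm 0 a F \<le> 1 * B" by (subst (asm) dual_le_l2) auto
  qed auto
qed

section \<open>From mild solutions to Fourier coefficients\<close>

lemma wnorm_diff_le:
  fixes a b :: "int ^ 'n::finite \<Rightarrow> complex"
  shows "wnorm s (\<lambda>k. cmod (a k - b k)) F \<le> wnorm s (\<lambda>k. cmod (a k)) F + wnorm s (\<lambda>k. cmod (b k)) F"
proof -
  have "wnorm s (\<lambda>k. cmod (a k - b k)) F \<le> L2_set (\<lambda>k. bracket k powr s * cmod (a k) + bracket k powr s * cmod (b k)) F"
    unfolding wnorm_def distrib_left[symmetric] by (intro L2_set_mono mult_left_mono norm_triangle_ineq4) auto
  also have "\<dots> \<le> wnorm s (\<lambda>k. cmod (a k)) F + wnorm s (\<lambda>k. cmod (b k)) F"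
    unfolding wnorm_def by (rule L2_set_triangle_ineq)
  finally show ?thesis .
qed

lemma sobolev_diff:
  assumes "0 \<le> s" "f \<in> sobolev s" "g \<in> sobolev s"
  shows "(\<lambda>x. f x - g x) \<in> sobolev s"
proof (rule sobolevI(1)[OF assms(1)])
  have fg: "f \<in> torus_L2" "g \<in> torus_L2" using assms by (auto simp: sobolev_def)
  show "(\<lambda>x. f x - g x) \<in> torus_L2" by (rule torus_L2_diff[OF fg])
  fix F :: "(int ^ 'a) set" assume F: "finite F"
  have "wnorm s (\<lambda>k. cmod (fc (\<lambda>x. f x - g x) k)) F \<le> wnorm s (\<lambda>k. cmod (fc f k)) F + wnorm s (\<lambda>k. cmod (fc g k)) F"
    unfolding fc_diff_L2[OF fg] by (rule wnorm_diff_le)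
  also have "\<dots> \<le> 2 powr s * sobolev_norm s f + 2 powr s * sobolev_norm s g"
    by (intro add_mono wnorm_le_sobolev_norm assms F)
  finally show "wnorm s (\<lambda>k. cmod (fc (\<lambda>x. f x - g x) k)) F \<le> 2 powr s * sobolev_norm s f + 2 powr s * sobolev_norm s g" .
qed

lemma fc_le_fnorm_l1: "fnorm_le l1_tests f B \<Longrightarrow> cmod (fc f k) \<le> B"
  unfolding fnorm_le_def dual_le_l1 by (auto dest!: spec[of _ "{k}"])

lemma gpF_lipschitz_l1:
  assumes V: "fnorm_le l1_tests V A" and v: "fnorm_le l1_tests v A" and w: "fnorm_le l1_tests w A"
    and d: "fnorm_le l1_tests (\<lambda>x. v x - w x) e"
  shows "fnorm_le l1_tests (\<lambda>x. gpF V v x - gpF V w x) ((A + 3 * A\<^sup>2) * e)"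
proof -
  note t = test_family_l1 and m = fnorm_le_mult[OF test_family_l1 conv_bound_l1]
  have "fnorm_le l1_tests (\<lambda>x. (V x + (v x + w x) * cnj (v x)) * (v x - w x) + w x * w x * cnj (v x - w x))
     ((A + (A + A) * A) * e + A * A * e)"
    by (intro fnorm_le_add[OF t] m fnorm_le_cnj[OF t] V v w d)
  moreover have "(V x + (v x + w x) * cnj (v x)) * (v x - w x) + w x * w x * cnj (v x - w x) = gpF V v x - gpF V w x" for x
    by (simp add: gpF_def power2_eq_square algebra_simps)
  moreover have "(A + (A + A) * A) * e + A * A * e = (A + 3 * A\<^sup>2) * e" by (simp add: power2_eq_square algebra_simps)
  ultimately show ?thesis by simp
qed

lemma gpF_bound_l1:
  assumes V: "fnorm_le l1_tests V A" and v: "fnorm_le l1_tests v A"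
  shows "fnorm_le l1_tests (gpF V v) (A * A + A * A * A)"
  unfolding gpF_def[abs_def] power2_eq_square
  by (intro fnorm_le_add[OF test_family_l1] fnorm_le_mult[OF test_family_l1 conv_bound_l1] fnorm_le_cnj[OF test_family_l1] V v)

lemma torus_L2_meas: "f \<in> torus_L2 \<Longrightarrow> f \<in> borel_measurable torus_measure"
  by (simp add: torus_L2_def)

lemma borel_measurable_cnj [measurable]: "f \<in> borel_measurable M \<Longrightarrow> (\<lambda>x. cnj (f x)) \<in> borel_measurable M"
  by (rule measurable_compose[of f M borel cnj]) (auto intro!: borel_measurable_continuous_onI continuous_intros)

text \<open>
  Above \<open>d/2\<close> every element of \<open>H^s\<close> has a representative in the Wiener algebra.
\<close>

locale mild_solution =
  fixes s T :: real and V u0 :: "real ^ 'n::finite \<Rightarrow> complex" and u :: "real \<Rightarrow> real ^ 'n \<Rightarrow> complex"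
  assumes s: "s > real CARD('n) / 2" and T: "0 < T" and u0: "u0 \<in> sobolev s" and V: "V \<in> sobolev s"
    and mild: "gp_mild_solution s T V u0 u"
begin

lemma s_nonneg: "0 \<le> s"
  using s by (meson less_imp_le order_le_less_trans of_nat_0_le_iff divide_nonneg_nonneg zero_le_numeral)

lemma u_sobolev: "t \<in> {0..T} \<Longrightarrow> u t \<in> sobolev s"
  using mild by (auto simp: gp_mild_solution_def continuous_into_sobolev_def)

lemma u_cont: "t \<in> {0..T} \<Longrightarrow> ((\<lambda>s'. sobolev_norm s (\<lambda>x. u s' x - u t x)) \<longlongrightarrow> 0) (at t within {0..T})"
  using mild by (auto simp: gp_mild_solution_def continuous_into_sobolev_def)

definition rep :: "(real ^ 'n \<Rightarrow> complex) \<Rightarrow> real ^ 'n \<Rightarrow> complex" where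
  "rep f = synth (fc f)"

lemma rep:
  assumes "f \<in> sobolev s"
  shows "rep f \<in> wiener" "fc (rep f) = fc f" "AE x in torus_measure. f x = rep f x" "f \<in> torus_L2"
proof -
  have S: "summable_abs (fc f)" by (rule sobolev_summable[OF s assms])
  show f: "f \<in> torus_L2" using assms by (simp add: sobolev_def)
  show "rep f \<in> wiener" "fc (rep f) = fc f" unfolding rep_def using S by (simp_all add: wiener_synth fc_synth)
  show "AE x in torus_measure. f x = rep f x" unfolding rep_def by (rule AE_eq_synth[OF f S])
qed

lemma fnorm_le_rep:
  assumes "f \<in> sobolev s"
  shows "fnorm_le (l2_tests 1 s) (rep f) (2 powr s * sobolev_norm s f)"
  unfolding fnorm_le_l2[OF zero_less_one] using rep[OF assms] wnorm_le_sobolev_norm[OF s_nonneg assms] by simp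

lemma rep_diff:
  assumes "f \<in> sobolev s" "g \<in> sobolev s"
  shows "rep (\<lambda>x. f x - g x) = (\<lambda>x. rep f x - rep g x)"
  by (rule wiener_eqI)
    (use rep[OF assms(1)] rep[OF assms(2)] rep[OF sobolev_diff[OF s_nonneg assms]] fc_diff_L2[of f g] in \<open>auto simp: wiener_diff\<close>)

text \<open>
  Continuity in time gives a bound near each time, and finitely many of these cover the time interval.
\<close>

lemma uniform_bound: "\<exists>B\<ge>0. \<forall>t\<in>{0..T}. fnorm_le (l2_tests 1 s) (rep (u t)) B"
proof -
  note tt = test_family_l2[of 1 s, OF zero_less_one]
  define c where "c t = 2 powr s * (sobolev_norm s (u t) + 1)" for t
  have c0: "0 \<le> c t" for t
    by (simp add: c_def sobolev_norm_def infsum_nonneg add_nonneg_nonneg)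
  have "\<exists>\<delta>>0. \<forall>t'\<in>{0..T}. dist t' t < \<delta> \<longrightarrow> fnorm_le (l2_tests 1 s) (rep (u t')) (c t)" if t: "t \<in> {0..T}" for t
  proof -
    have "eventually (\<lambda>t'. sobolev_norm s (\<lambda>x. u t' x - u t x) < 1) (at t within {0..T})"
      using u_cont[OF t] by (rule order_tendstoD) simp
    then obtain \<delta> where \<delta>: "\<delta> > 0" "\<And>t'. t' \<in> {0..T} \<Longrightarrow> t' \<noteq> t \<Longrightarrow> dist t' t < \<delta> \<Longrightarrow> sobolev_norm s (\<lambda>x. u t' x - u t x) < 1"
      unfolding eventually_at by blast
    have "fnorm_le (l2_tests 1 s) (rep (u t')) (c t)" if t': "t' \<in> {0..T}" "dist t' t < \<delta>" for t'
    proof (cases "t' = t")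
      case True
      have "fnorm_le (l2_tests 1 s) (rep (u t)) (2 powr s * sobolev_norm s (u t))" by (rule fnorm_le_rep[OF u_sobolev[OF t]])
      thus ?thesis unfolding True by (rule fnorm_le_mono[OF tt]) (simp add: c_def)
    next
      case False
      note ut = u_sobolev[OF t] and ut' = u_sobolev[OF t'(1)]
      have "fnorm_le (l2_tests 1 s) (\<lambda>x. rep (u t) x + (rep (u t') x - rep (u t) x))
         (2 powr s * sobolev_norm s (u t) + 2 powr s * sobolev_norm s (\<lambda>x. u t' x - u t x))"
        using fnorm_le_rep[OF sobolev_diff[OF s_nonneg ut' ut]] unfolding rep_diff[OF ut' ut]
        by (intro fnorm_le_add[OF tt] fnorm_le_rep[OF ut])
      hence "fnorm_le (l2_tests 1 s) (rep (u t')) (2 powr s * sobolev_norm s (u t) + 2 powr s * sobolev_norm s (\<lambda>x. u t' x - u t x))"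
        by simp
      thus ?thesis
      proof (rule fnorm_le_mono[OF tt])
        have "2 powr s * sobolev_norm s (\<lambda>x. u t' x - u t x) \<le> 2 powr s * 1"
          using \<delta>(2)[OF t'(1) False t'(2)] by (intro mult_left_mono) auto
        thus "2 powr s * sobolev_norm s (u t) + 2 powr s * sobolev_norm s (\<lambda>x. u t' x - u t x) \<le> c t"
          by (simp add: c_def distrib_left)
      qed
    qed
    thus ?thesis using \<delta>(1) by blast
  qed
  then obtain \<delta> where \<delta>: "\<And>t. t \<in> {0..T} \<Longrightarrow> \<delta> t > 0"
    "\<And>t t'. t \<in> {0..T} \<Longrightarrow> t' \<in> {0..T} \<Longrightarrow> dist t' t < \<delta> t \<Longrightarrow> fnorm_le (l2_tests 1 s) (rep (u t')) (c t)"
    by metis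
  have "{0..T} \<subseteq> (\<Union>t\<in>{0..T}. ball t (\<delta> t))" using \<delta>(1) by force
  note cover = this
  obtain C where C: "C \<subseteq> {0..T}" "finite C" "{0..T} \<subseteq> (\<Union>t\<in>C. ball t (\<delta> t))"
    by (rule compactE_image[OF compact_Icc[of 0 T], of "{0..T}" "\<lambda>t. ball t (\<delta> t)"]) (use cover in auto)
  show ?thesis
  proof (intro exI[of _ "sum c C"] conjI ballI)
    show "0 \<le> sum c C" using c0 by (intro sum_nonneg) auto
    fix t' assume t': "t' \<in> {0..T}"
    then obtain t where t: "t \<in> C" "t' \<in> ball t (\<delta> t)" using C(3) by blast
    have "fnorm_le (l2_tests 1 s) (rep (u t')) (c t)" using t C(1) t' by (intro \<delta>(2)) (auto simp: dist_commute)
    moreover have "c t \<le> sum c C" using t C(2) c0 by (intro member_le_sum) auto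
    ultimately show "fnorm_le (l2_tests 1 s) (rep (u t')) (sum c C)" by (rule fnorm_le_mono[OF tt])
  qed
qed

lemma l1_embedding: "\<exists>C\<ge>0. \<forall>f B. fnorm_le (l2_tests 1 s) f B \<longrightarrow> fnorm_le (l1_tests :: (int ^ 'n \<Rightarrow> real) set) f (C * B)"
proof -
  obtain C where C: "C > 0" "\<And>(a :: int ^ 'n \<Rightarrow> real) F. \<forall>k. 0 \<le> a k \<Longrightarrow> finite F \<Longrightarrow> sum a F \<le> C * wnorm s a F"
    using sum_le_wnorm[OF s] by blast
  have "fnorm_le l1_tests f (C * B)" if f: "fnorm_le (l2_tests 1 s) f B" for f :: "real ^ 'n \<Rightarrow> complex" and B
    unfolding fnorm_le_def dual_le_l1
  proof (intro conjI allI impI)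
    show "f \<in> wiener" using f by (simp add: fnorm_le_def)
    fix F :: "(int ^ 'n) set" assume F: "finite F"
    have "(\<Sum>k\<in>F. cmod (fc f k)) \<le> C * wnorm s (\<lambda>k. cmod (fc f k)) F" by (rule C(2)[OF _ F]) simp
    also have "\<dots> \<le> C * B" using f F C(1) by (intro mult_left_mono) (auto simp: fnorm_le_l2)
    finally show "(\<Sum>k\<in>F. cmod (fc f k)) \<le> C * B" .
  qed
  thus ?thesis using C(1) by (intro exI[of _ C]) auto
qed

lemma l1_bound: "\<exists>A. fnorm_le (l1_tests :: (int ^ 'n \<Rightarrow> real) set) (rep V) A \<and> (\<forall>t\<in>{0..T}. fnorm_le l1_tests (rep (u t)) A)"
proof -
  obtain B where B: "0 \<le> B" "\<And>t. t \<in> {0..T} \<Longrightarrow> fnorm_le (l2_tests 1 s) (rep (u t)) B" using uniform_bound by blast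
  obtain C where C: "0 \<le> C" "\<And>f B. fnorm_le (l2_tests 1 s) f B \<Longrightarrow> fnorm_le (l1_tests :: (int ^ 'n \<Rightarrow> real) set) f (C * B)"
    using l1_embedding by blast
  let ?A = "max (C * B) (C * (2 powr s * sobolev_norm s V))"
  show ?thesis
    using fnorm_le_mono[OF test_family_l1 C(2)[OF B(2)], of _ ?A] fnorm_le_mono[OF test_family_l1 C(2)[OF fnorm_le_rep[OF V]], of ?A] by auto
qed

abbreviation "F_coeff \<equiv> \<lambda>k \<zeta>. fc (gpF (rep V) (rep (u \<zeta>))) k"

lemma continuous_F_coeff: "continuous_on {0..T} (F_coeff k)"
  unfolding continuous_on_def
proof
  fix t assume t: "t \<in> {0..T}"
  obtain A where A: "fnorm_le l1_tests (rep V) A" "\<And>t. t \<in> {0..T} \<Longrightarrow> fnorm_le l1_tests (rep (u t)) A"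
    using l1_bound by blast
  obtain C where C: "0 \<le> C" "\<And>f B. fnorm_le (l2_tests 1 s) f B \<Longrightarrow> fnorm_le (l1_tests :: (int ^ 'n \<Rightarrow> real) set) f (C * B)"
    using l1_embedding by blast
  let ?e = "\<lambda>t'. (A + 3 * A\<^sup>2) * (C * (2 powr s * sobolev_norm s (\<lambda>x. u t' x - u t x)))"
  have "cmod (F_coeff k t' - F_coeff k t) \<le> ?e t'" if t': "t' \<in> {0..T}" for t'
  proof -
    note w = rep(1)[OF V] rep(1)[OF u_sobolev[OF t']] rep(1)[OF u_sobolev[OF t]]
    have "fnorm_le l1_tests (\<lambda>x. rep (u t') x - rep (u t) x) (C * (2 powr s * sobolev_norm s (\<lambda>x. u t' x - u t x)))"
      using C(2)[OF fnorm_le_rep[OF sobolev_diff[OF s_nonneg u_sobolev[OF t'] u_sobolev[OF t]]]]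
      unfolding rep_diff[OF u_sobolev[OF t'] u_sobolev[OF t]] .
    from fc_le_fnorm_l1[OF gpF_lipschitz_l1[OF A(1) A(2)[OF t'] A(2)[OF t] this], of k]
    show ?thesis using w by (simp add: wiener_diff gpF_wiener)
  qed
  hence ev: "eventually (\<lambda>t'. norm (F_coeff k t' - F_coeff k t) \<le> ?e t') (at t within {0..T})"
    by (auto simp: eventually_at intro!: exI[of _ 1])
  have "(?e \<longlongrightarrow> (A + 3 * A\<^sup>2) * (C * (2 powr s * 0))) (at t within {0..T})"
    by (rule tendsto_mult[OF tendsto_const tendsto_mult[OF tendsto_const tendsto_mult[OF tendsto_const u_cont[OF t]]]])
  hence lim: "(?e \<longlongrightarrow> 0) (at t within {0..T})" by simp
  have "((\<lambda>t'. F_coeff k t' - F_coeff k t) \<longlongrightarrow> 0) (at t within {0..T})"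
    by (rule Lim_null_comparison[OF ev lim])
  thus "(F_coeff k \<longlongrightarrow> F_coeff k t) (at t within {0..T})" by (simp add: LIM_zero_iff)
qed

lemma laplace_rhs:
  assumes "\<zeta> \<in> {0..T}"
  shows "laplace_op \<phi> \<xi> (\<lambda>y. V y * u \<zeta> y + (u \<zeta> y)\<^sup>2 * cnj (u \<zeta> y)) = laplace_op \<phi> \<xi> (gpF (rep V) (rep (u \<zeta>)))"
proof (rule laplace_cong, rule fc_cong_AE)
  note V' = rep[OF V] and u' = rep[OF u_sobolev[OF assms]]
  show "AE x in torus_measure. V x * u \<zeta> x + (u \<zeta> x)\<^sup>2 * cnj (u \<zeta> x) = gpF (rep V) (rep (u \<zeta>)) x"
    using V'(3) u'(3) by eventually_elim (simp add: gpF_def)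
  note [measurable] = torus_L2_meas[OF V'(4)] torus_L2_meas[OF u'(4)]
  show "(\<lambda>y. V y * u \<zeta> y + (u \<zeta> y)\<^sup>2 * cnj (u \<zeta> y)) \<in> borel_measurable torus_measure" by measurable
  show "gpF (rep V) (rep (u \<zeta>)) \<in> borel_measurable torus_measure"
    by (intro torus_L2_meas wiener_torus_L2 gpF_wiener V' u')
qed

text \<open>
  The pointwise integral in Duhamel's formula is exchanged with the Fourier series, and coefficients are compared
  by uniqueness.
\<close>

lemma duhamel_coeff:
  assumes t: "t \<in> {0..T}"
  shows "fc (u t) k = symb exp t k * fc u0 k - \<i> * integral {0..t} (\<lambda>\<zeta>. symb exp (t - \<zeta>) k * F_coeff k \<zeta>)"
proof -
  obtain A where A: "fnorm_le l1_tests (rep V) A" "\<And>t. t \<in> {0..T} \<Longrightarrow> fnorm_le l1_tests (rep (u t)) A"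
    using l1_bound by blast
  define B where "B = A * A + A * A * A"
  define g where "g k \<zeta> = symb exp (t - \<zeta>) k * F_coeff k \<zeta>" for k \<zeta>
  have sub: "{0..t} \<subseteq> {0..T}" using t by auto
  have cont: "continuous_on {0..t} (g k)" for k
    unfolding g_def by (intro continuous_intros continuous_on_subset[OF continuous_F_coeff sub])
  have ng: "cmod (g k \<zeta>) = cmod (F_coeff k \<zeta>)" for k \<zeta> by (simp add: g_def norm_mult)
  \<comment> \<open>The Wiener norm of the nonlinearity is bounded uniformly in time.\<close>
  have bd: "(\<Sum>k\<in>F. cmod (g k \<zeta>)) \<le> B" if "finite F" "\<zeta> \<in> {0..t}" for F \<zeta>
    unfolding ng B_def using gpF_bound_l1[OF A(1) A(2), of \<zeta>] that sub by (auto simp: fnorm_le_def dual_le_l1)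
  have int: "integral {0..t} (\<lambda>\<zeta>. laplace_op exp (t - \<zeta>) (\<lambda>y. V y * u \<zeta> y + (u \<zeta> y)\<^sup>2 * cnj (u \<zeta> y)) x)
    = synth (\<lambda>k. integral {0..t} (g k)) x" for x
  proof -
    have "integral {0..t} (\<lambda>\<zeta>. laplace_op exp (t - \<zeta>) (\<lambda>y. V y * u \<zeta> y + (u \<zeta> y)\<^sup>2 * cnj (u \<zeta> y)) x)
       = integral {0..t} (\<lambda>\<zeta>. \<Sum>\<^sub>\<infinity>k. g k \<zeta> * cis (freq k \<bullet> x))"
    proof (rule integral_cong)
      fix \<zeta> assume "\<zeta> \<in> {0..t}"
      hence "\<zeta> \<in> {0..T}" using sub by blast
      show "laplace_op exp (t - \<zeta>) (\<lambda>y. V y * u \<zeta> y + (u \<zeta> y)\<^sup>2 * cnj (u \<zeta> y)) x = (\<Sum>\<^sub>\<infinity>k. g k \<zeta> * cis (freq k \<bullet> x))"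
        unfolding laplace_rhs[OF \<open>\<zeta> \<in> {0..T}\<close>] by (simp add: laplace_op_fmult fmult_def synth_def g_def)
    qed
    also have "\<dots> = (\<Sum>\<^sub>\<infinity>k. integral {0..t} (\<lambda>\<zeta>. g k \<zeta> * cis (freq k \<bullet> x)))"
      by (rule integral_unique, rule has_integral_infsum_bounded(1)[where B = B])
        (use bd in \<open>auto intro!: continuous_intros cont simp: norm_mult\<close>)
    finally show ?thesis by (simp add: synth_def)
  qed
  have SI: "summable_abs (\<lambda>k. integral {0..t} (g k))" by (rule has_integral_infsum_bounded(2)[OF cont bd])
  have S0: "summable_abs (fc u0)" by (rule sobolev_summable[OF s u0])
  have S1: "summable_abs (\<lambda>k. symb exp t k * fc u0 k)"
    by (rule summable_abs_bounded_mult[OF S0, of _ 1]) (use unit_symbol_symb[OF unit_symbol_exp] in auto)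
  let ?f = "\<lambda>x. synth (\<lambda>k. symb exp t k * fc u0 k) x - \<i> * synth (\<lambda>k. integral {0..t} (g k)) x"
  have w: "?f \<in> wiener" and fcf: "fc ?f = (\<lambda>k. symb exp t k * fc u0 k - \<i> * integral {0..t} (g k))"
    using S1 SI by (simp_all add: wiener_diff wiener_cmult wiener_synth fc_synth del: mult_minus_left)
  have "AE x in torus_measure. u t x = laplace_op exp t u0 x
          - \<i> * integral {0..t} (\<lambda>\<zeta>. laplace_op exp (t - \<zeta>) (\<lambda>y. V y * u \<zeta> y + (u \<zeta> y)\<^sup>2 * cnj (u \<zeta> y)) x)"
    using mild t by (auto simp: gp_mild_solution_def)
  hence "AE x in torus_measure. u t x = ?f x"
    unfolding int unfolding laplace_op_fmult fmult_def .
  hence "fc (u t) = fc ?f"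
    by (rule fc_cong_AE) (use w rep(4)[OF u_sobolev[OF t]] in \<open>auto intro: torus_L2_meas wiener_torus_L2\<close>)
  thus ?thesis unfolding fcf g_def by simp
qed

lemma fc_initial: "fc (u 0) = fc u0"
  using duhamel_coeff[of 0] T by auto

text \<open>
  Subtracting Duhamel's formula from \<open>0\<close> to \<open>t\<close> from the one up to \<open>t + \<sigma>\<close> in the twisted variable moves the
  initial time to \<open>t\<close>.
\<close>

lemma duhamel_twisted:
  assumes "0 \<le> t" "0 \<le> \<sigma>" "t + \<sigma> \<le> T"
  shows "((\<lambda>\<zeta>. fc (laplace_op exp (- \<zeta>) (gpF (rep V) (rep (u (t + \<zeta>))))) k) has_integral
        fc (\<lambda>x. \<i> * (laplace_op exp (- \<sigma>) (rep (u (t + \<sigma>))) x - rep (u t) x)) k) {0..\<sigma>}"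
proof -
  define e where "e y = exp (\<i> * of_real (y * ksq k))" for y
  have e_add: "e (x + y) = e x * e y" for x y by (simp add: e_def exp_add[symmetric] algebra_simps)
  have e0: "e 0 = 1" by (simp add: e_def)
  have symb_e: "symb exp y k = e (- y)" for y by (simp add: e_def)
  define h where "h \<zeta> = e \<zeta> * F_coeff k \<zeta>" for \<zeta>
  have conth: "continuous_on {0..T} h"
    unfolding h_def e_def by (intro continuous_intros continuous_F_coeff)
  have inth: "h integrable_on {a..b}" if "0 \<le> a" "b \<le> T" for a b
    by (rule integrable_continuous_interval, rule continuous_on_subset[OF conth]) (use that in auto)
  have a: "e t * fc (u t) k = fc u0 k - \<i> * integral {0..t} h" if t: "t \<in> {0..T}" for t
  proof -
    have "integral {0..t} (\<lambda>\<zeta>. symb exp (t - \<zeta>) k * F_coeff k \<zeta>) = integral {0..t} (\<lambda>\<zeta>. e (- t) * h \<zeta>)"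
      unfolding symb_e h_def mult.assoc[symmetric] e_add[symmetric] by simp
    also have "\<dots> = e (- t) * integral {0..t} h" by simp
    finally have "fc (u t) k = e (- t) * (fc u0 k - \<i> * integral {0..t} h)"
      unfolding duhamel_coeff[OF t] symb_e by (simp add: algebra_simps)
    hence "e t * fc (u t) k = (e t * e (- t)) * (fc u0 k - \<i> * integral {0..t} h)" by simp
    thus ?thesis unfolding e_add[symmetric] by (simp add: e0)
  qed
  have "integral {0..t} h + integral {t..t + \<sigma>} h = integral {0..t + \<sigma>} h"
    by (rule Henstock_Kurzweil_Integration.integral_combine) (use assms inth in auto)
  hence I: "integral {t..t + \<sigma>} h = \<i> * (e (t + \<sigma>) * fc (u (t + \<sigma>)) k - e t * fc (u t) k)"
    using assms by (subst (1 2) a) (auto simp: algebra_simps)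
  have "(h has_integral integral {t..t + \<sigma>} h) (cbox t (t + \<sigma>))"
    using inth[of t "t + \<sigma>"] assms by (auto simp: has_integral_iff)
  from has_integral_affinity'[OF this zero_less_one, of t]
  have "((\<lambda>\<zeta>. h (\<zeta> + t)) has_integral integral {t..t + \<sigma>} h) {0..\<sigma>}" by simp
  hence h1: "((\<lambda>\<zeta>. e (- t) * h (\<zeta> + t)) has_integral e (- t) * integral {t..t + \<sigma>} h) {0..\<sigma>}"
    by (rule has_integral_mult_right)
  have h2: "e (- t) * integral {t..t + \<sigma>} h = fc (\<lambda>x. \<i> * (laplace_op exp (- \<sigma>) (rep (u (t + \<sigma>))) x - rep (u t) x)) k"
  proof -
    have 1: "t \<in> {0..T}" "t + \<sigma> \<in> {0..T}" using assms by auto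
    note r = rep[OF u_sobolev[OF 1(1)]] rep[OF u_sobolev[OF 1(2)]]
    have 2: "e (- t) * e (t + \<sigma>) = e \<sigma>" "e (- t) * e t = 1" unfolding e_add[symmetric] by (simp_all add: e0)
    have "e (- t) * integral {t..t + \<sigma>} h = \<i> * ((e (- t) * e (t + \<sigma>)) * fc (u (t + \<sigma>)) k - (e (- t) * e t) * fc (u t) k)"
      unfolding I by (simp add: algebra_simps)
    also have "\<dots> = \<i> * (e \<sigma> * fc (u (t + \<sigma>)) k - fc (u t) k)" unfolding 2 by simp
    also have "\<dots> = fc (\<lambda>x. \<i> * (laplace_op exp (- \<sigma>) (rep (u (t + \<sigma>))) x - rep (u t) x)) k"
      using r by (simp add: wiener_cmult wiener_diff prop_wiener e_def)
    finally show ?thesis .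
  qed
  have h3: "e (- t) * h (\<zeta> + t) = fc (laplace_op exp (- \<zeta>) (gpF (rep V) (rep (u (t + \<zeta>))))) k" if "\<zeta> \<in> {0..\<sigma>}" for \<zeta>
  proof -
    have "t + \<zeta> \<in> {0..T}" using that assms by auto
    note r = rep(1)[OF u_sobolev[OF this]] rep(1)[OF V]
    have "e (- t) * e (\<zeta> + t) = e \<zeta>" unfolding e_add[symmetric] by simp
    hence "e (- t) * h (\<zeta> + t) = e \<zeta> * F_coeff k (t + \<zeta>)" unfolding h_def mult.assoc[symmetric] by (simp add: add.commute)
    thus ?thesis using r by (simp add: prop_wiener gpF_wiener e_def)
  qed
  show ?thesis by (rule has_integral_eq[OF h3 h1[unfolded h2]])
qed

text \<open>
  For \<open>G\<close> a ball of \<open>H^s\<close> is taken, whose radius bounds the solution, the potential and the constant \<open>1\<close>.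
\<close>

lemma gp_setting_rep:
  fixes X Y :: "(int ^ 'n \<Rightarrow> real) set"
  assumes "good_norms s r X Y"
  shows "\<exists>G M. gp_setting X Y G (rep V) (\<lambda>t. rep (u t)) T M"
proof -
  note tt = test_family_l2[of 1 s, OF zero_less_one]
  obtain B where B: "0 \<le> B" "\<And>t. t \<in> {0..T} \<Longrightarrow> fnorm_le (l2_tests 1 s) (rep (u t)) B" using uniform_bound by blast
  define B' where "B' = max (max B 1) (2 powr s * sobolev_norm s V)"
  define G where "G = {f :: real ^ 'n \<Rightarrow> complex. fnorm_le (l2_tests 1 s) f B'}"
  obtain M where M: "\<And>f g. f \<in> G \<Longrightarrow> g \<in> G \<Longrightarrow>
        fnorm_le X f M \<and> fnorm_le Y f M \<and> fnorm_le (second_order Y) f M \<and>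
        bilinear_le X (\<lambda>k. norm (freq k)) M f g \<and> bilinear_le Y ksq M f g"
    using assms unfolding good_norms_def G_def by fastforce
  have "gp_setting X Y G (rep V) (\<lambda>t. rep (u t)) T M"
  proof
    show "test_family X" "test_family Y" "conv_bound X X" "conv_bound X Y" using assms by (auto simp: good_norms_def)
    show "rep V \<in> G" unfolding G_def mem_Collect_eq by (rule fnorm_le_mono[OF tt fnorm_le_rep[OF V]]) (simp add: B'_def)
    show "(\<lambda>x. 1) \<in> G"
    proof -
      have "wnorm s (\<lambda>k :: int ^ 'n. cmod (if k = 0 then 1 else 0)) F \<le> 1" if "finite F" for F
      proof -
        have "wnorm s (\<lambda>k :: int ^ 'n. cmod (if k = 0 then 1 else 0)) F = sqrt (\<Sum>k\<in>F. if k = 0 then 1 else 0)"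
          unfolding wnorm_def L2_set_def by (intro arg_cong[where f = sqrt] sum.cong) (auto simp: bracket_def)
        also have "\<dots> \<le> 1" using that by simp
        finally show ?thesis .
      qed
      hence "fnorm_le (l2_tests 1 s) (\<lambda>x :: real ^ 'n. 1) 1" by (simp add: fnorm_le_l2 wiener_const)
      thus ?thesis unfolding G_def mem_Collect_eq by (rule fnorm_le_mono[OF tt]) (simp add: B'_def)
    qed
    show "rep (u t) \<in> G" if "t \<in> {0..T}" for t
      unfolding G_def mem_Collect_eq by (rule fnorm_le_mono[OF tt B(2)[OF that]]) (simp add: B'_def)
    show "(\<lambda>x. cnj (f x)) \<in> G" if "f \<in> G" for f using that fnorm_le_cnj[OF tt] by (simp add: G_def)
  qed (use M T duhamel_twisted in auto)
  thus ?thesis by blast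
qed

section \<open>The error bound for mild solutions\<close>

text \<open>
  Both arguments occur in the step only inside Fourier multipliers, which see them up to null sets.
\<close>

lemma gp_step_cong:
  fixes W W' w w' :: "real ^ 'n \<Rightarrow> complex"
  assumes W: "W \<in> torus_L2" "W' \<in> wiener" "AE x in torus_measure. W x = W' x"
    and w: "w \<in> torus_L2" "w' \<in> wiener" "AE x in torus_measure. w x = w' x"
  shows "gp_step \<tau> W w = gp_step \<tau> W' w'"
proof -
  note [measurable] = torus_L2_meas[OF W(1)] torus_L2_meas[OF w(1)]
    torus_L2_meas[OF wiener_torus_L2[OF W(2)]] torus_L2_meas[OF wiener_torus_L2[OF w(2)]]
  have lc: "laplace_op \<phi> \<xi> f = laplace_op \<phi> \<xi> g" if "AE x in torus_measure. f x = g x"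
    "f \<in> borel_measurable torus_measure" "g \<in> borel_measurable torus_measure" for \<phi> \<xi> and f g :: "real ^ 'n \<Rightarrow> complex"
    by (rule laplace_cong, rule fc_cong_AE) (use that in auto)
  have V1: "laplace_op \<phi> \<xi> W = laplace_op \<phi> \<xi> W'" for \<phi> \<xi> by (rule lc[OF W(3)]) auto
  have w1: "laplace_op \<phi> \<xi> w = laplace_op \<phi> \<xi> w'" for \<phi> \<xi> by (rule lc[OF w(3)]) auto
  have wc: "laplace_op \<phi> \<xi> (\<lambda>y. cnj (w y)) = laplace_op \<phi> \<xi> (\<lambda>y. cnj (w' y))" for \<phi> \<xi>
    by (rule lc) (use w(3) in \<open>auto elim: eventually_mono\<close>)
  have fw: "filtered \<phi> \<tau> w W (\<lambda>y. cnj (w y)) x = w x * laplace_op \<phi> (- \<tau>) W' x + w x * w x * laplace_op \<phi> (- 2 * \<tau>) (\<lambda>y. cnj (w' y)) x" for \<phi> x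
    by (simp add: filtered_def V1 wc)
  have F: "laplace_op exp \<tau> (filtered \<phi> \<tau> w W (\<lambda>y. cnj (w y))) = laplace_op exp \<tau> (filtered \<phi> \<tau> w' W' (\<lambda>y. cnj (w' y)))"
    if \<phi>: "unit_symbol \<phi>" for \<phi>
  proof (rule lc)
    show "AE x in torus_measure. filtered \<phi> \<tau> w W (\<lambda>y. cnj (w y)) x = filtered \<phi> \<tau> w' W' (\<lambda>y. cnj (w' y)) x"
      using w(3) by eventually_elim (simp add: fw, simp add: filtered_def)
    note [measurable] = torus_L2_meas[OF wiener_torus_L2[OF laplace_wiener(1)[OF \<phi> W(2)]]]
      torus_L2_meas[OF wiener_torus_L2[OF laplace_wiener(1)[OF \<phi> wiener_cnj(1)[OF w(2)]]]]
    show "filtered \<phi> \<tau> w W (\<lambda>y. cnj (w y)) \<in> borel_measurable torus_measure"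
      unfolding fw[abs_def] by measurable
    show "filtered \<phi> \<tau> w' W' (\<lambda>y. cnj (w' y)) \<in> borel_measurable torus_measure"
      unfolding filtered_def[abs_def] by measurable
  qed
  have G: "laplace_op exp \<tau> (gpG W w) = laplace_op exp \<tau> (gpG W' w')"
  proof (rule lc)
    show "AE x in torus_measure. gpG W w x = gpG W' w' x"
      using w(3) W(3) by eventually_elim (simp add: gpG_def gpF_def)
    show "gpG W w \<in> borel_measurable torus_measure" "gpG W' w' \<in> borel_measurable torus_measure"
      unfolding gpG_def[abs_def] gpF_def[abs_def] by measurable
  qed
  show ?thesis
    unfolding gp_step_eq[abs_def] F[OF unit_symbol_phi1] F[OF unit_symbol_phi2] G V1 w1 wc ..
qed

text \<open>
  From the first step on the iterates are Wiener functions, so it is only for \<open>n = 0\<close> that the scheme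
  depends on the choice of the representative.
\<close>

lemma gp_scheme_rep:
  assumes "1 \<le> n"
  shows "gp_scheme \<tau> V u0 n = gp_scheme \<tau> (rep V) (rep u0) n" "gp_scheme \<tau> V u0 n \<in> wiener"
proof -
  note V' = rep[OF V] and u' = rep[OF u0]
  have wi: "gp_scheme \<tau> (rep V) (rep u0) n \<in> wiener" for n
    by (induction n) (auto intro: gp_step_wiener V' u')
  have "gp_scheme \<tau> V u0 (Suc n) = gp_scheme \<tau> (rep V) (rep u0) (Suc n)" for n
  proof (induction n)
    case 0
    show ?case using gp_step_cong[OF V'(4,1,3) u'(4,1,3)] by simp
  next
    case (Suc n)
    have "gp_step \<tau> V (gp_scheme \<tau> (rep V) (rep u0) (Suc n)) = gp_step \<tau> (rep V) (gp_scheme \<tau> (rep V) (rep u0) (Suc n))"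
      by (rule gp_step_cong[OF V'(4,1,3) wiener_torus_L2[OF wi] wi]) simp
    thus ?case using Suc by simp
  qed
  from this[of "n - 1"] assms show "gp_scheme \<tau> V u0 n = gp_scheme \<tau> (rep V) (rep u0) n" by simp
  thus "gp_scheme \<tau> V u0 n \<in> wiener" using wi by simp
qed

theorem second_order_convergence:
  fixes X Y :: "(int ^ 'n \<Rightarrow> real) set"
  assumes r: "0 \<le> r" and good: "good_norms s r X Y"
  shows "\<exists>\<tau>min>0. \<exists>C>0. \<forall>\<tau>. 0 < \<tau> \<and> \<tau> \<le> \<tau>min \<longrightarrow>
           (\<forall>n::nat. 1 \<le> n \<and> real n * \<tau> \<le> T \<longrightarrow>
              (\<lambda>x. gp_scheme \<tau> V u0 n x - u (real n * \<tau>) x) \<in> sobolev r \<and>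
              sobolev_norm r (\<lambda>x. gp_scheme \<tau> V u0 n x - u (real n * \<tau>) x) \<le> C * \<tau>\<^sup>2)"
proof -
  obtain G M where "gp_setting X Y G (rep V) (\<lambda>t. rep (u t)) T M" using gp_setting_rep[OF good] by blast
  then interpret S: gp_setting X Y G "rep V" "\<lambda>t. rep (u t)" T M .
  have init: "rep (u 0) = rep u0" by (simp add: rep_def fc_initial)
  define P where "P \<tau> n C \<longleftrightarrow> fnorm_le Y (\<lambda>x. gp_scheme \<tau> (rep V) (rep u0) n x - rep (u (real n * \<tau>)) x) (C * \<tau>\<^sup>2)" for \<tau> n C
  have "\<exists>\<tau>min>0. \<exists>C\<ge>0. \<forall>\<tau> n. 0 < \<tau> \<longrightarrow> \<tau> \<le> \<tau>min \<longrightarrow> real n * \<tau> \<le> T \<longrightarrow> P \<tau> n C"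
    unfolding P_def using S.convergence unfolding init .
  then obtain \<tau>min C where \<tau>min: "0 < \<tau>min" and C: "0 \<le> C" "\<And>\<tau> n. 0 < \<tau> \<Longrightarrow> \<tau> \<le> \<tau>min \<Longrightarrow> real n * \<tau> \<le> T \<Longrightarrow> P \<tau> n C"
    by blast
  have "\<exists>K\<ge>0. \<forall>a B. (\<forall>k. 0 \<le> a k) \<longrightarrow> dual_le Y a B \<longrightarrow> (\<forall>F. finite F \<longrightarrow> wnorm r a F \<le> K * B)"
    using good unfolding good_norms_def by (elim conjE)
  then obtain K where K: "0 \<le> K \<and> (\<forall>a B. (\<forall>k. 0 \<le> a k) \<longrightarrow> dual_le Y a B \<longrightarrow> (\<forall>F. finite F \<longrightarrow> wnorm r a F \<le> K * B))"
    by (rule exE)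
  define D where "D = sqrt (2 * (2 * pi) ^ CARD('n)) * (K * C) + 1"
  have D: "0 < D" unfolding D_def using conjunct1[OF K] C(1) by (intro add_nonneg_pos mult_nonneg_nonneg) auto
  show ?thesis
  proof (rule exI[of _ \<tau>min], intro conjI \<tau>min, rule exI[of _ D], intro conjI D allI impI)
    fix \<tau> and n :: nat assume "0 < \<tau> \<and> \<tau> \<le> \<tau>min" and "1 \<le> n \<and> real n * \<tau> \<le> T"
    hence \<tau>: "0 < \<tau>" "\<tau> \<le> \<tau>min" and n: "1 \<le> n" "real n * \<tau> \<le> T" by auto
    let ?e = "\<lambda>x. gp_scheme \<tau> V u0 n x - u (real n * \<tau>) x"
    have t: "real n * \<tau> \<in> {0..T}" using \<tau> n by auto
    note ut = rep[OF u_sobolev[OF t]] and g = gp_scheme_rep[OF n(1), of \<tau>]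
    have "fc ?e k = fc (\<lambda>x. gp_scheme \<tau> (rep V) (rep u0) n x - rep (u (real n * \<tau>)) x) k" for k
      unfolding fc_diff_L2[OF wiener_torus_L2[OF g(2)] ut(4)] using g ut by (simp add: wiener_diff)
    hence "dual_le Y (\<lambda>k. cmod (fc ?e k)) (C * \<tau>\<^sup>2)" using C(2)[OF \<tau> n(2)] by (simp add: P_def fnorm_le_def)
    hence "wnorm r (\<lambda>k. cmod (fc ?e k)) F \<le> K * (C * \<tau>\<^sup>2)" if "finite F" for F using that conjunct2[OF K] by simp
    note * = sobolevI[OF r torus_L2_diff[OF wiener_torus_L2[OF g(2)] ut(4)] this]
    show "?e \<in> sobolev r" by (rule *)
    have "sobolev_norm r ?e \<le> sqrt (2 * (2 * pi) ^ CARD('n)) * (K * (C * \<tau>\<^sup>2))" by (rule *)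
    also have "\<dots> \<le> D * \<tau>\<^sup>2" by (simp add: D_def algebra_simps)
    finally show "sobolev_norm r ?e \<le> D * \<tau>\<^sup>2" .
  qed
qed

end

theorem theorem1p2:
  fixes T r \<epsilon> r2 :: real
    and u0 V :: "real ^ 'n::finite \<Rightarrow> complex"
    and u :: "real \<Rightarrow> real ^ 'n \<Rightarrow> complex"
  assumes "CARD('n) \<in> {1, 2, 3}"
    and "T > 0" and "r \<ge> 0" and "0 < \<epsilon>" and "\<epsilon> < 1 / 4"
    and "r2 = data_regularity CARD('n) r \<epsilon>"
    and "u0 \<in> sobolev r2" and "V \<in> sobolev r2"
    and "gp_mild_solution r2 T V u0 u"
  shows "\<exists>\<tau>min>0. \<exists>C>0. \<forall>\<tau>. 0 < \<tau> \<and> \<tau> \<le> \<tau>min \<longrightarrow>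
           (\<forall>n::nat. 1 \<le> n \<and> real n * \<tau> \<le> T \<longrightarrow>
              (\<lambda>x. gp_scheme \<tau> V u0 n x - u (real n * \<tau>) x) \<in> sobolev r \<and>
              sobolev_norm r (\<lambda>x. gp_scheme \<tau> V u0 n x - u (real n * \<tau>) x) \<le> C * \<tau>\<^sup>2)"
proof -
  have r2: "r2 > real CARD('n) / 2"
    using assms(1,3,4,6) by (auto simp: data_regularity_def split: if_splits)
  interpret mild_solution r2 T V u0 u
    by unfold_locales (use assms r2 in auto)
  have "\<exists>X Y :: (int ^ 'n \<Rightarrow> real) set. good_norms r2 r X Y"
  proof (cases "r > real CARD('n) / 2")
    case True
    thus ?thesis using good_norms_supercritical[where 'n = 'n, of r r] assms(6) by (simp add: data_regularity_def)
  next
    case False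
    show ?thesis
    proof (cases "r > 0")
      case True
      thus ?thesis using False good_norms_supercritical[where 'n = 'n, of "real CARD('n) / 2 + \<epsilon>" r] assms(4,6)
        by (simp add: data_regularity_def add_ac)
    next
      case False
      hence "r = 0" using assms(3) by simp
      thus ?thesis using good_norms_L2[OF assms(1)] assms(6) by (auto simp: data_regularity_def)
    qed
  qed
  then obtain X Y :: "(int ^ 'n \<Rightarrow> real) set" where "good_norms r2 r X Y" by blast
  from second_order_convergence[OF assms(3) this] show ?thesis .
qed

end
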